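(* There is a large enough global constant $C>0$ such that the following holds. Let $M\in\mathbb{R}^{n_1\times n_2}$ be a rank-$r$, $\mu$-incoherent matrix with singular values $\sigma_1\ge\cdots\ge\sigma_r$, let $\kappa=\sigma_1/\sigma_r$, $n=n_1+n_2$, and let $\Omega\subseteq[n_1]\times[n_2]$ be generated by including each element of $[n_1]\times[n_2]$ independently with some fixed probability. Let $\alpha>1$, $\epsilon>0$, $T=\log\frac{100\mu^2 r\|M\|_2}{\epsilon}$, and suppose $$\mathbb{E}[|\Omega|]\ \ge\ C\,\alpha\,\mu^4\,\kappa^2\, r^5\, n\,(\log^2 n)\,T .$$ Then the output $X_T$ of the SVP algorithm (described in the context), run with input $\Omega,P_\Omega(M),r,\epsilon$, satisfies $\|X_T-M\|_F\le\epsilon$ with probability at least $1-T\,\min(n_1,n_2)^{-10-\log\alpha}$.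
   Context: Incoherence: a rank-$r$ matrix $M\in\mathbb{R}^{n_1\times n_2}$ with singular value decomposition $M=U^*\Sigma (V^* )^\top$ is $\mu$-incoherent if $\max_i\|e_i^\top U^*\|_2\le \mu\sqrt{r}/\sqrt{n_1}$ and $\max_j\|e_j^\top V^*\|_2\le\mu\sqrt{r}/\sqrt{n_2}$. Notation: for $\Omega\subseteq[n_1]\times[n_2]$ and a matrix $A$, $P_\Omega(A)$ has $(i,j)$ entry $A_{ij}$ if $(i,j)\in\Omega$ and $0$ otherwise. $P_r(A)$ is the best rank-$r$ approximation of $A$ (truncation of its SVD to the $r$ largest singular values). $\|\cdot\|_2$ is the operator norm, $\|\cdot\|_F$ the Frobenius norm. SVP algorithm. Input: $\Omega$, $P_\Omega(M)$, $r$, $\epsilon$. Partition $\Omega$ randomly into $T$ subsets $\Omega_1,\dots,\Omega_T$ ($T$ is understood as an integer when used as an iteration count). Set $X_0=0$. For $t=1,\dots,T$ set $$X_t\leftarrow P_r\!\left(X_{t-1}-\frac{n_1n_2}{|\Omega_t|}P_{\Omega_t}(X_{t-1}-M)\right).$$ Output $X_T$. *)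

theory Defs
  imports
    "HOL-Probability.Probability"
    "Jordan_Normal_Form.DL_Rank"
begin

text \<open>Matrices are those of \<open>Jordan_Normal_Form\<close>, so that their dimensions can be quantified over.
  All indices start at 0: the singular value usually called \<open>\<sigma>\<^sub>i\<close> is \<open>\<sigma> (i - 1)\<close> here.\<close>

definition vec_l2_norm :: "real Matrix.vec \<Rightarrow> real" where
  "vec_l2_norm v = sqrt (scalar_prod v v)"

definition op_norm :: "real mat \<Rightarrow> real" where
  "op_norm A = (SUP v \<in> {v \<in> carrier_vec (dim_col A). vec_l2_norm v \<le> 1}. vec_l2_norm (A *\<^sub>v v))"

definition frob_norm :: "real mat \<Rightarrow> real" where
  "frob_norm A = sqrt (\<Sum>i<dim_row A. \<Sum>j<dim_col A. (A $$ (i, j))\<^sup>2)"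

text \<open>Thin singular value decomposition with \<open>k\<close> columns. Zero singular values are allowed; they are
  excluded exactly when \<open>k\<close> is the rank of \<open>A\<close>.\<close>

definition is_svd :: "nat \<Rightarrow> real mat \<Rightarrow> real mat \<Rightarrow> (nat \<Rightarrow> real) \<Rightarrow> real mat \<Rightarrow> bool" where
  "is_svd k A U \<sigma> V \<longleftrightarrow>
     U \<in> carrier_mat (dim_row A) k \<and> V \<in> carrier_mat (dim_col A) k \<and>
     transpose_mat U * U = 1\<^sub>m k \<and> transpose_mat V * V = 1\<^sub>m k \<and>
     (\<forall>i<k. 0 \<le> \<sigma> i) \<and> (\<forall>i j. i \<le> j \<and> j < k \<longrightarrow> \<sigma> j \<le> \<sigma> i) \<and>
     A = U * mat_diag k \<sigma> * transpose_mat V"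

definition is_truncated_svd :: "nat \<Rightarrow> real mat \<Rightarrow> real mat \<Rightarrow> bool" where
  "is_truncated_svd r A B \<longleftrightarrow>
     (\<exists>k U \<sigma> V. is_svd k A U \<sigma> V \<and>
        B = U * mat_diag k (\<lambda>i. if i < r then \<sigma> i else 0) * transpose_mat V)"

text \<open>The truncation is not unique when the \<open>r\<close>-th and \<open>(r+1)\<close>-st singular values are equal and
  positive. The operator \<open>P\<^sub>r\<close> is therefore any function that selects a truncation of each matrix.\<close>

definition svd_truncation :: "nat \<Rightarrow> (real mat \<Rightarrow> real mat) \<Rightarrow> bool" where
  "svd_truncation r P \<longleftrightarrow> (\<forall>A. is_truncated_svd r A (P A))"

text \<open>The factors \<open>U\<close> and \<open>V\<close> are those of a thin singular value decomposition of a matrix of rank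
  \<open>r\<close>; the row norms do not depend on which one is chosen.\<close>

definition incoherent :: "nat \<Rightarrow> real \<Rightarrow> real mat \<Rightarrow> real mat \<Rightarrow> bool" where
  "incoherent r \<mu> U V \<longleftrightarrow>
     (\<forall>i<dim_row U. vec_l2_norm (Matrix.row U i) \<le> \<mu> * sqrt (real r) / sqrt (real (dim_row U))) \<and>
     (\<forall>j<dim_row V. vec_l2_norm (Matrix.row V j) \<le> \<mu> * sqrt (real r) / sqrt (real (dim_row V)))"

definition proj_entries :: "(nat \<times> nat) set \<Rightarrow> real mat \<Rightarrow> real mat" where
  "proj_entries \<Omega> A =
     Matrix.mat (dim_row A) (dim_col A) (\<lambda>(i, j). if (i, j) \<in> \<Omega> then A $$ (i, j) else 0)"

definition random_subset :: "'a set \<Rightarrow> real \<Rightarrow> 'a set pmf" where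
  "random_subset S p =
     map_pmf (\<lambda>b. {e \<in> S. b e}) (Pi_pmf S False (\<lambda>_. bernoulli_pmf p))"

text \<open>Every element of \<open>\<Omega>\<close> is put independently and uniformly into one of the parts \<open>1, \<dots>, N\<close>.
  For \<open>N = 0\<close> the distribution is meaningless, but then no part is ever used.\<close>

definition random_partition :: "nat \<Rightarrow> 'a set \<Rightarrow> (nat \<Rightarrow> 'a set) pmf" where
  "random_partition N \<Omega> =
     map_pmf (\<lambda>l t. {e \<in> \<Omega>. l e = t}) (Pi_pmf \<Omega> 0 (\<lambda>_. pmf_of_set {1..N}))"

text \<open>The algorithm sees \<open>Y = P\<^sub>\<Omega>(M)\<close> only. As \<open>\<Omega>\<^sub>t \<subseteq> \<Omega>\<close>, replacing \<open>M\<close> by \<open>Y\<close> does not change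
  \<open>P\<^bsub>\<Omega>\<^sub>t\<^esub>(X - M)\<close>. If \<open>\<Omega>\<^sub>t\<close> is empty, the correction term is 0.\<close>

primrec svp_iterate ::
    "(real mat \<Rightarrow> real mat) \<Rightarrow> (nat \<Rightarrow> (nat \<times> nat) set) \<Rightarrow> real mat \<Rightarrow> nat \<Rightarrow> real mat" where
  "svp_iterate P \<Omega>s Y 0 = 0\<^sub>m (dim_row Y) (dim_col Y)"
| "svp_iterate P \<Omega>s Y (Suc t) =
     (let X = svp_iterate P \<Omega>s Y t; \<Omega>' = \<Omega>s (Suc t) in
      P (X - (real (dim_row Y) * real (dim_col Y) / real (card \<Omega>')) \<cdot>\<^sub>m proj_entries \<Omega>' (X - Y)))"

definition svp_output ::
    "(real mat \<Rightarrow> real mat) \<Rightarrow> nat \<Rightarrow> (nat \<times> nat) set \<Rightarrow> real mat \<Rightarrow> real mat pmf" where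
  "svp_output P N \<Omega> Y = map_pmf (\<lambda>\<Omega>s. svp_iterate P \<Omega>s Y N) (random_partition N \<Omega>)"

end

theory Submission
  imports Defs
begin

text \<open>
Write $E = X_{t-1} - M$ for the error before a step. With \<open>c = n1 n2 / |\<Omega>\<^sub>t|\<close> the step truncates
\<open>M + H\<close>, where \<open>H = D \<circ> E\<close> is an entrywise product and \<open>D\<close> has entries \<open>1 - c\<close> on \<open>\<Omega>\<^sub>t\<close> and \<open>1\<close>
elsewhere; \<open>D\<close> has nearly mean zero. Let \<open>P0\<close> and \<open>Q0\<close> be the projections onto the column and the row space
of \<open>M\<close>. If \<open>H\<close> is small in operator norm compared with \<open>\<sigma>\<^sub>r\<close>, the new error is at most
\<open>4 (\<parallel>H Q0\<parallel> + \<parallel>P0 H\<parallel>)\<close> in Frobenius norm (\<open>truncation_error\<close>): a truncation keeps the noise only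
in directions that meet the row or the column space of \<open>M\<close>. So it suffices that \<open>E \<mapsto> (D \<circ> E) Q0\<close> is a
strong contraction.

The error splits as \<open>E = E Q0 + X (Q - Q0 Q)\<^sup>T\<close>, with \<open>Q\<close> the projection onto the row space of \<open>X\<close>. On the
first part \<open>D\<close> acts through the matrices \<open>\<Sum>\<^sub>j D\<^sub>i\<^sub>j V\<^sub>j\<^sub>k V\<^sub>j\<^sub>l\<close>, which are small by Bernstein's inequality
(\<open>gram_contraction\<close>). On the second part the operator norm of \<open>D\<close>, which is of order \<open>sqrt (n log n / q)\<close>
by a noncommutative Khintchine inequality (\<open>khintchine\<close>, \<open>centered_opn_tail\<close>), combines with the row norms
of the factors through Schur's bound for entrywise products (\<open>norm_had_mult_le\<close>). This gives
\<open>contraction_incoherent\<close> whenever the rows of \<open>X\<close> are about as small as those of \<open>M\<close>.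

Hence the iterates have to be kept incoherent. Row \<open>i\<close> of the new error is governed by row \<open>i\<close> of \<open>H Q\<close>,
and \<open>Q\<close> depends on that row. \<open>leave_one_out\<close> compares \<open>Q\<close> with the projection obtained after row \<open>i\<close> of \<open>H\<close>
has been removed; this one does not depend on which entries of row \<open>i\<close> are in \<open>\<Omega>\<^sub>t\<close>, and Bernstein's
inequality applies. \<open>row_step\<close> closes the resulting loop between rows and columns.

The parts \<open>\<Omega>\<^sub>1, \<Omega>\<^sub>2, \<dots>\<close> are disjoint and therefore dependent. An entry gets the label of its part, or
\<open>0\<close> if it is not sampled, independently of the others. Given the entries seen before step \<open>t\<close>, an unseen entry
still gets the label \<open>t\<close> with probability \<open>q / (1 - (t - 1) q)\<close>, independently (\<open>fresh_bernstein\<close>). A seen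
entry has \<open>D = 1\<close>, which is not centred, but the seen entries of a row carry only a share of order \<open>(t - 1) q r\<close>
of the weight of \<open>V\<close> (\<open>seen_weight\<close>). So incoherence can be propagated as long as \<open>(t - 1) q r\<close> is small.
When this ends, the error, which shrinks by a factor \<open>e\<close> in every step, is below a multiple of \<open>q \<sigma>\<^sub>r\<close>, and then
the trivial bound \<open>|D| \<le> 2 / q\<close> makes the quadratic part of the error harmless without incoherence of \<open>X\<close>
(\<open>contraction_close\<close>). Together these facts give \<open>linear_convergence\<close> on the event that all steps are
\<open>good\<close>, a union bound gives its probability (\<open>bad_event\<close>), and the assumption on the number of
samples makes all constants small enough (\<open>rate_conditions\<close>).
\<close>

section \<open>Finitely supported matrices\<close>

definition bnd :: "nat \<Rightarrow> (nat \<Rightarrow> nat \<Rightarrow> real) \<Rightarrow> bool" where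
  "bnd n f \<longleftrightarrow> (\<forall>i j. f i j \<noteq> 0 \<longrightarrow> i < n \<and> j < n)"

lemma bnd_mono: "bnd n f \<Longrightarrow> n \<le> m \<Longrightarrow> bnd m f"
  unfolding bnd_def by (meson less_le_trans)

text \<open>Matrices of all sizes live in one type, so that they form a real inner product space (with
  the Frobenius norm) and an associative algebra without any dimension conditions. There is no
  unit; projections \<open>idn n\<close> take its place.\<close>

typedef fmat = "{f :: nat \<Rightarrow> nat \<Rightarrow> real. \<exists>n. bnd n f}" morphisms ent Abs_fmat
  by (rule exI[of _ "\<lambda>i j. 0"]) (simp add: bnd_def)

setup_lifting type_definition_fmat

lemma fmat_eqI: "(\<And>i j. ent A i j = ent B i j) \<Longrightarrow> A = B"
  by (meson ent_inject ext)

lemma ex_bnd: obtains n where "bnd n (ent A)"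
  using ent[of A] by auto

lemma ex_bnd2: obtains n where "bnd n (ent A)" "bnd n (ent B)"
proof -
  obtain n m where "bnd n (ent A)" "bnd m (ent B)" using ex_bnd by metis
  then have "bnd (max n m) (ent A)" "bnd (max n m) (ent B)" by (auto intro: bnd_mono)
  then show ?thesis by (rule that)
qed

lemma ex_bnd3: obtains n where "bnd n (ent A)" "bnd n (ent B)" "bnd n (ent C)"
proof -
  obtain n m where "bnd n (ent A)" "bnd n (ent B)" "bnd m (ent C)" using ex_bnd ex_bnd2 by metis
  then have "bnd (max n m) (ent A)" "bnd (max n m) (ent B)" "bnd (max n m) (ent C)"
    by (auto intro: bnd_mono)
  then show ?thesis by (rule that)
qed

lemma bnd_ge: "bnd n f \<Longrightarrow> i \<ge> n \<or> j \<ge> n \<Longrightarrow> f i j = 0"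
  unfolding bnd_def by (meson not_less)

definition dimb :: "fmat \<Rightarrow> nat" where "dimb A = (SOME n. bnd n (ent A))"

lemma bnd_dimb: "bnd (dimb A) (ent A)"
  unfolding dimb_def by (rule someI_ex) (use ent[of A] in simp)

instantiation fmat :: real_vector
begin
lift_definition zero_fmat :: fmat is "\<lambda>i j. 0" by (auto simp: bnd_def)
lift_definition plus_fmat :: "fmat \<Rightarrow> fmat \<Rightarrow> fmat" is "\<lambda>f g i j. f i j + g i j"
proof -
  fix f g :: "nat \<Rightarrow> nat \<Rightarrow> real" assume "\<exists>n. bnd n f" "\<exists>n. bnd n g"
  then obtain n m where "bnd n f" "bnd m g" by auto
  then have "bnd (max n m) (\<lambda>i j. f i j + g i j)" unfolding bnd_def
    by (metis add.right_neutral less_max_iff_disj)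
  then show "\<exists>n. bnd n (\<lambda>i j. f i j + g i j)" by auto
qed
lift_definition uminus_fmat :: "fmat \<Rightarrow> fmat" is "\<lambda>f i j. - f i j" by (auto simp: bnd_def)
lift_definition minus_fmat :: "fmat \<Rightarrow> fmat \<Rightarrow> fmat" is "\<lambda>f g i j. f i j - g i j"
proof -
  fix f g :: "nat \<Rightarrow> nat \<Rightarrow> real" assume "\<exists>n. bnd n f" "\<exists>n. bnd n g"
  then obtain n m where "bnd n f" "bnd m g" by auto
  then have "bnd (max n m) (\<lambda>i j. f i j - g i j)" unfolding bnd_def
    by (metis diff_zero less_max_iff_disj)
  then show "\<exists>n. bnd n (\<lambda>i j. f i j - g i j)" by auto
qed
lift_definition scaleR_fmat :: "real \<Rightarrow> fmat \<Rightarrow> fmat" is "\<lambda>c f i j. c * f i j"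
  by (auto simp: bnd_def)
instance
  by standard (transfer, auto simp: algebra_simps)+
end

lemma ent_0 [simp]: "ent 0 i j = 0" by transfer simp
lemma ent_add [simp]: "ent (A + B) i j = ent A i j + ent B i j" by transfer simp
lemma ent_minus [simp]: "ent (- A) i j = - ent A i j" by transfer simp
lemma ent_diff [simp]: "ent (A - B) i j = ent A i j - ent B i j" by transfer simp
lemma ent_scaleR [simp]: "ent (c *\<^sub>R A) i j = c * ent A i j" by transfer simp
lemma ent_sum [simp]: "ent (sum f S) i j = (\<Sum>x\<in>S. ent (f x) i j)"
  by (induction S rule: infinite_finite_induct) auto

lemma sum_lt_extend:
  fixes f :: "nat \<Rightarrow> real"
  assumes "n \<le> m" "\<And>i. i \<ge> n \<Longrightarrow> f i = 0"
  shows "sum f {..<n} = sum f {..<m}"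
  using assms by (intro sum.mono_neutral_left) auto

lemma sum2_lt_extend:
  fixes f :: "nat \<Rightarrow> nat \<Rightarrow> real"
  assumes "bnd n f" "n \<le> m"
  shows "(\<Sum>i<n. \<Sum>j<n. f i j) = (\<Sum>i<m. \<Sum>j<m. f i j)"
proof -
  have "(\<Sum>i<n. \<Sum>j<n. f i j) = (\<Sum>i<n. \<Sum>j<m. f i j)"
    by (intro sum.cong refl sum_lt_extend assms) (use assms in \<open>auto simp: bnd_ge\<close>)
  also have "\<dots> = (\<Sum>i<m. \<Sum>j<m. f i j)"
    by (intro sum_lt_extend assms) (use assms in \<open>auto simp: bnd_ge\<close>)
  finally show ?thesis .
qed

lemma sum2_bnd_eq:
  fixes f :: "nat \<Rightarrow> nat \<Rightarrow> real"
  assumes "bnd n f" "bnd m f"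
  shows "(\<Sum>i<n. \<Sum>j<n. f i j) = (\<Sum>i<m. \<Sum>j<m. f i j)"
  using assms sum2_lt_extend by (metis nat_le_linear)

instantiation fmat :: real_inner
begin
definition inner_fmat :: "fmat \<Rightarrow> fmat \<Rightarrow> real" where
  "inner_fmat A B = (\<Sum>i<dimb A. \<Sum>j<dimb A. ent A i j * ent B i j)"
definition norm_fmat :: "fmat \<Rightarrow> real" where "norm_fmat A = sqrt (inner A A)"
definition dist_fmat :: "fmat \<Rightarrow> fmat \<Rightarrow> real" where "dist_fmat A B = norm (A - B)"
definition sgn_fmat :: "fmat \<Rightarrow> fmat" where "sgn_fmat A = A /\<^sub>R norm A"
definition uniformity_fmat :: "(fmat \<times> fmat) filter" where
  "uniformity_fmat = (INF e\<in>{0 <..}. principal {(x, y). dist x y < e})"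
definition open_fmat :: "fmat set \<Rightarrow> bool" where
  "open_fmat U = (\<forall>x\<in>U. eventually (\<lambda>(x', y). x' = x \<longrightarrow> y \<in> U) uniformity)"
lemma inner_fmat_bnd:
  assumes "bnd n (ent A) \<or> bnd n (ent B)"
  shows "inner A B = (\<Sum>i<n. \<Sum>j<n. ent A i j * ent B i j)"
  unfolding inner_fmat_def
  by (rule sum2_bnd_eq) (use bnd_dimb[of A] assms in \<open>auto simp: bnd_def\<close>)
instance
proof
  fix x y z :: fmat and r :: real
  show "inner x y = inner y x"
    using inner_fmat_bnd[of "dimb x" x y] inner_fmat_bnd[of "dimb x" y x] bnd_dimb[of x]
    by (simp add: mult.commute)
  obtain n where n: "bnd n (ent z)" using ex_bnd .
  then show "inner (x + y) z = inner x z + inner y z"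
    using inner_fmat_bnd[of n _ z] by (simp add: distrib_right sum.distrib)
  obtain n where n: "bnd n (ent y)" using ex_bnd .
  then show "inner (r *\<^sub>R x) y = r * inner x y"
    using inner_fmat_bnd[of n _ y] by (simp add: sum_distrib_left mult.assoc)
  have e: "inner x x = (\<Sum>i<dimb x. \<Sum>j<dimb x. (ent x i j)\<^sup>2)"
    by (simp add: inner_fmat_def power2_eq_square)
  show "0 \<le> inner x x" unfolding e by (intro sum_nonneg) auto
  show "inner x x = 0 \<longleftrightarrow> x = 0"
  proof
    assume "inner x x = 0"
    then have *: "i < dimb x \<Longrightarrow> j < dimb x \<Longrightarrow> ent x i j = 0" for i j
      unfolding e by (subst (asm) sum_nonneg_eq_0_iff) (auto simp: sum_nonneg_eq_0_iff sum_nonneg)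
    show "x = 0"
      by (rule fmat_eqI) (metis * bnd_dimb bnd_ge ent_0 not_less)
  qed (simp add: inner_fmat_def)
qed (fact norm_fmat_def dist_fmat_def sgn_fmat_def uniformity_fmat_def open_fmat_def)+
end

instantiation fmat :: real_algebra
begin
definition times_fmat :: "fmat \<Rightarrow> fmat \<Rightarrow> fmat" where
  "times_fmat A B = Abs_fmat (\<lambda>i j. \<Sum>k<dimb A. ent A i k * ent B k j)"
lemma ent_times_dimb: "ent (A * B) i j = (\<Sum>k<dimb A. ent A i k * ent B k j)"
proof -
  obtain n where n: "bnd n (ent A)" "bnd n (ent B)" using ex_bnd2 .
  have "bnd n (\<lambda>i j. \<Sum>k<dimb A. ent A i k * ent B k j)"
    unfolding bnd_def
  proof (intro allI impI)
    fix i j assume "(\<Sum>k<dimb A. ent A i k * ent B k j) \<noteq> 0"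
    then obtain k where "ent A i k * ent B k j \<noteq> 0" by (meson sum.neutral)
    then show "i < n \<and> j < n" using n unfolding bnd_def by (metis mult_eq_0_iff)
  qed
  then show ?thesis unfolding times_fmat_def by (subst Abs_fmat_inverse) auto
qed
lemma ent_times:
  assumes "bnd n (ent A) \<or> bnd n (ent B)"
  shows "ent (A * B) i j = (\<Sum>k<n. ent A i k * ent B k j)"
proof -
  let ?f = "\<lambda>k. ent A i k * ent B k j" and ?m = "max n (dimb A)"
  have "sum ?f {..<dimb A} = sum ?f {..<?m}"
    by (rule sum_lt_extend) (use bnd_dimb[of A] in \<open>auto simp: bnd_ge\<close>)
  moreover have "sum ?f {..<n} = sum ?f {..<?m}"
    by (rule sum_lt_extend) (use assms in \<open>auto simp: bnd_ge\<close>)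
  ultimately show ?thesis by (simp add: ent_times_dimb)
qed
instance
proof
  fix a b c :: fmat and r :: real
  obtain n where n: "bnd n (ent a)" "bnd n (ent b)" "bnd n (ent c)" using ex_bnd3 .
  show "a * b * c = a * (b * c)"
    by (rule fmat_eqI)
      (simp add: ent_times[of n] n sum_distrib_left sum_distrib_right mult.assoc,
       subst sum.swap, simp)
  show "(a + b) * c = a * c + b * c"
    by (rule fmat_eqI) (simp add: ent_times[of n] n distrib_right sum.distrib)
  show "a * (b + c) = a * b + a * c"
    by (rule fmat_eqI) (simp add: ent_times[of n] n distrib_left sum.distrib)
  show "r *\<^sub>R a * b = r *\<^sub>R (a * b)"
    by (rule fmat_eqI) (simp add: ent_times[of n] n sum_distrib_left mult.assoc)
  show "a * r *\<^sub>R b = r *\<^sub>R (a * b)"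
    by (rule fmat_eqI) (simp add: ent_times[of n] n sum_distrib_left mult_ac)
qed
end

lemma bnd_times:
  assumes "bnd n (ent A)" "bnd n (ent B)"
  shows "bnd n (ent (A * B))"
  unfolding bnd_def
proof (intro allI impI)
  fix i j assume "ent (A * B) i j \<noteq> 0"
  then obtain k where "ent A i k * ent B k j \<noteq> 0"
    unfolding ent_times_dimb by (meson sum.neutral)
  then show "i < n \<and> j < n" using assms unfolding bnd_def by (metis mult_eq_0_iff)
qed

lift_definition tp :: "fmat \<Rightarrow> fmat" is "\<lambda>f i j. f j i" by (auto simp: bnd_def)

lemma ent_tp [simp]: "ent (tp A) i j = ent A j i" by transfer simp
lemma bnd_tp [simp]: "bnd n (ent (tp A)) \<longleftrightarrow> bnd n (ent A)" by (auto simp: bnd_def)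
lemma tp_tp [simp]: "tp (tp A) = A" by (rule fmat_eqI) simp
lemma tp_add [simp]: "tp (A + B) = tp A + tp B" by (rule fmat_eqI) simp
lemma tp_diff [simp]: "tp (A - B) = tp A - tp B" by (rule fmat_eqI) simp
lemma tp_minus [simp]: "tp (- A) = - tp A" by (rule fmat_eqI) simp
lemma tp_scaleR [simp]: "tp (c *\<^sub>R A) = c *\<^sub>R tp A" by (rule fmat_eqI) simp
lemma tp_sum: "tp (sum f S) = (\<Sum>x\<in>S. tp (f x))" by (rule fmat_eqI) simp
lemma tp_mult [simp]: "tp (A * B) = tp B * tp A"
proof -
  obtain n where n: "bnd n (ent A)" "bnd n (ent B)" using ex_bnd2 .
  show ?thesis by (rule fmat_eqI) (simp add: ent_times[of n] n mult.commute)
qed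

lemma inner_tp_tp: "inner (tp A) (tp B) = inner A B"
proof -
  obtain n where n: "bnd n (ent A)" "bnd n (ent B)" using ex_bnd2 .
  show ?thesis using n by (simp add: inner_fmat_bnd[of n]) (rule sum.swap)
qed
lemma norm_tp [simp]: "norm (tp A) = norm (A::fmat)"
  by (simp add: norm_eq_sqrt_inner inner_tp_tp)

text \<open>The transpose is the adjoint of multiplication. Most of the geometry below uses only this.\<close>

lemma inner_mult_left: "inner (A * B) C = inner B (tp A * C)" for A B C :: fmat
proof -
  obtain n where n: "bnd n (ent A)" "bnd n (ent B)" "bnd n (ent C)" using ex_bnd3 .
  have "inner (A * B) C = (\<Sum>i<n. \<Sum>j<n. \<Sum>k<n. ent A i k * ent B k j * ent C i j)"
    using n by (simp add: inner_fmat_bnd[of n] ent_times[of n] sum_distrib_right)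
  also have "\<dots> = (\<Sum>k<n. \<Sum>j<n. \<Sum>i<n. ent A i k * ent B k j * ent C i j)"
    by (subst (2) sum.swap, subst (1) sum.swap, subst (2) sum.swap, rule refl)
  also have "\<dots> = inner B (tp A * C)"
    using n by (simp add: inner_fmat_bnd[of n] ent_times[of n] sum_distrib_left mult_ac)
  finally show ?thesis .
qed

lemma inner_mult_right: "inner (A * B) C = inner A (C * tp B)" for A B C :: fmat
proof -
  have "inner (A * B) C = inner (tp B * tp A) (tp C)"
    by (metis inner_tp_tp tp_mult)
  also have "\<dots> = inner (tp A) (B * tp C)" by (simp add: inner_mult_left)
  also have "\<dots> = inner A (C * tp B)" by (metis inner_tp_tp tp_mult tp_tp)
  finally show ?thesis .
qed

lemma inner_mult_left': "inner C (A * B) = inner (tp A * C) B" for A B C :: fmat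
  by (metis inner_commute inner_mult_left)
lemma inner_mult_right': "inner C (A * B) = inner (C * tp B) A" for A B C :: fmat
  by (metis inner_commute inner_mult_right)

text \<open>Matrix units. Rows are represented as matrices \<open>rw i A\<close> of the same type, so that their
  norms and products need no separate notion of vector.\<close>

lift_definition eu :: "nat \<Rightarrow> nat \<Rightarrow> fmat" is "\<lambda>a b i j. if i = a \<and> j = b then 1 else 0"
proof -
  fix a b :: nat
  have "bnd (Suc (max a b)) (\<lambda>i j. if i = a \<and> j = b then 1 else 0)" by (auto simp: bnd_def)
  then show "\<exists>n. bnd n (\<lambda>i j. if i = a \<and> j = b then 1 else (0::real))" by blast
qed
lemma ent_eu: "ent (eu a b) i j = (if i = a \<and> j = b then 1 else 0)" by transfer simp
lemma tp_eu [simp]: "tp (eu a b) = eu b a" by (rule fmat_eqI) (auto simp: ent_eu)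

lemma ent_eu_mult: "ent (eu a b * A) i j = (if i = a then ent A b j else 0)"
proof -
  obtain n where n: "bnd n (ent A)" using ex_bnd .
  have "ent (eu a b * A) i j = (\<Sum>k<n. ent (eu a b) i k * ent A k j)"
    using n by (simp add: ent_times[of n])
  also have "\<dots> = (\<Sum>k<n. if k = b then (if i = a then ent A b j else 0) else 0)"
    by (intro sum.cong refl) (simp add: ent_eu)
  also have "\<dots> = (if i = a then ent A b j else 0)" using n by (auto simp: bnd_ge)
  finally show ?thesis .
qed
lemma ent_mult_eu: "ent (A * eu a b) i j = (if j = b then ent A i a else 0)"
  using ent_eu_mult[of b a "tp A" j i] by (metis ent_tp tp_eu tp_mult tp_tp)

lemma eu_mult_eu: "eu a b * eu c d = (if b = c then eu a d else 0)"
  by (rule fmat_eqI) (auto simp: ent_eu_mult ent_eu)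

lemma norm_sq_ent: "bnd n (ent A) \<Longrightarrow> (norm A)\<^sup>2 = (\<Sum>i<n. \<Sum>j<n. (ent A i j)\<^sup>2)"
  unfolding power2_norm_eq_inner by (subst inner_fmat_bnd[of n]) (auto simp: power2_eq_square)

lemma inner_eu: "inner (eu a b) A = ent A a b"
proof -
  have b: "bnd (Suc (max a b)) (ent (eu a b))" by (auto simp: bnd_def ent_eu)
  have "inner (eu a b) A = (\<Sum>i<Suc (max a b). \<Sum>j<Suc (max a b). ent (eu a b) i j * ent A i j)"
    by (rule inner_fmat_bnd) (simp only: b simp_thms)
  also have "\<dots> = (\<Sum>i<Suc (max a b). if i = a then (\<Sum>j<Suc (max a b). if j = b then ent A a b else 0) else 0)"
  proof (intro sum.cong refl)
    fix i
    have "(\<Sum>j<Suc (max a b). ent (eu a b) i j * ent A i j)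
        = (\<Sum>j<Suc (max a b). if j = b then (if i = a then ent A a b else 0) else 0)"
      by (intro sum.cong refl) (simp add: ent_eu)
    then show "(\<Sum>j<Suc (max a b). ent (eu a b) i j * ent A i j)
        = (if i = a then (\<Sum>j<Suc (max a b). if j = b then ent A a b else 0) else 0)"
      by simp
  qed
  also have "\<dots> = ent A a b" by (subst sum.delta, simp, subst sum.delta) auto
  finally show ?thesis .
qed
lemma norm_eu [simp]: "norm (eu a b) = 1"
  by (simp add: norm_eq_sqrt_inner inner_eu ent_eu)

definition rw :: "nat \<Rightarrow> fmat \<Rightarrow> fmat" where "rw i A = eu i i * A"

lemma ent_rw [simp]: "ent (rw i A) a j = (if a = i then ent A i j else 0)"
  by (simp add: rw_def ent_eu_mult)
lemma rw_mult: "rw i (A * B) = rw i A * B" by (simp add: rw_def mult.assoc)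
lemma rw_diff: "rw i (A - B) = rw i A - rw i B" by (simp add: rw_def right_diff_distrib)
lemma rw_minus: "rw i (- A) = - rw i A" by (simp add: rw_def)
lemma rw_rw: "rw i (rw j A) = (if i = j then rw i A else 0)"
  by (rule fmat_eqI) auto
lemma bnd_rw: "bnd n (ent A) \<Longrightarrow> bnd n (ent (rw i A))"
  by (auto simp: bnd_def)

lemma norm_rw_sq: "bnd n (ent A) \<Longrightarrow> (norm (rw i A))\<^sup>2 = (\<Sum>j<n. (ent A i j)\<^sup>2)"
proof -
  assume n: "bnd n (ent A)"
  show ?thesis
  proof (cases "i < n")
    case True
    have "(norm (rw i A))\<^sup>2 = (\<Sum>a<n. if a = i then (\<Sum>j<n. (ent A i j)\<^sup>2) else 0)"
      unfolding norm_sq_ent[OF bnd_rw[OF n]] by (intro sum.cong refl) (auto intro!: sum.neutral)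
    then show ?thesis using True by simp
  next
    case False
    then have "rw i A = 0" by (intro fmat_eqI) (use n in \<open>auto simp: bnd_ge\<close>)
    then show ?thesis using False n by (auto simp: bnd_ge)
  qed
qed

lemma norm_sq_rows: "bnd n (ent A) \<Longrightarrow> (norm A)\<^sup>2 = (\<Sum>i<n. (norm (rw i A))\<^sup>2)"
  by (simp add: norm_rw_sq norm_sq_ent)

lemma norm_rw_le: "norm (rw i A) \<le> norm A"
proof -
  obtain n where n: "bnd n (ent A)" using ex_bnd .
  show ?thesis
  proof (cases "i < n")
    case True
    have "(norm (rw i A))\<^sup>2 \<le> (norm A)\<^sup>2"
      unfolding norm_sq_rows[OF n] using True by (intro member_le_sum) auto
    then show ?thesis by (rule power2_le_imp_le) simp
  next
    case False
    then have "rw i A = 0" by (intro fmat_eqI) (use n in \<open>auto simp: bnd_ge\<close>)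
    then show ?thesis by simp
  qed
qed

lemma norm_diff_rw_le: "norm (A - rw i A) \<le> norm A"
proof -
  obtain n where n: "bnd n (ent A)" using ex_bnd .
  have n2: "bnd n (ent (A - rw i A))" using n by (auto simp: bnd_def)
  have "(norm (A - rw i A))\<^sup>2 \<le> (norm A)\<^sup>2"
    unfolding norm_sq_ent[OF n] norm_sq_ent[OF n2] by (intro sum_mono) auto
  then show ?thesis by (rule power2_le_imp_le) simp
qed

lemma abs_ent_le: "\<bar>ent A i j\<bar> \<le> norm A"
  using Cauchy_Schwarz_ineq2[of "eu i j" A] by (simp add: inner_eu)

text \<open>Upper bounds of the operator norm, tested on matrices instead of vectors: with the Frobenius
  norm this gives the same bounds, and it composes with the algebra structure.\<close>

definition opb :: "fmat \<Rightarrow> real \<Rightarrow> bool" where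
  "opb A c \<longleftrightarrow> 0 \<le> c \<and> (\<forall>B. norm (A * B) \<le> c * norm B)"

lemma opbD: "opb A c \<Longrightarrow> norm (A * B) \<le> c * norm B" by (simp add: opb_def)
lemma opb_nonneg: "opb A c \<Longrightarrow> 0 \<le> c" by (simp add: opb_def)
lemma opb_mono: "opb A c \<Longrightarrow> c \<le> d \<Longrightarrow> opb A d"
  unfolding opb_def by (meson mult_right_mono norm_ge_zero order_trans)

lemma opbI_inner:
  assumes "0 \<le> c" "\<And>Y Z. inner Y (A * Z) \<le> c * norm Y * norm Z"
  shows "opb A c"
  unfolding opb_def
proof (intro conjI allI)
  fix B
  have "(norm (A * B))\<^sup>2 \<le> norm (A * B) * (c * norm B)"
    using assms(2)[of "A * B" B] by (simp add: power2_norm_eq_inner mult_ac)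
  then show "norm (A * B) \<le> c * norm B"
    using assms(1) by (cases "A * B = 0") (auto simp: power2_eq_square)
qed (fact assms(1))

lemma opb_inner: "opb A c \<Longrightarrow> \<bar>inner Y (A * Z)\<bar> \<le> c * norm Y * norm Z"
  using Cauchy_Schwarz_ineq2[of Y "A * Z"] mult_left_mono[OF opbD[of A c Z], of "norm Y"]
  by (auto simp: mult_ac)

lemma opb_tp: assumes "opb A c" shows "opb (tp A) c"
proof (rule opbI_inner)
  fix Y Z
  have "inner Y (tp A * Z) = inner (A * Y) Z" by (simp add: inner_mult_left)
  also have "\<dots> = inner Z (A * Y)" by (rule inner_commute)
  also have "\<dots> \<le> c * norm Z * norm Y" using opb_inner[OF assms, of Z Y] by simp
  finally show "inner Y (tp A * Z) \<le> c * norm Y * norm Z" by (simp add: mult_ac)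
qed (fact opb_nonneg[OF assms])

lemma opb_tp_iff [simp]: "opb (tp A) c \<longleftrightarrow> opb A c"
  using opb_tp[of A c] opb_tp[of "tp A" c] by auto

lemma opbD2: "opb A c \<Longrightarrow> norm (B * A) \<le> norm B * c"
  using opbD[OF opb_tp, of A c "tp B"] norm_tp[of "B * A"] by (simp add: mult.commute)

lemma norm_mult_fmat: "norm (A * B) \<le> norm A * norm (B::fmat)"
proof -
  obtain n where n: "bnd n (ent A)" "bnd n (ent B)" using ex_bnd2 .
  have n': "bnd n (ent (tp B))" using n by simp
  have "(ent (A * B) i j)\<^sup>2 \<le> (norm (rw i A))\<^sup>2 * (norm (rw j (tp B)))\<^sup>2" for i j
    unfolding ent_times[of n A B, OF disjI1[OF n(1)]] norm_rw_sq[OF n(1)] norm_rw_sq[OF n'] ent_tp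
    by (rule Cauchy_Schwarz_ineq_sum)
  then have "(norm (A * B))\<^sup>2 \<le> (\<Sum>i<n. \<Sum>j<n. (norm (rw i A))\<^sup>2 * (norm (rw j (tp B)))\<^sup>2)"
    unfolding norm_sq_ent[OF bnd_times[OF n]] by (intro sum_mono)
  also have "\<dots> = (norm A)\<^sup>2 * (norm (tp B))\<^sup>2"
    unfolding norm_sq_rows[OF n(1)] norm_sq_rows[OF n'] by (simp add: sum_product)
  finally have "(norm (A * B))\<^sup>2 \<le> (norm A * norm B)\<^sup>2" by (simp add: power_mult_distrib)
  then show ?thesis by (rule power2_le_imp_le) auto
qed

lemma opb_norm: "opb A (norm A)" by (simp add: opb_def norm_mult_fmat)
lemma opb_0: "opb 0 0" by (simp add: opb_def)

lemma opb_add: "opb A c \<Longrightarrow> opb B d \<Longrightarrow> opb (A + B) (c + d)"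
  unfolding opb_def by (auto simp: distrib_right intro!: norm_triangle_le add_mono)
lemma opb_minus: "opb (- A) c = opb A c" by (simp add: opb_def)
lemma opb_diff: "opb A c \<Longrightarrow> opb B d \<Longrightarrow> opb (A - B) (c + d)"
  using opb_add[of A c "- B" d] by (simp add: opb_minus)
lemma opb_scaleR: "opb A c \<Longrightarrow> opb (x *\<^sub>R A) (\<bar>x\<bar> * c)"
  unfolding opb_def by (auto simp: mult.assoc intro!: mult_left_mono)

section \<open>Entrywise products and row norms\<close>

lift_definition had :: "fmat \<Rightarrow> fmat \<Rightarrow> fmat" is "\<lambda>f g i j. f i j * g i j"
  by (auto simp: bnd_def)
lemma ent_had [simp]: "ent (had D A) i j = ent D i j * ent A i j" by transfer simp
lemma had_add_right: "had D (A + B) = had D A + had D B"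
  by (rule fmat_eqI) (simp add: algebra_simps)
lemma had_diff_right: "had D (A - B) = had D A - had D B"
  by (rule fmat_eqI) (simp add: algebra_simps)
lemma tp_had [simp]: "tp (had D A) = had (tp D) (tp A)" by (rule fmat_eqI) simp
lemma bnd_had1: "bnd n (ent D) \<Longrightarrow> bnd n (ent (had D A))" by (auto simp: bnd_def)
lemma bnd_had2: "bnd n (ent A) \<Longrightarrow> bnd n (ent (had D A))" by (auto simp: bnd_def)

lemma norm_had_le:
  assumes "0 \<le> c" "\<And>i j. \<bar>ent D i j\<bar> \<le> c"
  shows "norm (had D A) \<le> c * norm A"
proof -
  obtain n where n: "bnd n (ent A)" using ex_bnd .
  have "(norm (had D A))\<^sup>2 \<le> (c * norm A)\<^sup>2"
    unfolding power_mult_distrib norm_sq_ent[OF n] norm_sq_ent[OF bnd_had2[OF n]] sum_distrib_left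
  proof (intro sum_mono)
    fix i j
    have "(ent D i j)\<^sup>2 \<le> c\<^sup>2" using power_mono[OF assms(2)[of i j], of 2] by simp
    then show "(ent (had D A) i j)\<^sup>2 \<le> c\<^sup>2 * (ent A i j)\<^sup>2"
      by (simp add: power_mult_distrib mult_right_mono)
  qed
  then show ?thesis by (rule power2_le_imp_le) (simp add: assms)
qed

text \<open>Column \<open>k\<close> of \<open>A\<close>, used as a diagonal matrix, times \<open>Y\<close>. The sum over \<open>k\<close> of these matrices
  is what an entrywise product with \<open>A B\<^sup>T\<close> does to a bilinear form.\<close>

lift_definition scl :: "nat \<Rightarrow> fmat \<Rightarrow> fmat \<Rightarrow> fmat" is "\<lambda>k f g i l. f i k * g i l"
  unfolding bnd_def by (metis mult_eq_0_iff)
lemma ent_scl [simp]: "ent (scl k A Y) i l = ent A i k * ent Y i l" by transfer simp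
lemma bnd_scl: "bnd n (ent Y) \<Longrightarrow> bnd n (ent (scl k A Y))" by (auto simp: bnd_def)

lemma inner_had_eq_sum:
  assumes n: "bnd n (ent A)" "bnd n (ent B)" "bnd n (ent Y)" "bnd n (ent Z)" "bnd n (ent D)"
  shows "inner Y (had D (A * tp B) * Z) = (\<Sum>k<n. inner (scl k A Y) (D * scl k B Z))"
proof -
  have "inner Y (had D (A * tp B) * Z)
     = (\<Sum>i<n. \<Sum>l<n. \<Sum>j<n. \<Sum>k<n. ent Y i l * (ent D i j * (ent A i k * ent B j k) * ent Z j l))"
    using n by (simp add: inner_fmat_bnd[of n Y] ent_times[of n] bnd_had1 sum_distrib_left sum_distrib_right)
  also have "\<dots> = (\<Sum>i<n. \<Sum>l<n. \<Sum>k<n. \<Sum>j<n. ent Y i l * (ent D i j * (ent A i k * ent B j k) * ent Z j l))"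
    by (intro sum.cong refl sum.swap)
  also have "\<dots> = (\<Sum>i<n. \<Sum>k<n. \<Sum>l<n. \<Sum>j<n. ent Y i l * (ent D i j * (ent A i k * ent B j k) * ent Z j l))"
    by (intro sum.cong refl sum.swap)
  also have "\<dots> = (\<Sum>k<n. \<Sum>i<n. \<Sum>l<n. \<Sum>j<n. ent Y i l * (ent D i j * (ent A i k * ent B j k) * ent Z j l))"
    by (rule sum.swap)
  also have "\<dots> = (\<Sum>k<n. inner (scl k A Y) (D * scl k B Z))"
    using n by (intro sum.cong refl)
      (simp add: inner_fmat_bnd[of n] bnd_scl ent_times[of n] sum_distrib_left mult_ac)
  finally show ?thesis .
qed

lemma sum_norm_scl:
  assumes n: "bnd n (ent A)" "bnd n (ent Y)"
  shows "(\<Sum>k<n. (norm (scl k A Y))\<^sup>2) = (\<Sum>i<n. (norm (rw i A))\<^sup>2 * (norm (rw i Y))\<^sup>2)"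
proof -
  have "(\<Sum>k<n. (norm (scl k A Y))\<^sup>2) = (\<Sum>k<n. \<Sum>i<n. \<Sum>l<n. (ent A i k)\<^sup>2 * (ent Y i l)\<^sup>2)"
    using n by (simp add: norm_sq_ent[of n] bnd_scl power_mult_distrib)
  also have "\<dots> = (\<Sum>i<n. \<Sum>k<n. \<Sum>l<n. (ent A i k)\<^sup>2 * (ent Y i l)\<^sup>2)" by (rule sum.swap)
  also have "\<dots> = (\<Sum>i<n. (norm (rw i A))\<^sup>2 * (norm (rw i Y))\<^sup>2)"
    using n by (simp add: norm_rw_sq[of n] sum_product)
  finally show ?thesis .
qed

text \<open>Schur's bound. By \<open>inner_had_eq_sum\<close> the form is a sum of forms of \<open>D\<close> itself, and the
  Cauchy-Schwarz inequality over the index \<open>k\<close> collects the row norms of the factors. This is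
  where small rows pay off: the bound for \<open>D\<close> is multiplied by row norms instead of operator
  norms.\<close>

lemma had_bound:
  assumes D: "opb D c" and n: "bnd n (ent A)" "bnd n (ent B)" "bnd n (ent Y)" "bnd n (ent Z)" "bnd n (ent D)"
  shows "\<bar>inner Y (had D (A * tp B) * Z)\<bar>
    \<le> c * sqrt (\<Sum>i<n. (norm (rw i A))\<^sup>2 * (norm (rw i Y))\<^sup>2)
        * sqrt (\<Sum>i<n. (norm (rw i B))\<^sup>2 * (norm (rw i Z))\<^sup>2)"
proof -
  have "\<bar>inner Y (had D (A * tp B) * Z)\<bar> \<le> (\<Sum>k<n. \<bar>inner (scl k A Y) (D * scl k B Z)\<bar>)"
    unfolding inner_had_eq_sum[OF n] by (rule sum_abs)
  also have "\<dots> \<le> (\<Sum>k<n. c * (\<bar>norm (scl k A Y)\<bar> * \<bar>norm (scl k B Z)\<bar>))"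
    by (intro sum_mono) (use opb_inner[OF D] in \<open>simp add: mult.assoc\<close>)
  also have "\<dots> = c * (\<Sum>k<n. \<bar>norm (scl k A Y)\<bar> * \<bar>norm (scl k B Z)\<bar>)"
    by (simp add: sum_distrib_left)
  also have "\<dots> \<le> c * (L2_set (\<lambda>k. norm (scl k A Y)) {..<n} * L2_set (\<lambda>k. norm (scl k B Z)) {..<n})"
    by (intro mult_left_mono L2_set_mult_ineq opb_nonneg[OF D])
  also have "\<dots> = c * sqrt (\<Sum>i<n. (norm (rw i A))\<^sup>2 * (norm (rw i Y))\<^sup>2)
        * sqrt (\<Sum>i<n. (norm (rw i B))\<^sup>2 * (norm (rw i Z))\<^sup>2)"
    using n by (simp add: L2_set_def sum_norm_scl)
  finally show ?thesis .
qed

lemma sqrt_sum_rows_le: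
  assumes n: "bnd n (ent Y)" and a: "0 \<le> a" "\<And>i. norm (rw i A) \<le> a"
  shows "sqrt (\<Sum>i<n. (norm (rw i A))\<^sup>2 * (norm (rw i Y))\<^sup>2) \<le> a * norm Y"
proof -
  have "(\<Sum>i<n. (norm (rw i A))\<^sup>2 * (norm (rw i Y))\<^sup>2) \<le> (\<Sum>i<n. a\<^sup>2 * (norm (rw i Y))\<^sup>2)"
    using a by (intro sum_mono mult_right_mono power_mono) auto
  also have "\<dots> = (a * norm Y)\<^sup>2"
    by (simp add: norm_sq_rows[OF n] sum_distrib_left power_mult_distrib)
  finally show ?thesis using a by (intro real_le_lsqrt) auto
qed

lemma ex_bnd5: obtains n where "bnd n (ent A)" "bnd n (ent B)" "bnd n (ent C)" "bnd n (ent D)" "bnd n (ent E)"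
proof -
  obtain n where n: "bnd n (ent A)" "bnd n (ent B)" "bnd n (ent C)" using ex_bnd3 .
  obtain m where m: "bnd m (ent D)" "bnd m (ent E)" using ex_bnd2 .
  show ?thesis using n m by (intro that[of "max n m"]) (auto intro: bnd_mono)
qed

text \<open>Small rows in both factors turn a bound for \<open>D\<close> into a much smaller bound for \<open>D \<circ> (A B\<^sup>T)\<close>.\<close>

lemma opb_had:
  assumes D: "opb D c" and a: "\<And>i. norm (rw i A) \<le> a" and b: "\<And>i. norm (rw i B) \<le> b"
  shows "opb (had D (A * tp B)) (c * a * b)"
proof -
  have a0: "0 \<le> a" using a[of 0] norm_ge_zero order_trans by blast
  have b0: "0 \<le> b" using b[of 0] norm_ge_zero order_trans by blast
  note c0 = opb_nonneg[OF D]
  show ?thesis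
  proof (rule opbI_inner)
    show "0 \<le> c * a * b" using a0 b0 c0 by simp
    fix Y Z
    obtain n where n: "bnd n (ent A)" "bnd n (ent B)" "bnd n (ent Y)" "bnd n (ent Z)" "bnd n (ent D)"
      using ex_bnd5 .
    have "inner Y (had D (A * tp B) * Z) \<le> c * sqrt (\<Sum>i<n. (norm (rw i A))\<^sup>2 * (norm (rw i Y))\<^sup>2)
        * sqrt (\<Sum>i<n. (norm (rw i B))\<^sup>2 * (norm (rw i Z))\<^sup>2)"
      using had_bound[OF D n] by linarith
    also have "\<dots> \<le> c * (a * norm Y) * (b * norm Z)"
      by (intro mult_mono mult_left_mono sqrt_sum_rows_le n a b a0 b0 c0 mult_nonneg_nonneg norm_ge_zero
        real_sqrt_ge_zero sum_nonneg) auto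
    finally show "inner Y (had D (A * tp B) * Z) \<le> c * a * b * norm Y * norm Z" by (simp add: mult_ac)
  qed
qed

text \<open>The test matrix in \<open>had_bound\<close> is the product itself, so that one norm cancels. Only \<open>A\<close> and
  \<open>Z\<close> need small rows; \<open>B\<close> enters with its Frobenius norm.\<close>

lemma norm_had_mult_le:
  assumes D: "opb D c" and a: "\<And>i. norm (rw i A) \<le> a" and z: "\<And>i. norm (rw i Z) \<le> z"
  shows "norm (had D (A * tp B) * Z) \<le> c * a * norm B * z"
proof -
  have a0: "0 \<le> a" using a[of 0] norm_ge_zero order_trans by blast
  have z0: "0 \<le> z" using z[of 0] norm_ge_zero order_trans by blast
  note c0 = opb_nonneg[OF D]
  define Y where "Y = had D (A * tp B) * Z"
  obtain n where n: "bnd n (ent A)" "bnd n (ent B)" "bnd n (ent Y)" "bnd n (ent Z)" "bnd n (ent D)"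
    using ex_bnd5 .
  have "norm Y * norm Y \<le> c * sqrt (\<Sum>i<n. (norm (rw i A))\<^sup>2 * (norm (rw i Y))\<^sup>2)
      * sqrt (\<Sum>i<n. (norm (rw i B))\<^sup>2 * (norm (rw i Z))\<^sup>2)"
    using had_bound[OF D n] by (simp add: Y_def[symmetric] power2_norm_eq_inner[symmetric] power2_eq_square)
  also have "(\<Sum>i<n. (norm (rw i B))\<^sup>2 * (norm (rw i Z))\<^sup>2) = (\<Sum>i<n. (norm (rw i Z))\<^sup>2 * (norm (rw i B))\<^sup>2)"
    by (simp add: mult.commute)
  also have "c * sqrt (\<Sum>i<n. (norm (rw i A))\<^sup>2 * (norm (rw i Y))\<^sup>2) * sqrt \<dots> \<le> c * (a * norm Y) * (z * norm B)"
    by (intro mult_mono mult_left_mono sqrt_sum_rows_le n a z a0 z0 c0 mult_nonneg_nonneg norm_ge_zero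
        real_sqrt_ge_zero sum_nonneg) auto
  finally have "norm Y * norm Y \<le> norm Y * (c * a * norm B * z)" by (simp add: mult_ac)
  then have "norm Y \<le> c * a * norm B * z"
    using a0 z0 c0 by (cases "Y = 0") auto
  then show ?thesis by (simp add: Y_def)
qed

section \<open>Perturbation of truncations\<close>

definition oproj :: "fmat \<Rightarrow> bool" where "oproj Q \<longleftrightarrow> tp Q = Q \<and> Q * Q = Q"

lemma oproj_tp: "oproj Q \<Longrightarrow> tp Q = Q" by (simp add: oproj_def)
lemma oproj_idem: "oproj Q \<Longrightarrow> Q * Q = Q" by (simp add: oproj_def)
lemma oproj_idem': "oproj Q \<Longrightarrow> Q * (Q * A) = Q * A" by (simp add: oproj_def mult.assoc[symmetric])

lemma oproj_pyth: "oproj Q \<Longrightarrow> (norm B)\<^sup>2 = (norm (Q * B))\<^sup>2 + (norm (B - Q * B))\<^sup>2"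
proof -
  assume Q: "oproj Q"
  have "inner (Q * B) (B - Q * B) = 0"
    using Q by (simp add: inner_mult_left oproj_tp oproj_idem' right_diff_distrib)
  then have "(norm (Q * B + (B - Q * B)))\<^sup>2 = (norm (Q * B))\<^sup>2 + (norm (B - Q * B))\<^sup>2"
    unfolding power2_norm_eq_inner by (simp only: inner_add_left inner_add_right) (simp add: inner_commute)
  then show ?thesis by simp
qed

lemma oproj_norm_le: "oproj Q \<Longrightarrow> norm (Q * B) \<le> norm B"
  using oproj_pyth[of Q B] by (metis le_add_same_cancel1 le_add_same_cancel2 norm_ge_zero power2_le_imp_le zero_le_power2)
lemma oproj_norm_compl_le: "oproj Q \<Longrightarrow> norm (B - Q * B) \<le> norm B"
  using oproj_pyth[of Q B] by (metis le_add_same_cancel1 le_add_same_cancel2 norm_ge_zero power2_le_imp_le zero_le_power2)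
lemma oproj_opb: "oproj Q \<Longrightarrow> opb Q 1" by (simp add: opb_def oproj_norm_le)
lemma oproj_norm_le2: "oproj Q \<Longrightarrow> norm (B * Q) \<le> norm B"
  using opbD2[OF oproj_opb] by fastforce
lemma oproj_norm_compl_le2: assumes "oproj Q" shows "norm (B - B * Q) \<le> norm B"
  using oproj_norm_compl_le[OF assms, of "tp B"] norm_tp[of "B - B * Q"] assms
  by (simp add: oproj_tp)

text \<open>\<open>X\<close> is a truncation of \<open>W\<close>, with column space the range of \<open>P\<close> and row space the range of
  \<open>Q\<close>: the singular values of \<open>X\<close> on these spaces are at least \<open>s\<close>, and the remainder \<open>W - X\<close> has
  operator norm at most \<open>h\<close>. For a truncated singular value decomposition \<open>s\<close> and \<open>h\<close> are the two
  singular values next to the cut.\<close>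

definition spl :: "fmat \<Rightarrow> fmat \<Rightarrow> fmat \<Rightarrow> fmat \<Rightarrow> real \<Rightarrow> real \<Rightarrow> bool" where
  "spl W P Q X s h \<longleftrightarrow> oproj P \<and> oproj Q \<and> P * W = X \<and> W * Q = X \<and>
     (\<forall>B. s * norm (Q * B) \<le> norm (X * B)) \<and> (\<forall>B. s * norm (P * B) \<le> norm (tp X * B)) \<and>
     opb (W - X) h"

lemma splD:
  assumes "spl W P Q X s h"
  shows "oproj P" "oproj Q" "P * W = X" "W * Q = X"
    "s * norm (Q * B) \<le> norm (X * B)" "s * norm (P * B) \<le> norm (tp X * B)" "opb (W - X) h"
    "P * X = X" "X * Q = X"
  using assms unfolding spl_def by (auto simp: oproj_idem' mult.assoc oproj_idem)

lemma spl_tp: "spl W P Q X s h \<Longrightarrow> spl (tp W) Q P (tp X) s h"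
  unfolding spl_def
  by (auto simp: oproj_tp simp flip: tp_diff)
     (metis oproj_tp tp_mult)+

text \<open>Compress \<open>W - W'\<close> to the range of \<open>P'\<close> and the complement of \<open>Q\<close>: \<open>W'\<close> contributes \<open>X'\<close>,
  which is at least \<open>s'\<close> there, and \<open>W\<close> contributes only its remainder.\<close>

lemma sine_step:
  assumes 1: "spl W P Q X s h" and 2: "spl W' P' Q' X' s' h'"
  shows "s' * norm (Q' - Q' * Q) \<le> h * norm (P' - P' * P) + norm (P' * (W - W'))"
proof -
  note a = splD[OF 1] and b = splD[OF 2]
  let ?R = "W - X" and ?D = "W - W'"
  have "s' * norm (Q' * (Q' - Q)) \<le> norm (X' * (Q' - Q))" by (rule b(5))
  then have "s' * norm (Q' - Q' * Q) \<le> norm (X' - X' * Q)"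
    by (simp add: right_diff_distrib b(9) oproj_idem[OF b(2)])
  also have "X' - X' * Q = (P' - P' * P) * ?R - (P' * ?D - P' * ?D * Q)"
    by (simp add: algebra_simps a(3,4,8,9) b(3,4,8,9) mult.assoc[of P' P] flip: b(3))
  also have "norm \<dots> \<le> norm ((P' - P' * P) * ?R) + norm (P' * ?D - P' * ?D * Q)"
    by (rule norm_triangle_ineq4)
  also have "\<dots> \<le> norm (P' - P' * P) * h + norm (P' * ?D)"
    by (intro add_mono opbD2 a(7) oproj_norm_compl_le2 a(2))
  finally show ?thesis by (simp add: mult.commute)
qed

text \<open>\<open>sine_step\<close> bounds the angle between the row spaces by the angle between the column spaces
  and conversely; since \<open>h / s' \<le> 1 / 4\<close> the two inequalities can be solved.\<close>

lemma sine_theorem: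
  assumes 1: "spl W P Q X s h" and 2: "spl W' P' Q' X' s' h'" and s: "0 < s'" "h \<le> s' / 4"
  shows "norm (Q' - Q' * Q) \<le> 2 / s' * (norm ((W - W') * Q') + norm (P' * (W - W')))"
proof -
  let ?z = "norm (Q' - Q' * Q)" and ?y = "norm (P' - P' * P)"
  let ?a = "norm (P' * (W - W'))" and ?b = "norm ((W - W') * Q')"
  have h0: "0 \<le> h" using splD(7)[OF 1] by (rule opb_nonneg)
  have lin: "z \<le> 2 * (b + a)" if "z \<le> z / 16 + b / 4 + a" "0 \<le> a" "0 \<le> b" for a b z :: real
    using that by argo
  have z: "s' * ?z \<le> h * ?y + ?a" by (rule sine_step[OF 1 2])
  have "norm (Q' * (tp W - tp W')) = ?b"
    using norm_tp[of "(W - W') * Q'"] oproj_tp[OF splD(2)[OF 2]] by simp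
  then have y: "s' * ?y \<le> h * ?z + ?b"
    using sine_step[OF spl_tp[OF 1] spl_tp[OF 2]] by simp
  have "h * ?y \<le> s' / 4 * ?y" using s by (intro mult_right_mono) auto
  moreover have "h * ?z \<le> s' / 4 * ?z" using s by (intro mult_right_mono) auto
  ultimately have "s' * ?z \<le> (s' * ?y) / 4 + ?a" "s' * ?y \<le> (s' * ?z) / 4 + ?b"
    using z y by linarith+
  then have "s' * ?z \<le> (s' * ?z) / 16 + ?b / 4 + ?a" by linarith
  then have "s' * ?z \<le> 2 * (?b + ?a)"
    using lin[OF _ norm_ge_zero norm_ge_zero] by blast
  then show ?thesis using s by (simp add: field_simps)
qed

text \<open>The part of \<open>X\<close> outside the column space of \<open>M\<close> comes from \<open>H\<close>, up to a small multiple of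
  its part outside the row space, and conversely; this bounds both parts by \<open>H Q0\<close> and \<open>P0 H\<close>. The
  part inside both spaces is compared with \<open>M\<close> directly, up to the compression of the remainder
  \<open>M + H - X\<close>, which is a small multiple of the error itself.\<close>

lemma truncation_error:
  assumes M: "spl M P0 Q0 M s0 0" and W: "spl (M + H) P Q X s h" and H: "opb H h"
    and s: "0 < s" "0 < s0" "h \<le> s / 4" "h \<le> s0 / 4"
  shows "norm (X - M) \<le> 4 * (norm (H * Q0) + norm (P0 * H))"
proof -
  note m = splD[OF M] and w = splD[OF W]
  let ?f1 = "norm (H * Q0)" and ?f2 = "norm (P0 * H)"
  let ?a = "norm (X - P0 * X)" and ?b = "norm (X - X * Q0)"
  have h0: "0 \<le> h" using H by (rule opb_nonneg)
  have step: "norm (X - P0 * X) \<le> norm (H * Q0) + h * norm (X - X * Q0) / s"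
    if M: "spl M P0 Q0 M s0 0" and W: "spl (M + H) P Q X s h" and H: "opb H h"
    for M P0 Q0 H P Q X
  proof -
    note m = splD[OF M] and w = splD[OF W]
    have "X - P0 * X = (H * Q0) * Q - P0 * ((H * Q0) * Q) + (H * (Q - Q0 * Q) - P0 * (H * (Q - Q0 * Q)))"
      by (simp add: algebra_simps m(3,4,8,9) flip: w(4)) (simp add: mult.assoc[symmetric] m(3))
    also have "norm \<dots> \<le> norm ((H * Q0) * Q - P0 * ((H * Q0) * Q)) + norm (H * (Q - Q0 * Q) - P0 * (H * (Q - Q0 * Q)))"
      by (rule norm_triangle_ineq)
    also have "\<dots> \<le> norm ((H * Q0) * Q) + norm (H * (Q - Q0 * Q))"
      by (intro add_mono oproj_norm_compl_le m)
    also have "\<dots> \<le> norm (H * Q0) + h * norm (Q - Q0 * Q)"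
      by (intro add_mono oproj_norm_le2 w opbD H)
    finally have 1: "norm (X - P0 * X) \<le> norm (H * Q0) + h * norm (Q - Q0 * Q)" .
    have "norm (Q - Q0 * Q) = norm (Q - Q * Q0)"
      using norm_tp[of "Q - Q0 * Q"] by (simp add: oproj_tp m w)
    moreover have "s * norm (Q * (Q - Q0)) \<le> norm (X * (Q - Q0))" by (rule w)
    ultimately have "s * norm (Q - Q0 * Q) \<le> norm (X - X * Q0)"
      by (simp add: right_diff_distrib w oproj_idem)
    then have "h * norm (Q - Q0 * Q) \<le> h * (norm (X - X * Q0) / s)"
      using h0 s by (intro mult_left_mono) (auto simp: field_simps)
    then show ?thesis using 1 by simp
  qed
  have a: "?a \<le> ?f1 + h * ?b / s" by (rule step[OF M W H])
  have "norm (tp X - Q0 * tp X) \<le> norm (tp H * P0) + h * norm (tp X - tp X * P0) / s"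
    by (rule step[OF spl_tp[OF M]]) (use spl_tp[OF W] opb_tp[OF H] in auto)
  moreover have "norm (tp X - Q0 * tp X) = ?b" "norm (tp X - tp X * P0) = ?a" "norm (tp H * P0) = ?f2"
    using norm_tp[of "X - X * Q0"] norm_tp[of "X - P0 * X"] norm_tp[of "P0 * H"]
    by (simp_all add: oproj_tp m)
  ultimately have b: "?b \<le> ?f2 + h * ?a / s" by simp
  have hs: "h / s \<le> 1 / 4" using s by (simp add: field_simps)
  have "h / s * ?b \<le> 1 / 4 * ?b" "h / s * ?a \<le> 1 / 4 * ?a"
    using hs by (intro mult_right_mono; simp)+
  then have "h * ?b / s \<le> ?b / 4" "h * ?a / s \<le> ?a / 4" by simp_all
  then have ab: "?a + ?b \<le> 4 / 3 * (?f1 + ?f2)" using a b by argo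
  \<comment> \<open>The last two terms are the part of the error inside both spaces of \<open>M\<close>.\<close>
  have dec: "X - M = (X - P0 * X) + P0 * (X - X * Q0) + (P0 * H * Q0 - P0 * (M + H - X) * Q0)"
    by (simp add: right_diff_distrib left_diff_distrib distrib_left distrib_right m mult.assoc)
  have "norm (P0 * (M + H - X) * Q0) \<le> h / s0 * norm (X - M)"
  proof -
    have PR: "P * (M + H - X) = 0" by (simp add: right_diff_distrib w)
    have "P0 * (M + H - X) = (P0 - P0 * P) * (M + H - X)"
      by (simp add: left_diff_distrib mult.assoc PR)
    then have "norm (P0 * (M + H - X) * Q0) \<le> norm ((P0 - P0 * P) * (M + H - X))"
      using oproj_norm_le2[OF m(2)] by simp
    also have "\<dots> \<le> norm (P0 - P0 * P) * h" by (intro opbD2 w)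
    also have "\<dots> \<le> (norm (X - M) / s0) * h"
    proof (intro mult_right_mono h0)
      have "s0 * norm (P0 * (P0 - P)) \<le> norm (tp M * (P0 - P))" by (rule m)
      also have "P0 * (P0 - P) = P0 - P0 * P" by (simp add: right_diff_distrib oproj_idem m)
      also have "norm (tp M * (P0 - P)) = norm (M - P * M)"
        using norm_tp[of "tp M * (P0 - P)"] by (simp add: left_diff_distrib right_diff_distrib oproj_tp m w)
      also have "M - P * M = (M - X) - P * (M - X)" by (simp add: algebra_simps w)
      also have "norm \<dots> \<le> norm (X - M)"
        using oproj_norm_compl_le[OF w(1), of "M - X"] by (simp add: norm_minus_commute)
      finally show "norm (P0 - P0 * P) \<le> norm (X - M) / s0" using s by (simp add: field_simps)
    qed
    finally show ?thesis by (simp add: mult.commute)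
  qed
  also have "\<dots> \<le> 1 / 4 * norm (X - M)"
    using s by (intro mult_right_mono) (auto simp: field_simps)
  finally have r: "norm (P0 * (M + H - X) * Q0) \<le> 1 / 4 * norm (X - M)" .
  have "norm (X - M) \<le> norm ((X - P0 * X) + P0 * (X - X * Q0)) + norm (P0 * H * Q0 - P0 * (M + H - X) * Q0)"
    by (subst dec) (rule norm_triangle_ineq)
  also have "\<dots> \<le> (norm (X - P0 * X) + norm (P0 * (X - X * Q0))) + (norm (P0 * H * Q0) + norm (P0 * (M + H - X) * Q0))"
    by (intro add_mono norm_triangle_ineq norm_triangle_ineq4)
  also have "\<dots> \<le> (?a + ?b) + (?f2 + 1 / 4 * norm (X - M))"
    by (intro add_mono oproj_norm_le oproj_norm_le2 m r order_refl)
  finally show ?thesis using ab norm_ge_zero[of "H * Q0"] norm_ge_zero[of "P0 * H"] by argo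
qed

text \<open>Row by row, the truncation error is the row of the projected noise plus a share of the total
  error that is proportional to the incoherence of \<open>M\<close>.\<close>

lemma truncation_error_row:
  assumes M: "spl M P0 Q0 M s0 0" and W: "spl (M + H) P Q X s h"
  shows "norm (rw i (X - M)) \<le> norm (rw i P0) * norm (X - M) + norm (rw i H * Q)"
proof -
  note m = splD[OF M] and w = splD[OF W]
  have "X - M = H * Q - P0 * ((M - X) - (M - X) * Q)"
    by (simp add: algebra_simps m w flip: w(4)) (simp add: mult.assoc[symmetric] m oproj_idem w mult.assoc[of _ Q Q])
  then have "rw i (X - M) = rw i H * Q - rw i P0 * ((M - X) - (M - X) * Q)"
    by (metis rw_diff rw_mult)
  also have "norm \<dots> \<le> norm (rw i H * Q) + norm (rw i P0 * ((M - X) - (M - X) * Q))"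
    by (rule norm_triangle_ineq4)
  also have "norm (rw i P0 * ((M - X) - (M - X) * Q)) \<le> norm (rw i P0) * norm ((M - X) - (M - X) * Q)"
    by (rule norm_mult_fmat)
  also have "\<dots> \<le> norm (rw i P0) * norm (M - X)"
    by (intro mult_left_mono oproj_norm_compl_le2 w) auto
  finally show ?thesis by (simp add: norm_minus_commute)
qed

lemma row_eq_col: "norm (A * eu i i) = norm (rw i (tp A))"
  using norm_tp[of "A * eu i i"] by (simp add: rw_def)

text \<open>Incoherence of the column space of the truncation, from row \<open>i\<close> of the projected noise:
  \<open>X\<^sup>T\<close> is bounded below by \<open>s\<close> on the range of \<open>P\<close>, and it annihilates the part of \<open>e\<^sub>i\<close> outside
  the column space of \<open>M\<close> up to the noise.\<close>

lemma left_proj_row: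
  assumes M: "spl M P0 Q0 M s0 0" and W: "spl (M + H) P Q X s h0" and H: "opb H h" and s: "0 < s"
  shows "norm (rw i P) \<le> norm (rw i P0) + (norm (rw i H * Q) + h * norm (rw i P0)) / s"
proof -
  note m = splD[OF M] and w = splD[OF W]
  define u where "u = eu i i - P0 * eu i i"
  have MP: "tp M * P0 = tp M" by (metis m(1,3) oproj_tp tp_mult)
  have Mu: "tp M * u = 0"
    by (simp add: u_def right_diff_distrib MP mult.assoc[symmetric])
  have X: "tp X = Q * (tp M + tp H)" by (metis w(2,4) oproj_tp tp_mult tp_add)
  have "tp X * u = Q * (tp H * u)"
    by (simp add: X mult.assoc distrib_right Mu)
  also have "\<dots> = Q * (tp H * eu i i) - Q * (tp H * (P0 * eu i i))" by (simp add: u_def right_diff_distrib)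
  also have "norm \<dots> \<le> norm (Q * (tp H * eu i i)) + norm (Q * (tp H * (P0 * eu i i)))"
    by (rule norm_triangle_ineq4)
  also have "norm (Q * (tp H * eu i i)) = norm (rw i H * Q)"
    using norm_tp[of "Q * (tp H * eu i i)"] by (simp add: rw_def oproj_tp w)
  also have "norm (Q * (tp H * (P0 * eu i i))) \<le> norm (tp H * (P0 * eu i i))" by (intro oproj_norm_le w)
  also have "\<dots> \<le> h * norm (P0 * eu i i)" by (intro opbD) (simp add: H)
  also have "norm (P0 * eu i i) = norm (rw i P0)" by (simp add: row_eq_col oproj_tp m)
  finally have "norm (tp X * u) \<le> norm (rw i H * Q) + h * norm (rw i P0)" by simp
  moreover have "s * norm (P * u) \<le> norm (tp X * u)" by (rule w)
  ultimately have Pu: "norm (P * u) \<le> (norm (rw i H * Q) + h * norm (rw i P0)) / s"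
    using s by (simp add: field_simps)
  have "rw i P = rw i P0 * P + tp (P * u)"
    by (simp add: u_def rw_def right_diff_distrib oproj_tp m w mult.assoc)
  then have "norm (rw i P) \<le> norm (rw i P0 * P) + norm (P * u)"
    by (metis norm_tp norm_triangle_ineq)
  then show ?thesis using Pu oproj_norm_le2[OF w(1), of "rw i P0"] by linarith
qed

text \<open>The same estimate with row \<open>i\<close> of the error in place of the noise; it applies without
  knowledge of the matrix that was truncated.\<close>

lemma left_proj_row_error:
  assumes M: "spl M P0 Q0 M s0 0" and W: "spl W P Q X s h0" and s: "0 < s"
  shows "norm (rw i P) \<le> norm (rw i P0) + (norm (rw i (X - M)) + norm (X - M) * norm (rw i P0)) / s"
proof -
  note m = splD[OF M] and w = splD[OF W]
  define u where "u = eu i i - P0 * eu i i"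
  have MP: "tp M * P0 = tp M" by (metis m(1,3) oproj_tp tp_mult)
  have Mu: "tp M * u = 0"
    by (simp add: u_def right_diff_distrib MP mult.assoc[symmetric])
  have "tp X * u = tp (X - M) * u" by (simp add: left_diff_distrib Mu)
  also have "\<dots> = tp (X - M) * eu i i - tp (X - M) * (P0 * eu i i)" by (simp add: u_def right_diff_distrib)
  also have "norm \<dots> \<le> norm (tp (X - M) * eu i i) + norm (tp (X - M) * (P0 * eu i i))"
    by (rule norm_triangle_ineq4)
  also have "norm (tp (X - M) * eu i i) = norm (rw i (X - M))" by (simp only: row_eq_col tp_tp)
  also have "norm (tp (X - M) * (P0 * eu i i)) \<le> norm (tp (X - M)) * norm (P0 * eu i i)" by (rule norm_mult_fmat)
  also have "norm (P0 * eu i i) = norm (rw i P0)" by (simp add: row_eq_col oproj_tp m)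
  finally have "norm (tp X * u) \<le> norm (rw i (X - M)) + norm (X - M) * norm (rw i P0)"
    by (simp only: norm_tp)
  moreover have "s * norm (P * u) \<le> norm (tp X * u)" by (rule w)
  ultimately have Pu: "norm (P * u) \<le> (norm (rw i (X - M)) + norm (X - M) * norm (rw i P0)) / s"
    using s by (simp add: field_simps)
  have "rw i P = rw i P0 * P + tp (P * u)"
    by (simp add: u_def rw_def right_diff_distrib oproj_tp m w mult.assoc)
  then have "norm (rw i P) \<le> norm (rw i P0 * P) + norm (P * u)"
    by (metis norm_tp norm_triangle_ineq)
  then show ?thesis using Pu oproj_norm_le2[OF w(1), of "rw i P0"] by linarith
qed

lemma norm_row_opb: assumes "opb H h" shows "norm (rw i H) \<le> h"
proof -
  have "norm (tp H * eu i i) \<le> h * norm (eu i i)" using assms by (intro opbD) simp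
  then show ?thesis by (simp add: row_eq_col)
qed

lemma opb_diff_rw: "opb H h \<Longrightarrow> opb (H - rw i H) h"
  unfolding opb_def by (metis (no_types, lifting) left_diff_distrib norm_diff_rw_le order_trans rw_mult)

text \<open>Removing row \<open>i\<close> of the noise changes the row space \<open>Q\<close> into \<open>Q'\<close>. By the sine theorem the
  change is controlled by the removed row after projection to \<open>Q\<close>, that is, by the quantity to be
  bounded; it comes with a factor \<open>h / s\<close>, so it can be absorbed. The second claim returns from
  \<open>Q'\<close> to \<open>Q\<close> in the rows.\<close>

lemma leave_one_out:
  assumes M: "spl M P0 Q0 M s0 0" and W: "spl (M + H) P Q X s h"
    and W': "spl (M + (H - rw i H)) P' Q' X' s h" and H: "opb H h"
    and s: "0 < s" "h \<le> s / 16" and b: "norm (rw i P0) \<le> b"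
  shows "norm (rw i H * Q) \<le> 2 * norm (rw i H * Q') + h * b"
    and "norm (rw j Q') \<le> norm (rw j Q) + 2 / s * (norm (rw i H * Q') + 2 * h * b)"
proof -
  note m = splD[OF M] and w = splD[OF W] and w' = splD[OF W']
  let ?D = "rw i H"
  define x where "x = norm (?D * Q)"
  define g where "g = norm (?D * Q')"
  have h0: "0 \<le> h" using H by (rule opb_nonneg)
  have b0: "0 \<le> b" using b norm_ge_zero order_trans by blast
  have hs: "h / s \<le> 1 / 16" using s by (simp add: field_simps)
  have Dh: "norm ?D \<le> h" using H by (rule norm_row_opb)
  have PD: "norm (R * ?D) \<le> norm (rw i R) * h" if "oproj R" for R
  proof -
    have "R * ?D = tp (rw i R) * ?D"
      using that by (simp add: rw_def oproj_tp mult.assoc[symmetric]) (simp add: mult.assoc eu_mult_eu)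
    then have "norm (R * ?D) \<le> norm (tp (rw i R)) * norm ?D" by (simp only: norm_mult_fmat)
    also have "\<dots> \<le> norm (rw i R) * h" using Dh by (simp add: mult_left_mono)
    finally show ?thesis .
  qed
  have u: "norm (rw i P) \<le> b + (x + h * b) / s"
  proof -
    have "norm (rw i P) \<le> norm (rw i P0) + (x + h * norm (rw i P0)) / s"
      unfolding x_def by (rule left_proj_row[OF M W H s(1)])
    also have "\<dots> \<le> b + (x + h * b) / s"
      using b s h0 by (intro add_mono divide_right_mono mult_left_mono) auto
    finally show ?thesis .
  qed
  have u': "norm (rw i P') \<le> 2 * b"
  proof -
    have "norm (rw i P') \<le> norm (rw i P0) + (norm (rw i (H - rw i H) * Q') + h * norm (rw i P0)) / s"
      by (rule left_proj_row[OF M W' opb_diff_rw[OF H] s(1)])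
    also have "rw i (H - rw i H) = 0" by (simp add: rw_diff rw_rw)
    also have "norm (rw i P0) + (norm (0 * Q') + h * norm (rw i P0)) / s \<le> b + h / s * b"
      using b s h0 by (simp add: add_mono divide_right_mono mult_left_mono)
    also have "\<dots> \<le> b + 1 / 16 * b" using hs b0 by (intro add_left_mono mult_right_mono)
    finally show ?thesis using b0 by linarith
  qed
  have 1: "norm (Q - Q * Q') \<le> 2 / s * (x + norm (rw i P) * h)"
  proof -
    have "norm (Q - Q * Q') \<le> 2 / s * (norm ((M + (H - rw i H) - (M + H)) * Q) + norm (P * (M + (H - rw i H) - (M + H))))"
      using s by (intro sine_theorem[OF W' W]) auto
    also have "M + (H - rw i H) - (M + H) = - ?D" by simp
    also have "2 / s * (norm (- ?D * Q) + norm (P * - ?D)) \<le> 2 / s * (x + norm (rw i P) * h)"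
      using PD[OF w(1)] s by (intro mult_left_mono) (auto simp: x_def)
    finally show ?thesis .
  qed
  have 2: "norm (Q' - Q' * Q) \<le> 2 / s * (g + norm (rw i P') * h)"
  proof -
    have "norm (Q' - Q' * Q) \<le> 2 / s * (norm ((M + H - (M + (H - rw i H))) * Q') + norm (P' * (M + H - (M + (H - rw i H)))))"
      using s by (intro sine_theorem[OF W W']) auto
    also have "M + H - (M + (H - rw i H)) = ?D" by simp
    also have "2 / s * (norm (?D * Q') + norm (P' * ?D)) \<le> 2 / s * (g + norm (rw i P') * h)"
      using PD[OF w'(1)] s by (intro mult_left_mono) (auto simp: g_def)
    finally show ?thesis .
  qed
  have "?D * Q = (?D * Q') * Q + ?D * (Q - Q' * Q)" by (simp add: algebra_simps)
  then have "x \<le> norm ((?D * Q') * Q) + norm (?D * (Q - Q' * Q))"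
    unfolding x_def by (metis norm_triangle_ineq)
  also have "\<dots> \<le> g + norm ?D * norm (Q - Q' * Q)"
    unfolding g_def by (intro add_mono oproj_norm_le2 w norm_mult_fmat)
  also have "norm (Q - Q' * Q) = norm (Q - Q * Q')"
    using norm_tp[of "Q - Q' * Q"] by (simp add: oproj_tp w w')
  also have "g + norm ?D * norm (Q - Q * Q') \<le> g + h * (2 / s * (x + norm (rw i P) * h))"
    using Dh h0 1 by (intro add_left_mono mult_mono) auto
  also have "\<dots> = g + 2 * (h / s) * (x + norm (rw i P) * h)" by simp
  also have "\<dots> \<le> g + 2 * (1 / 16) * (x + (b + (x + h * b) / s) * h)"
    using hs h0 u b0 s by (intro add_left_mono mult_mono) (auto simp: x_def intro!: mult_nonneg_nonneg add_nonneg_nonneg mult_right_mono divide_nonneg_pos)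
  also have "\<dots> = g + 1 / 8 * (x + b * h + (h / s) * x + (h / s) * (h * b))"
    by (simp add: algebra_simps add_divide_distrib)
  also have "\<dots> \<le> g + 1 / 8 * (x + b * h + (1 / 16) * x + (1 / 16) * (h * b))"
    using hs h0 b0 by (intro add_left_mono mult_left_mono add_mono mult_right_mono) (auto simp: x_def)
  finally have "x \<le> g + 1 / 8 * (x + b * h + (1 / 16) * x + (1 / 16) * (h * b))" .
  moreover have "0 \<le> g" "0 \<le> h * b" using h0 b0 by (auto simp: g_def)
  moreover have "x \<le> 2 * g + z" if "x \<le> g + 1 / 8 * (x + z + (1 / 16) * x + (1 / 16) * z)" "0 \<le> g" "0 \<le> z" for z
    using that by argo
  ultimately show "norm (?D * Q) \<le> 2 * norm (?D * Q') + h * b"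
    unfolding x_def[symmetric] g_def[symmetric] mult.commute[of b h] by blast
  have "rw j Q' = rw j Q * Q' + rw j (Q' - Q * Q')" by (simp add: rw_diff rw_mult)
  then have "norm (rw j Q') \<le> norm (rw j Q * Q') + norm (rw j (Q' - Q * Q'))"
    by (metis norm_triangle_ineq)
  also have "\<dots> \<le> norm (rw j Q) + norm (Q' - Q * Q')"
    by (intro add_mono oproj_norm_le2 w' norm_rw_le)
  also have "norm (Q' - Q * Q') = norm (Q' - Q' * Q)"
    using norm_tp[of "Q' - Q' * Q"] by (simp add: oproj_tp w w')
  also have "\<dots> \<le> 2 / s * (g + norm (rw i P') * h)" by (rule 2)
  also have "\<dots> \<le> 2 / s * (g + 2 * b * h)"
    using s u' h0 by (intro mult_left_mono add_left_mono mult_right_mono) auto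
  finally show "norm (rw j Q') \<le> norm (rw j Q) + 2 / s * (norm (?D * Q') + 2 * h * b)"
    by (simp add: g_def mult_ac)
qed

section \<open>Contraction of the error\<close>

definition blk :: "nat \<Rightarrow> nat \<Rightarrow> fmat \<Rightarrow> bool" where
  "blk n1 n2 A \<longleftrightarrow> (\<forall>i j. ent A i j \<noteq> 0 \<longrightarrow> i < n1 \<and> j < n2)"

lemma blk_add: "blk m n A \<Longrightarrow> blk m n B \<Longrightarrow> blk m n (A + B)"
  unfolding blk_def by (metis add_cancel_right_right ent_add)
lemma blk_diff: "blk m n A \<Longrightarrow> blk m n B \<Longrightarrow> blk m n (A - B)"
  unfolding blk_def by (metis diff_zero ent_diff)
lemma blk_had1: "blk m n D \<Longrightarrow> blk m n (had D A)" by (auto simp: blk_def)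
lemma blk_rw: "blk m n A \<Longrightarrow> blk m n (rw i A)" by (auto simp: blk_def split: if_splits)
lemma blk_tp [simp]: "blk m n (tp A) \<longleftrightarrow> blk n m A" by (auto simp: blk_def)
lemma blk_bnd: "blk m n A \<Longrightarrow> m \<le> k \<Longrightarrow> n \<le> k \<Longrightarrow> bnd k (ent A)"
  by (force simp: blk_def bnd_def)
lemma blk_rw_0: "blk m n A \<Longrightarrow> i \<ge> m \<Longrightarrow> rw i A = 0"
  by (rule fmat_eqI) (auto simp: blk_def, metis not_less)
lemma blk_mult: "blk m n A \<Longrightarrow> blk n k B \<Longrightarrow> blk m k (A * B)"
  unfolding blk_def ent_times_dimb by (metis (no_types, lifting) mult_eq_0_iff sum.neutral)

lemma opb_factor: assumes "oproj (V * tp V)" shows "opb V 1" "opb (tp V) 1"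
proof -
  show "opb (tp V) 1"
    unfolding opb_def
  proof (intro conjI allI)
    fix B
    have "(norm (tp V * B))\<^sup>2 = inner B (V * tp V * B)"
      by (simp add: power2_norm_eq_inner inner_mult_left mult.assoc)
    also have "\<dots> \<le> norm B * norm (V * tp V * B)" by (rule norm_cauchy_schwarz)
    also have "\<dots> \<le> norm B * norm B" by (intro mult_left_mono oproj_norm_le assms) auto
    finally show "norm (tp V * B) \<le> 1 * norm B" by (simp add: power2_eq_square[symmetric])
  qed simp
  then show "opb V 1" by simp
qed

text \<open>The weights \<open>D i j\<close> distort the orthonormality of the columns of \<open>V\<close> by at most \<open>g\<close> on every
  row. For a sampling pattern this is a bound on sums of independent variables for fixed \<open>V\<close>.\<close>

definition gram_le :: "nat \<Rightarrow> nat \<Rightarrow> fmat \<Rightarrow> fmat \<Rightarrow> real \<Rightarrow> bool" where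
  "gram_le n r D V g \<longleftrightarrow>
     (\<forall>i. \<forall>k<r. \<forall>l<r. \<bar>\<Sum>j<n. ent D i j * (ent V j k * ent V j l)\<bar> \<le> g)"

text \<open>A row of \<open>C V V\<^sup>T\<close> is a combination of \<open>r\<close> rows of \<open>V\<^sup>T\<close>, so \<open>D\<close> acts on it by an \<open>r \<times> r\<close>
  matrix whose entries are the sums in \<open>gram_le\<close>.\<close>

lemma gram_contraction:
  assumes g: "gram_le n r D V g" "0 \<le> g" and V: "blk n r V" and Q: "oproj (V * tp V)"
  shows "norm (had D (C * (V * tp V)) * (V * tp V)) \<le> real r * g * norm C"
proof -
  define Y where "Y = C * V"
  obtain m0 where m0: "bnd m0 (ent C)" "bnd m0 (ent D)" using ex_bnd2 .
  define m where "m = max m0 (max n r)"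
  have m: "bnd m (ent C)" "bnd m (ent D)" "bnd m (ent V)" "n \<le> m" "r \<le> m"
    using m0 blk_bnd[OF V, of m] by (auto simp: m_def intro: bnd_mono)
  have mY: "bnd m (ent Y)" unfolding Y_def by (intro bnd_times m)
  have Yr: "ent Y i k = 0" if "k \<ge> r" for i k
  proof -
    have "ent V j k = 0" for j using V that by (force simp: blk_def)
    then show ?thesis unfolding Y_def ent_times_dimb by simp
  qed
  let ?Z = "had D (Y * tp V) * V"
  have mZ: "bnd m (ent ?Z)" by (intro bnd_times bnd_had1 m)
  have Zl: "ent ?Z i l = (\<Sum>k<r. ent Y i k * (\<Sum>j<n. ent D i j * (ent V j k * ent V j l)))" for i l
  proof -
    have "ent ?Z i l = (\<Sum>j<m. \<Sum>k<m. ent Y i k * (ent D i j * (ent V j k * ent V j l)))"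
      using m mY by (simp add: ent_times[of m] bnd_had1 sum_distrib_left sum_distrib_right mult_ac)
    also have "\<dots> = (\<Sum>k<m. \<Sum>j<m. ent Y i k * (ent D i j * (ent V j k * ent V j l)))"
      by (rule sum.swap)
    also have "\<dots> = (\<Sum>k<m. ent Y i k * (\<Sum>j<m. ent D i j * (ent V j k * ent V j l)))"
      by (simp add: sum_distrib_left)
    also have "\<dots> = (\<Sum>k<r. ent Y i k * (\<Sum>j<m. ent D i j * (ent V j k * ent V j l)))"
      by (rule sum_lt_extend[symmetric]) (use m Yr in auto)
    also have "\<dots> = (\<Sum>k<r. ent Y i k * (\<Sum>j<n. ent D i j * (ent V j k * ent V j l)))"
      by (intro sum.cong refl arg_cong2[where f="(*)"] sum_lt_extend[symmetric])
        (use m V in \<open>auto simp: blk_def\<close>, metis not_less)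
    finally show ?thesis .
  qed
  have Zl0: "ent ?Z i l = 0" if "l \<ge> r" for i l
  proof -
    have "ent V j l = 0" for j using V that by (force simp: blk_def)
    then show ?thesis unfolding ent_times_dimb[of "had D (Y * tp V)"] by simp
  qed
  have Zb: "(ent ?Z i l)\<^sup>2 \<le> g\<^sup>2 * (real r * (\<Sum>k<r. (ent Y i k)\<^sup>2))" if "l < r" for i l
  proof -
    have "\<bar>ent ?Z i l\<bar> \<le> (\<Sum>k<r. \<bar>ent Y i k\<bar> * g)"
      unfolding Zl using g(1) that
      by (intro order_trans[OF sum_abs] sum_mono) (auto simp: abs_mult gram_le_def intro!: mult_left_mono)
    also have "\<dots> = g * (\<Sum>k<r. \<bar>ent Y i k\<bar> * 1)" by (simp add: sum_distrib_left mult.commute)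
    finally have "\<bar>ent ?Z i l\<bar>\<^sup>2 \<le> (g * (\<Sum>k<r. \<bar>ent Y i k\<bar> * 1))\<^sup>2"
      by (intro power_mono) auto
    also have "\<dots> \<le> g\<^sup>2 * ((\<Sum>k<r. \<bar>ent Y i k\<bar>\<^sup>2) * (\<Sum>k<r. 1\<^sup>2))"
      unfolding power_mult_distrib by (intro mult_left_mono Cauchy_Schwarz_ineq_sum) auto
    finally show ?thesis by (simp add: mult.commute)
  qed
  have "(norm ?Z)\<^sup>2 = (\<Sum>i<m. \<Sum>l<r. (ent ?Z i l)\<^sup>2)"
    unfolding norm_sq_ent[OF mZ]
    by (intro sum.cong refl sum_lt_extend[symmetric]) (use m Zl0 in auto)
  also have "\<dots> \<le> (\<Sum>i<m. \<Sum>l<r. g\<^sup>2 * (real r * (\<Sum>k<r. (ent Y i k)\<^sup>2)))"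
    by (intro sum_mono Zb) auto
  also have "\<dots> = (real r * g)\<^sup>2 * (\<Sum>i<m. \<Sum>k<r. (ent Y i k)\<^sup>2)"
    by (simp add: power_mult_distrib power2_eq_square[of "real r"] sum_distrib_left mult_ac)
  also have "(\<Sum>i<m. \<Sum>k<r. (ent Y i k)\<^sup>2) = (norm Y)\<^sup>2"
    unfolding norm_sq_ent[OF mY]
    by (intro sum.cong refl sum_lt_extend) (use m Yr in auto)
  finally have "(norm ?Z)\<^sup>2 \<le> (real r * g * norm Y)\<^sup>2" by (simp add: power_mult_distrib)
  then have Z: "norm ?Z \<le> real r * g * norm Y" by (rule power2_le_imp_le) (simp add: g)
  have "had D (C * (V * tp V)) * (V * tp V) = ?Z * tp V" by (simp add: Y_def mult.assoc)
  also have "norm \<dots> \<le> norm ?Z * 1" by (intro opbD2 opb_factor Q)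
  also have "\<dots> \<le> real r * g * norm Y" using Z by simp
  also have "\<dots> \<le> real r * g * (norm C * 1)"
    unfolding Y_def by (intro mult_left_mono opbD2 opb_factor Q) (simp add: g)
  finally show ?thesis by simp
qed

text \<open>The decomposition \<open>E = E Q0 + X (Q - Q0 Q)\<^sup>T\<close>. The angle between \<open>Q\<close> and \<open>Q0\<close> is at most of
  the order of the error, because \<open>X\<close> is bounded below on its row space.\<close>

lemma contraction_core:
  assumes M: "spl M P0 Q0 M sg 0" and sg: "0 < sg"
    and V: "blk n r V" "Q0 = V * tp V" and g: "gram_le n r D V g" "0 \<le> g"
    and X: "oproj Q" "X * Q = X" "\<And>B. sg / 2 * norm (Q * B) \<le> norm (X * B)"
  shows "norm (had D (X - M) * Q0) \<le> real r * g * norm (X - M) + norm (had D (X * tp (Q - Q0 * Q)) * Q0)"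
    and "norm (Q - Q0 * Q) \<le> 2 / sg * norm (X - M)"
proof -
  note m = splD[OF M]
  let ?E = "X - M"
  have "?E = ?E * Q0 + X * tp (Q - Q0 * Q)"
    by (simp add: algebra_simps m oproj_tp X mult.assoc[symmetric])
  then have "had D ?E * Q0 = had D (?E * Q0) * Q0 + had D (X * tp (Q - Q0 * Q)) * Q0"
    by (metis had_add_right distrib_right)
  also have "norm \<dots> \<le> norm (had D (?E * Q0) * Q0) + norm (had D (X * tp (Q - Q0 * Q)) * Q0)"
    by (rule norm_triangle_ineq)
  also have "norm (had D (?E * Q0) * Q0) \<le> real r * g * norm ?E"
    using gram_contraction[OF g V(1)] m(2) unfolding V(2) by blast
  finally show "norm (had D (X - M) * Q0) \<le> real r * g * norm (X - M) + norm (had D (X * tp (Q - Q0 * Q)) * Q0)"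
    by simp
  have "norm (Q - Q0 * Q) = norm (Q * (Q - Q0))"
    using norm_tp[of "Q - Q0 * Q"] by (simp add: oproj_tp X m right_diff_distrib oproj_idem)
  then have "sg / 2 * norm (Q - Q0 * Q) \<le> norm (X * (Q - Q0))" using X(3) by simp
  also have "X * (Q - Q0) = ?E - ?E * Q0" by (simp add: algebra_simps X m)
  also have "norm \<dots> \<le> norm ?E" by (intro oproj_norm_compl_le2 m)
  finally show "norm (Q - Q0 * Q) \<le> 2 / sg * norm (X - M)" using sg by (simp add: field_simps)
qed

lemma row_M_le:
  assumes M: "spl M P0 Q0 M sg 0" "opb M (kap * sg)" "norm (rw i P0) \<le> b"
  shows "norm (rw i M) \<le> kap * sg * b"
proof -
  have "norm (rw i M) = norm (rw i P0 * M)" by (simp add: rw_mult[symmetric] splD[OF M(1)])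
  also have "\<dots> \<le> norm (rw i P0) * (kap * sg)" by (intro opbD2 M)
  also have "\<dots> \<le> b * (kap * sg)" by (intro mult_right_mono M opb_nonneg[OF M(2)])
  finally show ?thesis by (simp add: mult_ac)
qed

text \<open>The second part of \<open>contraction_core\<close> is an entrywise product with a factorised matrix, so
  Schur's bound applies if \<open>X\<close> has small rows.\<close>

lemma contraction_incoherent:
  assumes M: "spl M P0 Q0 M sg 0" and sg: "0 < sg"
    and V: "blk n r V" "Q0 = V * tp V" and g: "gram_le n r D V g" "0 \<le> g"
    and X: "oproj Q" "X * Q = X" "\<And>B. sg / 2 * norm (Q * B) \<le> norm (X * B)"
    and D: "opb D L" and rX: "\<And>i. norm (rw i X) \<le> 2 * kap * sg * b1" and b2: "\<And>j. norm (rw j Q0) \<le> b2"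
  shows "norm (had D (X - M) * Q0) \<le> (real r * g + 4 * (L * kap * b1 * b2)) * norm (X - M)"
proof -
  note c = contraction_core[OF M sg V g X]
  have nn: "0 \<le> L" "0 \<le> 2 * kap * sg * b1" "0 \<le> b2"
    using D opb_nonneg rX[of 0] b2[of 0] norm_ge_zero order_trans by blast+
  have "norm (had D (X * tp (Q - Q0 * Q)) * Q0) \<le> L * (2 * kap * sg * b1) * norm (Q - Q0 * Q) * b2"
    by (rule norm_had_mult_le[OF D rX b2])
  also have "\<dots> \<le> L * (2 * kap * sg * b1) * (2 / sg * norm (X - M)) * b2"
    by (intro mult_right_mono mult_left_mono c(2) mult_nonneg_nonneg[OF nn(1,2)] nn(3))
  also have "\<dots> = 4 * (L * kap * b1 * b2) * norm (X - M)" using sg by (simp add: field_simps)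
  finally show ?thesis using c(1) by (simp add: distrib_right)
qed

text \<open>Replace \<open>X\<close> by \<open>M + E\<close> in the second part of \<open>contraction_core\<close>. For \<open>M\<close> Schur's bound
  applies; for \<open>E\<close> the remaining term is quadratic in the error, and a bound on the entries of \<open>D\<close>
  is enough when the error is small.\<close>

lemma contraction_close:
  assumes M: "spl M P0 Q0 M sg 0" "opb M (kap * sg)" and sg: "0 < sg"
    and V: "blk n r V" "Q0 = V * tp V" and g: "gram_le n r D V g" "0 \<le> g"
    and X: "oproj Q" "X * Q = X" "\<And>B. sg / 2 * norm (Q * B) \<le> norm (X * B)"
    and D: "opb D L" "0 \<le> dm" "\<And>i j. \<bar>ent D i j\<bar> \<le> dm"
    and b1: "\<And>i. norm (rw i P0) \<le> b1" and b2: "\<And>j. norm (rw j Q0) \<le> b2"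
  shows "norm (had D (X - M) * Q0)
      \<le> (real r * g + 2 * (L * kap * b1 * b2) + 2 * dm * norm (X - M) / sg) * norm (X - M)"
proof -
  note m = splD[OF M(1)]
  note c = contraction_core[OF M(1) sg V g X]
  let ?E = "X - M" and ?B = "Q - Q0 * Q"
  have nn: "0 \<le> L" "0 \<le> kap * sg" "0 \<le> b1" "0 \<le> b2"
    using D opb_nonneg M(2) b1[of 0] b2[of 0] norm_ge_zero order_trans by blast+
  have rM: "norm (rw i M) \<le> kap * sg * b1" for i by (rule row_M_le[OF M b1])
  have "X * tp ?B = M * tp ?B + ?E * tp ?B" by (simp add: algebra_simps)
  then have "had D (X * tp ?B) * Q0 = had D (M * tp ?B) * Q0 + had D (?E * tp ?B) * Q0"
    by (metis had_add_right distrib_right)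
  also have "norm \<dots> \<le> norm (had D (M * tp ?B) * Q0) + norm (had D (?E * tp ?B) * Q0)"
    by (rule norm_triangle_ineq)
  also have "norm (had D (M * tp ?B) * Q0) \<le> L * (kap * sg * b1) * norm ?B * b2"
    by (rule norm_had_mult_le[OF D(1) rM b2])
  also have "\<dots> \<le> L * (kap * sg * b1) * (2 / sg * norm ?E) * b2"
    by (intro mult_right_mono mult_left_mono c(2) nn(4)
        mult_nonneg_nonneg[OF nn(1) mult_nonneg_nonneg[OF nn(2,3)]])
  also have "\<dots> = 2 * (L * kap * b1 * b2) * norm ?E" using sg by (simp add: field_simps)
  also have "norm (had D (?E * tp ?B) * Q0) \<le> norm (had D (?E * tp ?B))" by (intro oproj_norm_le2 m)
  also have "\<dots> \<le> dm * norm (?E * tp ?B)" by (intro norm_had_le D)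
  also have "\<dots> \<le> dm * (norm ?E * norm (tp ?B))" by (intro mult_left_mono norm_mult_fmat D)
  also have "\<dots> \<le> dm * (norm ?E * (2 / sg * norm ?E))"
    unfolding norm_tp by (intro mult_left_mono c(2) D) auto
  finally show ?thesis using c(1) by (simp add: algebra_simps)
qed

text \<open>\<open>X - M = X Q - M Q0\<close> is a difference of two products with small rows. This controls the
  noise in operator norm, as the perturbation bounds require, and the entries of the error, as
  Bernstein's inequality requires.\<close>

lemma opb_had_incoherent:
  assumes M: "spl M P0 Q0 M sg 0" "opb M (kap * sg)"
    and X: "oproj Q" "X * Q = X"
    and D: "opb D L" and rX: "\<And>i. norm (rw i X) \<le> 2 * kap * sg * b1" and rQ: "\<And>j. norm (rw j Q) \<le> 2 * b2"
    and b1: "\<And>i. norm (rw i P0) \<le> b1" and b2: "\<And>j. norm (rw j Q0) \<le> b2"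
  shows "opb (had D (X - M)) (5 * (L * kap * b1 * b2) * sg)" and "\<bar>ent (X - M) i j\<bar> \<le> 5 * kap * sg * b1 * b2"
proof -
  note m = splD[OF M(1)]
  have rM: "norm (rw i M) \<le> kap * sg * b1" for i by (rule row_M_le[OF M b1])
  have "opb (had D (X * tp Q) - had D (M * tp Q0)) (L * (2 * kap * sg * b1) * (2 * b2) + L * (kap * sg * b1) * b2)"
    by (intro opb_diff opb_had D rX rQ rM b2)
  then show "opb (had D (X - M)) (5 * (L * kap * b1 * b2) * sg)"
    by (simp add: oproj_tp X m had_diff_right algebra_simps)
  have *: "\<bar>ent (A * R) i j\<bar> \<le> norm (rw i A) * norm (rw j R)" if "oproj R" for A R
  proof -
    have "ent (A * R) i j = ent (rw i A * (R * eu j j)) i j"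
      by (simp only: rw_mult[symmetric] mult.assoc[symmetric]) (simp add: ent_mult_eu)
    also have "\<bar>\<dots>\<bar> \<le> norm (rw i A * (R * eu j j))" by (rule abs_ent_le)
    also have "\<dots> \<le> norm (rw i A) * norm (R * eu j j)" by (rule norm_mult_fmat)
    also have "norm (R * eu j j) = norm (rw j R)" using that by (simp add: row_eq_col oproj_tp)
    finally show ?thesis .
  qed
  have nn: "0 \<le> kap * sg * b1" "0 \<le> b2" "0 \<le> 2 * kap * sg * b1"
    using rM[of 0] b2[of 0] rX[of 0] norm_ge_zero order_trans by blast+
  have "\<bar>ent (X * Q) i j\<bar> \<le> (2 * kap * sg * b1) * (2 * b2)"
    by (intro order_trans[OF *[OF X(1)]] mult_mono rX rQ nn norm_ge_zero)
  moreover have "\<bar>ent (M * Q0) i j\<bar> \<le> (kap * sg * b1) * b2"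
    by (intro order_trans[OF *[OF m(2)]] mult_mono rM b2 nn norm_ge_zero)
  ultimately show "\<bar>ent (X - M) i j\<bar> \<le> 5 * kap * sg * b1 * b2" by (simp add: X m)
qed

lemma proj_rows_of_error:
  assumes M: "spl M P0 Q0 M sg 0" and W: "spl W P Q X s h" and s: "sg / 2 \<le> s" "0 < sg"
    and b: "norm (rw i P0) \<le> b" and e: "norm (rw i (X - M)) \<le> sg * b / 4" "norm (X - M) \<le> sg / 4"
  shows "norm (rw i P) \<le> 2 * b"
proof -
  have b0: "0 \<le> b" using b norm_ge_zero order_trans by blast
  have "norm (rw i P) \<le> norm (rw i P0) + (norm (rw i (X - M)) + norm (X - M) * norm (rw i P0)) / s"
    using s by (intro left_proj_row_error[OF M W]) auto
  also have "\<dots> \<le> b + (sg * b / 4 + sg / 4 * b) / s"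
    using s b b0 e by (intro add_mono divide_right_mono mult_mono) auto
  also have "\<dots> \<le> b + (sg * b / 4 + sg / 4 * b) / (sg / 2)"
    using s b0 by (intro add_left_mono divide_left_mono) auto
  also have "\<dots> = 2 * b" using s by (simp add: field_simps)
  finally show ?thesis .
qed

section \<open>Row and column control of one step\<close>

definition cw :: "nat \<Rightarrow> fmat \<Rightarrow> fmat" where "cw j A = tp (rw j (tp A))"
lemma tp_cw: "tp (cw j A) = rw j (tp A)" by (simp add: cw_def)
lemma blk_cw: "blk m n A \<Longrightarrow> blk m n (cw j A)" by (simp add: cw_def blk_rw)

text \<open>The assumption on \<open>g\<close> is what fresh randomness gives for the projection \<open>Q'\<close> without row
  \<open>i\<close>; it contains the row norms of \<open>Q'\<close>. These are bounded through \<open>Q\<close> and hence through the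
  columns of the noise (\<open>y\<close>). The result bounds the rows by a small multiple of the column bound.\<close>

lemma row_step_half:
  assumes M: "spl M P0 Q0 M sg 0" and W: "spl (M + H) P Q X s h"
    and W': "spl (M + (H - rw i H)) P' Q' X' s h" and H: "opb H h"
    and s: "19 / 20 * sg \<le> s" "0 < sg" "h \<le> sg / 100"
    and b: "norm (rw i P0) \<le> b1" "\<And>j. norm (rw j Q0) \<le> b2"
    and phi: "0 \<le> phi" "phi * b2 \<le> ep * sg * b1" "phi \<le> ep * sg" and ep: "0 \<le> ep" "ep \<le> 1 / 24"
    and g: "\<And>v. (\<And>j. norm (rw j Q') \<le> v) \<Longrightarrow> norm (rw i H * Q') \<le> ep * sg * b1 + phi * v"
    and y: "\<And>j. norm (rw j (tp H) * P) \<le> y * sg * b2" "0 \<le> y"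
  shows "norm (rw i H * Q) \<le> (11 * ep + 6 * ep * y + h / sg) * sg * b1"
proof -
  note m = splD[OF M] and w = splD[OF W] and w' = splD[OF W']
  have h0: "0 \<le> h" using H by (rule opb_nonneg)
  have b1: "0 \<le> b1" using b(1) norm_ge_zero order_trans by blast
  have b2: "0 \<le> b2" using b(2)[of 0] norm_ge_zero order_trans by blast
  have s0: "0 < s" using s by linarith
  have h16: "h \<le> s / 16" using s by linarith
  note l = leave_one_out[OF M W W' H s0 h16 b(1)]
  define G where "G = norm (rw i H * Q')"
  have s1: "1 / s \<le> 20 / 19 / sg" using s s0 by (simp add: field_simps)
  have rq: "norm (rw j Q) \<le> 2 * b2 + 2 * y * b2" for j
  proof -
    have "norm (rw j Q) \<le> norm (rw j Q0) + (norm (rw j (tp H) * P) + h * norm (rw j Q0)) / s"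
      using left_proj_row[OF spl_tp[OF M] _ opb_tp[OF H] s0, of Q P "tp X" h] spl_tp[OF W] by simp
    also have "\<dots> \<le> b2 + (y * sg * b2 + sg / 100 * b2) / s"
      using s0 h0 b(2) y(1) s by (intro add_mono divide_right_mono mult_mono) auto
    also have "\<dots> \<le> b2 + (y * sg * b2 + sg / 100 * b2) / (sg / 2)"
      using s s0 b2 y by (intro add_left_mono divide_left_mono) auto
    also have "\<dots> \<le> 2 * b2 + 2 * y * b2" using s b2 by (simp add: field_simps)
    finally show ?thesis .
  qed
  \<comment> \<open>\<open>v\<close> contains \<open>G\<close> itself; it enters the bound for \<open>G\<close> with the factor \<open>3 phi / sg \<le> 1 / 8\<close>.\<close>
  define v where "v = 2 * b2 + 2 * y * b2 + 3 / sg * G + b1"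
  have "norm (rw j Q') \<le> v" for j
  proof -
    have "norm (rw j Q') \<le> norm (rw j Q) + 2 / s * (G + 2 * h * b1)" unfolding G_def by (rule l(2))
    also have "\<dots> \<le> (2 * b2 + 2 * y * b2) + 2 * (20 / 19 / sg) * (G + 2 * (sg / 100) * b1)"
      using s1 s h0 b1 rq[of j] by (intro add_mono mult_mono) (auto simp: G_def)
    also have "\<dots> \<le> v" unfolding v_def using s b1 norm_ge_zero[of "rw i H * Q'"]
      by (simp add: field_simps G_def)
    finally show ?thesis .
  qed
  define z where "z = ep * sg * b1"
  have z0: "0 \<le> z" "0 \<le> y * z" using ep s b1 y by (auto simp: z_def)
  have "ep * sg \<le> 1 / 24 * sg" using ep s by (intro mult_right_mono) auto
  then have p24: "phi * 24 \<le> sg" using phi by linarith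
  have p8: "3 * phi / sg \<le> 1 / 8" using p24 s by (simp add: pos_divide_le_eq)
  have "G \<le> ep * sg * b1 + phi * v" unfolding G_def by (rule g) fact
  also have "\<dots> = ep * sg * b1 + (2 + 2 * y) * (phi * b2) + (3 * phi / sg) * G + phi * b1"
    by (simp add: v_def algebra_simps)
  also have "\<dots> \<le> ep * sg * b1 + (2 + 2 * y) * (ep * sg * b1) + (1 / 8) * G + (ep * sg) * b1"
    using y(2) by (intro add_mono mult_left_mono mult_right_mono order_refl phi(2,3) p8 b1) (auto simp: G_def)
  also have "\<dots> = 4 * z + 2 * (y * z) + 1 / 8 * G" by (simp add: z_def distrib_right)
  finally have "G \<le> 4 * z + 2 * (y * z) + 1 / 8 * G" .
  then have "2 * G \<le> 11 * z + 6 * (y * z)" using z0 by linarith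
  also have "\<dots> = (11 + 6 * y) * (ep * sg * b1)" by (simp add: z_def distrib_right)
  finally have "2 * G \<le> (11 + 6 * y) * (ep * sg * b1)" .
  moreover have "norm (rw i H * Q) \<le> 2 * G + h * b1" unfolding G_def by (rule l(1))
  ultimately have "norm (rw i H * Q) \<le> (11 + 6 * y) * (ep * sg * b1) + h * b1" by linarith
  also have "\<dots> = (11 * ep + 6 * ep * y + h / sg) * sg * b1" using s by (simp add: field_simps)
  finally show ?thesis .
qed

text \<open>Let \<open>y\<close> be the maximum of all normalised row and column quantities. Each of them is at most
  \<open>11 ep + y / 4 + h / sg\<close> by \<open>row_step_half\<close>, since \<open>6 ep \<le> 1 / 4\<close>, so the maximum bounds itself.\<close>

lemma row_step:
  fixes Pf Qf :: "fmat \<Rightarrow> fmat"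
  assumes M: "spl M P0 Q0 M sg 0" and W: "spl (M + H) P Q X s h" and H: "opb H h" "blk n1 n2 H"
    and Wi: "\<And>i. i < n1 \<Longrightarrow> \<exists>P' X'. spl (M + (H - rw i H)) P' (Qf (M + (H - rw i H))) X' s h"
    and Wj: "\<And>j. j < n2 \<Longrightarrow> \<exists>Q' X'. spl (M + (H - cw j H)) (Pf (M + (H - cw j H))) Q' X' s h"
    and s: "19 / 20 * sg \<le> s" "0 < sg" "h \<le> sg / 100"
    and b: "\<And>i. norm (rw i P0) \<le> b1" "\<And>j. norm (rw j Q0) \<le> b2" "0 < b1" "0 < b2"
    and phi: "0 \<le> phi" "phi * b2 \<le> ep * sg * b1" "phi * b1 \<le> ep * sg * b2" and ep: "0 \<le> ep" "ep \<le> 1 / 24"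
    and gi: "\<And>i v. i < n1 \<Longrightarrow> (\<And>j. norm (rw j (Qf (M + (H - rw i H)))) \<le> v) \<Longrightarrow>
        norm (rw i H * Qf (M + (H - rw i H))) \<le> ep * sg * b1 + phi * v"
    and gj: "\<And>j v. j < n2 \<Longrightarrow> (\<And>i. norm (rw i (Pf (M + (H - cw j H)))) \<le> v) \<Longrightarrow>
        norm (rw j (tp H) * Pf (M + (H - cw j H))) \<le> ep * sg * b2 + phi * v"
  shows "norm (rw i H * Q) \<le> (15 * ep + 2 * h / sg) * sg * b1"
    and "norm (rw j (tp H) * P) \<le> (15 * ep + 2 * h / sg) * sg * b2"
proof -
  have h0: "0 \<le> h" using H(1) by (rule opb_nonneg)
  have phi': "phi \<le> ep * sg"
  proof -
    have "(phi * b2) * (phi * b1) \<le> (ep * sg * b1) * (ep * sg * b2)"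
      using phi(1) ep s b by (intro mult_mono[OF phi(2,3)]) auto
    then have "(phi * phi) * (b1 * b2) \<le> ((ep * sg) * (ep * sg)) * (b1 * b2)" by (simp add: mult_ac)
    then have "phi * phi \<le> (ep * sg) * (ep * sg)"
      using b(3,4) by (rule mult_right_le_imp_le[OF _ mult_pos_pos])
    then have "phi\<^sup>2 \<le> (ep * sg)\<^sup>2" by (simp only: power2_eq_square)
    moreover have "0 \<le> ep * sg" using ep s by simp
    ultimately show ?thesis by (rule power2_le_imp_le)
  qed
  define S where "S = insert 0 ((\<lambda>i. norm (rw i H * Q) / (sg * b1)) ` {..<n1} \<union> (\<lambda>j. norm (rw j (tp H) * P) / (sg * b2)) ` {..<n2})"
  define y where "y = Max S"
  have fin: "finite S" "S \<noteq> {}" by (auto simp: S_def)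
  have y0: "0 \<le> y" unfolding y_def using fin by (intro Max_ge) (auto simp: S_def)
  have yi: "norm (rw i H * Q) \<le> y * sg * b1" for i
  proof (cases "i < n1")
    case True
    then have "norm (rw i H * Q) / (sg * b1) \<le> y" unfolding y_def using fin by (intro Max_ge) (auto simp: S_def)
    then show ?thesis using s b by (simp add: pos_divide_le_eq mult.assoc)
  next
    case False
    then have "rw i H = 0" using blk_rw_0[OF H(2)] by simp
    then show ?thesis using y0 s b(3) by simp
  qed
  have yj: "norm (rw j (tp H) * P) \<le> y * sg * b2" for j
  proof (cases "j < n2")
    case True
    then have "norm (rw j (tp H) * P) / (sg * b2) \<le> y" unfolding y_def using fin by (intro Max_ge) (auto simp: S_def)
    then show ?thesis using s b by (simp add: pos_divide_le_eq mult.assoc)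
  next
    case False
    then have "rw j (tp H) = 0" using blk_rw_0[of n2 n1 "tp H"] H(2) by simp
    then show ?thesis using y0 s b(4) by simp
  qed
  let ?c = "11 * ep + 6 * ep * y + h / sg"
  have c0: "0 \<le> ?c" using ep y0 h0 s by auto
  have i: "norm (rw i H * Q) / (sg * b1) \<le> ?c" if i: "i < n1" for i
  proof -
    obtain P' X' where W': "spl (M + (H - rw i H)) P' (Qf (M + (H - rw i H))) X' s h" using Wi[OF i] by blast
    have "norm (rw i H * Q) \<le> ?c * sg * b1"
      by (rule row_step_half[OF M W W' H(1) s b(1) b(2) phi(1,2) phi' ep gi[OF i] yj y0])
    then show ?thesis using s b by (simp add: pos_divide_le_eq mult.assoc)
  qed
  have j: "norm (rw j (tp H) * P) / (sg * b2) \<le> ?c" if j: "j < n2" for j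
  proof -
    obtain Q' X' where W': "spl (M + (H - cw j H)) (Pf (M + (H - cw j H))) Q' X' s h" using Wj[OF j] by blast
    have W'': "spl (tp M + (tp H - rw j (tp H))) Q' (Pf (M + (H - cw j H))) (tp X') s h"
      using spl_tp[OF W'] by (simp add: tp_cw)
    have "norm (rw j (tp H) * P) \<le> ?c * sg * b2"
    proof (rule row_step_half[OF spl_tp[OF M] _ W'' opb_tp[OF H(1)] s b(2) b(1) phi(1,3) phi' ep gj[OF j] _ y0])
      show "spl (tp M + tp H) Q P (tp X) s h" using spl_tp[OF W] by simp
      show "norm (rw i (tp (tp H)) * Q) \<le> y * sg * b1" for i using yi by simp
    qed
    then show ?thesis using s b by (simp add: pos_divide_le_eq mult.assoc)
  qed
  have "y \<le> ?c" unfolding y_def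
    using fin i j c0 by (intro Max.boundedI) (auto simp: S_def y_def[unfolded S_def])
  moreover have "6 * ep * y \<le> 6 * (1 / 24) * y" using ep y0 by (intro mult_right_mono) auto
  moreover have "0 \<le> h / sg" using h0 s by simp
  moreover have "t \<le> 15 * a + 2 * c" if "t \<le> 11 * a + u + c" "u \<le> 6 * (1 / 24) * t" "0 \<le> c" "0 \<le> a"
    for t a u c :: real using that by argo
  ultimately have "y \<le> 15 * ep + 2 * (h / sg)" using ep by blast
  then have y': "y \<le> 15 * ep + 2 * h / sg" by simp
  show "norm (rw i H * Q) \<le> (15 * ep + 2 * h / sg) * sg * b1"
    using y' s b by (intro order_trans[OF yi] mult_right_mono) auto
  show "norm (rw j (tp H) * P) \<le> (15 * ep + 2 * h / sg) * sg * b2"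
    using y' s b by (intro order_trans[OF yj] mult_right_mono) auto
qed

section \<open>A noncommutative Khintchine inequality\<close>

definition opn :: "fmat \<Rightarrow> real" where "opn A = Inf {c. opb A c}"

lemma opn_nonneg: "0 \<le> opn A"
  unfolding opn_def using opb_norm opb_nonneg by (intro cInf_greatest) auto
lemma opn_le: "opb A c \<Longrightarrow> opn A \<le> c"
  unfolding opn_def by (intro cInf_lower) (auto intro: opb_nonneg bdd_belowI[of _ 0])
lemma opb_opn: "opb A (opn A)"
  unfolding opb_def
proof (intro conjI allI opn_nonneg)
  fix B
  show "norm (A * B) \<le> opn A * norm B"
  proof (cases "B = 0")
    case False
    have "norm (A * B) / norm B \<le> opn A"
      unfolding opn_def
    proof (rule cInf_greatest)
      show "{c. opb A c} \<noteq> {}" using opb_norm[of A] by blast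
      show "norm (A * B) / norm B \<le> c" if "c \<in> {c. opb A c}" for c
        using that False opbD[of A c B] by (simp add: pos_divide_le_eq)
    qed
    then show ?thesis using False by (simp add: pos_divide_le_eq)
  qed simp
qed

lemma opb_sum:
  assumes "\<And>x. x \<in> S \<Longrightarrow> opb (f x) (c x)"
  shows "opb (sum f S) (sum c S)"
  using assms by (induction S rule: infinite_finite_induct) (auto intro: opb_add opb_0)

lemma opn_convex_sum:
  assumes "\<And>x. x \<in> S \<Longrightarrow> 0 \<le> p x"
  shows "opn (\<Sum>x\<in>S. p x *\<^sub>R A x) \<le> (\<Sum>x\<in>S. p x * opn (A x))"
proof (intro opn_le opb_sum)
  fix x assume "x \<in> S"
  then show "opb (p x *\<^sub>R A x) (p x * opn (A x))"
    using opb_scaleR[OF opb_opn, of "p x" "A x"] assms by simp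
qed

text \<open>A symmetric matrix together with a projection that acts as a unit on it, so that powers with
  exponent \<open>0\<close> make sense.\<close>

definition unit_for :: "fmat \<Rightarrow> fmat \<Rightarrow> bool" where
  "unit_for e S \<longleftrightarrow> e * e = e \<and> tp e = e \<and> e * S = S \<and> S * e = S \<and> tp S = S"

primrec pw :: "fmat \<Rightarrow> fmat \<Rightarrow> nat \<Rightarrow> fmat" where
  "pw e S 0 = e" | "pw e S (Suc k) = S * pw e S k"

context
  fixes e S assumes u: "unit_for e S"
begin

lemma pw_comm: "pw e S k * S = S * pw e S k"
  using u by (induction k) (auto simp: unit_for_def mult.assoc)
lemma e_pw: "e * pw e S k = pw e S k"
  using u by (induction k) (auto simp: unit_for_def mult.assoc[symmetric])
lemma pw_add: "pw e S (a + b) = pw e S a * pw e S b"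
  by (induction a) (auto simp: e_pw mult.assoc)
lemma tp_pw: "tp (pw e S k) = pw e S k"
  using u by (induction k) (auto simp: unit_for_def pw_comm)

lemma norm_pw_Suc_sq: "(norm (pw e S (Suc m)))\<^sup>2 = inner S (pw e S (2 * m + 1))"
proof -
  have "(norm (pw e S (Suc m)))\<^sup>2 = inner (S * pw e S m) (pw e S (Suc m))"
    by (simp add: power2_norm_eq_inner)
  also have "\<dots> = inner S (pw e S (Suc m) * pw e S m)" by (simp add: inner_mult_right tp_pw)
  also have "pw e S (Suc m) * pw e S m = pw e S (Suc m + m)" by (simp only: pw_add)
  also have "Suc m + m = 2 * m + 1" by simp
  finally show ?thesis .
qed

end

lemma pw_telescope:
  assumes "unit_for e S" "unit_for e T"
  shows "pw e S (Suc m) - pw e T (Suc m) = (\<Sum>l\<le>m. pw e S l * (S - T) * pw e T (m - l))"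
proof (induction m)
  case 0
  show ?case using assms by (simp add: unit_for_def algebra_simps)
next
  case (Suc m)
  have e': "e * ((S - T) * X) = (S - T) * X" for X
    using assms by (simp add: unit_for_def right_diff_distrib mult.assoc[symmetric])
  have "pw e S (Suc (Suc m)) - pw e T (Suc (Suc m))
      = S * (pw e S (Suc m) - pw e T (Suc m)) + (S - T) * pw e T (Suc m)"
    by (simp add: algebra_simps)
  also have "\<dots> = (\<Sum>l\<le>m. pw e S (Suc l) * (S - T) * pw e T (m - l)) + e * (S - T) * pw e T (Suc m)"
    unfolding Suc by (simp only: e' sum_distrib_left pw.simps mult.assoc)
  also have "\<dots> = (\<Sum>l\<le>Suc m. pw e S l * (S - T) * pw e T (Suc m - l))"
    by (subst sum.atMost_Suc_shift) simp
  finally show ?case .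
qed

text \<open>The first maximum cannot be an interior point. Arguing with a maximum instead of slopes of
  logarithms covers sequences with zeros.\<close>

lemma log_convex_le_max:
  fixes f :: "nat \<Rightarrow> real"
  assumes f: "\<And>a. 0 \<le> f a" and c: "\<And>a. 0 < a \<Longrightarrow> a < m \<Longrightarrow> (f a)\<^sup>2 \<le> f (a - 1) * f (a + 1)"
    and a: "a \<le> m"
  shows "f a \<le> max (f 0) (f m)"
proof (rule ccontr)
  assume "\<not> ?thesis"
  then have big: "f 0 < f a" "f m < f a" by auto
  define x where "x = Max (f ` {..m})"
  have x: "\<And>b. b \<le> m \<Longrightarrow> f b \<le> x" unfolding x_def by (intro Max_ge) auto
  have "x \<in> f ` {..m}" unfolding x_def by (intro Max_in) auto
  then have ex: "\<exists>b. b \<le> m \<and> f b = x" by auto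
  define b where "b = (LEAST b. b \<le> m \<and> f b = x)"
  have b: "b \<le> m" "f b = x" using LeastI_ex[OF ex] unfolding b_def by auto
  have least: "f b' \<noteq> x" if "b' < b" for b'
    using not_less_Least[of b' "\<lambda>b. b \<le> m \<and> f b = x"] that b unfolding b_def[symmetric] by auto
  have fa: "f a \<le> x" using x a by auto
  have b0: "0 < b" "b < m" using b big fa by (metis leD neq0_conv, metis leD order_le_less)
  have lt: "f (b - 1) < x" using least[of "b - 1"] x[of "b - 1"] b0 by force
  have x0: "0 < x" using big fa f[of 0] by linarith
  have "x * x \<le> f (b - 1) * f (b + 1)" using c[OF b0] b by (simp add: power2_eq_square)
  also have "\<dots> \<le> f (b - 1) * x" using x[of "b + 1"] b0 f by (intro mult_left_mono) auto
  also have "\<dots> < x * x" using lt x0 by simp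
  finally show False by simp
qed

text \<open>The trace inequality behind the Khintchine inequality. As a function of the exponent \<open>a\<close> the
  norm of \<open>S\<^sup>a A T\<^bsup>m-a\<^esup>\<close> is log-convex by the Cauchy-Schwarz inequality, hence dominated by its
  values at the two ends, where only one of the two matrices occurs.\<close>

lemma inner_sandwich_le:
  assumes S: "unit_for e S" and T: "unit_for e T" and A: "tp A = A" "e * A = A" and l: "l \<le> 2 * m"
  shows "inner A (pw e S l * A * pw e T (2 * m - l)) \<le> (norm (A * pw e S m))\<^sup>2 + (norm (A * pw e T m))\<^sup>2"
proof -
  let ?B = "\<lambda>a. pw e S a * A * pw e T (m - a)"
  have Ae: "A * e = A" by (metis A S tp_mult unit_for_def)
  \<comment> \<open>Distributing the exponents differently over the two factors gives both log-convexity and the final estimate.\<close>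
  have split: "inner A (pw e S (a + b) * A * pw e T (2 * m - (a + b))) = inner (?B a) (?B b)"
    if "a \<le> m" "b \<le> m" for a b
  proof -
    have *: "2 * m - (a + b) = (m - b) + (m - a)" using that by simp
    have "inner A (pw e S (a + b) * A * pw e T (2 * m - (a + b)))
        = inner A (pw e S a * (?B b * pw e T (m - a)))"
      unfolding * pw_add[OF S] pw_add[OF T] by (simp add: mult.assoc)
    also have "\<dots> = inner (pw e S a * A) (?B b * pw e T (m - a))"
      by (subst inner_mult_left') (simp add: tp_pw[OF S])
    also have "\<dots> = inner (?B a) (?B b)"
      by (subst inner_mult_right') (simp add: tp_pw[OF T])
    finally show ?thesis .
  qed
  let ?f = "\<lambda>a. norm (?B a)"
  have mx: "?f a \<le> max (?f 0) (?f m)" if "a \<le> m" for a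
  proof (rule log_convex_le_max[OF _ _ that])
    fix a assume a: "0 < a" "a < m"
    have "(?f a)\<^sup>2 = inner (?B (a - 1)) (?B (a + 1))"
      using a split[of a a] split[of "a - 1" "a + 1"] by (simp add: power2_norm_eq_inner)
    also have "\<dots> \<le> ?f (a - 1) * ?f (a + 1)" by (rule norm_cauchy_schwarz)
    finally show "(?f a)\<^sup>2 \<le> ?f (a - 1) * ?f (a + 1)" .
  qed simp
  define a where "a = min l m"
  define b where "b = l - a"
  have ab: "a \<le> m" "b \<le> m" "l = a + b" using l by (auto simp: a_def b_def)
  have "inner A (pw e S l * A * pw e T (2 * m - l)) = inner (?B a) (?B b)"
    unfolding ab(3) using split ab(1,2) by blast
  also have "\<dots> \<le> ?f a * ?f b" by (rule norm_cauchy_schwarz)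
  also have "\<dots> \<le> max (?f 0) (?f m) * max (?f 0) (?f m)"
    by (intro mult_mono mx ab) (auto simp: le_max_iff_disj)
  also have "\<dots> \<le> (?f 0)\<^sup>2 + (?f m)\<^sup>2" by (auto simp: max_def power2_eq_square)
  also have "?B 0 = A * pw e T m" using A(2) by simp
  also have "norm (?B m) = norm (A * pw e S m)"
    using norm_tp[of "?B m"] by (simp add: tp_pw[OF S] A mult.assoc Ae)
  finally show ?thesis by simp
qed

definition signs :: "'a set \<Rightarrow> ('a \<Rightarrow> real) set" where "signs E = PiE E (\<lambda>_. {-1, 1})"

lemma finite_signs: "finite E \<Longrightarrow> finite (signs E)" by (simp add: signs_def finite_PiE)
lemma card_signs: "finite E \<Longrightarrow> card (signs E) = 2 ^ card E"
  by (simp add: signs_def card_PiE numeral_2_eq_2)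

lemma bij_flip: "x \<in> E \<Longrightarrow> bij_betw (\<lambda>s. s(x := - s x)) (signs E) (signs E)"
proof -
  assume x: "x \<in> E"
  have st: "s(x := - s x) \<in> signs E" if "s \<in> signs E" for s
    using that x unfolding signs_def PiE_iff extensional_def by (simp add: fun_upd_def) fastforce
  show ?thesis
    by (rule bij_betw_byWitness[where f' = "\<lambda>s. s(x := - s x)"]) (use st in auto)
qed

text \<open>A sum with random signs is compared with the one in which a single sign is flipped;
  averaging over the signs makes this an exact identity. The difference of two powers telescopes,
  every summand is bounded by \<open>inner_sandwich_le\<close>, and what remains is a power of lower degree.
  This is the discrete form of Gaussian integration by parts.\<close>

lemma khintchine_step:
  fixes A :: "'a \<Rightarrow> fmat"
  defines "Y \<equiv> \<lambda>E s. \<Sum>x\<in>E. s x *\<^sub>R A x"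
  assumes E: "finite E" and e: "e * e = e" "tp e = e"
    and A: "\<And>x. x \<in> E \<Longrightarrow> tp (A x) = A x" "\<And>x. x \<in> E \<Longrightarrow> e * A x = A x"
    and c: "\<And>B. (\<Sum>x\<in>E. (norm (A x * B))\<^sup>2) \<le> c * (norm B)\<^sup>2"
  shows "(\<Sum>s\<in>signs E. (norm (pw e (Y E s) (Suc m)))\<^sup>2)
    \<le> 2 * real (2 * m + 1) * c * (\<Sum>s\<in>signs E. (norm (pw e (Y E s) m))\<^sup>2)"
proof -
  have eA: "A x * e = A x" if "x \<in> E" for x by (metis A e tp_mult that)
  have U: "unit_for e (Y E s)" for s
    unfolding unit_for_def Y_def using A eA e
    by (simp add: sum_distrib_left sum_distrib_right tp_sum)
  let ?fl = "\<lambda>x s. s(x := - s x)"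
  let ?p = "\<lambda>s k. pw e (Y E s) k"
  let ?G = "\<lambda>x s. (norm (A x * ?p s m))\<^sup>2"
  have Sflip: "Y E s - Y E (?fl x s) = (2 * s x) *\<^sub>R A x" if "x \<in> E" for x s
  proof -
    have "Y E s - Y E (?fl x s) = (\<Sum>y\<in>E. if y = x then (2 * s x) *\<^sub>R A x else 0)"
      unfolding Y_def sum_subtractf[symmetric] scaleR_left_diff_distrib[symmetric]
      by (intro sum.cong refl) simp
    then show ?thesis using E that by simp
  qed
  have one: "(\<Sum>s\<in>signs E. s x * inner (A x) (?p s (2 * m + 1))) \<le> real (2 * m + 1) * (2 * (\<Sum>s\<in>signs E. ?G x s))"
    if x: "x \<in> E" for x
  proof -
    let ?F = "\<lambda>s. inner (A x) (?p s (2 * m + 1))"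
    have "(\<Sum>s\<in>signs E. s x * ?F s) = (\<Sum>s\<in>signs E. (?fl x s) x * ?F (?fl x s))"
      by (rule sum.reindex_bij_betw[OF bij_flip[OF x], symmetric])
    then have "(\<Sum>s\<in>signs E. s x * ?F s) = (\<Sum>s\<in>signs E. s x * (?F s - ?F (?fl x s)) / 2)"
      by (simp add: right_diff_distrib sum_subtractf sum_divide_distrib[symmetric] sum_negf)
    also have "\<dots> \<le> (\<Sum>s\<in>signs E. real (2 * m + 1) * (?G x s + ?G x (?fl x s)))"
    proof (intro sum_mono)
      fix s assume s: "s \<in> signs E"
      then have sx: "s x = 1 \<or> s x = -1" using x by (auto simp: signs_def)
      have "?F s - ?F (?fl x s) = inner (A x) (\<Sum>l\<le>2 * m. ?p s l * (2 * s x) *\<^sub>R A x * ?p (?fl x s) (2 * m - l))"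
        using pw_telescope[OF U U, of s "2 * m" "?fl x s"] Sflip[OF x, of s]
        by (simp add: inner_diff_right[symmetric])
      also have "\<dots> = 2 * s x * (\<Sum>l\<le>2 * m. inner (A x) (?p s l * A x * ?p (?fl x s) (2 * m - l)))"
        by (simp add: inner_sum_right sum_distrib_left)
      finally have "s x * (?F s - ?F (?fl x s)) / 2 = (\<Sum>l\<le>2 * m. inner (A x) (?p s l * A x * ?p (?fl x s) (2 * m - l)))"
        using sx by auto
      also have "\<dots> \<le> (\<Sum>l\<le>2 * m. ?G x s + ?G x (?fl x s))"
        by (intro sum_mono inner_sandwich_le U A x) auto
      finally show "s x * (?F s - ?F (?fl x s)) / 2 \<le> real (2 * m + 1) * (?G x s + ?G x (?fl x s))"
        by (simp add: algebra_simps)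
    qed
    also have "\<dots> = real (2 * m + 1) * ((\<Sum>s\<in>signs E. ?G x s) + (\<Sum>s\<in>signs E. ?G x (?fl x s)))"
      by (simp only: sum_distrib_left[symmetric] sum.distrib)
    also have "(\<Sum>s\<in>signs E. ?G x (?fl x s)) = (\<Sum>s\<in>signs E. ?G x s)"
      by (rule sum.reindex_bij_betw[OF bij_flip[OF x]])
    finally show ?thesis by simp
  qed
  have "(\<Sum>s\<in>signs E. (norm (?p s (Suc m)))\<^sup>2) = (\<Sum>s\<in>signs E. \<Sum>x\<in>E. s x * inner (A x) (?p s (2 * m + 1)))"
  proof (intro sum.cong refl)
    fix s
    have "(norm (?p s (Suc m)))\<^sup>2 = inner (Y E s) (?p s (2 * m + 1))" by (rule norm_pw_Suc_sq[OF U])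
    also have "\<dots> = (\<Sum>x\<in>E. s x * inner (A x) (?p s (2 * m + 1)))"
      by (subst (1) Y_def) (simp add: inner_sum_left)
    finally show "(norm (?p s (Suc m)))\<^sup>2 = (\<Sum>x\<in>E. s x * inner (A x) (?p s (2 * m + 1)))" .
  qed
  also have "\<dots> = (\<Sum>x\<in>E. \<Sum>s\<in>signs E. s x * inner (A x) (?p s (2 * m + 1)))" by (rule sum.swap)
  also have "\<dots> \<le> (\<Sum>x\<in>E. real (2 * m + 1) * (2 * (\<Sum>s\<in>signs E. ?G x s)))"
    by (intro sum_mono one)
  also have "\<dots> = 2 * real (2 * m + 1) * (\<Sum>x\<in>E. \<Sum>s\<in>signs E. ?G x s)"
    by (simp add: sum_distrib_left algebra_simps)
  also have "(\<Sum>x\<in>E. \<Sum>s\<in>signs E. ?G x s) = (\<Sum>s\<in>signs E. \<Sum>x\<in>E. ?G x s)" by (rule sum.swap)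
  also have "2 * real (2 * m + 1) * \<dots> \<le> 2 * real (2 * m + 1) * (\<Sum>s\<in>signs E. c * (norm (?p s m))\<^sup>2)"
    by (intro mult_left_mono sum_mono c) auto
  finally show ?thesis by (simp add: sum_distrib_left algebra_simps)
qed

lemma khintchine:
  fixes A :: "'a \<Rightarrow> fmat"
  defines "Y \<equiv> \<lambda>E s. \<Sum>x\<in>E. s x *\<^sub>R A x"
  assumes E: "finite E" and e: "e * e = e" "tp e = e"
    and A: "\<And>x. x \<in> E \<Longrightarrow> tp (A x) = A x" "\<And>x. x \<in> E \<Longrightarrow> e * A x = A x"
    and c: "\<And>B. (\<Sum>x\<in>E. (norm (A x * B))\<^sup>2) \<le> c * (norm B)\<^sup>2" "0 \<le> c" and j: "j \<le> k"
  shows "(\<Sum>s\<in>signs E. (norm (pw e (Y E s) j))\<^sup>2) \<le> (4 * real k * c) ^ j * (2 ^ card E * (norm e)\<^sup>2)"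
  using j
proof (induction j)
  case 0
  show ?case using E by (simp add: card_signs)
next
  case (Suc j)
  have "(\<Sum>s\<in>signs E. (norm (pw e (Y E s) (Suc j)))\<^sup>2)
      \<le> 2 * real (2 * j + 1) * c * (\<Sum>s\<in>signs E. (norm (pw e (Y E s) j))\<^sup>2)"
    unfolding Y_def by (rule khintchine_step) (use assms in auto)
  also have "\<dots> \<le> 4 * real k * c * (\<Sum>s\<in>signs E. (norm (pw e (Y E s) j))\<^sup>2)"
    using Suc.prems c by (intro mult_right_mono sum_nonneg) auto
  also have "\<dots> \<le> 4 * real k * c * ((4 * real k * c) ^ j * (2 ^ card E * (norm e)\<^sup>2))"
    using Suc c by (intro mult_left_mono) auto
  finally show ?case by (simp add: mult_ac)
qed

text \<open>The largest eigenvalue of a symmetric matrix is bounded by the trace of a power.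
  Log-convexity of \<open>j \<mapsto> \<parallel>S\<^sup>j B\<parallel>\<close> replaces the spectral theorem.\<close>

lemma opn_power_le:
  assumes U: "unit_for e S" and k: "0 < k"
  shows "opn S ^ (2 * k) \<le> (norm (pw e S k))\<^sup>2"
proof -
  have e: "oproj e" using U by (simp add: unit_for_def oproj_def)
  have "opb S (root k (norm (pw e S k)))"
    unfolding opb_def
  proof (intro conjI allI)
    show "0 \<le> root k (norm (pw e S k))" by (simp add: real_root_ge_zero)
    fix B
    let ?f = "\<lambda>j. norm (pw e S j * B)"
    have c: "(?f (Suc j))\<^sup>2 \<le> ?f j * ?f (Suc (Suc j))" for j
    proof -
      have "(?f (Suc j))\<^sup>2 = inner (S * (pw e S j * B)) (S * (pw e S j * B))"
        by (simp add: power2_norm_eq_inner mult.assoc)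
      also have "\<dots> = inner (pw e S j * B) (pw e S (Suc (Suc j)) * B)"
        using U by (simp add: inner_mult_left unit_for_def mult.assoc)
      also have "\<dots> \<le> ?f j * ?f (Suc (Suc j))" by (rule norm_cauchy_schwarz)
      finally show ?thesis .
    qed
    have r: "?f 1 * ?f j \<le> ?f 0 * ?f (Suc j)" for j
    proof (induction j)
      case (Suc j)
      show ?case
      proof (cases "?f j = 0")
        case True
        then have "?f (Suc j) = 0" using c[of j] by simp
        then show ?thesis by (metis mult_zero_right norm_ge_zero mult_nonneg_nonneg)
      next
        case False
        have "?f j * (?f 1 * ?f (Suc j)) \<le> ?f 0 * ?f (Suc j) * ?f (Suc j)"
          using mult_right_mono[OF Suc, of "?f (Suc j)"] by (simp add: mult_ac)
        also have "\<dots> \<le> ?f 0 * (?f j * ?f (Suc (Suc j)))"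
          using mult_left_mono[OF c[of j], of "?f 0"] by (simp add: power2_eq_square mult_ac)
        finally have "?f j * (?f 1 * ?f (Suc j)) \<le> ?f j * (?f 0 * ?f (Suc (Suc j)))" by (simp add: mult_ac)
        moreover have "0 < ?f j" using False by (simp add: less_le)
        ultimately show ?thesis by (rule mult_left_le_imp_le)
      qed
    qed (simp add: mult.commute)
    have p: "?f 1 ^ Suc j \<le> ?f 0 ^ j * ?f (Suc j)" for j
    proof (induction j)
      case (Suc j)
      have "?f 1 ^ Suc (Suc j) \<le> ?f 1 * (?f 0 ^ j * ?f (Suc j))"
        using mult_left_mono[OF Suc, of "?f 1"] by simp
      also have "\<dots> \<le> ?f 0 ^ j * (?f 0 * ?f (Suc (Suc j)))"
        using mult_left_mono[OF r[of "Suc j"], of "?f 0 ^ j"] by (simp add: mult_ac)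
      finally show ?case by (simp add: mult_ac)
    qed simp
    obtain j where j: "k = Suc j" using k by (cases k) auto
    have "S * e = S" using U by (simp add: unit_for_def)
    then have "norm (S * B) ^ k = ?f 1 ^ k" by simp
    also have "\<dots> \<le> ?f 0 ^ j * ?f k" using p[of j] unfolding j .
    also have "\<dots> \<le> norm B ^ j * (norm (pw e S k) * norm B)"
      using oproj_norm_le[OF e, of B] by (intro mult_mono power_mono norm_mult_fmat) auto
    also have "\<dots> = norm (pw e S k) * norm B ^ k" by (simp add: j)
    also have "\<dots> = (root k (norm (pw e S k)) * norm B) ^ k"
      using k by (simp add: power_mult_distrib real_root_pow_pos2)
    finally show "norm (S * B) \<le> root k (norm (pw e S k)) * norm B"
      by (rule power_le_imp_le_base[of _ j, folded j]) (simp add: real_root_ge_zero)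
  qed
  then have "opn S \<le> root k (norm (pw e S k))" by (rule opn_le)
  then have "opn S ^ (2 * k) \<le> root k (norm (pw e S k)) ^ (2 * k)"
    by (intro power_mono opn_nonneg)
  also have "\<dots> = (root k (norm (pw e S k)) ^ k)\<^sup>2" by (simp add: power_mult mult.commute)
  also have "\<dots> = (norm (pw e S k))\<^sup>2" using k by (simp add: real_root_pow_pos2)
  finally show ?thesis .
qed

definition idn :: "nat \<Rightarrow> fmat" where "idn n = (\<Sum>i<n. eu i i)"

lemma ent_idn: "ent (idn n) i j = (if i = j \<and> i < n then 1 else 0)"
proof -
  have "ent (idn n) i j = (\<Sum>a<n. if a = i then (if i = j then 1 else 0) else 0)"
    unfolding idn_def ent_sum by (intro sum.cong refl) (auto simp: ent_eu)
  then show ?thesis by simp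
qed
lemma tp_idn [simp]: "tp (idn n) = idn n" by (rule fmat_eqI) (auto simp: ent_idn)
lemma ent_idn_mult: "ent (idn n * A) i j = (if i < n then ent A i j else 0)"
proof -
  have "ent (idn n * A) i j = (\<Sum>a<n. if a = i then ent A i j else 0)"
    unfolding idn_def sum_distrib_right ent_sum by (intro sum.cong refl) (auto simp: ent_eu_mult)
  then show ?thesis by simp
qed
lemma idn_mult_eq: "(\<And>i j. ent A i j \<noteq> 0 \<Longrightarrow> i < n) \<Longrightarrow> idn n * A = A"
  by (rule fmat_eqI) (auto simp: ent_idn_mult)
lemma mult_idn_eq: "(\<And>i j. ent A i j \<noteq> 0 \<Longrightarrow> j < n) \<Longrightarrow> A * idn n = A"
  using idn_mult_eq[of "tp A" n] by (metis ent_tp tp_idn tp_mult tp_tp)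
lemma oproj_idn: "oproj (idn n)"
  unfolding oproj_def by (auto intro!: idn_mult_eq simp: ent_idn split: if_splits)
lemma norm_idn_sq: "(norm (idn n))\<^sup>2 = real n"
proof -
  have b: "bnd n (ent (idn n))" by (auto simp: bnd_def ent_idn)
  have "(norm (idn n))\<^sup>2 = (\<Sum>i<n. \<Sum>j<n. if j = i then 1 else 0)"
    unfolding norm_sq_ent[OF b] by (intro sum.cong refl) (auto simp: ent_idn)
  then show ?thesis by simp
qed

lemma norm_eu_mult: "norm (eu a b * B) = norm (rw b B)"
proof (rule antisym)
  have "norm (eu a b * (eu b b * B)) \<le> norm (eu a b) * norm (eu b b * B)" by (rule norm_mult_fmat)
  then show "norm (eu a b * B) \<le> norm (rw b B)" by (simp add: rw_def mult.assoc[symmetric] eu_mult_eu)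
  have "norm (eu b a * (eu a b * B)) \<le> norm (eu b a) * norm (eu a b * B)" by (rule norm_mult_fmat)
  then show "norm (rw b B) \<le> norm (eu a b * B)" by (simp add: rw_def mult.assoc[symmetric] eu_mult_eu)
qed

definition wmat :: "nat \<Rightarrow> nat \<Rightarrow> (nat \<times> nat \<Rightarrow> real) \<Rightarrow> fmat" where
  "wmat n1 n2 w = (\<Sum>x\<in>{..<n1} \<times> {..<n2}. w x *\<^sub>R eu (fst x) (snd x))"

lemma ent_wmat: "ent (wmat n1 n2 w) i j = (if i < n1 \<and> j < n2 then w (i, j) else 0)"
proof -
  have "ent (wmat n1 n2 w) i j = (\<Sum>x\<in>{..<n1} \<times> {..<n2}. if x = (i, j) then w (i, j) else 0)"
    unfolding wmat_def ent_sum by (intro sum.cong refl) (auto simp: ent_eu)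
  also have "\<dots> = (if i < n1 \<and> j < n2 then w (i, j) else 0)" by (subst sum.delta) auto
  finally show ?thesis .
qed

lemma blk_wmat: "blk n1 n2 (wmat n1 n2 w)" by (auto simp: blk_def ent_wmat)

text \<open>Rectangular matrices are reduced to symmetric ones of size \<open>n1 + n2\<close> by placing the matrix
  and its transpose in the two off-diagonal blocks. The squares of the summands then add up to the
  sums of squares along rows and columns.\<close>

lemma rademacher_moment:
  fixes w :: "nat \<times> nat \<Rightarrow> real"
  assumes k: "0 < k" and d: "0 \<le> d" "\<And>i. i < n1 \<Longrightarrow> (\<Sum>j<n2. (w (i, j))\<^sup>2) \<le> d"
    "\<And>j. j < n2 \<Longrightarrow> (\<Sum>i<n1. (w (i, j))\<^sup>2) \<le> d"
  shows "(\<Sum>s\<in>signs ({..<n1} \<times> {..<n2}). opn (wmat n1 n2 (\<lambda>x. s x * w x)) ^ (2 * k))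
    \<le> (8 * real k * d) ^ k * (2 ^ (n1 * n2) * real (n1 + n2))"
proof -
  let ?E = "{..<n1} \<times> {..<n2}"
  define A where "A x = w x *\<^sub>R (eu (fst x) (n1 + snd x) + eu (n1 + snd x) (fst x))" for x
  define e where "e = idn (n1 + n2)"
  define Y where "Y s = (\<Sum>x\<in>?E. s x *\<^sub>R A x)" for s :: "nat \<times> nat \<Rightarrow> real"
  have e: "e * e = e" "tp e = e" using oproj_idn[of "n1 + n2"] by (auto simp: e_def oproj_def)
  have A1: "tp (A x) = A x" for x by (simp add: A_def add.commute)
  have A2: "e * A x = A x" if "x \<in> ?E" for x
    unfolding e_def
  proof (rule idn_mult_eq)
    fix i j assume "ent (A x) i j \<noteq> 0"
    moreover have "ent (A x) i j = 0" if "i \<noteq> fst x" "i \<noteq> n1 + snd x"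
      using that by (simp add: A_def ent_eu)
    ultimately have "i = fst x \<or> i = n1 + snd x" by blast
    then show "i < n1 + n2" using that by auto
  qed
  have A3: "A x * e = A x" if "x \<in> ?E" for x by (metis A1 A2 e tp_mult that)
  have U: "unit_for e (Y s)" for s
    unfolding unit_for_def Y_def using A1 A2 A3 e
    by (simp add: sum_distrib_left sum_distrib_right tp_sum)
  have cB: "(\<Sum>x\<in>?E. (norm (A x * B))\<^sup>2) \<le> 2 * d * (norm B)\<^sup>2" for B
  proof -
    obtain m0 where m0: "bnd m0 (ent B)" using ex_bnd .
    define m where "m = max m0 (n1 + n2)"
    have m: "bnd m (ent B)" "n1 + n2 \<le> m" using m0 by (auto simp: m_def intro: bnd_mono)
    let ?b = "\<lambda>i. (norm (rw i B))\<^sup>2"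
    have "(norm (A x * B))\<^sup>2 \<le> (w x)\<^sup>2 * (2 * (?b (fst x) + ?b (n1 + snd x)))" for x
    proof -
      let ?X = "eu (fst x) (n1 + snd x) * B" and ?Z = "eu (n1 + snd x) (fst x) * B"
      have "(norm (?X + ?Z))\<^sup>2 \<le> (norm ?X + norm ?Z)\<^sup>2"
        by (intro power_mono norm_triangle_ineq norm_ge_zero)
      also have "\<dots> \<le> 2 * ((norm ?X)\<^sup>2 + (norm ?Z)\<^sup>2)"
        using sum_squares_bound[of "norm ?X" "norm ?Z"] unfolding power2_sum by argo
      also have "\<dots> = 2 * (?b (fst x) + ?b (n1 + snd x))"
        unfolding norm_eu_mult by (rule arg_cong[where f = "\<lambda>t. 2 * t"], rule add.commute)
      finally have "(norm (?X + ?Z))\<^sup>2 \<le> 2 * (?b (fst x) + ?b (n1 + snd x))" .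
      then have "(w x)\<^sup>2 * (norm (?X + ?Z))\<^sup>2 \<le> (w x)\<^sup>2 * (2 * (?b (fst x) + ?b (n1 + snd x)))"
        by (rule mult_left_mono) simp
      moreover have "A x * B = w x *\<^sub>R (?X + ?Z)" by (simp only: A_def distrib_right mult_scaleR_left)
      ultimately show ?thesis by (simp only: norm_scaleR power_mult_distrib power2_abs)
    qed
    then have "(\<Sum>x\<in>?E. (norm (A x * B))\<^sup>2) \<le> (\<Sum>x\<in>?E. (w x)\<^sup>2 * (2 * (?b (fst x) + ?b (n1 + snd x))))"
      by (rule sum_mono)
    also have "\<dots> = (\<Sum>i<n1. \<Sum>j<n2. (w (i, j))\<^sup>2 * (2 * (?b i + ?b (n1 + j))))"
      by (simp add: sum.cartesian_product case_prod_beta)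
    also have "\<dots> = 2 * ((\<Sum>i<n1. \<Sum>j<n2. (w (i, j))\<^sup>2 * ?b i) + (\<Sum>i<n1. \<Sum>j<n2. (w (i, j))\<^sup>2 * ?b (n1 + j)))"
    proof -
      have "(\<Sum>i<n1. \<Sum>j<n2. (w (i, j))\<^sup>2 * (2 * (?b i + ?b (n1 + j))))
          = (\<Sum>i<n1. \<Sum>j<n2. 2 * ((w (i, j))\<^sup>2 * ?b i) + 2 * ((w (i, j))\<^sup>2 * ?b (n1 + j)))"
        by (intro sum.cong refl) (simp add: distrib_left mult.left_commute)
      then show ?thesis by (simp only: sum.distrib sum_distrib_left distrib_left)
    qed
    also have "(\<Sum>i<n1. \<Sum>j<n2. (w (i, j))\<^sup>2 * ?b (n1 + j)) = (\<Sum>j<n2. \<Sum>i<n1. (w (i, j))\<^sup>2 * ?b (n1 + j))"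
      by (rule sum.swap)
    also have "2 * ((\<Sum>i<n1. \<Sum>j<n2. (w (i, j))\<^sup>2 * ?b i) + \<dots>)
        \<le> 2 * ((\<Sum>i<n1. d * ?b i) + (\<Sum>j<n2. d * ?b (n1 + j)))"
      unfolding sum_distrib_right[symmetric] using d
      by (intro mult_left_mono add_mono sum_mono mult_right_mono) auto
    also have "\<dots> = 2 * d * ((\<Sum>i<n1. ?b i) + (\<Sum>j<n2. ?b (n1 + j)))"
      by (simp add: sum_distrib_left distrib_left mult_ac)
    also have "(\<Sum>j<n2. ?b (n1 + j)) = (\<Sum>i\<in>{n1..<n1 + n2}. ?b i)"
      by (rule sum.reindex_bij_witness[where j = "\<lambda>j. n1 + j" and i = "\<lambda>i. i - n1"]) auto
    also have "(\<Sum>i<n1. ?b i) + (\<Sum>i\<in>{n1..<n1 + n2}. ?b i) = (\<Sum>i\<in>{..<n1} \<union> {n1..<n1 + n2}. ?b i)"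
      by (rule sum.union_disjoint[symmetric]) auto
    also have "\<dots> \<le> (\<Sum>i<m. ?b i)" using m by (intro sum_mono2) auto
    also have "\<dots> = (norm B)\<^sup>2" by (simp add: norm_sq_rows[OF m(1)])
    finally show ?thesis using d by (simp add: mult_left_mono)
  qed
  \<comment> \<open>\<open>K\<close> moves the columns of the upper right block to the front, so \<open>Y s * K\<close> is the original matrix.\<close>
  define K where "K = (\<Sum>j<n2. eu (n1 + j) j)"
  have KK: "tp K * K = idn n2"
  proof -
    have "tp K * K = (\<Sum>j<n2. \<Sum>j'<n2. if j' = j then eu j j else 0)"
      unfolding K_def tp_sum sum_product by (intro sum.cong refl) (auto simp: eu_mult_eu)
    then show ?thesis by (simp add: idn_def)
  qed
  have K: "opb K 1"
    unfolding opb_def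
  proof (intro conjI allI)
    fix B
    have "(norm (K * B))\<^sup>2 = inner B (idn n2 * B)"
      by (simp add: power2_norm_eq_inner inner_mult_left mult.assoc[symmetric] KK)
    also have "\<dots> \<le> norm B * norm (idn n2 * B)" by (rule norm_cauchy_schwarz)
    also have "\<dots> \<le> norm B * norm B" by (intro mult_left_mono oproj_norm_le oproj_idn) auto
    finally show "norm (K * B) \<le> 1 * norm B" by (simp add: power2_eq_square[symmetric])
  qed simp
  have AK: "A x * K = w x *\<^sub>R eu (fst x) (snd x)" if "x \<in> ?E" for x
  proof -
    have "eu (fst x) (n1 + snd x) * K = (\<Sum>j<n2. if j = snd x then eu (fst x) (snd x) else 0)"
      unfolding K_def sum_distrib_left by (intro sum.cong refl) (auto simp: eu_mult_eu)
    moreover have "eu (n1 + snd x) (fst x) * K = 0"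
      unfolding K_def sum_distrib_left using that by (intro sum.neutral) (auto simp: eu_mult_eu)
    ultimately show ?thesis using that by (auto simp: A_def distrib_right)
  qed
  have G: "opn (wmat n1 n2 (\<lambda>x. s x * w x)) \<le> opn (Y s)" for s
  proof (rule opn_le)
    have eq: "wmat n1 n2 (\<lambda>x. s x * w x) = Y s * K"
      unfolding wmat_def Y_def sum_distrib_right by (intro sum.cong refl) (simp add: AK)
    have "norm (Y s * (K * B)) \<le> opn (Y s) * (1 * norm B)" for B
      by (intro order_trans[OF opbD[OF opb_opn]] mult_left_mono opbD K opn_nonneg)
    then show "opb (wmat n1 n2 (\<lambda>x. s x * w x)) (opn (Y s))"
      unfolding eq by (simp add: opb_def opn_nonneg mult.assoc)
  qed
  have "(\<Sum>s\<in>signs ?E. opn (wmat n1 n2 (\<lambda>x. s x * w x)) ^ (2 * k)) \<le> (\<Sum>s\<in>signs ?E. (norm (pw e (Y s) k))\<^sup>2)"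
    by (intro sum_mono order_trans[OF power_mono[OF G opn_nonneg] opn_power_le[OF U k]])
  also have "\<dots> \<le> (4 * real k * (2 * d)) ^ k * (2 ^ card ?E * (norm e)\<^sup>2)"
    unfolding Y_def by (rule khintchine) (use e A1 A2 cB d in auto)
  finally show ?thesis by (simp add: e_def norm_idn_sq mult_ac)
qed

section \<open>Concentration inequalities\<close>

lemma expectation_mono_pmf:
  fixes f g :: "'a \<Rightarrow> real"
  assumes "finite (set_pmf p)" "\<And>x. x \<in> set_pmf p \<Longrightarrow> f x \<le> g x"
  shows "measure_pmf.expectation p f \<le> measure_pmf.expectation p g"
  by (intro integral_mono_AE integrable_measure_pmf_finite assms) (use assms in \<open>auto simp: AE_measure_pmf_iff\<close>)

lemma markov_pmf:
  fixes f :: "'a \<Rightarrow> real"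
  assumes fin: "finite (set_pmf p)" and c: "0 < c" and f: "\<And>x. x \<in> set_pmf p \<Longrightarrow> 0 \<le> f x"
    and A: "\<And>x. x \<in> set_pmf p \<Longrightarrow> x \<in> A \<Longrightarrow> c \<le> f x"
  shows "measure_pmf.prob p A \<le> measure_pmf.expectation p f / c"
proof -
  have "measure_pmf.prob p A = measure_pmf.expectation p (indicator A)" by simp
  also have "\<dots> \<le> measure_pmf.expectation p (\<lambda>x. f x / c)"
    using c f A by (intro expectation_mono_pmf fin) (auto simp: indicator_def pos_le_divide_eq)
  finally show ?thesis by simp
qed

lemma prob_bind_pmf_le:
  assumes "\<And>x. x \<in> set_pmf p \<Longrightarrow> measure_pmf.prob (f x) A \<le> c"
  shows "measure_pmf.prob (bind_pmf p f) A \<le> c"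
proof -
  obtain x where "x \<in> set_pmf p" using set_pmf_not_empty[of p] by blast
  then have c0: "0 \<le> c" using assms measure_nonneg order_trans by blast
  have "ennreal (measure_pmf.prob (bind_pmf p f) A) = (\<integral>\<^sup>+x. emeasure (f x) A \<partial>p)"
    by (simp add: measure_pmf.emeasure_eq_measure[symmetric])
  also have "\<dots> \<le> (\<integral>\<^sup>+x. ennreal c \<partial>p)"
    by (intro nn_integral_mono_AE) (use assms in \<open>auto simp: AE_measure_pmf_iff measure_pmf.emeasure_eq_measure intro!: ennreal_leI\<close>)
  also have "\<dots> = ennreal c" by (simp add: measure_pmf.emeasure_space_1)
  finally show ?thesis using c0 by simp
qed

lemma pmf_prob_mono:
  assumes "\<And>x. x \<in> set_pmf p \<Longrightarrow> x \<in> A \<Longrightarrow> x \<in> B"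
  shows "measure_pmf.prob p A \<le> measure_pmf.prob p B"
proof -
  have "measure_pmf.prob p A = measure_pmf.prob p (A \<inter> set_pmf p)" by (simp add: measure_Int_set_pmf)
  also have "\<dots> \<le> measure_pmf.prob p B" by (rule measure_pmf.finite_measure_mono) (use assms in auto)
  finally show ?thesis .
qed

lemma finite_set_Pi_pmf:
  assumes "finite S" "\<And>x. x \<in> S \<Longrightarrow> finite (set_pmf (p x))"
  shows "finite (set_pmf (Pi_pmf S d p))"
  unfolding set_Pi_pmf[OF assms(1)] by (intro finite_PiE_dflt) (use assms in auto)

lemma exp_le_quadratic: assumes "\<bar>x::real\<bar> \<le> 1" shows "exp x \<le> 1 + x + x\<^sup>2"
proof (cases "0 \<le> x")
  case True
  then show ?thesis using assms by (intro exp_bound) auto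
next
  case False
  define y where "y = - x"
  have y: "0 \<le> y" "y \<le> 1" using False assms by (auto simp: y_def)
  have "1 + y + y\<^sup>2 / 2 \<le> exp y" by (rule exp_lower_Taylor_quadratic[OF y(1)])
  then have "(1 - y + y\<^sup>2) * (1 + y + y\<^sup>2 / 2) \<le> (1 - y + y\<^sup>2) * exp y"
    using y by (intro mult_left_mono) auto
  moreover have "(1 - y + y\<^sup>2) * (1 + y + y\<^sup>2 / 2) = 1 + (y\<^sup>2 + y ^ 3 + y ^ 4) / 2"
    by (simp add: field_simps power2_eq_square power3_eq_cube power4_eq_xxxx)
  ultimately have "1 + (y\<^sup>2 + y ^ 3 + y ^ 4) / 2 \<le> (1 - y + y\<^sup>2) * exp y" by metis
  moreover have "1 \<le> 1 + (y\<^sup>2 + y ^ 3 + y ^ 4) / 2" using y by simp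
  ultimately have "1 \<le> (1 - y + y\<^sup>2) * exp y" by (rule order_trans[rotated])
  then have "exp (- y) \<le> 1 - y + y\<^sup>2" by (simp add: exp_minus field_simps)
  then show ?thesis by (simp add: y_def)
qed

lemma bernoulli_mgf:
  fixes a x :: real
  assumes a: "0 \<le> a" "a \<le> 1" and x: "\<bar>x\<bar> \<le> 1"
  shows "a * exp (x * (1 - a)) + (1 - a) * exp (x * (0 - a)) \<le> exp (a * x\<^sup>2)"
proof -
  have "a * exp (x * (1 - a)) + (1 - a) * exp (x * (0 - a)) = exp (- (a * x)) * (1 + a * (exp x - 1))"
    by (simp add: algebra_simps flip: exp_add)
  also have "\<dots> \<le> exp (- (a * x)) * exp (a * (exp x - 1))"
    by (intro mult_left_mono exp_ge_add_one_self) auto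
  also have "\<dots> = exp (a * (exp x - 1 - x))" by (simp add: algebra_simps flip: exp_add)
  also have "\<dots> \<le> exp (a * x\<^sup>2)"
    using exp_le_quadratic[OF x] a by (simp add: mult_left_mono)
  finally show ?thesis .
qed

lemma bernoulli_sum_mgf:
  assumes R: "finite R" and a: "0 \<le> a" "a \<le> 1" and w: "\<And>e. e \<in> R \<Longrightarrow> \<bar>w e\<bar> \<le> (1::real)"
  shows "measure_pmf.expectation (Pi_pmf R False (\<lambda>_. bernoulli_pmf a))
      (\<lambda>f. exp (\<Sum>e\<in>R. (of_bool (f e) - a) * w e)) \<le> exp (a * (\<Sum>e\<in>R. (w e)\<^sup>2))"
proof -
  have "measure_pmf.expectation (Pi_pmf R False (\<lambda>_. bernoulli_pmf a))
      (\<lambda>f. exp (\<Sum>e\<in>R. (of_bool (f e) - a) * w e))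
    = measure_pmf.expectation (Pi_pmf R False (\<lambda>_. bernoulli_pmf a))
      (\<lambda>f. \<Prod>e\<in>R. exp ((of_bool (f e) - a) * w e))"
    by (simp add: exp_sum R)
  also have "\<dots> = (\<Prod>e\<in>R. measure_pmf.expectation (bernoulli_pmf a) (\<lambda>v. exp ((of_bool v - a) * w e)))"
    using a by (intro expectation_prod_Pi_pmf R integrable_measure_pmf_finite) auto
  also have "\<dots> \<le> (\<Prod>e\<in>R. exp (a * (w e)\<^sup>2))"
  proof (intro prod_mono conjI)
    fix e assume "e \<in> R"
    then have "\<bar>w e\<bar> \<le> 1" by (rule w)
    from bernoulli_mgf[OF a this]
    show "measure_pmf.expectation (bernoulli_pmf a) (\<lambda>v. exp ((of_bool v - a) * w e)) \<le> exp (a * (w e)\<^sup>2)"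
      using a by (simp add: mult.commute)
    show "0 \<le> measure_pmf.expectation (bernoulli_pmf a) (\<lambda>v. exp ((of_bool v - a) * w e))"
      by (intro Bochner_Integration.integral_nonneg) auto
  qed
  also have "\<dots> = exp (a * (\<Sum>e\<in>R. (w e)\<^sup>2))" by (simp add: exp_sum R sum_distrib_left)
  finally show ?thesis .
qed

text \<open>Exponential Markov inequality. The weights are scaled by a number \<open>y\<close> such that the scaled
  weights stay below \<open>1\<close> and the quadratic term of the exponent is at most \<open>l\<close>: the largest such
  \<open>y\<close> is the smaller of \<open>1 / b\<close> and \<open>sqrt (l / (a S))\<close>.\<close>

lemma bernstein_upper:
  assumes R: "finite R" and a: "0 \<le> a" "a \<le> 1" and w: "\<And>e. e \<in> R \<Longrightarrow> \<bar>w e\<bar> \<le> b"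
    and S: "(\<Sum>e\<in>R. (w e)\<^sup>2) \<le> S" and l: "0 \<le> l" and b: "0 \<le> b"
  shows "measure_pmf.prob (Pi_pmf R False (\<lambda>_. bernoulli_pmf a))
      {f. 2 * sqrt (a * S * l) + 2 * b * l < (\<Sum>e\<in>R. (of_bool (f e) - a) * w e)} \<le> exp (- l)"
proof (cases "b = 0")
  case True
  have S0: "0 \<le> S" using sum_nonneg[of R "\<lambda>e. (w e)\<^sup>2"] S by fastforce
  have "w e = 0" if "e \<in> R" for e using w[OF that] True by simp
  then have "{f. 2 * sqrt (a * S * l) + 2 * b * l < (\<Sum>e\<in>R. (of_bool (f e) - a) * w e)} = {}"
    using S0 a l True by (auto simp: not_less)
  then show ?thesis by (metis exp_ge_zero measure_empty)
next
  case False
  with b have b: "0 < b" by simp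
  have S0: "0 \<le> S" using sum_nonneg[of R "\<lambda>e. (w e)\<^sup>2"] S by fastforce
  let ?\<tau> = "2 * sqrt (a * S * l) + 2 * b * l"
  have "\<exists>y. 0 \<le> y \<and> y * b \<le> 1 \<and> 2 * l \<le> y * ?\<tau> \<and> a * (y\<^sup>2 * S) \<le> l"
  proof (cases "a * S \<le> b\<^sup>2 * l")
    case True
    show ?thesis
    proof (intro exI[of _ "1 / b"] conjI)
      show "2 * l \<le> 1 / b * ?\<tau>" using b S0 a l by (simp add: field_simps)
      show "a * ((1 / b)\<^sup>2 * S) \<le> l" using True b by (simp add: field_simps power2_eq_square)
    qed (use b in auto)
  next
    case False
    then have aS1: "b\<^sup>2 * l < a * S" by simp
    have "0 \<le> b\<^sup>2 * l" using l by simp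
    then have aS: "b\<^sup>2 * l < a * S" "0 < a * S" using aS1 by (auto intro: order.strict_trans1)
    let ?y = "sqrt (l / (a * S))"
    have y2: "?y\<^sup>2 = l / (a * S)" using aS l by simp
    show ?thesis
    proof (intro exI[of _ ?y] conjI)
      show "0 \<le> ?y" using aS l by simp
      have "(?y * b)\<^sup>2 \<le> 1\<^sup>2" unfolding power_mult_distrib y2 using aS by (simp add: field_simps)
      then show "?y * b \<le> 1" by (rule power2_le_imp_le) simp
      have "?y * (2 * sqrt (a * S * l)) = 2 * sqrt (l / (a * S) * (a * S * l))"
        by (simp only: real_sqrt_mult[symmetric] mult.left_commute)
      also have "l / (a * S) * (a * S * l) = l\<^sup>2" using aS(2) by (auto simp: power2_eq_square)
      finally have "?y * (2 * sqrt (a * S * l)) = 2 * l" using l by simp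
      moreover have "0 \<le> ?y * (2 * b * l)" using aS l b by simp
      ultimately show "2 * l \<le> ?y * ?\<tau>" by (simp only: distrib_left)
      have "a * (?y\<^sup>2 * S) = l" unfolding y2 using aS by auto
      then show "a * (?y\<^sup>2 * S) \<le> l" by simp
    qed
  qed
  then obtain y where y: "0 \<le> y" "y * b \<le> 1" "2 * l \<le> y * ?\<tau>" "a * (y\<^sup>2 * S) \<le> l" by blast
  let ?p = "Pi_pmf R False (\<lambda>_. bernoulli_pmf a)"
  have "measure_pmf.prob ?p {f. ?\<tau> < (\<Sum>e\<in>R. (of_bool (f e) - a) * w e)}
      \<le> measure_pmf.expectation ?p (\<lambda>f. exp (\<Sum>e\<in>R. (of_bool (f e) - a) * (y * w e))) / exp (2 * l)"
  proof (rule markov_pmf)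
    show "finite (set_pmf ?p)" by (intro finite_set_Pi_pmf R) auto
    fix f assume "f \<in> {f. ?\<tau> < (\<Sum>e\<in>R. (of_bool (f e) - a) * w e)}"
    then have "y * ?\<tau> \<le> y * (\<Sum>e\<in>R. (of_bool (f e) - a) * w e)" using y by (intro mult_left_mono) auto
    also have "\<dots> = (\<Sum>e\<in>R. (of_bool (f e) - a) * (y * w e))" by (simp add: sum_distrib_left mult_ac)
    finally show "exp (2 * l) \<le> exp (\<Sum>e\<in>R. (of_bool (f e) - a) * (y * w e))" using y by simp
  qed auto
  also have "\<dots> \<le> exp (a * (\<Sum>e\<in>R. (y * w e)\<^sup>2)) / exp (2 * l)"
  proof (intro divide_right_mono bernoulli_sum_mgf R a)
    fix e assume "e \<in> R"
    then have "y * \<bar>w e\<bar> \<le> y * b" using w y by (intro mult_left_mono) auto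
    then show "\<bar>y * w e\<bar> \<le> 1" using y by (simp add: abs_mult)
  qed auto
  also have "a * (\<Sum>e\<in>R. (y * w e)\<^sup>2) = a * (y\<^sup>2 * (\<Sum>e\<in>R. (w e)\<^sup>2))"
    by (simp add: power_mult_distrib sum_distrib_left)
  also have "exp \<dots> \<le> exp l"
  proof -
    have "a * (y\<^sup>2 * (\<Sum>e\<in>R. (w e)\<^sup>2)) \<le> a * (y\<^sup>2 * S)" using a S by (intro mult_left_mono) auto
    then show ?thesis using y by simp
  qed
  finally show ?thesis by (simp add: divide_right_mono exp_diff[symmetric])
qed

lemma bernstein:
  assumes R: "finite R" and a: "0 \<le> a" "a \<le> 1" and w: "\<And>e. e \<in> R \<Longrightarrow> \<bar>w e\<bar> \<le> b"
    and S: "(\<Sum>e\<in>R. (w e)\<^sup>2) \<le> S" and l: "0 \<le> l" and b: "0 \<le> b"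
  shows "measure_pmf.prob (Pi_pmf R False (\<lambda>_. bernoulli_pmf a))
      {f. 2 * sqrt (a * S * l) + 2 * b * l < \<bar>\<Sum>e\<in>R. (of_bool (f e) - a) * w e\<bar>} \<le> 2 * exp (- l)"
proof -
  let ?p = "Pi_pmf R False (\<lambda>_. bernoulli_pmf a)" and ?t = "2 * sqrt (a * S * l) + 2 * b * l"
  let ?A = "\<lambda>w. {f. ?t < (\<Sum>e\<in>R. (of_bool (f e) - a) * w e)}"
  have sub: "{f. ?t < \<bar>\<Sum>e\<in>R. (of_bool (f e) - a) * w e\<bar>} \<subseteq> ?A w \<union> ?A (\<lambda>e. - w e)"
    by (auto simp: sum_negf)
  have "measure_pmf.prob ?p {f. ?t < \<bar>\<Sum>e\<in>R. (of_bool (f e) - a) * w e\<bar>} \<le> measure_pmf.prob ?p (?A w \<union> ?A (\<lambda>e. - w e))"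
    using sub by (intro measure_pmf.finite_measure_mono) auto
  also have "\<dots> \<le> measure_pmf.prob ?p (?A w) + measure_pmf.prob ?p (?A (\<lambda>e. - w e))"
    by (intro measure_Un_le) auto
  also have "\<dots> \<le> exp (- l) + exp (- l)"
    by (intro add_mono bernstein_upper assms) (use w S in auto)
  finally show ?thesis by simp
qed

text \<open>The difference of two independent Bernoulli variables, which is invariant under a change of
  sign.\<close>

definition diff_pmf :: "real \<Rightarrow> real pmf" where
  "diff_pmf q = map_pmf (\<lambda>(a, b). of_bool b - of_bool a) (pair_pmf (bernoulli_pmf q) (bernoulli_pmf q))"

lemma finite_diff_pmf: "finite (set_pmf (diff_pmf q))"
  by (simp add: diff_pmf_def)

lemma diff_pmf_uminus: "map_pmf uminus (diff_pmf q) = diff_pmf q"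
proof -
  have "map_pmf uminus (diff_pmf q) = map_pmf (\<lambda>(a, b). of_bool b - of_bool a)
      (map_pmf (\<lambda>(x, y). (y, x)) (pair_pmf (bernoulli_pmf q) (bernoulli_pmf q)))"
    unfolding diff_pmf_def map_pmf_comp by (intro map_pmf_cong refl) auto
  then show ?thesis unfolding diff_pmf_def by (metis pair_commute_pmf)
qed

lemma expectation_diff_pmf:
  fixes f :: "real \<Rightarrow> real"
  assumes "0 \<le> q" "q \<le> 1"
  shows "measure_pmf.expectation (diff_pmf q) f
    = q * ((1 - q) * f (- 1) + q * f 0) + (1 - q) * ((1 - q) * f 0 + q * f 1)"
  unfolding diff_pmf_def integral_map_pmf
  by (subst integral_measure_pmf[where A = UNIV])
    (use assms in \<open>auto simp: UNIV_Times_UNIV[symmetric] UNIV_bool pmf_pair algebra_simps simp del: UNIV_Times_UNIV\<close>)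

lemma pow_le_exp: "0 \<le> x \<Longrightarrow> 0 < y \<Longrightarrow> (x::real) ^ k \<le> y ^ k * exp (real k / y * x - real k)"
proof -
  assume x: "0 \<le> x" "0 < y"
  have "x / y \<le> exp (x / y - 1)" using exp_ge_add_one_self[of "x / y - 1"] by simp
  then have "(x / y) ^ k \<le> exp (x / y - 1) ^ k" using x by (intro power_mono) auto
  also have "\<dots> = exp (real k / y * x - real k)" by (simp add: exp_of_nat_mult[symmetric] algebra_simps)
  finally show ?thesis using x by (simp add: power_divide field_simps)
qed

text \<open>Moments of the number of nonzero entries in a row or a column. The power is bounded by an
  exponential, whose expectation factorises.\<close>

lemma degree_moment:
  assumes S: "finite S" and R: "R \<subseteq> S" and q: "0 \<le> q" "q \<le> 1" and y: "0 < y" "real k \<le> y" "4 * q * real (card R) \<le> y"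
  shows "measure_pmf.expectation (Pi_pmf S 0 (\<lambda>_. diff_pmf q)) (\<lambda>d. (\<Sum>e\<in>R. (d e)\<^sup>2) ^ k) \<le> y ^ k"
proof -
  let ?p = "Pi_pmf S 0 (\<lambda>_. diff_pmf q)" and ?t = "real k / y"
  have finp: "finite (set_pmf ?p)" by (intro finite_set_Pi_pmf S finite_diff_pmf)
  have t: "0 \<le> ?t" "?t \<le> 1" using y by (auto simp: field_simps)
  have "measure_pmf.expectation ?p (\<lambda>d. (\<Sum>e\<in>R. (d e)\<^sup>2) ^ k)
      \<le> measure_pmf.expectation ?p (\<lambda>d. y ^ k * exp (?t * (\<Sum>e\<in>R. (d e)\<^sup>2) - real k))"
    by (intro expectation_mono_pmf finp pow_le_exp sum_nonneg y) auto
  also have "\<dots> = y ^ k * exp (- real k) * measure_pmf.expectation ?p (\<lambda>d. \<Prod>e\<in>S. exp (if e \<in> R then ?t * (d e)\<^sup>2 else 0))"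
  proof -
    have eq: "y ^ k * exp (?t * (\<Sum>e\<in>R. (d e)\<^sup>2) - real k)
        = (y ^ k * exp (- real k)) * (\<Prod>e\<in>S. exp (if e \<in> R then ?t * (d e)\<^sup>2 else 0))" for d :: "'a \<Rightarrow> real"
    proof -
      have "(\<Prod>e\<in>S. exp (if e \<in> R then ?t * (d e)\<^sup>2 else 0)) = exp (?t * (\<Sum>e\<in>R. (d e)\<^sup>2))"
        by (simp add: exp_sum[OF S, symmetric] sum.inter_restrict[OF S, symmetric] Int_absorb1[OF R] sum_distrib_left sum_divide_distrib)
      moreover have "exp (?t * (\<Sum>e\<in>R. (d e)\<^sup>2) - real k) = exp (- real k) * exp (?t * (\<Sum>e\<in>R. (d e)\<^sup>2))"
        by (simp add: exp_add[symmetric])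
      ultimately show ?thesis by (simp only: mult.assoc)
    qed
    show ?thesis by (simp only: eq integral_mult_right_zero)
  qed
  also have "measure_pmf.expectation ?p (\<lambda>d. \<Prod>e\<in>S. exp (if e \<in> R then ?t * (d e)\<^sup>2 else 0))
      = (\<Prod>e\<in>S. measure_pmf.expectation (diff_pmf q) (\<lambda>v. exp (if e \<in> R then ?t * v\<^sup>2 else 0)))"
    by (intro expectation_prod_Pi_pmf[where f = "\<lambda>e v. exp (if e \<in> R then ?t * v\<^sup>2 else 0)"] S
      integrable_measure_pmf_finite finite_diff_pmf) auto
  also have "\<dots> \<le> (\<Prod>e\<in>S. exp (if e \<in> R then 4 * q * ?t else 0))"
  proof (intro prod_mono conjI)
    fix e
    have "measure_pmf.expectation (diff_pmf q) (\<lambda>v. exp (?t * v\<^sup>2)) = 1 + 2 * (q * (1 - q)) * (exp ?t - 1)"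
      by (subst expectation_diff_pmf[OF q]) (simp add: algebra_simps power2_eq_square)
    also have "\<dots> \<le> 1 + 2 * (q * 1) * (2 * ?t)"
    proof -
      have "exp ?t \<le> 1 + ?t + ?t\<^sup>2" using t by (intro exp_le_quadratic) auto
      moreover have "?t\<^sup>2 \<le> ?t" using mult_left_mono[OF t(2) t(1)] by (simp only: power2_eq_square mult_1_right)
      ultimately have "exp ?t - 1 \<le> 2 * ?t" by linarith
      then show ?thesis using q t by (intro add_left_mono mult_mono mult_left_mono) auto
    qed
    also have "\<dots> = 1 + 4 * q * ?t" by simp
    also have "\<dots> \<le> exp (4 * q * ?t)" by (rule exp_ge_add_one_self)
    finally show "measure_pmf.expectation (diff_pmf q) (\<lambda>v. exp (if e \<in> R then ?t * v\<^sup>2 else 0)) \<le> exp (if e \<in> R then 4 * q * ?t else 0)"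
      by simp
  qed (auto intro!: Bochner_Integration.integral_nonneg)
  also have "\<dots> = exp (4 * q * real (card R) * ?t)"
    by (simp add: exp_sum[OF S, symmetric] sum.inter_restrict[OF S, symmetric] Int_absorb1[OF R])
  also have "\<dots> \<le> exp (real k)"
  proof -
    have "4 * q * real (card R) * ?t \<le> y * ?t" using y t by (intro mult_right_mono) auto
    then show ?thesis using y by simp
  qed
  finally show ?thesis using y by (simp add: mult_left_mono exp_minus field_simps)
qed

lemma Pi_diff_pmf_sign:
  assumes S: "finite S" and s: "s \<in> signs S"
  shows "map_pmf (\<lambda>d e. if e \<in> S then s e * d e else 0) (Pi_pmf S 0 (\<lambda>_. diff_pmf q)) = Pi_pmf S 0 (\<lambda>_. diff_pmf q)"
proof -
  have "Pi_pmf S 0 (\<lambda>_. diff_pmf q) = Pi_pmf S 0 (\<lambda>e. bind_pmf (diff_pmf q) (\<lambda>v. return_pmf (s e * v)))"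
  proof (rule Pi_pmf_cong)
    fix e assume "e \<in> S"
    then consider "s e = 1" | "s e = - 1" using s by (force simp: signs_def)
    then show "diff_pmf q = bind_pmf (diff_pmf q) (\<lambda>v. return_pmf (s e * v))"
    proof cases
      case 1 then show ?thesis by (simp add: bind_return_pmf')
    next
      case 2 then show ?thesis using diff_pmf_uminus[of q] by (simp add: map_pmf_def)
    qed
  qed auto
  also have "\<dots> = bind_pmf (Pi_pmf S 0 (\<lambda>_. diff_pmf q)) (\<lambda>d. Pi_pmf S 0 (\<lambda>e. return_pmf (s e * d e)))"
    by (rule Pi_pmf_bind[OF S])
  also have "\<dots> = map_pmf (\<lambda>d e. if e \<in> S then s e * d e else 0) (Pi_pmf S 0 (\<lambda>_. diff_pmf q))"
    by (simp add: Pi_pmf_return_pmf[OF S] map_pmf_def)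
  finally show ?thesis by simp
qed

lemma wmat_cong: "(\<And>i j. i < n1 \<Longrightarrow> j < n2 \<Longrightarrow> w (i, j) = w' (i, j)) \<Longrightarrow> wmat n1 n2 w = wmat n1 n2 w'"
  by (rule fmat_eqI) (simp add: ent_wmat)

text \<open>Random signs can be inserted because the law is symmetric. For fixed absolute values the
  Khintchine inequality applies, with the largest row or column sum as variance; the maximum is
  replaced by a sum of \<open>k\<close>-th powers, which costs a factor \<open>n1 + n2\<close>.\<close>

lemma symmetric_moment:
  assumes q: "0 \<le> q" "q \<le> 1" and k: "0 < k" "real k \<le> 4 * q * real (n1 + n2)"
  shows "measure_pmf.expectation (Pi_pmf ({..<n1} \<times> {..<n2}) 0 (\<lambda>_. diff_pmf q)) (\<lambda>d. opn (wmat n1 n2 d) ^ (2 * k))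
    \<le> (real (n1 + n2))\<^sup>2 * (32 * real k * q * real (n1 + n2)) ^ k"
proof -
  let ?S = "{..<n1} \<times> {..<n2}" and ?n = "real (n1 + n2)"
  let ?p = "Pi_pmf ?S 0 (\<lambda>_. diff_pmf q)" and ?F = "\<lambda>d. opn (wmat n1 n2 d) ^ (2 * k)"
  let ?N = "(2::real) ^ (n1 * n2)" and ?y = "4 * q * real (n1 + n2)"
  define Lr where "Lr i d = (\<Sum>e\<in>{i} \<times> {..<n2}. (d e)\<^sup>2)" for i and d :: "nat \<times> nat \<Rightarrow> real"
  define Lc where "Lc j d = (\<Sum>e\<in>{..<n1} \<times> {j}. (d e)\<^sup>2)" for j and d :: "nat \<times> nat \<Rightarrow> real"
  have y0: "0 < ?y" using k by (metis of_nat_0_less_iff order_less_le_trans)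
  have finS: "finite ?S" by simp
  have finp: "finite (set_pmf ?p)" by (intro finite_set_Pi_pmf finite_diff_pmf) auto
  have sg: "finite (signs ?S)" "card (signs ?S) = 2 ^ (n1 * n2)"
    by (simp_all add: finite_signs card_signs card_cartesian_product)
  have inv: "measure_pmf.expectation ?p ?F = measure_pmf.expectation ?p (\<lambda>d. ?F (\<lambda>e. s e * d e))" if "s \<in> signs ?S" for s
  proof -
    have "measure_pmf.expectation ?p ?F = measure_pmf.expectation (map_pmf (\<lambda>d e. if e \<in> ?S then s e * d e else 0) ?p) ?F"
      by (simp only: Pi_diff_pmf_sign[OF finS that])
    also have "\<dots> = measure_pmf.expectation ?p (\<lambda>d. ?F (\<lambda>e. s e * d e))"
    proof -
      have "wmat n1 n2 (\<lambda>e. if e \<in> ?S then s e * d e else 0) = wmat n1 n2 (\<lambda>e. s e * d e)" for d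
        by (rule wmat_cong) simp
      then show ?thesis by (simp only: integral_map_pmf)
    qed
    finally show ?thesis .
  qed
  have pt: "(\<Sum>s\<in>signs ?S. ?F (\<lambda>e. s e * d e)) \<le> (8 * real k) ^ k * (?N * ?n) * ((\<Sum>i<n1. (Lr i d) ^ k) + (\<Sum>j<n2. (Lc j d) ^ k))" for d
  proof -
    define m where "m = Max (insert 0 ((\<lambda>i. Lr i d) ` {..<n1} \<union> (\<lambda>j. Lc j d) ` {..<n2}))"
    have m0: "0 \<le> m" unfolding m_def by (intro Max_ge) auto
    have mr: "Lr i d \<le> m" if "i < n1" for i unfolding m_def by (intro Max_ge) (use that in auto)
    have mc: "Lc j d \<le> m" if "j < n2" for j unfolding m_def by (intro Max_ge) (use that in auto)
    have L0: "0 \<le> Lr i d" "0 \<le> Lc i d" for i unfolding Lr_def Lc_def by (auto intro: sum_nonneg)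
    have Lr_eq: "Lr i d = (\<Sum>j<n2. (d (i, j))\<^sup>2)" for i
      unfolding Lr_def by (rule sum.reindex_bij_witness[where i = "\<lambda>j. (i, j)" and j = snd]) auto
    have Lc_eq: "Lc j d = (\<Sum>i<n1. (d (i, j))\<^sup>2)" for j
      unfolding Lc_def by (rule sum.reindex_bij_witness[where i = "\<lambda>i. (i, j)" and j = fst]) auto
    have "(\<Sum>s\<in>signs ?S. ?F (\<lambda>e. s e * d e)) \<le> (8 * real k * m) ^ k * (?N * ?n)"
      using rademacher_moment[OF k(1) m0, of n1 d n2] mr mc unfolding Lr_eq Lc_eq by (simp add: mult.commute)
    also have "\<dots> = (8 * real k) ^ k * (?N * ?n) * m ^ k" by (simp add: power_mult_distrib)
    also have "m ^ k \<le> (\<Sum>i<n1. (Lr i d) ^ k) + (\<Sum>j<n2. (Lc j d) ^ k)"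
    proof -
      have "m \<in> insert 0 ((\<lambda>i. Lr i d) ` {..<n1} \<union> (\<lambda>j. Lc j d) ` {..<n2})"
        unfolding m_def by (intro Max_in) auto
      then consider "m = 0" | i where "i < n1" "m = Lr i d" | j where "j < n2" "m = Lc j d" by auto
      then show ?thesis
      proof cases
        case 1
        then show ?thesis using k L0 by (auto intro!: add_nonneg_nonneg sum_nonneg simp: zero_power)
      next
        case 2
        then have "m ^ k \<le> (\<Sum>i<n1. (Lr i d) ^ k)" using L0 by (auto intro!: member_le_sum)
        then show ?thesis using sum_nonneg[of "{..<n2}" "\<lambda>j. (Lc j d) ^ k"] L0 by force
      next
        case 3
        then have "m ^ k \<le> (\<Sum>j<n2. (Lc j d) ^ k)" using L0 by (auto intro!: member_le_sum)
        then show ?thesis using sum_nonneg[of "{..<n1}" "\<lambda>j. (Lr j d) ^ k"] L0 by force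
      qed
    qed
    finally show ?thesis by (simp add: mult_left_mono)
  qed
  have int: "integrable (measure_pmf ?p) f" for f :: "_ \<Rightarrow> real" by (rule integrable_measure_pmf_finite[OF finp])
  have "?N * measure_pmf.expectation ?p ?F = (\<Sum>s\<in>signs ?S. measure_pmf.expectation ?p ?F)"
    by (simp add: sg)
  also have "\<dots> = (\<Sum>s\<in>signs ?S. measure_pmf.expectation ?p (\<lambda>d. ?F (\<lambda>e. s e * d e)))"
    by (intro sum.cong refl inv)
  also have "\<dots> = measure_pmf.expectation ?p (\<lambda>d. \<Sum>s\<in>signs ?S. ?F (\<lambda>e. s e * d e))"
    by (rule Bochner_Integration.integral_sum[symmetric]) (rule int)
  also have "\<dots> \<le> measure_pmf.expectation ?p (\<lambda>d. (8 * real k) ^ k * (?N * ?n) * ((\<Sum>i<n1. (Lr i d) ^ k) + (\<Sum>j<n2. (Lc j d) ^ k)))"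
    by (intro expectation_mono_pmf finp pt)
  also have "\<dots> = (8 * real k) ^ k * (?N * ?n) * ((\<Sum>i<n1. measure_pmf.expectation ?p (\<lambda>d. (Lr i d) ^ k)) + (\<Sum>j<n2. measure_pmf.expectation ?p (\<lambda>d. (Lc j d) ^ k)))"
    by (simp add: Bochner_Integration.integral_sum int Bochner_Integration.integral_add)
  also have "\<dots> \<le> (8 * real k) ^ k * (?N * ?n) * ((\<Sum>i<n1. ?y ^ k) + (\<Sum>j<n2. ?y ^ k))"
    unfolding Lr_def Lc_def using q k y0
    by (intro mult_left_mono add_mono sum_mono degree_moment) (auto simp: card_cartesian_product intro!: mult_left_mono)
  also have "\<dots> = ?N * (?n\<^sup>2 * (32 * real k * q * ?n) ^ k)"
  proof -
    have "(8 * real k) ^ k * ?y ^ k = (32 * real k * q * ?n) ^ k"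
      by (simp only: power_mult_distrib[symmetric]) (simp add: mult_ac)
    moreover have "(\<Sum>i<n1. ?y ^ k) + (\<Sum>j<n2. ?y ^ k) = ?n * ?y ^ k" by (simp add: distrib_right)
    moreover have "A * (N * n) * (n * Y) = N * (n\<^sup>2 * (A * Y))" for A N n Y :: real
      by (simp add: power2_eq_square)
    ultimately show ?thesis by presburger
  qed
  finally show ?thesis by simp
qed

lemma convex_power_expectation:
  fixes x :: "'a \<Rightarrow> real"
  assumes "finite (set_pmf p)"
  shows "(\<Sum>a\<in>set_pmf p. pmf p a * x a) ^ (2 * k) \<le> measure_pmf.expectation p (\<lambda>a. x a ^ (2 * k))"
proof -
  have "(\<Sum>a\<in>set_pmf p. pmf p a *\<^sub>R x a) ^ (2 * k) \<le> (\<Sum>a\<in>set_pmf p. pmf p a * x a ^ (2 * k))"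
    using assms by (intro convex_on_sum[OF _ _ convex_power_even[of "2 * k"]])
      (auto simp: sum_pmf_eq_1 set_pmf_not_empty)
  then show ?thesis using assms
    by (subst integral_measure_pmf[where A = "set_pmf p"]) auto
qed

lemma bernoulli_diff_pmf:
  assumes S: "finite S"
  shows "bind_pmf (Pi_pmf S False (\<lambda>_. bernoulli_pmf q)) (\<lambda>f. map_pmf (\<lambda>g e. if e \<in> S then of_bool (g e) - of_bool (f e) else 0)
      (Pi_pmf S False (\<lambda>_. bernoulli_pmf q))) = Pi_pmf S 0 (\<lambda>_. diff_pmf q)"
proof -
  let ?B = "\<lambda>_. bernoulli_pmf q"
  have "Pi_pmf S 0 (\<lambda>_. diff_pmf q)
      = Pi_pmf S 0 (\<lambda>_. bind_pmf (bernoulli_pmf q) (\<lambda>a. bind_pmf (bernoulli_pmf q) (\<lambda>b. return_pmf (of_bool b - of_bool a))))"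
    by (simp add: diff_pmf_def pair_pmf_def map_bind_pmf)
  also have "\<dots> = bind_pmf (Pi_pmf S False ?B) (\<lambda>f. Pi_pmf S 0 (\<lambda>e. bind_pmf (bernoulli_pmf q) (\<lambda>b. return_pmf (of_bool b - of_bool (f e)))))"
    by (rule Pi_pmf_bind[OF S])
  also have "\<dots> = bind_pmf (Pi_pmf S False ?B) (\<lambda>f. bind_pmf (Pi_pmf S False ?B) (\<lambda>g. Pi_pmf S 0 (\<lambda>e. return_pmf (of_bool (g e) - of_bool (f e)))))"
    by (intro bind_pmf_cong refl Pi_pmf_bind[OF S])
  finally show ?thesis by (simp add: Pi_pmf_return_pmf[OF S] map_pmf_def)
qed

text \<open>Symmetrisation: \<open>q\<close> is the mean of an independent copy, and \<open>x \<mapsto> x\<^bsup>2k\<^esup>\<close> of a seminorm is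
  convex.\<close>

lemma centered_moment:
  assumes q: "0 \<le> q" "q \<le> 1" and k: "0 < k" "real k \<le> 4 * q * real (n1 + n2)"
  shows "measure_pmf.expectation (Pi_pmf ({..<n1} \<times> {..<n2}) False (\<lambda>_. bernoulli_pmf q))
      (\<lambda>f. opn (wmat n1 n2 (\<lambda>e. q - of_bool (f e))) ^ (2 * k))
    \<le> (real (n1 + n2))\<^sup>2 * (32 * real k * q * real (n1 + n2)) ^ k"
proof -
  let ?S = "{..<n1} \<times> {..<n2}"
  let ?p = "Pi_pmf ?S False (\<lambda>_. bernoulli_pmf q)"
  let ?F = "\<lambda>d. opn (wmat n1 n2 d) ^ (2 * k)"
  let ?d = "\<lambda>f g e. if e \<in> ?S then of_bool (g e) - of_bool (f e) else (0::real)"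
  have finS: "finite ?S" by simp
  have finp: "finite (set_pmf ?p)" by (intro finite_set_Pi_pmf) auto
  have pt: "?F (\<lambda>e. q - of_bool (f e)) \<le> measure_pmf.expectation ?p (\<lambda>g. ?F (?d f g))" for f
  proof -
    have eq: "wmat n1 n2 (\<lambda>e. q - of_bool (f e)) = (\<Sum>g\<in>set_pmf ?p. pmf ?p g *\<^sub>R wmat n1 n2 (?d f g))"
    proof (rule fmat_eqI)
      fix i j
      show "ent (wmat n1 n2 (\<lambda>e. q - of_bool (f e))) i j = ent (\<Sum>g\<in>set_pmf ?p. pmf ?p g *\<^sub>R wmat n1 n2 (?d f g)) i j"
      proof (cases "i < n1 \<and> j < n2")
        case True
        have "(\<Sum>g\<in>set_pmf ?p. pmf ?p g * (of_bool (g (i, j)) - of_bool (f (i, j))))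
            = measure_pmf.expectation ?p (\<lambda>g. of_bool (g (i, j)) :: real) - of_bool (f (i, j))"
          using finp by (subst integral_measure_pmf[where A = "set_pmf ?p"])
            (auto simp: right_diff_distrib sum_subtractf sum_distrib_right[symmetric] sum_pmf_eq_1)
        also have "measure_pmf.expectation ?p (\<lambda>g. of_bool (g (i, j)) :: real) = measure_pmf.expectation (map_pmf (\<lambda>g. g (i, j)) ?p) (of_bool :: bool \<Rightarrow> real)"
          by simp
        also have "map_pmf (\<lambda>g. g (i, j)) ?p = bernoulli_pmf q"
          using True by (subst Pi_pmf_component) auto
        also have "measure_pmf.expectation (bernoulli_pmf q) (of_bool :: bool \<Rightarrow> real) = q" using q by simp
        finally show ?thesis using True by (simp add: ent_wmat)
      next
        case False
        then show ?thesis by (simp add: ent_wmat False)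
      qed
    qed
    have "opn (wmat n1 n2 (\<lambda>e. q - of_bool (f e))) \<le> (\<Sum>g\<in>set_pmf ?p. pmf ?p g * opn (wmat n1 n2 (?d f g)))"
      unfolding eq by (rule opn_convex_sum) simp
    then have "?F (\<lambda>e. q - of_bool (f e)) \<le> (\<Sum>g\<in>set_pmf ?p. pmf ?p g * opn (wmat n1 n2 (?d f g))) ^ (2 * k)"
      by (intro power_mono opn_nonneg)
    also have "\<dots> \<le> measure_pmf.expectation ?p (\<lambda>g. ?F (?d f g))"
      by (rule convex_power_expectation[OF finp])
    finally show ?thesis .
  qed
  have "measure_pmf.expectation ?p (\<lambda>f. ?F (\<lambda>e. q - of_bool (f e)))
      \<le> measure_pmf.expectation ?p (\<lambda>f. measure_pmf.expectation ?p (\<lambda>g. ?F (?d f g)))"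
    by (intro expectation_mono_pmf finp pt)
  also have "\<dots> = measure_pmf.expectation (bind_pmf ?p (\<lambda>f. map_pmf (?d f) ?p)) ?F"
    using finp by (subst pmf_expectation_bind[where A = "set_pmf ?p"])
      (auto simp: integral_measure_pmf[where A = "set_pmf ?p"])
  also have "\<dots> = measure_pmf.expectation (Pi_pmf ?S 0 (\<lambda>_. diff_pmf q)) ?F"
    by (simp only: bernoulli_diff_pmf[OF finS])
  also have "\<dots> \<le> (real (n1 + n2))\<^sup>2 * (32 * real k * q * real (n1 + n2)) ^ k"
    by (rule symmetric_moment[OF q k])
  finally show ?thesis .
qed

text \<open>Markov's inequality. The \<open>2k\<close>-th power of the threshold is \<open>3\<^sup>k\<close> times the moment bound
  without the factor \<open>n\<^sup>2\<close>, and \<open>3 \<ge> e\<close>.\<close>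

lemma centered_opn_tail:
  assumes q: "0 < q" "q \<le> 1" and k: "0 < k" "real k \<le> 4 * q * real (n1 + n2)"
  shows "measure_pmf.prob (Pi_pmf ({..<n1} \<times> {..<n2}) False (\<lambda>_. bernoulli_pmf q))
      {f. sqrt (96 * real k * q * real (n1 + n2)) < opn (wmat n1 n2 (\<lambda>e. q - of_bool (f e)))}
    \<le> (real (n1 + n2))\<^sup>2 * exp (- real k)"
proof -
  let ?p = "Pi_pmf ({..<n1} \<times> {..<n2}) False (\<lambda>_. bernoulli_pmf q)"
  let ?z = "32 * real k * q * real (n1 + n2)"
  have finp: "finite (set_pmf ?p)" by (intro finite_set_Pi_pmf) auto
  have n0: "0 < real (n1 + n2)" using k by (cases "n1 + n2 = 0") auto
  have z0: "0 < ?z" using k q n0 by simp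
  have sq: "sqrt (96 * real k * q * real (n1 + n2)) ^ (2 * k) = (3 * ?z) ^ k"
  proof -
    have e96: "96 * real k * q * real (n1 + n2) = 3 * ?z" by simp
    have "0 \<le> 3 * ?z" using z0 by simp
    then have "sqrt (3 * ?z) ^ (2 * k) = (3 * ?z) ^ k" by (simp only: power_mult real_sqrt_pow2)
    then show ?thesis by (simp only: e96)
  qed
  have "measure_pmf.prob ?p {f. sqrt (96 * real k * q * real (n1 + n2)) < opn (wmat n1 n2 (\<lambda>e. q - of_bool (f e)))}
      \<le> measure_pmf.expectation ?p (\<lambda>f. opn (wmat n1 n2 (\<lambda>e. q - of_bool (f e))) ^ (2 * k)) / (3 * ?z) ^ k"
  proof (rule markov_pmf[OF finp])
    show "0 < (3 * ?z) ^ k" by (rule zero_less_power[OF mult_pos_pos[OF _ z0]]) simp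
    fix f assume "f \<in> {f. sqrt (96 * real k * q * real (n1 + n2)) < opn (wmat n1 n2 (\<lambda>e. q - of_bool (f e)))}"
    then have "sqrt (96 * real k * q * real (n1 + n2)) ^ (2 * k) \<le> opn (wmat n1 n2 (\<lambda>e. q - of_bool (f e))) ^ (2 * k)"
      using q by (intro power_mono) auto
    then show "(3 * ?z) ^ k \<le> opn (wmat n1 n2 (\<lambda>e. q - of_bool (f e))) ^ (2 * k)" by (simp only: sq)
  qed (simp add: opn_nonneg)
  also have "\<dots> \<le> ((real (n1 + n2))\<^sup>2 * ?z ^ k) / (3 * ?z) ^ k"
    using q z0 by (intro divide_right_mono centered_moment k) auto
  also have "\<dots> = (real (n1 + n2))\<^sup>2 * (1 / 3) ^ k"
  proof -
    have "N * Z ^ k / (3 * Z) ^ k = N * (1 / 3) ^ k" if "0 < Z" for N Z :: real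
      using that by (simp add: power_mult_distrib power_divide)
    then show ?thesis using z0 by blast
  qed
  also have "\<dots> \<le> (real (n1 + n2))\<^sup>2 * exp (- 1) ^ k"
  proof (intro mult_left_mono power_mono)
    have "exp 1 \<le> (3::real)" by (rule exp_le)
    then show "1 / 3 \<le> exp (- 1::real)" by (simp add: exp_minus field_simps)
  qed auto
  also have "exp (- 1::real) ^ k = exp (- real k)" by (simp add: exp_of_nat_mult[symmetric])
  finally show ?thesis .
qed

text \<open>Labels in \<open>A\<close> are drawn again, conditionally on being in \<open>A\<close>; the others are kept.\<close>

definition resample :: "nat pmf \<Rightarrow> nat set \<Rightarrow> nat \<Rightarrow> nat pmf" where
  "resample p A c = (if c \<in> A then cond_pmf p A else return_pmf c)"

lemma bind_resample:
  assumes A: "set_pmf p \<inter> A \<noteq> {}" and fin: "finite (set_pmf p)"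
  shows "bind_pmf p (resample p A) = p"
proof (rule pmf_eqI)
  fix x
  have mA: "measure_pmf.prob p A = (\<Sum>c\<in>set_pmf p. if c \<in> A then pmf p c else 0)"
  proof -
    have "measure_pmf.prob p A = measure_pmf.expectation p (indicator A)" by simp
    also have "\<dots> = (\<Sum>c\<in>set_pmf p. pmf p c *\<^sub>R indicator A c)"
      by (rule integral_measure_pmf[OF fin])
    also have "\<dots> = (\<Sum>c\<in>set_pmf p. if c \<in> A then pmf p c else 0)"
      by (intro sum.cong refl) (simp add: indicator_def)
    finally show ?thesis .
  qed
  have m0: "measure_pmf.prob p A \<noteq> 0" by (rule measure_measure_pmf_not_zero[OF A])
  have "pmf (bind_pmf p (resample p A)) x = (\<Sum>c\<in>set_pmf p. pmf p c * pmf (resample p A c) x)"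
    unfolding pmf_bind using fin by (subst integral_measure_pmf[where A = "set_pmf p"]) auto
  also have "\<dots> = pmf p x"
  proof (cases "x \<in> A")
    case True
    have "(\<Sum>c\<in>set_pmf p. pmf p c * pmf (resample p A c) x)
        = (\<Sum>c\<in>set_pmf p. (if c \<in> A then pmf p c else 0) * (pmf p x / measure_pmf.prob p A))"
      using True by (intro sum.cong refl) (auto simp: resample_def pmf_cond[OF A] indicator_def split: if_splits)
    also have "\<dots> = measure_pmf.prob p A * (pmf p x / measure_pmf.prob p A)"
      unfolding sum_distrib_right[symmetric] mA by simp
    finally show ?thesis using m0 by simp
  next
    case False
    have "(\<Sum>c\<in>set_pmf p. pmf p c * pmf (resample p A c) x) = (\<Sum>c\<in>set_pmf p. if c = x then pmf p x else 0)"
      using False by (intro sum.cong refl) (auto simp: resample_def pmf_cond[OF A] indicator_def split: if_splits)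
    also have "\<dots> = pmf p x" using fin by (auto simp: set_pmf_iff)
    finally show ?thesis .
  qed
  finally show "pmf (bind_pmf p (resample p A)) x = pmf p x" .
qed

text \<open>Bernstein's inequality for the labels on \<open>R\<close> that lie in \<open>A\<close>, with weights that may depend
  on all labels outside \<open>R\<close> and on those labels on \<open>R\<close> that are not in \<open>A\<close>. Drawing the labels in
  \<open>A\<close> again does not change the joint law, and given the old labels it makes them independent
  while the weights are fixed. With \<open>A\<close> the set of labels that have not been used yet, this is the
  substitute for the independence of the parts.\<close>

lemma fresh_bernstein:
  fixes w :: "('a \<Rightarrow> nat) \<Rightarrow> 'a \<Rightarrow> real" and b Sq :: "('a \<Rightarrow> nat) \<Rightarrow> real"
  assumes S: "finite S" and R: "R \<subseteq> S" and p: "finite (set_pmf p)" "set_pmf p \<inter> A \<noteq> {}"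
    and t: "t \<in> A" "t \<noteq> 0" and a: "a = pmf p t / measure_pmf.prob p A"
    and inv: "\<And>l l'. (\<And>e. e \<notin> R \<Longrightarrow> l' e = l e) \<Longrightarrow> (\<And>e. e \<in> R \<Longrightarrow> l e \<notin> A \<Longrightarrow> l' e = l e)
        \<Longrightarrow> (\<And>e. e \<in> R \<Longrightarrow> l e \<in> A \<Longrightarrow> l' e \<in> A) \<Longrightarrow> w l' = w l \<and> b l' = b l \<and> Sq l' = Sq l"
    and w: "\<And>l e. e \<in> R \<Longrightarrow> \<bar>w l e\<bar> \<le> b l" "\<And>l. (\<Sum>e\<in>R. (w l e)\<^sup>2) \<le> Sq l" "\<And>l. 0 \<le> b l" and x: "0 \<le> x"
  shows "measure_pmf.prob (Pi_pmf S 0 (\<lambda>_. p))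
      {l. 2 * sqrt (a * Sq l * x) + 2 * b l * x < \<bar>\<Sum>e\<in>{e\<in>R. l e \<in> A}. (of_bool (l e = t) - a) * w l e\<bar>} \<le> 2 * exp (- x)"
proof -
  define K where "K e c = (if e \<in> R then resample p A c else return_pmf c)" for e c
  let ?bad = "{l. 2 * sqrt (a * Sq l * x) + 2 * b l * x < \<bar>\<Sum>e\<in>{e\<in>R. l e \<in> A}. (of_bool (l e = t) - a) * w l e\<bar>}"
  have finR: "finite R" using S R finite_subset by blast
  have mA: "0 < measure_pmf.prob p A" using p(2) measure_pmf_posI by fastforce
  have a01: "0 \<le> a" "a \<le> 1"
  proof -
    have "pmf p t \<le> measure_pmf.prob p A" using t(1) by (metis measure_pmf_single pmf.rep_eq measure_pmf.finite_measure_mono empty_subsetI insert_subset sets_measure_pmf UNIV_I)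
    then show "0 \<le> a" "a \<le> 1" using mA by (auto simp: a)
  qed
  have "Pi_pmf S 0 (\<lambda>_. p) = Pi_pmf S 0 (\<lambda>e. bind_pmf p (K e))"
  proof (rule Pi_pmf_cong)
    fix e
    show "p = bind_pmf p (K e)"
    proof (cases "e \<in> R")
      case True
      then have "K e = resample p A" by (auto simp: K_def)
      then show ?thesis using bind_resample[OF p(2,1)] by simp
    next
      case False
      then have "K e = return_pmf" by (auto simp: K_def)
      then show ?thesis by (simp add: bind_return_pmf')
    qed
  qed auto
  also have "\<dots> = bind_pmf (Pi_pmf S 0 (\<lambda>_. p)) (\<lambda>l. Pi_pmf S 0 (\<lambda>e. K e (l e)))"
    by (rule Pi_pmf_bind[OF S])
  finally have eq: "Pi_pmf S 0 (\<lambda>_. p) = \<dots>" .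
  have "measure_pmf.prob (Pi_pmf S 0 (\<lambda>e. K e (l e))) ?bad \<le> 2 * exp (- x)" if l: "l \<in> set_pmf (Pi_pmf S 0 (\<lambda>_. p))" for l
  proof -
    let ?q = "Pi_pmf S 0 (\<lambda>e. K e (l e))" and ?R = "{e\<in>R. l e \<in> A}"
    let ?bad' = "{f. 2 * sqrt (a * Sq l * x) + 2 * b l * x < \<bar>\<Sum>e\<in>?R. (of_bool (f e) - a) * w l e\<bar>}"
    have l0: "l e = 0" if "e \<notin> S" for e using l set_Pi_pmf_subset[OF S] that by fastforce
    have sub: "?R \<subseteq> S" using R by auto
    have finR': "finite ?R" using finR by auto
    have "measure_pmf.prob ?q ?bad \<le> measure_pmf.prob ?q ((\<lambda>l' e. if e \<in> ?R then l' e = t else False) -` ?bad')"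
    proof (rule pmf_prob_mono)
      fix l' assume l': "l' \<in> set_pmf ?q" and bad: "l' \<in> ?bad"
      have comp: "l' e \<in> set_pmf (K e (l e))" if "e \<in> S" for e
        using l' that unfolding set_Pi_pmf[OF S] by (auto simp: PiE_dflt_def)
      have out: "l' e = 0" if "e \<notin> S" for e using l' set_Pi_pmf_subset[OF S] that by fastforce
      have 1: "l' e = l e" if "e \<notin> R" for e
        using comp[of e] out[of e] l0[of e] that by (cases "e \<in> S") (auto simp: K_def)
      have 2: "l' e = l e" if "e \<in> R" "l e \<notin> A" for e
        using comp[of e] that R by (auto simp: K_def resample_def)
      have 3: "l' e \<in> A" if "e \<in> R" "l e \<in> A" for e
        using comp[of e] that R set_cond_pmf[OF p(2)] by (auto simp: K_def resample_def)
      have "w l' = w l \<and> b l' = b l \<and> Sq l' = Sq l" by (rule inv[OF 1 2 3])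
      moreover have "{e\<in>R. l' e \<in> A} = ?R" using 2 3 by metis
      moreover have "(\<Sum>e\<in>?R. (of_bool (l' e = t) - a) * w l e) = (\<Sum>e\<in>?R. (of_bool (if e \<in> ?R then l' e = t else False) - a) * w l e)"
        by (intro sum.cong refl) auto
      ultimately show "l' \<in> (\<lambda>l' e. if e \<in> ?R then l' e = t else False) -` ?bad'" using bad by simp
    qed
    also have "\<dots> = measure_pmf.prob (map_pmf (\<lambda>l' e. if e \<in> ?R then l' e = t else False) ?q) ?bad'"
      by simp
    also have "map_pmf (\<lambda>l' e. if e \<in> ?R then l' e = t else False) ?q = Pi_pmf ?R False (\<lambda>_. bernoulli_pmf a)"
    proof -
      have cb: "map_pmf (\<lambda>c. c = t) (cond_pmf p A) = bernoulli_pmf a"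
      proof (rule pmf_eqI)
        have T: "pmf (map_pmf (\<lambda>c. c = t) (cond_pmf p A)) True = a"
        proof -
          have "(\<lambda>c. c = t) -` {True} = {t}" by auto
          then show ?thesis using t by (simp add: pmf_map measure_pmf_single pmf_cond[OF p(2)] a)
        qed
        fix v
        show "pmf (map_pmf (\<lambda>c. c = t) (cond_pmf p A)) v = pmf (bernoulli_pmf a) v"
        proof (cases v)
          case True then show ?thesis using T a01 by simp
        next
          case False
          have "pmf (map_pmf (\<lambda>c. c = t) (cond_pmf p A)) False = 1 - pmf (map_pmf (\<lambda>c. c = t) (cond_pmf p A)) True"
            by (simp add: pmf_False_conv_True)
          then show ?thesis using T a01 False by simp
        qed
      qed
      have "Pi_pmf ?R False (\<lambda>_. bernoulli_pmf a) = Pi_pmf ?R False (\<lambda>e. map_pmf (\<lambda>c. c = t) (K e (l e)))"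
        by (rule Pi_pmf_cong) (auto simp: K_def resample_def cb)
      also have "\<dots> = map_pmf (\<lambda>h. (\<lambda>c. c = t) \<circ> h) (Pi_pmf ?R 0 (\<lambda>e. K e (l e)))"
        using t by (intro Pi_pmf_map finR') auto
      also have "Pi_pmf ?R 0 (\<lambda>e. K e (l e)) = map_pmf (\<lambda>f e. if e \<in> ?R then f e else 0) ?q"
        by (rule Pi_pmf_subset[OF S sub])
      finally show ?thesis using t by (simp add: map_pmf_comp o_def if_distrib cong: if_cong)
    qed
    also have "measure_pmf.prob \<dots> ?bad' \<le> 2 * exp (- x)"
    proof (rule bernstein[OF finR' a01 _ _ x w(3)])
      show "\<bar>w l e\<bar> \<le> b l" if "e \<in> ?R" for e using w(1) that by auto
      have "(\<Sum>e\<in>?R. (w l e)\<^sup>2) \<le> (\<Sum>e\<in>R. (w l e)\<^sup>2)" using finR by (intro sum_mono2) auto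
      then show "(\<Sum>e\<in>?R. (w l e)\<^sup>2) \<le> Sq l" using w(2)[of l] by linarith
    qed
    finally show ?thesis .
  qed
  then show ?thesis by (subst eq) (rule prob_bind_pmf_le)
qed

section \<open>Singular value decompositions\<close>

lemma homogeneous_system:
  fixes A :: "nat \<Rightarrow> 'a \<Rightarrow> real"
  assumes "finite I" "m < card I"
  shows "\<exists>c. (\<exists>i\<in>I. c i \<noteq> 0) \<and> (\<forall>e<m. (\<Sum>i\<in>I. A e i * c i) = 0)"
  using assms
proof (induction m arbitrary: I A)
  case 0
  then obtain i where "i \<in> I" by fastforce
  then show ?case by (intro exI[of _ "\<lambda>_. 1"]) auto
next
  case (Suc m)
  show ?case
  proof (cases "\<forall>i\<in>I. A m i = 0")
    case True
    obtain c where c: "\<exists>i\<in>I. c i \<noteq> 0" "\<forall>e<m. (\<Sum>i\<in>I. A e i * c i) = 0"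
      using Suc.IH[of I A] Suc.prems by auto
    then show ?thesis using True by (intro exI[of _ c]) (auto simp: less_Suc_eq)
  next
    case False
    then obtain p where p: "p \<in> I" "A m p \<noteq> 0" by auto
    let ?I = "I - {p}"
    have fin: "finite ?I" "m < card ?I" using Suc.prems p by auto
    obtain c where c: "\<exists>i\<in>?I. c i \<noteq> 0" "\<forall>e<m. (\<Sum>i\<in>?I. (A e i - A e p * A m i / A m p) * c i) = 0"
      using Suc.IH[OF fin, of "\<lambda>e i. A e i - A e p * A m i / A m p"] by auto
    define cp where "cp = - (\<Sum>i\<in>?I. A m i * c i) / A m p"
    define d where "d = c(p := cp)"
    have sum: "(\<Sum>i\<in>I. A e i * d i) = A e p * cp + (\<Sum>i\<in>?I. A e i * c i)" for e
    proof -
      have "(\<Sum>i\<in>I. A e i * d i) = A e p * d p + (\<Sum>i\<in>?I. A e i * d i)"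
        using Suc.prems p by (subst sum.remove[of _ p]) auto
      also have "(\<Sum>i\<in>?I. A e i * d i) = (\<Sum>i\<in>?I. A e i * c i)" by (intro sum.cong refl) (auto simp: d_def)
      finally show ?thesis by (simp add: d_def)
    qed
    have "(\<Sum>i\<in>I. A e i * d i) = 0" if "e < Suc m" for e
    proof (cases "e = m")
      case True
      then show ?thesis using p by (simp add: sum cp_def)
    next
      case False
      then have "(\<Sum>i\<in>?I. (A e i - A e p * A m i / A m p) * c i) = 0" using c that by auto
      moreover have "(\<Sum>i\<in>?I. (A e i - A e p * A m i / A m p) * c i)
          = (\<Sum>i\<in>?I. A e i * c i) - A e p / A m p * (\<Sum>i\<in>?I. A m i * c i)"
        unfolding sum_distrib_left sum_subtractf[symmetric]
        by (intro sum.cong refl) (simp add: left_diff_distrib)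
      ultimately have "(\<Sum>i\<in>?I. A e i * c i) = A e p / A m p * (\<Sum>i\<in>?I. A m i * c i)" by linarith
      then show ?thesis by (simp add: sum cp_def)
    qed
    moreover have "\<exists>i\<in>I. d i \<noteq> 0" using c(1) by (auto simp: d_def)
    ultimately show ?thesis by blast
  qed
qed

lemma ent_mult_idn: "ent (A * idn n) i j = (if j < n then ent A i j else 0)"
  using ent_idn_mult[of n "tp A" j i] by (metis ent_tp tp_idn tp_mult tp_tp)

definition dg :: "nat \<Rightarrow> (nat \<Rightarrow> real) \<Rightarrow> fmat" where "dg k s = (\<Sum>i<k. s i *\<^sub>R eu i i)"

lemma ent_dg: "ent (dg k s) i j = (if i = j \<and> i < k then s i else 0)"
proof -
  have "ent (dg k s) i j = (\<Sum>a<k. if a = i then (if i = j then s i else 0) else 0)"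
    unfolding dg_def ent_sum by (intro sum.cong refl) (auto simp: ent_eu)
  then show ?thesis by simp
qed
lemma tp_dg [simp]: "tp (dg k s) = dg k s" by (rule fmat_eqI) (auto simp: ent_dg)
lemma ent_dg_mult: "ent (dg k s * A) i j = (if i < k then s i * ent A i j else 0)"
proof -
  have "ent (dg k s * A) i j = (\<Sum>a<k. if a = i then s i * ent A i j else 0)"
    unfolding dg_def sum_distrib_right ent_sum by (intro sum.cong refl) (auto simp: ent_eu_mult)
  then show ?thesis by simp
qed

lemma norm_mono_ent:
  assumes "\<And>i j. \<bar>ent A i j\<bar> \<le> \<bar>ent B i j\<bar>" shows "norm A \<le> norm B"
proof -
  obtain n where n: "bnd n (ent A)" "bnd n (ent B)" using ex_bnd2 .
  have "(norm A)\<^sup>2 \<le> (norm B)\<^sup>2"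
    unfolding norm_sq_ent[OF n(1)] norm_sq_ent[OF n(2)]
    by (intro sum_mono) (use assms in \<open>auto simp: abs_le_square_iff\<close>)
  then show ?thesis by (rule power2_le_imp_le) simp
qed

lemma norm_isometry: "tp u * u = idn k \<Longrightarrow> idn k * Y = Y \<Longrightarrow> norm (u * Y) = norm Y"
proof -
  assume u: "tp u * u = idn k" "idn k * Y = Y"
  have "(norm (u * Y))\<^sup>2 = inner Y (tp u * u * Y)"
    by (simp add: power2_norm_eq_inner inner_mult_left mult.assoc)
  also have "\<dots> = (norm Y)\<^sup>2" by (simp add: u power2_norm_eq_inner)
  finally show ?thesis by simp
qed

lemma oproj_isometry: "tp u * u = idn k \<Longrightarrow> u * idn k = u \<Longrightarrow> oproj (u * tp u)"
proof -
  assume u: "tp u * u = idn k" "u * idn k = u"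
  have "u * tp u * (u * tp u) = u * (tp u * u) * tp u" by (simp only: mult.assoc)
  then show ?thesis unfolding oproj_def by (simp add: u)
qed

lemma idn_idn: "idn a * idn b = idn (min a b)"
  by (rule fmat_eqI) (auto simp: ent_idn_mult ent_idn)
lemma idn_dg: "idn a * dg k s = dg k (\<lambda>i. if i < a then s i else 0)"
  by (rule fmat_eqI) (auto simp: ent_idn_mult ent_dg)
lemma dg_idn: "dg k s * idn a = dg k (\<lambda>i. if i < a then s i else 0)"
  by (rule fmat_eqI) (auto simp: ent_dg_mult ent_dg ent_idn)

definition fsvd :: "nat \<Rightarrow> nat \<Rightarrow> nat \<Rightarrow> fmat \<Rightarrow> fmat \<Rightarrow> (nat \<Rightarrow> real) \<Rightarrow> fmat \<Rightarrow> bool" where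
  "fsvd n1 n2 k W u s v \<longleftrightarrow> blk n1 k u \<and> blk n2 k v \<and> tp u * u = idn k \<and> tp v * v = idn k \<and>
     (\<forall>i<k. 0 \<le> s i) \<and> (\<forall>i j. i \<le> j \<and> j < k \<longrightarrow> s j \<le> s i) \<and> W = u * dg k s * tp v"

lemma blk_mult_idn: "blk n k u \<Longrightarrow> u * idn k = u"
  by (rule mult_idn_eq) (auto simp: blk_def)

lemma fsvdD:
  assumes "fsvd n1 n2 k W u s v"
  shows "blk n1 k u" "blk n2 k v" "tp u * u = idn k" "tp v * v = idn k"
    "\<And>i. i < k \<Longrightarrow> 0 \<le> s i" "\<And>i j. i \<le> j \<Longrightarrow> j < k \<Longrightarrow> s j \<le> s i" "W = u * dg k s * tp v"
    "u * idn k = u" "v * idn k = v" "idn k * tp u = tp u" "idn k * tp v = tp v"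
    "oproj (u * tp u)" "oproj (v * tp v)" "opb u 1" "opb v 1"
proof -
  show a: "blk n1 k u" "blk n2 k v" "tp u * u = idn k" "tp v * v = idn k"
    "\<And>i. i < k \<Longrightarrow> 0 \<le> s i" "\<And>i j. i \<le> j \<Longrightarrow> j < k \<Longrightarrow> s j \<le> s i" "W = u * dg k s * tp v"
    using assms by (auto simp: fsvd_def)
  show b: "u * idn k = u" "v * idn k = v" using a by (auto intro: blk_mult_idn)
  show "idn k * tp u = tp u" "idn k * tp v = tp v" using b by (metis tp_idn tp_mult)+
  show c: "oproj (u * tp u)" "oproj (v * tp v)" using a b by (auto intro: oproj_isometry)
  show "opb u 1" "opb v 1" using c by (auto intro: opb_factor)
qed

lemma fsvd_split:
  assumes W: "fsvd n1 n2 k W u s v" and r: "r \<le> k" and s: "0 \<le> t" "\<And>i. i < r \<Longrightarrow> t \<le> s i"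
    and h: "0 \<le> h" "\<And>i. r \<le> i \<Longrightarrow> i < k \<Longrightarrow> s i \<le> h"
  defines "X \<equiv> u * dg k (\<lambda>i. if i < r then s i else 0) * tp v"
  shows "spl W (u * idn r * tp (u * idn r)) (v * idn r * tp (v * idn r)) X t h"
proof -
  note w = fsvdD[OF W]
  have ii: "idn r * idn r = idn r" "idn r * idn k = idn r" "idn k * idn r = idn r" using r by (auto simp: idn_idn min_def)
  have iso: "tp (a * idn r) * (a * idn r) = idn r" if "tp a * a = idn k" for a
  proof -
    have "tp (a * idn r) * (a * idn r) = idn r * (tp a * a) * idn r" by (simp add: mult.assoc)
    then show ?thesis by (simp add: that ii)
  qed
  have isor: "(a * idn r) * idn r = a * idn r" for a by (simp add: mult.assoc ii)
  have half: "t * norm ((b * idn r * tp (b * idn r)) * B) \<le> norm (a * dg k (\<lambda>i. if i < r then s i else 0) * tp b * B)"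
    if a: "tp a * a = idn k" and b: "tp b * b = idn k" for a b B
  proof -
    have "norm ((b * idn r * tp (b * idn r)) * B) = norm (b * (idn r * (tp b * B)))"
    proof -
      have "(b * idn r * tp (b * idn r)) * B = b * ((idn r * idn r) * (tp b * B))" by (simp only: tp_mult tp_idn mult.assoc)
      then show ?thesis by (simp only: ii)
    qed
    also have "\<dots> = norm (idn r * (tp b * B))"
      by (rule norm_isometry[OF b]) (simp add: mult.assoc[symmetric] ii)
    finally have "t * norm ((b * idn r * tp (b * idn r)) * B) = norm (t *\<^sub>R (idn r * (tp b * B)))" using s by simp
    also have "\<dots> \<le> norm (dg k (\<lambda>i. if i < r then s i else 0) * (tp b * B))"
    proof (rule norm_mono_ent)
      fix i j
      show "\<bar>ent (t *\<^sub>R (idn r * (tp b * B))) i j\<bar> \<le> \<bar>ent (dg k (\<lambda>i. if i < r then s i else 0) * (tp b * B)) i j\<bar>"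
        using s(1) s(2)[of i] r by (auto simp: ent_idn_mult ent_dg_mult abs_mult intro!: mult_right_mono)
    qed
    also have "\<dots> = norm (a * (dg k (\<lambda>i. if i < r then s i else 0) * (tp b * B)))"
      by (rule norm_isometry[OF a, symmetric]) (auto intro!: idn_mult_eq simp: ent_dg_mult split: if_splits)
    finally show ?thesis by (simp add: mult.assoc)
  qed
  have tX: "tp X = v * dg k (\<lambda>i. if i < r then s i else 0) * tp u" by (simp add: X_def mult.assoc)
  have "u * idn r * tp (u * idn r) * W = X"
  proof -
    have "u * idn r * tp (u * idn r) * W = u * (idn r * idn r * (tp u * u) * dg k s) * tp v"
      by (simp add: w(7) mult.assoc)
    also have "idn r * idn r * (tp u * u) * dg k s = dg k (\<lambda>i. if i < r then s i else 0)"
      by (simp add: w(3) ii idn_dg)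
    finally show ?thesis by (simp add: X_def)
  qed
  moreover have "W * (v * idn r * tp (v * idn r)) = X"
  proof -
    have "W * (v * idn r * tp (v * idn r)) = u * (dg k s * ((tp v * v) * (idn r * idn r))) * tp v"
      by (simp add: w(7) mult.assoc)
    also have "dg k s * ((tp v * v) * (idn r * idn r)) = dg k (\<lambda>i. if i < r then s i else 0)"
      by (simp add: w(4) ii dg_idn)
    finally show ?thesis by (simp add: X_def)
  qed
  moreover have "opb (W - X) h"
    unfolding opb_def
  proof (intro conjI allI h)
    fix B
    have "(W - X) * B = u * (dg k (\<lambda>i. if i < r then 0 else s i) * (tp v * B))"
    proof -
      have "dg k s - dg k (\<lambda>i. if i < r then s i else 0) = dg k (\<lambda>i. if i < r then 0 else s i)"
        by (rule fmat_eqI) (auto simp: ent_dg)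
      then have "dg k s = dg k (\<lambda>i. if i < r then 0 else s i) + dg k (\<lambda>i. if i < r then s i else 0)"
        by (simp add: algebra_simps)
      then show ?thesis unfolding w(7) X_def
        by (simp only: distrib_left distrib_right add_diff_cancel_right' mult.assoc)
    qed
    then have "norm ((W - X) * B) \<le> norm (dg k (\<lambda>i. if i < r then 0 else s i) * (tp v * B))"
      using opbD[OF w(14)] by simp
    also have "\<dots> \<le> norm (h *\<^sub>R (tp v * B))"
    proof (rule norm_mono_ent)
      fix i j
      show "\<bar>ent (dg k (\<lambda>i. if i < r then 0 else s i) * (tp v * B)) i j\<bar> \<le> \<bar>ent (h *\<^sub>R (tp v * B)) i j\<bar>"
        using h(1) h(2)[of i] w(5)[of i] by (auto simp: ent_dg_mult abs_mult intro!: mult_right_mono)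
    qed
    also have "\<dots> = h * norm (tp v * B)" using h by simp
    also have "\<dots> \<le> h * norm B" using opbD[OF opb_tp[OF w(15)], of B] h by (simp add: mult_left_mono)
    finally show "norm ((W - X) * B) \<le> h * norm B" .
  qed
  ultimately show ?thesis
    unfolding spl_def using half[OF w(3,4)] half[OF w(4,3)]
      oproj_isometry[OF iso[OF w(3)] isor] oproj_isometry[OF iso[OF w(4)] isor]
    unfolding tX unfolding X_def by blast
qed

lemma exists_kernel_vector:
  assumes "m < n"
  obtains c where "c \<noteq> 0" "blk n 1 c" "\<And>i j. i < m \<Longrightarrow> ent (A * c) i j = 0"
proof -
  obtain d where d: "\<exists>i\<in>{..<n}. d i \<noteq> 0" "\<forall>e<m. (\<Sum>i<n. ent A e i * d i) = 0"
    using homogeneous_system[of "{..<n}" m "\<lambda>e i. ent A e i"] assms by auto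
  define c where "c = (\<Sum>i<n. d i *\<^sub>R eu i 0)"
  have ec: "ent c i j = (if i < n \<and> j = 0 then d i else 0)" for i j
  proof -
    have "ent c i j = (\<Sum>a<n. if a = i then (if j = 0 then d i else 0) else 0)"
      unfolding c_def ent_sum by (intro sum.cong refl) (auto simp: ent_eu)
    then show ?thesis by simp
  qed
  have b: "bnd (Suc n) (ent c)" by (auto simp: bnd_def ec)
  have "ent (A * c) i j = (if j = 0 then (\<Sum>a<n. ent A i a * d a) else 0)" for i j
    unfolding ent_times[OF disjI2[OF b]] by (simp add: ec)
  then have "ent (A * c) i j = 0" if "i < m" for i j using d(2) that by simp
  moreover have "c \<noteq> 0"
  proof
    assume "c = 0"
    obtain i where i: "i < n" "d i \<noteq> 0" using d(1) by auto
    then have "ent c i 0 = d i" by (simp add: ec)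
    then show False using \<open>c = 0\<close> i by simp
  qed
  moreover have "blk n 1 c" by (auto simp: blk_def ec)
  ultimately show ?thesis using that by blast
qed

lemma norm_dg_le:
  assumes "\<And>i. i < k \<Longrightarrow> (\<exists>j. ent c i j \<noteq> 0) \<Longrightarrow> \<bar>s i\<bar> \<le> t" "0 \<le> t"
  shows "norm (dg k s * c) \<le> t * norm c"
proof -
  have "norm (dg k s * c) \<le> norm (t *\<^sub>R c)"
  proof (rule norm_mono_ent)
    fix i j
    show "\<bar>ent (dg k s * c) i j\<bar> \<le> \<bar>ent (t *\<^sub>R c) i j\<bar>"
      using assms(1)[of i] assms(2) by (cases "ent c i j = 0") (auto simp: ent_dg_mult abs_mult intro!: mult_right_mono)
  qed
  then show ?thesis using assms by simp
qed

lemma norm_dg_ge: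
  assumes "\<And>i. (\<exists>j. ent c i j \<noteq> 0) \<Longrightarrow> i < k \<and> t \<le> s i" "0 \<le> t"
  shows "t * norm c \<le> norm (dg k s * c)"
proof -
  have "norm (t *\<^sub>R c) \<le> norm (dg k s * c)"
  proof (rule norm_mono_ent)
    fix i j
    show "\<bar>ent (t *\<^sub>R c) i j\<bar> \<le> \<bar>ent (dg k s * c) i j\<bar>"
    proof (cases "ent c i j = 0")
      case False
      then have "i < k" "t \<le> s i" using assms(1)[of i] by auto
      then show ?thesis using assms(2) by (simp add: ent_dg_mult abs_mult mult_right_mono)
    qed (simp add: ent_dg_mult)
  qed
  then show ?thesis using assms by simp
qed

text \<open>Weyl's inequality by a dimension count: among the combinations of the first \<open>i + 1\<close> right
  singular vectors of \<open>M\<close> there is one orthogonal to the first \<open>i\<close> right singular vectors of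
  \<open>M + H\<close>; on it \<open>M\<close> is at least \<open>sg\<close> and \<open>M + H\<close> at most \<open>s' i\<close>.\<close>

lemma weyl_lower:
  assumes M: "fsvd n1 n2 r M u s v" and W: "fsvd n1 n2 k (M + H) u' s' v'" and H: "opb H h"
    and sg: "\<And>i. i < r \<Longrightarrow> sg \<le> s i" "h < sg" and i: "i < r"
  shows "i < k \<and> sg - h \<le> s' i"
proof -
  note m = fsvdD[OF M] and w = fsvdD[OF W]
  have sg0: "0 < sg" using sg(2) opb_nonneg[OF H] by linarith
  obtain c where c: "c \<noteq> 0" "blk (Suc i) 1 c" "\<And>a b. a < i \<Longrightarrow> ent (tp v' * v * c) a b = 0"
    using exists_kernel_vector[of i "Suc i" "tp v' * v", OF lessI] by blast
  have ic: "idn r * c = c" using c(2) i by (intro idn_mult_eq) (force simp: blk_def)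
  define x where "x = v * c"
  have nx: "norm x = norm c" unfolding x_def by (rule norm_isometry[OF m(4) ic])
  have "sg * norm c \<le> norm (dg r s * c)"
    using c(2) i sg sg0 by (intro norm_dg_ge) (force simp: blk_def)+
  also have "\<dots> = norm (u * (dg r s * c))"
    by (rule norm_isometry[OF m(3), symmetric]) (auto intro!: idn_mult_eq simp: ent_dg_mult split: if_splits)
  also have "u * (dg r s * c) = M * x"
  proof -
    have "M * x = u * (dg r s * ((tp v * v) * c))" by (simp add: m(7) x_def mult.assoc)
    then show ?thesis by (simp only: m(4) ic)
  qed
  finally have Mx: "sg * norm c \<le> norm (M * x)" .
  define t where "t = (if i < k then s' i else 0)"
  have t0: "0 \<le> t" using w(5) by (simp add: t_def)
  have "norm ((M + H) * x) = norm (u' * (dg k s' * (tp v' * x)))" by (simp add: w(7) mult.assoc)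
  also have "\<dots> = norm (dg k s' * (tp v' * x))"
    by (rule norm_isometry[OF w(3)]) (auto intro!: idn_mult_eq simp: ent_dg_mult split: if_splits)
  also have "\<dots> \<le> t * norm (tp v' * x)"
  proof (rule norm_dg_le[OF _ t0])
    fix a assume a: "a < k" "\<exists>b. ent (tp v' * x) a b \<noteq> 0"
    have "tp v' * x = tp v' * v * c" by (simp add: x_def mult.assoc)
    then have "i \<le> a" using a(2) c(3) by (metis not_less)
    then show "\<bar>s' a\<bar> \<le> t" using a w(5)[of a] w(6)[of i a] by (auto simp: t_def)
  qed
  also have "\<dots> \<le> t * (1 * norm x)" using t0 opb_tp[OF w(15)] by (intro mult_left_mono opbD) auto
  finally have "norm ((M + H) * x) \<le> t * norm c" using nx by simp
  moreover have "norm (M * x) \<le> norm ((M + H) * x) + norm (H * x)"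
    using norm_triangle_ineq4[of "(M + H) * x" "H * x"] by (simp add: distrib_right)
  moreover have "norm (H * x) \<le> h * norm c" using opbD[OF H, of x] nx by simp
  ultimately have "sg * norm c \<le> (t + h) * norm c" using Mx by (simp add: distrib_right)
  then have "sg \<le> t + h" using c(1) by simp
  then show ?thesis using sg(2) by (auto simp: t_def split: if_splits)
qed

text \<open>Conversely, since \<open>i \<ge> r\<close>, some combination of the first \<open>i + 1\<close> right singular vectors of
  \<open>M + H\<close> is annihilated by \<open>M\<close>; on it \<open>M + H\<close> agrees with \<open>H\<close> and is at least \<open>s' i\<close>.\<close>

lemma weyl_upper:
  assumes M: "fsvd n1 n2 r M u s v" and W: "fsvd n1 n2 k (M + H) u' s' v'" and H: "opb H h"
    and i: "r \<le> i" "i < k"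
  shows "s' i \<le> h"
proof -
  note m = fsvdD[OF M] and w = fsvdD[OF W]
  obtain c where c: "c \<noteq> 0" "blk (Suc i) 1 c" "\<And>a b. a < r \<Longrightarrow> ent (tp v * v' * c) a b = 0"
    using exists_kernel_vector[of r "Suc i" "tp v * v'", OF le_imp_less_Suc[OF i(1)]] by blast
  have ic: "idn k * c = c" using c(2) i by (intro idn_mult_eq) (force simp: blk_def)
  define x where "x = v' * c"
  have nx: "norm x = norm c" unfolding x_def by (rule norm_isometry[OF w(4) ic])
  have vx: "tp v * x = 0"
  proof (rule fmat_eqI)
    fix a b
    have "blk r 1 (tp v * x)" unfolding x_def
      using m(2) w(2) c(2) ic by (metis blk_mult blk_tp ex_bnd blk_def i(2) less_le_trans nat_le_linear not_less_eq x_def ent_idn_mult)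
    then show "ent (tp v * x) a b = ent 0 a b"
      using c(3)[of a b] by (cases "a < r") (auto simp: blk_def x_def mult.assoc)
  qed
  have "s' i * norm c \<le> norm (dg k s' * c)"
  proof (rule norm_dg_ge)
    fix a assume "\<exists>b. ent c a b \<noteq> 0"
    then have "a \<le> i" using c(2) by (force simp: blk_def)
    then show "a < k \<and> s' i \<le> s' a" using i w(6) by auto
  qed (use w(5) i in auto)
  also have "\<dots> = norm (u' * (dg k s' * c))"
    by (rule norm_isometry[OF w(3), symmetric]) (auto intro!: idn_mult_eq simp: ent_dg_mult split: if_splits)
  also have "u' * (dg k s' * c) = (M + H) * x"
  proof -
    have "(M + H) * x = u' * (dg k s' * ((tp v' * v') * c))" by (simp add: w(7) x_def mult.assoc)
    then show ?thesis by (simp only: w(4) ic)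
  qed
  also have "(M + H) * x = H * x" using vx by (simp add: m(7) distrib_right mult.assoc)
  also have "norm \<dots> \<le> h * norm c" using opbD[OF H, of x] nx by simp
  finally show ?thesis using c(1) by simp
qed

text \<open>The truncation that the algorithm computes is a truncation in the sense of \<open>spl\<close>, whatever
  singular value decomposition was chosen.\<close>

lemma perturbed_split:
  assumes M: "fsvd n1 n2 r M u s v" and W: "fsvd n1 n2 k (M + H) u' s' v'" and H: "opb H h"
    and sg: "\<And>i. i < r \<Longrightarrow> sg \<le> s i" "h < sg"
  shows "spl (M + H) (u' * idn r * tp (u' * idn r)) (v' * idn r * tp (v' * idn r))
    (u' * dg k (\<lambda>i. if i < r then s' i else 0) * tp v') (sg - h) h"
proof (rule fsvd_split[OF W])
  show "r \<le> k" using weyl_lower[OF M W H sg] by (cases r) (auto simp: Suc_le_eq)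
qed (use sg opb_nonneg[OF H] weyl_lower[OF M W H sg] weyl_upper[OF M W H] in auto)

text \<open>Embedding of the matrices with dimensions into \<open>fmat\<close>; its inverse on matrices of a given
  size is \<open>mt\<close> below.\<close>

definition fm :: "real mat \<Rightarrow> fmat" where
  "fm A = Abs_fmat (\<lambda>i j. if i < dim_row A \<and> j < dim_col A then A $$ (i, j) else 0)"

lemma ent_fm: "ent (fm A) i j = (if i < dim_row A \<and> j < dim_col A then A $$ (i, j) else 0)"
proof -
  have "bnd (max (dim_row A) (dim_col A)) (\<lambda>i j. if i < dim_row A \<and> j < dim_col A then A $$ (i, j) else 0)"
    by (auto simp: bnd_def)
  then show ?thesis unfolding fm_def by (subst Abs_fmat_inverse) auto
qed

lemma blk_fm: "blk (dim_row A) (dim_col A) (fm A)" by (auto simp: blk_def ent_fm)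
lemma blk_fm': "A \<in> carrier_mat m n \<Longrightarrow> blk m n (fm A)" using blk_fm[of A] by auto

lemma fm_mult: "dim_col A = dim_row B \<Longrightarrow> fm (A * B) = fm A * fm B"
proof (rule fmat_eqI)
  fix i j assume d: "dim_col A = dim_row B"
  let ?n = "max (dim_row A) (dim_col A)"
  have b: "bnd ?n (ent (fm A))" by (rule blk_bnd[OF blk_fm]) auto
  have "ent (fm A * fm B) i j = (\<Sum>k<?n. ent (fm A) i k * ent (fm B) k j)" using b by (simp add: ent_times)
  also have "\<dots> = (\<Sum>k<dim_col A. ent (fm A) i k * ent (fm B) k j)"
    by (intro sum_lt_extend[symmetric]) (auto simp: ent_fm)
  also have "\<dots> = ent (fm (A * B)) i j"
    using d by (auto simp: ent_fm scalar_prod_def lessThan_atLeast0 intro!: sum.cong sum.neutral)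
  finally show "ent (fm (A * B)) i j = ent (fm A * fm B) i j" ..
qed

lemma fm_transpose: "fm (transpose_mat A) = tp (fm A)" by (rule fmat_eqI) (auto simp: ent_fm)
lemma fm_minus: "A \<in> carrier_mat m n \<Longrightarrow> B \<in> carrier_mat m n \<Longrightarrow> fm (A - B) = fm A - fm B"
  by (rule fmat_eqI) (auto simp: ent_fm)
lemma fm_one: "fm (1\<^sub>m k) = idn k" by (rule fmat_eqI) (auto simp: ent_fm ent_idn)
lemma fm_zero: "fm (0\<^sub>m m n) = 0" by (rule fmat_eqI) (auto simp: ent_fm)
lemma fm_diag: "fm (mat_diag k s) = dg k s" by (rule fmat_eqI) (auto simp: ent_fm ent_dg mat_diag_def)

lemma norm_fm: "norm (fm A) = frob_norm A"
proof -
  let ?n = "max (dim_row A) (dim_col A)"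
  have b: "bnd ?n (ent (fm A))" by (rule blk_bnd[OF blk_fm]) auto
  have "(norm (fm A))\<^sup>2 = (\<Sum>i<?n. \<Sum>j<?n. (ent (fm A) i j)\<^sup>2)" by (rule norm_sq_ent[OF b])
  also have "\<dots> = (\<Sum>i<?n. \<Sum>j<dim_col A. (ent (fm A) i j)\<^sup>2)"
    by (intro sum.cong refl sum_lt_extend[symmetric]) (auto simp: ent_fm)
  also have "\<dots> = (\<Sum>i<dim_row A. \<Sum>j<dim_col A. (ent (fm A) i j)\<^sup>2)"
    by (intro sum_lt_extend[symmetric]) (auto simp: ent_fm)
  also have "\<dots> = (\<Sum>i<dim_row A. \<Sum>j<dim_col A. (A $$ (i, j))\<^sup>2)"
    by (intro sum.cong refl) (auto simp: ent_fm)
  finally show ?thesis unfolding frob_norm_def by (metis norm_ge_zero real_sqrt_unique)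
qed

lemma fm_svd_product:
  assumes "U \<in> carrier_mat m k" "V \<in> carrier_mat n k"
  shows "fm (U * mat_diag k s * transpose_mat V) = fm U * dg k s * tp (fm V)"
proof -
  have d: "dim_row (mat_diag k s) = k" "dim_col (mat_diag k s) = k" by (simp_all add: mat_diag_def)
  show ?thesis using assms by (simp add: fm_mult d fm_diag fm_transpose)
qed

lemma is_svd_fsvd: "is_svd k A U s V \<Longrightarrow> fsvd (dim_row A) (dim_col A) k (fm A) (fm U) s (fm V)"
  unfolding is_svd_def fsvd_def
proof (elim conjE, intro conjI)
  assume a: "U \<in> carrier_mat (dim_row A) k" "V \<in> carrier_mat (dim_col A) k"
    "transpose_mat U * U = 1\<^sub>m k" "transpose_mat V * V = 1\<^sub>m k" "A = U * mat_diag k s * transpose_mat V"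
  show "blk (dim_row A) k (fm U)" "blk (dim_col A) k (fm V)" using a blk_fm' by blast+
  show "tp (fm U) * fm U = idn k" using a(1,3) by (metis fm_mult fm_one fm_transpose index_transpose_mat(3))
  show "tp (fm V) * fm V = idn k" using a(2,4) by (metis fm_mult fm_one fm_transpose index_transpose_mat(3))
  have "fm (U * mat_diag k s * transpose_mat V) = fm U * dg k s * tp (fm V)"
    by (rule fm_svd_product[OF a(1,2)])
  then show "fm A = fm U * dg k s * tp (fm V)" using a(5) by simp
qed auto

definition mt :: "nat \<Rightarrow> nat \<Rightarrow> fmat \<Rightarrow> real mat" where
  "mt m n F = Matrix.mat m n (\<lambda>(i, j). ent F i j)"
lemma mt_carrier [simp]: "mt m n F \<in> carrier_mat m n" "dim_row (mt m n F) = m" "dim_col (mt m n F) = n"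
  by (auto simp: mt_def)
lemma fm_mt: "blk m n F \<Longrightarrow> fm (mt m n F) = F"
  by (rule fmat_eqI) (auto simp: ent_fm mt_def blk_def)
lemma truncation_factors:
  assumes P: "svd_truncation r P" and A: "A \<in> carrier_mat n1 n2"
  shows "\<exists>k u s v. fsvd n1 n2 k (fm A) u s v \<and> fm (P A) = u * dg k (\<lambda>i. if i < r then s i else 0) * tp v
    \<and> P A \<in> carrier_mat n1 n2"
proof -
  obtain k U s V where s: "is_svd k A U s V"
    "P A = U * mat_diag k (\<lambda>i. if i < r then s i else 0) * transpose_mat V"
    using P unfolding svd_truncation_def is_truncated_svd_def by blast
  have U: "U \<in> carrier_mat n1 k" "V \<in> carrier_mat n2 k" using s(1) A by (auto simp: is_svd_def)
  have "fm (P A) = fm U * dg k (\<lambda>i. if i < r then s i else 0) * tp (fm V)"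
    unfolding s(2) by (rule fm_svd_product[OF U])
  moreover have "P A \<in> carrier_mat n1 n2" unfolding s(2) using U by (auto simp: mat_diag_def)
  ultimately show ?thesis using is_svd_fsvd[OF s(1)] A by auto
qed

text \<open>The factors of the truncation are chosen as functions of the matrix that is truncated. This
  matters for probability: a projection that is a function of the matrix is independent of
  everything that the matrix is independent of.\<close>

lemma exists_truncation_functions:
  assumes P: "svd_truncation r P" and M: "fsvd n1 n2 r M u s v" and sg: "\<And>i. i < r \<Longrightarrow> sg \<le> s i"
  shows "\<exists>Uf Vf. \<forall>F. blk n1 n2 F \<longrightarrow> blk n1 r (Uf F) \<and> blk n2 r (Vf F) \<and>
    oproj (Uf F * tp (Uf F)) \<and> oproj (Vf F * tp (Vf F)) \<and>
    Uf F * tp (Uf F) * Uf F = Uf F \<and> Vf F * tp (Vf F) * Vf F = Vf F \<and>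
    P (mt n1 n2 F) \<in> carrier_mat n1 n2 \<and>
    (\<forall>H h. F = M + H \<longrightarrow> opb H h \<longrightarrow> h < sg \<longrightarrow>
       spl F (Uf F * tp (Uf F)) (Vf F * tp (Vf F)) (fm (P (mt n1 n2 F))) (sg - h) h)"
proof -
  have "\<exists>U V. blk n1 n2 F \<longrightarrow> blk n1 r U \<and> blk n2 r V \<and> oproj (U * tp U) \<and> oproj (V * tp V) \<and>
    U * tp U * U = U \<and> V * tp V * V = V \<and>
    P (mt n1 n2 F) \<in> carrier_mat n1 n2 \<and>
    (\<forall>H h. F = M + H \<longrightarrow> opb H h \<longrightarrow> h < sg \<longrightarrow>
       spl F (U * tp U) (V * tp V) (fm (P (mt n1 n2 F))) (sg - h) h)" for F
  proof (cases "blk n1 n2 F")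
    case True
    obtain k u' s' v' where w: "fsvd n1 n2 k F u' s' v'"
      "fm (P (mt n1 n2 F)) = u' * dg k (\<lambda>i. if i < r then s' i else 0) * tp v'"
      "P (mt n1 n2 F) \<in> carrier_mat n1 n2"
      using truncation_factors[OF P mt_carrier(1), of n1 n2 F] fm_mt[OF True] by auto
    note d = fsvdD[OF w(1)]
    have b: "blk m r (a * idn r)" if "blk m k a" for a m
      using that by (auto simp: blk_def ent_mult_idn split: if_splits)
    have pr: "oproj (a * idn r * tp (a * idn r)) \<and> a * idn r * tp (a * idn r) * (a * idn r) = a * idn r"
      if a: "tp a * a = idn k" "a * idn k = a" for a
    proof -
      let ?V = "a * idn r" and ?I = "idn (min r k)"
      have "?V = a * idn k * idn r" by (simp add: a)
      also have "\<dots> = a * ?I" by (simp add: mult.assoc idn_idn min.commute)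
      finally have V: "?V = a * ?I" .
      have II: "?I * ?I = ?I" by (simp add: idn_idn)
      have VI: "?V * ?I = ?V" by (metis II V mult.assoc)
      have "tp ?V * ?V = ?I * (tp a * a) * ?I" unfolding V by (simp add: mult.assoc)
      also have "\<dots> = ?I" by (simp add: a idn_idn mult.assoc)
      finally have VV: "tp ?V * ?V = ?I" .
      have "?V * tp ?V * ?V = ?V" by (metis VV VI mult.assoc)
      then show ?thesis using oproj_isometry[OF VV VI] by simp
    qed
    show ?thesis
    proof (rule exI[of _ "u' * idn r"], rule exI[of _ "v' * idn r"], intro impI conjI allI)
      show "blk n1 r (u' * idn r)" "blk n2 r (v' * idn r)" using b d(1,2) by auto
      show "oproj (u' * idn r * tp (u' * idn r))" "oproj (v' * idn r * tp (v' * idn r))"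
        "u' * idn r * tp (u' * idn r) * (u' * idn r) = u' * idn r"
        "v' * idn r * tp (v' * idn r) * (v' * idn r) = v' * idn r"
        using pr[OF d(3,8)] pr[OF d(4,9)] by auto
      fix H h assume H: "F = M + H" "opb H h" "h < sg"
      then show "spl F (u' * idn r * tp (u' * idn r)) (v' * idn r * tp (v' * idn r)) (fm (P (mt n1 n2 F))) (sg - h) h"
        using perturbed_split[OF M, of k H u' s' v' h sg] w sg by simp
    qed (rule w(3))
  qed auto
  then show ?thesis by metis
qed

text \<open>If the last singular value vanishes, the remaining \<open>r - 1\<close> ones describe the column space,
  so any \<open>r\<close> distinct columns are linearly dependent.\<close>

lemma rank_less:
  assumes M: "M \<in> carrier_mat n1 n2" and u: "fsvd n1 n2 r (fm M) u s v" and r: "0 < r" "s (r - 1) = 0"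
  shows "vec_space.rank n1 M < r"
proof -
  interpret vec_space "TYPE(real)" n1 .
  note d = fsvdD[OF u]
  have colsM: "set (cols M) \<subseteq> carrier_vec n1" using cols_dim M by blast
  obtain S where S: "maximal S (\<lambda>T. T \<subseteq> set (cols M) \<and> lin_indpt T)"
    using maximal_exists[of "(\<lambda>T. T \<subseteq> set (cols M) \<and> lin_indpt T)" "card (set (cols M))" "{}"]
    by (meson List.finite_set card_mono empty_iff empty_subsetI finite_lin_indpt2 rev_finite_subset)
  have rk: "rank M = card S" by (rule rank_card_indpt[OF M S])
  have S1: "S \<subseteq> set (cols M)" "lin_indpt S" using S by (auto simp: maximal_def)
  have finS: "finite S" using S1(1) finite_subset by blast
  show ?thesis
  proof (rule ccontr)
    assume "\<not> vec_space.rank n1 M < r"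
    then have card: "r \<le> card S" using rk by simp
    obtain xs where xs: "set xs = S" "distinct xs" using finite_distinct_list[OF finS] by blast
    have len: "length xs = card S" using xs distinct_card by metis
    have "\<exists>j<n2. xs ! b = col M j" if "b < length xs" for b
      using that xs(1) S1(1) M by (metis carrier_matD(2) cols_length cols_nth in_set_conv_nth subsetD)
    then obtain jf where jf: "\<And>b. b < length xs \<Longrightarrow> jf b < n2 \<and> xs ! b = col M (jf b)" by metis
    have "r - 1 < card {..<length xs}" using card len r by simp
    then obtain c where c: "\<exists>b\<in>{..<length xs}. c b \<noteq> 0" "\<forall>e<r - 1. (\<Sum>b<length xs. ent v (jf b) e * c b) = 0"
      using homogeneous_system[of "{..<length xs}" "r - 1" "\<lambda>e b. ent v (jf b) e"] by auto
    let ?A = "mat_of_cols n1 xs" and ?c = "vec (length xs) c"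
    have cA: "cols ?A = xs" using xs(1) S1(1) colsM by (intro cols_mat_of_cols) auto
    have A: "?A \<in> carrier_mat n1 (length xs)" by simp
    have "?A *\<^sub>v ?c = 0\<^sub>v n1"
    proof (rule eq_vecI)
      fix i assume "i < dim_vec (0\<^sub>v n1)"
      then have i: "i < n1" by simp
      have Me: "M $$ (i, j) = (\<Sum>a<r. ent u i a * s a * ent v j a)" if "j < n2" for j
      proof -
        let ?m = "n1 + n2 + r"
        have b: "bnd ?m (ent u)" by (rule blk_bnd[OF d(1)]) auto
        have "M $$ (i, j) = ent (fm M) i j" using M i that by (simp add: ent_fm)
        also have "\<dots> = ent (u * (dg r s * tp v)) i j" by (subst d(7)) (simp add: mult.assoc)
        also have "\<dots> = (\<Sum>a<?m. ent u i a * (if a < r then s a * ent v j a else 0))"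
          using b by (auto simp: ent_times[of ?m] ent_dg_mult intro!: sum.cong)
        also have "\<dots> = (\<Sum>a<r. ent u i a * (if a < r then s a * ent v j a else 0))"
          by (intro sum_lt_extend[symmetric]) auto
        also have "\<dots> = (\<Sum>a<r. ent u i a * s a * ent v j a)" by (intro sum.cong refl) auto
        finally show ?thesis .
      qed
      have "(?A *\<^sub>v ?c) $ i = (\<Sum>b<length xs. (xs ! b) $ i * c b)"
        using i by (simp add: scalar_prod_def mat_of_cols_def lessThan_atLeast0)
      also have "\<dots> = (\<Sum>b<length xs. (\<Sum>a<r. ent u i a * s a * (ent v (jf b) a * c b)))"
        using jf M i by (intro sum.cong refl) (auto simp: Me sum_distrib_right mult.assoc)
      also have "\<dots> = (\<Sum>a<r. ent u i a * s a * (\<Sum>b<length xs. ent v (jf b) a * c b))"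
        by (subst sum.swap) (simp add: sum_distrib_left)
      also have "\<dots> = 0"
      proof (intro sum.neutral ballI)
        fix a assume a: "a \<in> {..<r}"
        show "ent u i a * s a * (\<Sum>b<length xs. ent v (jf b) a * c b) = 0"
          using c(2) r a by (cases "a = r - 1") auto
      qed
      finally show "(?A *\<^sub>v ?c) $ i = 0\<^sub>v n1 $ i" using i by simp
    qed simp
    moreover have "?c \<noteq> 0\<^sub>v (length xs)"
    proof
      assume "?c = 0\<^sub>v (length xs)"
      then have "c b = 0" if "b < length xs" for b using that by (metis index_vec index_zero_vec(1))
      then show False using c(1) by auto
    qed
    ultimately have "lin_dep (set (cols ?A))"
      using lin_depI[OF A, of ?c] xs(2) cA by simp
    then show False using S1(2) cA xs(1) by simp
  qed
qed

lemma opb_fsvd: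
  assumes "fsvd n1 n2 k W u s v" "0 \<le> t" "\<And>i. i < k \<Longrightarrow> s i \<le> t"
  shows "opb W t"
  unfolding opb_def
proof (intro conjI allI assms)
  fix B
  note d = fsvdD[OF assms(1)]
  have "norm (W * B) = norm (u * (dg k s * (tp v * B)))" by (simp add: d(7) mult.assoc)
  also have "\<dots> \<le> 1 * norm (dg k s * (tp v * B))" by (intro opbD d)
  also have "\<dots> \<le> t * norm (tp v * B)"
    using norm_dg_le[of k "tp v * B" s t] d(5) assms by simp
  also have "\<dots> \<le> t * (1 * norm B)" using opb_tp[OF d(15)] assms by (intro mult_left_mono opbD) auto
  finally show "norm (W * B) \<le> t * norm B" by simp
qed

lemma fsvd_full_split:
  assumes W: "fsvd n1 n2 r W u s v" and t: "0 \<le> t" "\<And>i. i < r \<Longrightarrow> t \<le> s i"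
  shows "spl W (u * tp u) (v * tp v) W t 0"
proof -
  note d = fsvdD[OF W]
  have "dg r (\<lambda>i. if i < r then s i else 0) = dg r s" by (rule fmat_eqI) (auto simp: ent_dg)
  then show ?thesis using fsvd_split[OF W order_refl t, of 0] d by simp
qed

lemma norm_isometry_proj: assumes "tp u * u = idn k" shows "norm (u * tp u) = sqrt (real k)"
proof -
  have "(norm (u * tp u))\<^sup>2 = inner u (u * (tp u * u))"
    by (simp add: power2_norm_eq_inner inner_mult_right mult.assoc)
  also have "\<dots> = inner (idn k) (idn k * idn k)" unfolding inner_mult_left' assms by (simp add: inner_commute idn_idn)
  also have "\<dots> = real k" by (simp add: idn_idn power2_norm_eq_inner[symmetric] norm_idn_sq)
  finally show ?thesis by (metis norm_ge_zero real_sqrt_unique)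
qed

lemma vec_l2_norm_row:
  assumes "i < dim_row U" shows "vec_l2_norm (Matrix.row U i) = norm (rw i (fm U))"
proof -
  let ?n = "max (dim_row U) (dim_col U)"
  have b: "bnd ?n (ent (fm U))" by (rule blk_bnd[OF blk_fm]) auto
  have "(norm (rw i (fm U)))\<^sup>2 = (\<Sum>j<?n. (ent (fm U) i j)\<^sup>2)" by (rule norm_rw_sq[OF b])
  also have "\<dots> = (\<Sum>j<dim_col U. (ent (fm U) i j)\<^sup>2)" by (intro sum_lt_extend[symmetric]) (auto simp: ent_fm)
  also have "\<dots> = scalar_prod (Matrix.row U i) (Matrix.row U i)"
    using assms by (simp add: scalar_prod_def ent_fm lessThan_atLeast0 power2_eq_square)
  finally show ?thesis unfolding vec_l2_norm_def by (metis norm_ge_zero real_sqrt_unique)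
qed

lemma vec_l2_norm_frob: "vec_l2_norm w = norm (fm (mat_of_cols (dim_vec w) [w]))"
proof -
  have "(frob_norm (mat_of_cols (dim_vec w) [w]))\<^sup>2 = scalar_prod w w"
    unfolding frob_norm_def
    by (subst real_sqrt_pow2) (auto intro!: sum_nonneg simp: mat_of_cols_def scalar_prod_def lessThan_atLeast0 power2_eq_square)
  then show ?thesis unfolding norm_fm vec_l2_norm_def
    by (metis frob_norm_def norm_fm norm_ge_zero real_sqrt_unique)
qed

lemma op_norm_ge:
  assumes A: "A \<in> carrier_mat n1 n2" and w: "w \<in> carrier_vec n2" "vec_l2_norm w \<le> 1"
  shows "vec_l2_norm (A *\<^sub>v w) \<le> op_norm A"
  unfolding op_norm_def
proof (rule cSUP_upper)
  show "w \<in> {w \<in> carrier_vec (dim_col A). vec_l2_norm w \<le> 1}" using A w by auto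
  show "bdd_above ((\<lambda>v. vec_l2_norm (A *\<^sub>v v)) ` {v \<in> carrier_vec (dim_col A). vec_l2_norm v \<le> 1})"
  proof (rule bdd_aboveI2)
    fix w assume w: "w \<in> {v \<in> carrier_vec (dim_col A). vec_l2_norm v \<le> 1}"
    have "mat_of_cols (dim_vec (A *\<^sub>v w)) [A *\<^sub>v w] = A * mat_of_cols (dim_vec w) [w]"
      using w by (intro eq_matI) (auto simp: mat_of_cols_def scalar_prod_def intro!: sum.cong)
    moreover have "fm (A * mat_of_cols (dim_vec w) [w]) = fm A * fm (mat_of_cols (dim_vec w) [w])"
      by (rule fm_mult) (use w in \<open>auto simp: mat_of_cols_def\<close>)
    ultimately have "vec_l2_norm (A *\<^sub>v w) = norm (fm A * fm (mat_of_cols (dim_vec w) [w]))"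
      unfolding vec_l2_norm_frob[of "A *\<^sub>v w"] by simp
    also have "\<dots> \<le> norm (fm A) * norm (fm (mat_of_cols (dim_vec w) [w]))" by (rule norm_mult_fmat)
    also have "\<dots> \<le> norm (fm A) * 1" using w by (intro mult_left_mono) (auto simp: vec_l2_norm_frob[symmetric])
    finally show "vec_l2_norm (A *\<^sub>v w) \<le> norm (fm A)" by simp
  qed
qed

text \<open>Evaluate at the first right singular vector.\<close>

lemma op_norm_ge_sigma:
  assumes A: "is_svd k A U s V" and k: "0 < k"
  shows "s 0 \<le> op_norm A"
proof -
  have U: "U \<in> carrier_mat (dim_row A) k" "V \<in> carrier_mat (dim_col A) k" using A by (auto simp: is_svd_def)
  note d = fsvdD[OF is_svd_fsvd[OF A]]
  let ?w = "col V 0"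
  have w: "?w \<in> carrier_vec (dim_col A)" using U by (intro carrier_vecI) auto
  have mw: "fm (mat_of_cols (dim_vec ?w) [?w]) = fm V * eu 0 0"
    using U k by (intro fmat_eqI) (auto simp: ent_fm ent_mult_eu mat_of_cols_def)
  have i0: "idn k * eu 0 0 = eu 0 0" using k by (intro idn_mult_eq) (auto simp: ent_eu split: if_splits)
  have "vec_l2_norm ?w = norm (fm V * eu 0 0)" unfolding vec_l2_norm_frob mw ..
  also have "\<dots> = 1" using norm_isometry[OF d(4) i0] by simp
  finally have n1: "vec_l2_norm ?w = 1" .
  have "mat_of_cols (dim_vec (A *\<^sub>v ?w)) [A *\<^sub>v ?w] = A * mat_of_cols (dim_vec ?w) [?w]"
    using w by (intro eq_matI) (auto simp: mat_of_cols_def scalar_prod_def intro!: sum.cong)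
  moreover have "fm (A * mat_of_cols (dim_vec ?w) [?w]) = fm A * fm (mat_of_cols (dim_vec ?w) [?w])"
    by (rule fm_mult) (use U in \<open>auto simp: mat_of_cols_def\<close>)
  ultimately have "vec_l2_norm (A *\<^sub>v ?w) = norm (fm A * (fm V * eu 0 0))"
    unfolding vec_l2_norm_frob[of "A *\<^sub>v ?w"] mw by simp
  also have "fm A * (fm V * eu 0 0) = fm U * (dg k s * ((tp (fm V) * fm V) * eu 0 0))"
    by (subst d(7)) (simp add: mult.assoc)
  also have "\<dots> = fm U * (dg k s * eu 0 0)" by (simp only: d(4) i0)
  also have "norm \<dots> = norm (dg k s * eu 0 0)"
    by (rule norm_isometry[OF d(3)]) (auto intro!: idn_mult_eq simp: ent_dg_mult split: if_splits)
  also have "dg k s * eu 0 0 = s 0 *\<^sub>R eu 0 0" using k by (intro fmat_eqI) (auto simp: ent_dg_mult ent_eu)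
  also have "norm \<dots> = s 0" using d(5)[OF k] by simp
  finally show ?thesis using op_norm_ge[of A "dim_row A" "dim_col A" ?w] w n1 by simp
qed

section \<open>One step of the iteration\<close>

definition rv :: "nat \<Rightarrow> nat \<Rightarrow> (nat \<Rightarrow> real) \<Rightarrow> fmat" where
  "rv n i f = (\<Sum>j<n. f j *\<^sub>R eu i j)"

lemma ent_rv: "ent (rv n i f) a j = (if a = i \<and> j < n then f j else 0)"
proof -
  have "ent (rv n i f) a j = (\<Sum>b<n. if b = j then (if a = i then f j else 0) else 0)"
    unfolding rv_def ent_sum by (intro sum.cong refl) (auto simp: ent_eu)
  then show ?thesis by simp
qed

lemma ent_rv_mult: "ent (rv n i f * A) a k = (if a = i then (\<Sum>j<n. f j * ent A j k) else 0)"
proof -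
  have "ent (rv n i f * A) a k = (\<Sum>j<n. if a = i then f j * ent A j k else 0)"
    unfolding rv_def sum_distrib_right ent_sum by (intro sum.cong refl) (simp add: ent_eu_mult)
  then show ?thesis by auto
qed

lemma norm_single_row_le:
  assumes "\<And>a k. a \<noteq> i \<Longrightarrow> ent A a k = 0" "\<And>k. k \<ge> r \<Longrightarrow> ent A i k = 0" "\<And>k. k < r \<Longrightarrow> \<bar>ent A i k\<bar> \<le> B" "0 \<le> B"
  shows "norm A \<le> sqrt (real r) * B"
proof -
  obtain n0 where n0: "bnd n0 (ent A)" using ex_bnd .
  define n where "n = max n0 r"
  have n: "bnd n (ent A)" "r \<le> n" using n0 by (auto simp: n_def intro: bnd_mono)
  have "A = rw i A" by (rule fmat_eqI) (auto simp: assms)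
  then have "(norm A)\<^sup>2 = (\<Sum>j<n. (ent A i j)\<^sup>2)" by (metis norm_rw_sq[OF n(1)])
  also have "\<dots> = (\<Sum>j<r. (ent A i j)\<^sup>2)" by (rule sum_lt_extend[symmetric]) (use n assms in auto)
  also have "\<dots> \<le> (\<Sum>j<r. B\<^sup>2)" by (intro sum_mono) (use assms(3,4) in \<open>auto simp: abs_le_square_iff[symmetric]\<close>)
  also have "\<dots> = (sqrt (real r) * B)\<^sup>2" by (simp add: power_mult_distrib)
  finally show ?thesis by (rule power2_le_imp_le) (simp add: assms)
qed

text \<open>Row \<open>i\<close> of \<open>D \<circ> E\<close> splits into three pieces: the centred contribution of the unseen entries,
  which Bernstein's inequality bounds by \<open>B\<close>; the mean of the unseen entries, with the small
  factor \<open>1 - c q\<close>; and the seen entries, where \<open>D = 1\<close>. The last piece is not random. It is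
  supported on columns on which \<open>Q0\<close> has little weight (\<open>gam\<close>), and \<open>Q\<close> is close to \<open>Q0\<close> in
  operator norm (\<open>bet\<close>).\<close>

lemma row_fresh_bound:
  fixes c q :: real and lab :: "nat \<Rightarrow> nat"
  assumes D: "\<And>j. j < n \<Longrightarrow> ent D i j = 1 - c * of_bool (lab j = t)" and E: "blk m n E"
    and V: "blk n r V" and Q: "oproj (V * tp V)"
    and B: "\<And>k. k < r \<Longrightarrow> \<bar>\<Sum>j<n. of_bool (lab j \<notin> {1..<t}) * (of_bool (lab j = t) - q) * (ent E i j * ent V j k)\<bar> \<le> B" "0 \<le> B"
    and gam: "(\<Sum>j\<in>{j\<in>{..<n}. lab j \<in> {1..<t}}. (norm (rw j Q0))\<^sup>2) \<le> gam\<^sup>2" "0 \<le> gam"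
    and bet: "\<And>z. norm (z * (V * tp V - Q0 * (V * tp V))) \<le> bet * norm z" "0 \<le> bet" and VV: "V * tp V * V = V"
  shows "norm (rw i (had D E) * (V * tp V)) \<le> \<bar>c\<bar> * (sqrt (real r) * B) + \<bar>1 - c * q\<bar> * norm (rw i E)
    + (gam + bet) * (if \<exists>j<n. lab j \<in> {1..<t} then norm (rw i E) else 0)"
proof -
  let ?Q = "V * tp V"
  define us where "us j = (of_bool (lab j \<notin> {1..<t}) :: real)" for j :: nat
  define sn where "sn j = (of_bool (lab j \<in> {1..<t}) :: real)" for j :: nat
  define f1 where "f1 j = us j * (of_bool (lab j = t) - q) * ent E i j" for j
  define f2 where "f2 j = us j * ent E i j" for j
  define f3 where "f3 j = sn j * ent E i j" for j
  have dec: "rw i (had D E) = (- c) *\<^sub>R rv n i f1 + (1 - c * q) *\<^sub>R rv n i f2 + rv n i f3"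
  proof (rule fmat_eqI)
    fix a j
    have "ent E i j = 0" if "\<not> j < n" using E that by (auto simp: blk_def)
    moreover have "of_bool (lab j = t) * sn j = 0" by (auto simp: sn_def)
    moreover have "us j = 1 - sn j" by (auto simp: us_def sn_def)
    ultimately show "ent (rw i (had D E)) a j = ent ((- c) *\<^sub>R rv n i f1 + (1 - c * q) *\<^sub>R rv n i f2 + rv n i f3) a j"
      by (auto simp: ent_rv f1_def f2_def f3_def D algebra_simps) (auto simp: sn_def)
  qed
  have n1: "norm (rv n i f1 * ?Q) \<le> sqrt (real r) * B"
  proof -
    have "norm (rv n i f1 * ?Q) = norm ((rv n i f1 * V) * tp V)" by (simp add: mult.assoc)
    also have "\<dots> \<le> norm (rv n i f1 * V) * 1" by (intro opbD2 opb_factor Q)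
    also have "norm (rv n i f1 * V) \<le> sqrt (real r) * B"
    proof (rule norm_single_row_le[of i _ r B, OF _ _ _ B(2)])
      show "ent (rv n i f1 * V) a k = 0" if "a \<noteq> i" for a k using that by (simp add: ent_rv_mult)
      show "ent (rv n i f1 * V) i k = 0" if "k \<ge> r" for k
      proof -
        have "ent V j k = 0" for j by (metis V blk_def not_less that)
        then show ?thesis by (simp add: ent_rv_mult)
      qed
      show "\<bar>ent (rv n i f1 * V) i k\<bar> \<le> B" if "k < r" for k
        using B(1)[OF that] by (simp add: ent_rv_mult f1_def us_def mult.assoc)
    qed
    finally show ?thesis by simp
  qed
  have le: "norm (rv n i f) \<le> norm (rw i E)" if "\<And>j. \<bar>f j\<bar> \<le> \<bar>ent E i j\<bar>" for f
    by (rule norm_mono_ent) (use that in \<open>auto simp: ent_rv\<close>)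
  have n2: "norm (rv n i f2 * ?Q) \<le> norm (rw i E)"
    by (rule order_trans[OF oproj_norm_le2[OF Q] le]) (auto simp: f2_def us_def)
  have n3: "norm (rv n i f3 * ?Q) \<le> (gam + bet) * (if \<exists>j<n. lab j \<in> {1..<t} then norm (rw i E) else 0)"
  proof (cases "\<exists>j<n. lab j \<in> {1..<t}")
    case False
    then have "rv n i f3 = 0" by (intro fmat_eqI) (auto simp: ent_rv f3_def sn_def)
    then show ?thesis using False gam(2) bet(2) by auto
  next
    case True
    define J where "J = dg n sn"
    have "rv n i f3 * J = rv n i f3"
    proof (rule fmat_eqI)
      fix a j
      have "ent (rv n i f3 * J) a j = (if a = i then (\<Sum>b<n. if b = j then f3 j * sn j else 0) else 0)"
        unfolding ent_rv_mult J_def by (intro if_cong refl sum.cong) (auto simp: ent_dg)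
      then show "ent (rv n i f3 * J) a j = ent (rv n i f3) a j"
        by (auto simp: ent_rv f3_def sn_def)
    qed
    then have eq: "rv n i f3 * ?Q = rv n i f3 * (J * Q0) * ?Q + rv n i f3 * (?Q - Q0 * ?Q)"
      by (simp add: right_diff_distrib mult.assoc[symmetric])
    have JQ: "norm (J * Q0) \<le> gam"
    proof -
      obtain m0 where m0: "bnd m0 (ent Q0)" using ex_bnd .
      define k where "k = max m0 n"
      have k: "bnd k (ent Q0)" "n \<le> k" using m0 by (auto simp: k_def intro: bnd_mono)
      have kJ: "bnd k (ent (J * Q0))" using k by (auto simp: bnd_def J_def ent_dg_mult)
      have "(norm (J * Q0))\<^sup>2 = (\<Sum>a<k. (norm (rw a (J * Q0)))\<^sup>2)" by (rule norm_sq_rows[OF kJ])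
      also have "\<dots> = (\<Sum>a<n. (norm (rw a (J * Q0)))\<^sup>2)"
      proof (rule sum_lt_extend[symmetric, OF k(2)])
        fix a assume "n \<le> a"
        then have "rw a (J * Q0) = 0" by (intro fmat_eqI) (auto simp: J_def ent_dg_mult)
        then show "(norm (rw a (J * Q0)))\<^sup>2 = 0" by simp
      qed
      also have "\<dots> = (\<Sum>a<n. if lab a \<in> {1..<t} then (norm (rw a Q0))\<^sup>2 else 0)"
      proof (intro sum.cong refl)
        fix a assume "a \<in> {..<n}"
        then have "rw a (J * Q0) = sn a *\<^sub>R rw a Q0" by (intro fmat_eqI) (auto simp: J_def ent_dg_mult)
        then show "(norm (rw a (J * Q0)))\<^sup>2 = (if lab a \<in> {1..<t} then (norm (rw a Q0))\<^sup>2 else 0)"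
          by (auto simp: sn_def)
      qed
      also have "\<dots> = (\<Sum>j\<in>{j\<in>{..<n}. lab j \<in> {1..<t}}. (norm (rw j Q0))\<^sup>2)"
        by (rule sum.inter_filter[symmetric]) simp
      also have "\<dots> \<le> gam\<^sup>2" by (rule gam)
      finally show ?thesis by (rule power2_le_imp_le) (rule gam)
    qed
    have "norm (rv n i f3 * ?Q) \<le> norm (rv n i f3 * (J * Q0) * ?Q) + norm (rv n i f3 * (?Q - Q0 * ?Q))"
      unfolding eq by (rule norm_triangle_ineq)
    also have "\<dots> \<le> norm (rv n i f3) * gam + bet * norm (rv n i f3)"
    proof (intro add_mono bet)
      have "norm (rv n i f3 * (J * Q0) * ?Q) \<le> norm (rv n i f3 * (J * Q0))" by (rule oproj_norm_le2[OF Q])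
      also have "\<dots> \<le> norm (rv n i f3) * norm (J * Q0)" by (rule norm_mult_fmat)
      also have "\<dots> \<le> norm (rv n i f3) * gam" using JQ by (simp add: mult_left_mono)
      finally show "norm (rv n i f3 * (J * Q0) * ?Q) \<le> norm (rv n i f3) * gam" .
    qed
    also have "\<dots> = (gam + bet) * norm (rv n i f3)" by (simp add: algebra_simps)
    also have "\<dots> \<le> (gam + bet) * norm (rw i E)"
      using gam bet by (intro mult_left_mono le) (auto simp: f3_def sn_def)
    finally show ?thesis using True by simp
  qed
  have "rw i (had D E) * ?Q = (- c) *\<^sub>R (rv n i f1 * ?Q) + (1 - c * q) *\<^sub>R (rv n i f2 * ?Q) + rv n i f3 * ?Q"
    unfolding dec by (simp only: distrib_right mult_scaleR_left)
  then have "norm (rw i (had D E) * ?Q) \<le> norm ((- c) *\<^sub>R (rv n i f1 * ?Q)) + norm ((1 - c * q) *\<^sub>R (rv n i f2 * ?Q)) + norm (rv n i f3 * ?Q)"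
    by (metis norm_triangle_ineq norm_triangle_mono order_refl)
  also have "\<dots> = \<bar>c\<bar> * norm (rv n i f1 * ?Q) + \<bar>1 - c * q\<bar> * norm (rv n i f2 * ?Q) + norm (rv n i f3 * ?Q)" by simp
  also have "\<dots> \<le> \<bar>c\<bar> * (sqrt (real r) * B) + \<bar>1 - c * q\<bar> * norm (rw i E)
    + (gam + bet) * (if \<exists>j<n. lab j \<in> {1..<t} then norm (rw i E) else 0)"
    by (intro add_mono mult_left_mono n1 n2 n3) auto
  finally show ?thesis .
qed

lemma sine_op:
  assumes M: "spl M P0 Q0 M sg 0" and W: "spl (M + H) P Q X s h'" and H: "opb H h" and s: "0 < s"
  shows "norm (z * (Q - Q0 * Q)) \<le> h / s * norm z"
proof -
  note m = splD[OF M] and w = splD[OF W]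
  let ?y = "tp z - Q0 * tp z"
  have My: "M * ?y = 0" by (simp add: right_diff_distrib mult.assoc[symmetric] m)
  have "s * norm (Q * ?y) \<le> norm (X * ?y)" by (rule w)
  also have "X * ?y = P * (H * ?y)"
    unfolding w(3)[symmetric] by (simp add: mult.assoc distrib_right My)
  also have "norm \<dots> \<le> norm (H * ?y)" by (intro oproj_norm_le w)
  also have "\<dots> \<le> h * norm ?y" by (intro opbD H)
  also have "\<dots> \<le> h * norm (tp z)" using opb_nonneg[OF H] by (intro mult_left_mono oproj_norm_compl_le m) auto
  finally have "s * norm (Q * ?y) \<le> h * norm z" by simp
  moreover have "norm (z * (Q - Q0 * Q)) = norm (Q * ?y)"
    using norm_tp[of "z * (Q - Q0 * Q)"] by (simp add: oproj_tp m w left_diff_distrib right_diff_distrib mult.assoc)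
  ultimately show ?thesis using s by (simp add: field_simps)
qed

definition Dm :: "nat \<Rightarrow> nat \<Rightarrow> real \<Rightarrow> (nat \<times> nat) set \<Rightarrow> fmat" where
  "Dm n1 n2 c O' = wmat n1 n2 (\<lambda>e. 1 - c * of_bool (e \<in> O'))"

lemma ent_Dm: "ent (Dm n1 n2 c O') i j = (if i < n1 \<and> j < n2 then 1 - c * of_bool ((i, j) \<in> O') else 0)"
  by (simp add: Dm_def ent_wmat)
lemma blk_Dm: "blk n1 n2 (Dm n1 n2 c O')" by (simp add: Dm_def blk_wmat)

lemma svp_iterate_carrier:
  assumes P: "\<And>A. A \<in> carrier_mat n1 n2 \<Longrightarrow> P A \<in> carrier_mat n1 n2" and Y: "Y \<in> carrier_mat n1 n2"
  shows "svp_iterate P Os Y t \<in> carrier_mat n1 n2"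
proof (induction t)
  case (Suc t)
  show ?case unfolding svp_iterate.simps Let_def
    by (intro P minus_carrier_mat smult_carrier_mat) (use Y in \<open>auto simp: proj_entries_def\<close>)
qed (use Y in auto)

text \<open>The parts are subsets of the observed set, so the iteration never reads an unobserved entry.\<close>

lemma svp_iterate_observed:
  assumes P: "\<And>A. A \<in> carrier_mat n1 n2 \<Longrightarrow> P A \<in> carrier_mat n1 n2" and M: "M \<in> carrier_mat n1 n2"
    and Os: "\<And>t. 1 \<le> t \<Longrightarrow> Os t \<subseteq> O'"
  shows "svp_iterate P Os (proj_entries O' M) t = svp_iterate P Os M t"
proof (induction t)
  case (Suc t)
  have c: "svp_iterate P Os M t \<in> carrier_mat n1 n2" by (rule svp_iterate_carrier[OF P M])
  have "proj_entries (Os (Suc t)) (svp_iterate P Os M t - proj_entries O' M) = proj_entries (Os (Suc t)) (svp_iterate P Os M t - M)"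
    using Os[of "Suc t"] c M by (intro eq_matI) (auto simp: proj_entries_def)
  then show ?case using Suc M by (simp add: Let_def proj_entries_def)
qed (use M in \<open>simp add: proj_entries_def\<close>)

lemma fm_svp_step:
  assumes X: "X \<in> carrier_mat n1 n2" and M: "M \<in> carrier_mat n1 n2"
  shows "X - c \<cdot>\<^sub>m proj_entries O' (X - M) = mt n1 n2 (fm M + had (Dm n1 n2 c O') (fm X - fm M))"
  using X M by (intro eq_matI) (auto simp: mt_def ent_fm ent_Dm proj_entries_def algebra_simps)

lemma fm_svp_iterate_Suc:
  assumes P: "\<And>A. A \<in> carrier_mat n1 n2 \<Longrightarrow> P A \<in> carrier_mat n1 n2" and M: "M \<in> carrier_mat n1 n2"
  shows "fm (svp_iterate P Os M (Suc t)) = fm (P (mt n1 n2 (fm M +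
    had (Dm n1 n2 (real n1 * real n2 / real (card (Os (Suc t)))) (Os (Suc t))) (fm (svp_iterate P Os M t) - fm M))))"
proof -
  have c: "svp_iterate P Os M t \<in> carrier_mat n1 n2" by (rule svp_iterate_carrier[OF P M])
  have d: "dim_row M = n1" "dim_col M = n2" using M by auto
  show ?thesis unfolding svp_iterate.simps Let_def fm_svp_step[OF c M] d ..
qed

text \<open>Both maxima include \<open>0\<close>, so that they are defined for empty index ranges.\<close>

definition emax :: "nat \<Rightarrow> nat \<Rightarrow> fmat \<Rightarrow> real" where
  "emax n1 n2 E = Max (insert 0 ((\<lambda>(i, j). \<bar>ent E i j\<bar>) ` ({..<n1} \<times> {..<n2})))"
definition rmax :: "nat \<Rightarrow> fmat \<Rightarrow> real" where
  "rmax n Q = Max (insert 0 ((\<lambda>j. norm (rw j Q)) ` {..<n}))"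

lemma emax_nonneg: "0 \<le> emax n1 n2 E" unfolding emax_def by (intro Max_ge) auto
lemma emax_ge: "i < n1 \<Longrightarrow> j < n2 \<Longrightarrow> \<bar>ent E i j\<bar> \<le> emax n1 n2 E"
  unfolding emax_def by (intro Max_ge) auto
lemma emax_le: "0 \<le> x \<Longrightarrow> (\<And>i j. \<bar>ent E i j\<bar> \<le> x) \<Longrightarrow> emax n1 n2 E \<le> x"
  unfolding emax_def by (intro Max.boundedI) auto
lemma rmax_nonneg: "0 \<le> rmax n Q" unfolding rmax_def by (intro Max_ge) auto
lemma rmax_ge: "j < n \<Longrightarrow> norm (rw j Q) \<le> rmax n Q" unfolding rmax_def by (intro Max_ge) auto
lemma rmax_le: "0 \<le> x \<Longrightarrow> (\<And>j. norm (rw j Q) \<le> x) \<Longrightarrow> rmax n Q \<le> x"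
  unfolding rmax_def by (intro Max.boundedI) auto

text \<open>A matrix of rank \<open>r\<close> with incoherent factors, and a truncation with chosen factors. Here
  \<open>b1\<close> and \<open>b2\<close> bound the row norms of the singular vectors, and the singular values lie between
  \<open>sg\<close> and \<open>kap sg\<close>.\<close>

locale completion =
  fixes n1 n2 r :: nat and Mm :: "real mat" and u v :: fmat and s :: "nat \<Rightarrow> real"
    and sg kap b1 b2 :: real and P :: "real mat \<Rightarrow> real mat" and Uf Vf :: "fmat \<Rightarrow> fmat"
  assumes Mm: "Mm \<in> carrier_mat n1 n2" and svd: "fsvd n1 n2 r (fm Mm) u s v" and r: "0 < r"
    and sg: "0 < sg" "\<And>i. i < r \<Longrightarrow> sg \<le> s i" "\<And>i. i < r \<Longrightarrow> s i \<le> kap * sg" and kap: "1 \<le> kap"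
    and b: "0 < b1" "0 < b2" "\<And>i. norm (rw i u) \<le> b1" "\<And>j. norm (rw j v) \<le> b2"
    and Pc: "\<And>A. A \<in> carrier_mat n1 n2 \<Longrightarrow> P A \<in> carrier_mat n1 n2"
    and fn: "\<And>F. blk n1 n2 F \<Longrightarrow> blk n1 r (Uf F) \<and> blk n2 r (Vf F) \<and>
      oproj (Uf F * tp (Uf F)) \<and> oproj (Vf F * tp (Vf F)) \<and>
      Uf F * tp (Uf F) * Uf F = Uf F \<and> Vf F * tp (Vf F) * Vf F = Vf F"
    and trunc: "\<And>H h. blk n1 n2 H \<Longrightarrow> opb H h \<Longrightarrow> h < sg \<Longrightarrow>
       spl (fm Mm + H) (Uf (fm Mm + H) * tp (Uf (fm Mm + H))) (Vf (fm Mm + H) * tp (Vf (fm Mm + H)))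
         (fm (P (mt n1 n2 (fm Mm + H)))) (sg - h) h"
begin

definition M :: fmat where "M = fm Mm"
definition P0 :: fmat where "P0 = u * tp u"
definition Q0 :: fmat where "Q0 = v * tp v"
abbreviation Pf :: "fmat \<Rightarrow> fmat" where "Pf F \<equiv> Uf F * tp (Uf F)"
abbreviation Qf :: "fmat \<Rightarrow> fmat" where "Qf F \<equiv> Vf F * tp (Vf F)"

text \<open>A configuration is a labelling \<open>l\<close> of the entries; the entries with label \<open>t\<close> form the part
  used in step \<open>t\<close>. The factor \<open>c\<close> is an explicit argument of \<open>Dt\<close> and \<open>Ht\<close>: the true factor
  \<open>cc l t\<close> depends on all labels through the size of the part, and the leave-one-out argument
  needs a matrix that does not depend on the labels in row \<open>i\<close>. For each of the finitely many
  values of \<open>c\<close> it is one.\<close>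

definition parts :: "(nat \<times> nat \<Rightarrow> nat) \<Rightarrow> nat \<Rightarrow> (nat \<times> nat) set" where
  "parts l t = {e \<in> {..<n1} \<times> {..<n2}. l e = t}"
definition Xs :: "(nat \<times> nat \<Rightarrow> nat) \<Rightarrow> nat \<Rightarrow> fmat" where
  "Xs l t = fm (svp_iterate P (parts l) Mm t)"
definition cc :: "(nat \<times> nat \<Rightarrow> nat) \<Rightarrow> nat \<Rightarrow> real" where
  "cc l t = real n1 * real n2 / real (card (parts l t))"
definition Dt :: "real \<Rightarrow> (nat \<times> nat \<Rightarrow> nat) \<Rightarrow> nat \<Rightarrow> fmat" where
  "Dt c l t = Dm n1 n2 c (parts l t)"
definition Ht :: "real \<Rightarrow> (nat \<times> nat \<Rightarrow> nat) \<Rightarrow> nat \<Rightarrow> fmat" where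
  "Ht c l t = had (Dt c l t) (Xs l (t - 1) - M)"

text \<open>The conclusion of Bernstein's inequality for the unseen entries of row \<open>i\<close>, tested against
  the columns of the leave-one-out factor.\<close>

definition fresh_row :: "real \<Rightarrow> real \<Rightarrow> real \<Rightarrow> (nat \<times> nat \<Rightarrow> nat) \<Rightarrow> nat \<Rightarrow> nat \<Rightarrow> bool" where
  "fresh_row c q x l t i \<longleftrightarrow> (\<forall>k<r.
     \<bar>\<Sum>j<n2. of_bool (l (i, j) \<notin> {1..<t}) * (of_bool (l (i, j) = t) - q) *
        (ent (Xs l (t - 1) - M) i j * ent (Vf (M + (Ht c l t - rw i (Ht c l t)))) j k)\<bar>
     \<le> 2 * sqrt (q * (emax n1 n2 (Xs l (t - 1) - M))\<^sup>2 * x)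
       + 2 * (emax n1 n2 (Xs l (t - 1) - M) * rmax n2 (Qf (M + (Ht c l t - rw i (Ht c l t))))) * x)"

definition fresh_col :: "real \<Rightarrow> real \<Rightarrow> real \<Rightarrow> (nat \<times> nat \<Rightarrow> nat) \<Rightarrow> nat \<Rightarrow> nat \<Rightarrow> bool" where
  "fresh_col c q x l t j \<longleftrightarrow> (\<forall>k<r.
     \<bar>\<Sum>i<n1. of_bool (l (i, j) \<notin> {1..<t}) * (of_bool (l (i, j) = t) - q) *
        (ent (Xs l (t - 1) - M) i j * ent (Uf (M + (Ht c l t - cw j (Ht c l t)))) i k)\<bar>
     \<le> 2 * sqrt (q * (emax n1 n2 (Xs l (t - 1) - M))\<^sup>2 * x)
       + 2 * (emax n1 n2 (Xs l (t - 1) - M) * rmax n1 (Pf (M + (Ht c l t - cw j (Ht c l t))))) * x)"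

lemma blk_M: "blk n1 n2 M" unfolding M_def by (rule blk_fm'[OF Mm])

lemma Mspl: "spl M P0 Q0 M sg 0"
  unfolding M_def P0_def Q0_def by (rule fsvd_full_split[OF svd]) (use sg in auto)

lemma Mopb: "opb M (kap * sg)"
  unfolding M_def by (rule opb_fsvd[OF svd]) (use sg kap in auto)

lemma rows0: "norm (rw i P0) \<le> b1" "norm (rw j Q0) \<le> b2"
proof -
  note d = fsvdD[OF svd]
  have "norm (rw i P0) \<le> norm (rw i u) * 1" unfolding P0_def rw_mult using opb_tp[OF d(14)] by (rule opbD2)
  then show "norm (rw i P0) \<le> b1" using b(3)[of i] by simp
  have "norm (rw j Q0) \<le> norm (rw j v) * 1" unfolding Q0_def rw_mult using opb_tp[OF d(15)] by (rule opbD2)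
  then show "norm (rw j Q0) \<le> b2" using b(4)[of j] by simp
qed

lemma norm_P0_Q0: "norm P0 = sqrt (real r)" "norm Q0 = sqrt (real r)"
  unfolding P0_def Q0_def using fsvdD[OF svd] by (auto intro: norm_isometry_proj)

lemma Xs_0: "Xs l 0 = 0" using Mm by (simp add: Xs_def fm_zero)

lemma blk_Xs: "blk n1 n2 (Xs l t)"
  unfolding Xs_def by (rule blk_fm'[OF svp_iterate_carrier[OF Pc Mm]])

lemma Xs_Suc: "Xs l (Suc t) = fm (P (mt n1 n2 (M + Ht (cc l (Suc t)) l (Suc t))))"
  by (simp only: Xs_def fm_svp_iterate_Suc[OF Pc Mm] M_def Ht_def Dt_def cc_def diff_Suc_1)

lemma blk_Ht: "blk n1 n2 (Ht c l t)"
  unfolding Ht_def Dt_def by (intro blk_had1 blk_Dm)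

lemma trunc': "blk n1 n2 H \<Longrightarrow> opb H h \<Longrightarrow> h < sg \<Longrightarrow>
   spl (M + H) (Pf (M + H)) (Qf (M + H)) (fm (P (mt n1 n2 (M + H)))) (sg - h) h"
  unfolding M_def by (rule trunc)

lemma fn': assumes "blk n1 n2 H"
  shows "blk n1 r (Uf (M + H))" "blk n2 r (Vf (M + H))" "oproj (Pf (M + H))" "oproj (Qf (M + H))"
    "Pf (M + H) * Uf (M + H) = Uf (M + H)" "Qf (M + H) * Vf (M + H) = Vf (M + H)"
  using fn[OF blk_add[OF blk_M assms]] by auto

lemma step_split:
  assumes "opb (Ht (cc l (Suc t)) l (Suc t)) h" "h \<le> sg / 100"
  defines "W \<equiv> M + Ht (cc l (Suc t)) l (Suc t)"
  shows "spl W (Pf W) (Qf W) (Xs l (Suc t)) (sg - h) h"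
  unfolding W_def Xs_Suc by (rule trunc'[OF blk_Ht assms(1)]) (use assms(2) sg(1) in argo)

lemma step_error:
  assumes H: "opb (Ht (cc l (Suc t)) l (Suc t)) h" "h \<le> sg / 100"
  shows "norm (Xs l (Suc t) - M) \<le> 4 * (norm (Ht (cc l (Suc t)) l (Suc t) * Q0) + norm (P0 * Ht (cc l (Suc t)) l (Suc t)))"
  by (rule truncation_error[OF Mspl step_split[OF H] H(1)]) (use H(2) sg(1) opb_nonneg[OF H(1)] in argo)+

lemma abs_Dt_le:
  assumes q: "0 < q" "q \<le> 1" and c: "\<bar>c * q - 1\<bar> \<le> tau" "tau \<le> 1"
  shows "\<bar>ent (Dt c l t) i j\<bar> \<le> 2 / q" "0 \<le> c" "c \<le> 2 / q"
proof -
  have "0 \<le> c * q" "c * q \<le> 2" using c by auto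
  then show c': "0 \<le> c" "c \<le> 2 / q" using q by (auto simp: zero_le_mult_iff pos_le_divide_eq)
  have "1 \<le> 2 / q" using q by (simp add: pos_le_divide_eq)
  then have "0 \<le> 2 / q" by linarith
  moreover have "\<bar>1 - c\<bar> \<le> 2 / q" using c' \<open>1 \<le> 2 / q\<close> unfolding abs_le_iff by argo
  ultimately have "\<bar>1 - c\<bar> \<le> 2 / q" "0 \<le> 2 / q" by auto
  with \<open>1 \<le> 2 / q\<close> show "\<bar>ent (Dt c l t) i j\<bar> \<le> 2 / q" by (simp add: Dt_def ent_Dm)
qed

lemma sum_col_sq_le: assumes "opb V 1" shows "(\<Sum>j<n. (ent V j k)\<^sup>2) \<le> 1"
proof -
  obtain m0 where m0: "bnd m0 (ent V)" using ex_bnd .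
  define m where "m = max m0 n"
  have m: "bnd m (ent (tp V))" "n \<le> m" using m0 by (auto simp: m_def intro: bnd_mono)
  have "(\<Sum>j<n. (ent V j k)\<^sup>2) \<le> (\<Sum>j<m. (ent (tp V) k j)\<^sup>2)" using m by (auto intro!: sum_mono2)
  also have "\<dots> = (norm (rw k (tp V)))\<^sup>2" by (rule norm_rw_sq[OF m(1), symmetric])
  also have "\<dots> \<le> 1"
  proof -
    have "norm (eu k k * tp V) \<le> norm (eu k k) * 1" using opb_tp[OF assms] by (rule opbD2)
    then show ?thesis by (simp add: rw_def power_le_one)
  qed
  finally show ?thesis .
qed

text \<open>The distortion bound \<open>gram_le\<close> for an earlier step also says how much weight of a column of
  \<open>V\<close> lies on the entries of row \<open>i\<close> used in that step: at most a multiple of \<open>q\<close>. Summing over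
  the earlier steps and the \<open>r\<close> columns gives the bound, without another probabilistic event.\<close>

lemma seen_weight:
  fixes lab :: "nat \<Rightarrow> nat"
  assumes V: "opb V 1" "blk n r V" and q: "0 < q"
    and g: "\<And>tt. tt \<in> {1..<t} \<Longrightarrow> \<exists>c D. (\<forall>j<n. ent D i j = 1 - c * of_bool (lab j = tt)) \<and> gram_le n r D V g \<and> 1 / 2 \<le> c * q"
    and g1: "g \<le> 1" and t: "1 \<le> t"
  shows "(\<Sum>j\<in>{j\<in>{..<n}. lab j \<in> {1..<t}}. (norm (rw j V))\<^sup>2) \<le> 4 * ((real t - 1) * q * real r)"
proof -
  have rowV: "(norm (rw j V))\<^sup>2 = (\<Sum>k<r. (ent V j k)\<^sup>2)" for j
  proof -
    have m: "bnd (max n r) (ent V)" by (rule blk_bnd[OF V(2)]) auto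
    show ?thesis unfolding norm_rw_sq[OF m]
      by (rule sum_lt_extend[symmetric]) (use V(2) in \<open>auto simp: blk_def\<close>, metis not_less)
  qed
  have one: "(\<Sum>j<n. of_bool (lab j = tt) * (ent V j k)\<^sup>2) \<le> 4 * q" if tt: "tt \<in> {1..<t}" and k: "k < r" for tt k
  proof -
    obtain c D where cD: "\<And>j. j < n \<Longrightarrow> ent D i j = 1 - c * of_bool (lab j = tt)" "gram_le n r D V g" "1 / 2 \<le> c * q"
      using g[OF tt] by blast
    have "- g \<le> (\<Sum>j<n. ent D i j * (ent V j k * ent V j k))"
    proof -
      have "\<bar>\<Sum>j<n. ent D i j * (ent V j k * ent V j k)\<bar> \<le> g" using cD(2) k unfolding gram_le_def by blast
      then show ?thesis by (simp add: abs_le_iff)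
    qed
    also have "\<dots> = (\<Sum>j<n. (ent V j k)\<^sup>2) - c * (\<Sum>j<n. of_bool (lab j = tt) * (ent V j k)\<^sup>2)"
      unfolding sum_distrib_left sum_subtractf[symmetric]
      by (intro sum.cong refl) (auto simp: cD(1) power2_eq_square algebra_simps)
    finally have "c * (\<Sum>j<n. of_bool (lab j = tt) * (ent V j k)\<^sup>2) \<le> 2"
      using sum_col_sq_le[OF V(1), of k n] g1 by linarith
    then have "q * (c * (\<Sum>j<n. of_bool (lab j = tt) * (ent V j k)\<^sup>2)) \<le> q * 2" using q by (intro mult_left_mono) auto
    moreover have "1 / 2 * (\<Sum>j<n. of_bool (lab j = tt) * (ent V j k)\<^sup>2) \<le> (c * q) * (\<Sum>j<n. of_bool (lab j = tt) * (ent V j k)\<^sup>2)"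
      by (intro mult_right_mono cD(3) sum_nonneg) auto
    ultimately show ?thesis by (simp add: mult_ac)
  qed
  have "(\<Sum>j\<in>{j\<in>{..<n}. lab j \<in> {1..<t}}. (norm (rw j V))\<^sup>2) = (\<Sum>j<n. if lab j \<in> {1..<t} then (norm (rw j V))\<^sup>2 else 0)"
    by (rule sum.inter_filter) simp
  also have "\<dots> = (\<Sum>j<n. \<Sum>tt\<in>{1..<t}. if lab j = tt then (norm (rw j V))\<^sup>2 else 0)"
    by (intro sum.cong refl) simp
  also have "\<dots> = (\<Sum>j<n. \<Sum>tt\<in>{1..<t}. \<Sum>k<r. of_bool (lab j = tt) * (ent V j k)\<^sup>2)"
    unfolding rowV by (intro sum.cong refl) auto
  also have "\<dots> = (\<Sum>tt\<in>{1..<t}. \<Sum>j<n. \<Sum>k<r. of_bool (lab j = tt) * (ent V j k)\<^sup>2)" by (rule sum.swap)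
  also have "\<dots> = (\<Sum>tt\<in>{1..<t}. \<Sum>k<r. \<Sum>j<n. of_bool (lab j = tt) * (ent V j k)\<^sup>2)"
    by (intro sum.cong refl sum.swap)
  also have "\<dots> \<le> (\<Sum>tt\<in>{1..<t}. \<Sum>k<r. 4 * q)" by (intro sum_mono one) auto
  also have "\<dots> = 4 * ((real t - 1) * q * real r)" using t by (simp add: of_nat_diff)
  finally show ?thesis .
qed

text \<open>The square root in Bernstein's bound is absorbed by incoherence; the term with the maximal
  weight keeps the row norm \<open>v'\<close> of the leave-one-out projection, as \<open>row_step_half\<close> expects.\<close>

lemma fresh_num:
  fixes q x c qt em rm v' ep K sr :: real
  assumes q: "0 < q" and x: "0 \<le> x" and c: "\<bar>c\<bar> \<le> 2 / q" and qt: "0 \<le> qt" "qt \<le> 2 * q"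
    and em: "0 \<le> em" "em \<le> 5 * (kap' * sg' * b1' * b2')" and rm: "0 \<le> rm" "rm \<le> v'"
    and sr: "0 \<le> sr" and small: "sr * kap' * b2' * sqrt (x / q) \<le> ep / 60" and pos: "0 \<le> sg' * b1'"
  shows "\<bar>c\<bar> * (sr * (2 * sqrt (qt * em\<^sup>2 * x) + 2 * (em * rm) * x))
    \<le> ep / 2 * sg' * b1' + (20 * sr * (kap' * sg' * b1' * b2') * (x / q)) * v'"
proof -
  let ?e = "5 * (kap' * sg' * b1' * b2')" and ?y = "sqrt (x / q)"
  have e0: "0 \<le> ?e" using em by linarith
  have v0: "0 \<le> v'" using rm by linarith
  have "sqrt (qt * em\<^sup>2 * x) \<le> sqrt ((3 / 2 * (em * q * ?y))\<^sup>2)"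
  proof (rule real_sqrt_le_mono)
    have "qt * em\<^sup>2 * x \<le> 2 * q * em\<^sup>2 * x" using qt x by (intro mult_right_mono) auto
    also have "\<dots> \<le> 9 / 4 * q * em\<^sup>2 * x" using q x by (intro mult_right_mono) auto
    also have "\<dots> = (3 / 2 * (em * q * ?y))\<^sup>2"
      using q x by (simp add: power_mult_distrib) (simp add: power2_eq_square)
    finally show "qt * em\<^sup>2 * x \<le> (3 / 2 * (em * q * ?y))\<^sup>2" .
  qed
  also have "\<dots> = 3 / 2 * (em * q * ?y)" using em q x by (simp only: real_sqrt_abs) (simp add: abs_mult)
  finally have s: "sqrt (qt * em\<^sup>2 * x) \<le> 3 / 2 * (em * q * ?y)" .
  have "2 * sqrt (qt * em\<^sup>2 * x) + 2 * (em * rm) * x \<le> 3 * (?e * q * ?y) + 2 * (?e * v') * x"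
  proof (intro add_mono)
    have "em * q * ?y \<le> ?e * q * ?y" using em q x by (intro mult_right_mono) auto
    then show "2 * sqrt (qt * em\<^sup>2 * x) \<le> 3 * (?e * q * ?y)" using s by linarith
    show "2 * (em * rm) * x \<le> 2 * (?e * v') * x"
      using em rm x e0 by (intro mult_right_mono mult_left_mono mult_mono) auto
  qed
  then have "\<bar>c\<bar> * (sr * (2 * sqrt (qt * em\<^sup>2 * x) + 2 * (em * rm) * x)) \<le> (2 / q) * (sr * (3 * (?e * q * ?y) + 2 * (?e * v') * x))"
    using c sr q em rm x qt by (intro mult_mono mult_left_mono) (auto intro!: mult_nonneg_nonneg add_nonneg_nonneg)
  also have "\<dots> = 30 * (sr * kap' * b2' * ?y) * (sg' * b1') + (20 * sr * (kap' * sg' * b1' * b2') * (x / q)) * v'"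
    using q by (simp add: field_simps)
  also have "\<dots> \<le> 30 * (ep / 60) * (sg' * b1') + (20 * sr * (kap' * sg' * b1' * b2') * (x / q)) * v'"
    using small pos by (intro add_right_mono mult_right_mono mult_left_mono) auto
  finally show ?thesis by simp
qed

text \<open>In the first step the error is \<open>- M\<close>, whose rows need not be below \<open>sg b1 / 4\<close>. There no
  entry has been seen, and the factor \<open>1 - c q\<close> is at most \<open>tau\<close>; this is the first alternative in
  the assumption on row \<open>i\<close>.\<close>

lemma fresh_to_bound:
  fixes lab :: "nat \<Rightarrow> nat"
  assumes Mspl': "spl M' P0' Q0' M' sg 0" and W': "spl (M' + H') P' (V * tp V) X' s' h" and H': "opb H' h"
    and s': "sg / 2 \<le> s'" "h \<le> sg / 400"
    and D: "\<And>j. j < n \<Longrightarrow> ent D i j = 1 - c * of_bool (lab j = t)" and E: "blk m n E"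
    and V: "blk n r V" "oproj (V * tp V)" "V * tp V * V = V"
    and fresh: "\<And>k. k < r \<Longrightarrow> \<bar>\<Sum>j<n. of_bool (lab j \<notin> {1..<t}) * (of_bool (lab j = t) - qt) * (ent E i j * ent V j k)\<bar>
      \<le> 2 * sqrt (qt * em\<^sup>2 * x) + 2 * (em * rmax n (V * tp V)) * x"
    and q: "0 < q" "q \<le> 1" and qst: "(real t - 1) * q \<le> 1 / 1000000" "(real t - 1) * q * real r \<le> 1 / 1000000" "1 \<le> t"
    and qt: "qt = q / (1 - (real t - 1) * q)" and cq: "\<bar>c * q - 1\<bar> \<le> tau" "tau \<le> 1 / 1000"
    and em: "0 \<le> em" "em \<le> 5 * (kap * sg * b1' * b2')" and x: "0 \<le> x" and b': "0 < b1'"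
    and small: "sqrt (real r) * kap * b2' * sqrt (x / q) \<le> 1 / 6000"
    and v0: "Q0' = v' * tp v'" "opb v' 1" "blk n r v'"
    and gram: "\<And>tt. tt \<in> {1..<t} \<Longrightarrow> \<exists>c D. (\<forall>j<n. ent D i j = 1 - c * of_bool (lab j = tt)) \<and> gram_le n r D v' g \<and> 1 / 2 \<le> c * q"
    and g1: "g \<le> 1"
    and rowE: "(t = 1 \<and> tau * norm (rw i E) \<le> sg * b1' / 400) \<or> norm (rw i E) \<le> sg * b1' / 4"
    and vm: "\<And>j. norm (rw j (V * tp V)) \<le> vm"
  shows "norm (rw i (had D E) * (V * tp V)) \<le> 1 / 100 * sg * b1' + (20 * sqrt (real r) * (kap * sg * b1' * b2') * (x / q)) * vm"
proof -
  define st where "st = (real t - 1) * q"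
  have st: "0 \<le> st" "st \<le> 1 / 1000000" using qst q by (auto simp: st_def)
  have cnn: "0 \<le> c" "c \<le> 2 / q" using abs_Dt_le(2,3)[OF q cq(1)] cq(2) by auto
  have qt': "q \<le> qt" "qt \<le> 2 * q"
    unfolding qt st_def[symmetric] using st q by (auto simp: pos_le_divide_eq pos_divide_le_eq algebra_simps)
  have vm0: "0 \<le> vm" using vm[of 0] norm_ge_zero order_trans by blast
  have h0: "0 \<le> h" using H' by (rule opb_nonneg)
  let ?B = "2 * sqrt (qt * em\<^sup>2 * x) + 2 * (em * rmax n (V * tp V)) * x"
  have B0: "0 \<le> ?B" using em x qt' q rmax_nonneg[of n "V * tp V"] by (auto intro!: add_nonneg_nonneg mult_nonneg_nonneg)
  define gam :: real where "gam = 2 / 1000"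
  define bet :: real where "bet = 1 / 200"
  have s0: "0 < s'" using s' sg(1) by argo
  have "norm (rw i (had D E) * (V * tp V)) \<le> \<bar>c\<bar> * (sqrt (real r) * ?B) + \<bar>1 - c * qt\<bar> * norm (rw i E)
      + (gam + bet) * (if \<exists>j<n. lab j \<in> {1..<t} then norm (rw i E) else 0)"
  proof (rule row_fresh_bound[OF D E V(1,2) fresh B0 _ _ _ _ V(3)])
    have "(\<Sum>j\<in>{j\<in>{..<n}. lab j \<in> {1..<t}}. (norm (rw j Q0'))\<^sup>2) \<le> (\<Sum>j\<in>{j\<in>{..<n}. lab j \<in> {1..<t}}. (norm (rw j v'))\<^sup>2)"
    proof (intro sum_mono power_mono)
      fix j show "norm (rw j Q0') \<le> norm (rw j v')"
        using opbD2[OF opb_tp[OF v0(2)], of "rw j v'"] unfolding v0(1) rw_mult by simp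
    qed simp
    also have "\<dots> \<le> 4 * ((real t - 1) * q * real r)"
      by (rule seen_weight[OF v0(2,3) q(1) gram g1 qst(3)])
    also have "\<dots> \<le> gam\<^sup>2" using qst(2) by (simp add: gam_def power2_eq_square)
    finally show "(\<Sum>j\<in>{j\<in>{..<n}. lab j \<in> {1..<t}}. (norm (rw j Q0'))\<^sup>2) \<le> gam\<^sup>2" .
    show "norm (z * (V * tp V - Q0' * (V * tp V))) \<le> bet * norm z" for z
    proof -
      have "norm (z * (V * tp V - Q0' * (V * tp V))) \<le> h / s' * norm z" by (rule sine_op[OF Mspl' W' H' s0])
      also have "\<dots> \<le> bet * norm z"
      proof (rule mult_right_mono)
        have "h \<le> bet * s'" using s' unfolding bet_def by argo
        then show "h / s' \<le> bet" using s0 by (simp add: pos_divide_le_eq)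
      qed simp
      finally show ?thesis .
    qed
  qed (auto simp: gam_def bet_def)
  also have "\<dots> \<le> (1 / 100 / 2 * sg * b1' + (20 * sqrt (real r) * (kap * sg * b1' * b2') * (x / q)) * vm) + 1 / 200 * sg * b1'"
  proof -
    have "\<bar>c\<bar> * (sqrt (real r) * ?B) \<le> 1 / 100 / 2 * sg * b1' + (20 * sqrt (real r) * (kap * sg * b1' * b2') * (x / q)) * vm"
      using cnn qt' q b' sg small
      by (intro fresh_num[OF q(1) x _ _ _ em rmax_nonneg rmax_le[OF vm0 vm]]) (auto simp: mult.assoc)
    moreover have "\<bar>1 - c * qt\<bar> * norm (rw i E) + (gam + bet) * (if \<exists>j<n. lab j \<in> {1..<t} then norm (rw i E) else 0) \<le> 1 / 200 * sg * b1'"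
      using rowE
    proof (elim disjE conjE)
      assume t1: "t = 1" "tau * norm (rw i E) \<le> sg * b1' / 400"
      have "qt = q" using t1 by (simp add: qt)
      then have "\<bar>1 - c * qt\<bar> * norm (rw i E) \<le> tau * norm (rw i E)"
        using cq by (intro mult_right_mono) auto
      moreover have "(if \<exists>j<n. lab j \<in> {1..<t} then norm (rw i E) else 0) = 0" using t1 by simp
      moreover have "0 \<le> sg * b1'" using sg b' by simp
      ultimately show ?thesis using t1(2) by simp
    next
      assume e: "norm (rw i E) \<le> sg * b1' / 4"
      have "\<bar>1 - c * qt\<bar> \<le> 1 / 100"
      proof -
        have "1 - c * qt = ((1 - c * q) - st) / (1 - st)" using st unfolding qt st_def[symmetric] by (simp add: field_simps)
        then have "\<bar>1 - c * qt\<bar> = \<bar>(1 - c * q) - st\<bar> / (1 - st)" using st by (simp add: abs_divide)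
        also have "\<dots> \<le> (1 / 1000 + 1 / 1000000) / (1 - 1 / 1000000)"
        proof (rule frac_le)
          have "\<bar>(1 - c * q) - st\<bar> \<le> \<bar>1 - c * q\<bar> + \<bar>st\<bar>" by (rule abs_triangle_ineq4)
          then show "\<bar>(1 - c * q) - st\<bar> \<le> 1 / 1000 + 1 / 1000000"
            using cq st by (simp add: abs_minus_commute)
        qed (use st in auto)
        finally show ?thesis by simp
      qed
      then have "\<bar>1 - c * qt\<bar> * norm (rw i E) \<le> 1 / 100 * (sg * b1' / 4)"
        using e by (intro mult_mono) auto
      moreover have "(gam + bet) * (if \<exists>j<n. lab j \<in> {1..<t} then norm (rw i E) else 0) \<le> 1 / 100 * (sg * b1' / 4)"
        using e sg b' by (intro mult_mono) (auto simp: gam_def bet_def)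
      ultimately show ?thesis by simp
    qed
    ultimately show ?thesis by linarith
  qed
  also have "\<dots> = 1 / 100 * sg * b1' + (20 * sqrt (real r) * (kap * sg * b1' * b2') * (x / q)) * vm"
    by (simp add: field_simps)
  finally show ?thesis .
qed

end

section \<open>Linear convergence on the good event\<close>

context completion
begin

text \<open>The control of the fresh randomness is part of the event only as long as few entries have
  been seen; the constant is the one needed in \<open>fresh_to_bound\<close>.\<close>

definition good :: "real \<Rightarrow> real \<Rightarrow> real \<Rightarrow> real \<Rightarrow> real \<Rightarrow> (nat \<times> nat \<Rightarrow> nat) \<Rightarrow> nat \<Rightarrow> bool" where
  "good q g L tau x l t \<longleftrightarrow>
     \<bar>cc l t * q - 1\<bar> \<le> tau \<and> opb (Dt (cc l t) l t) L \<and>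
     gram_le n2 r (Dt (cc l t) l t) v g \<and> gram_le n1 r (tp (Dt (cc l t) l t)) u g \<and>
     ((real t - 1) * q * real r \<le> 1 / 1000000 \<longrightarrow>
       (\<forall>i<n1. fresh_row (cc l t) (q / (1 - (real t - 1) * q)) x l t i) \<and>
       (\<forall>j<n2. fresh_col (cc l t) (q / (1 - (real t - 1) * q)) x l t j))"

context
  fixes q g L tau x Th :: real and l :: "nat \<times> nat \<Rightarrow> nat"
  assumes q: "0 < q" "q \<le> 1" and g: "0 \<le> g" "real r * g \<le> 1 / 1000" and x: "0 \<le> x"
    and tau: "tau * kap \<le> 1 / 1000"
    and Th: "Th = L * kap * b1 * b2" "sqrt (real r) * real r * Th \<le> 1 / 10000000000"
    and small: "sqrt (real r) * kap * b1 * sqrt (x / q) \<le> 1 / 6000" "sqrt (real r) * kap * b2 * sqrt (x / q) \<le> 1 / 6000"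
begin

lemma r1: "1 \<le> real r" using r by simp

lemma tau_le: assumes "0 \<le> tau" shows "tau \<le> 1 / 1000"
proof -
  have "tau * 1 \<le> tau * kap" using assms kap by (intro mult_left_mono)
  then show ?thesis using tau by simp
qed

lemma g_le: "g \<le> 1 / 1000"
  using mult_right_mono[OF r1 g(1)] g(2) by simp

lemma Th_bounds:
  assumes "0 \<le> Th"
  shows "Th \<le> 1 / 10000000000" "sqrt (real r) * Th \<le> 1 / 10000000000"
proof -
  have s1: "1 \<le> sqrt (real r)" using r1 by simp
  have "sqrt (real r) * Th * 1 \<le> sqrt (real r) * Th * real r" using r1 assms by (intro mult_left_mono) auto
  then show 1: "sqrt (real r) * Th \<le> 1 / 10000000000" using Th(2) by (simp add: mult_ac)
  have "1 * Th \<le> sqrt (real r) * Th" using s1 assms by (intro mult_right_mono)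
  then show "Th \<le> 1 / 10000000000" using 1 by simp
qed

lemma four_sum: "a \<le> K * n \<Longrightarrow> b \<le> K * n \<Longrightarrow> 4 * (a + b) \<le> 8 * K * (n :: real)"
  by (simp add: mult.assoc)

lemma goodD:
  assumes "good q g L tau x l t"
  shows "\<bar>cc l t * q - 1\<bar> \<le> tau" "opb (Dt (cc l t) l t) L"
    "gram_le n2 r (Dt (cc l t) l t) v g" "gram_le n1 r (tp (Dt (cc l t) l t)) u g"
    "\<And>i. (real t - 1) * q * real r \<le> 1 / 1000000 \<Longrightarrow> i < n1 \<Longrightarrow> fresh_row (cc l t) (q / (1 - (real t - 1) * q)) x l t i"
    "\<And>j. (real t - 1) * q * real r \<le> 1 / 1000000 \<Longrightarrow> j < n2 \<Longrightarrow> fresh_col (cc l t) (q / (1 - (real t - 1) * q)) x l t j"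
    "0 \<le> tau" "0 \<le> Th"
proof -
  show a: "\<bar>cc l t * q - 1\<bar> \<le> tau" "opb (Dt (cc l t) l t) L"
    "gram_le n2 r (Dt (cc l t) l t) v g" "gram_le n1 r (tp (Dt (cc l t) l t)) u g"
    "\<And>i. (real t - 1) * q * real r \<le> 1 / 1000000 \<Longrightarrow> i < n1 \<Longrightarrow> fresh_row (cc l t) (q / (1 - (real t - 1) * q)) x l t i"
    "\<And>j. (real t - 1) * q * real r \<le> 1 / 1000000 \<Longrightarrow> j < n2 \<Longrightarrow> fresh_col (cc l t) (q / (1 - (real t - 1) * q)) x l t j"
    using assms unfolding good_def by blast+
  show "0 \<le> tau" using a(1) by linarith
  show "0 \<le> Th" using opb_nonneg[OF a(2)] kap b by (simp add: Th)
qed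

lemma cc_half: "good q g L tau x l t \<Longrightarrow> 1 / 2 \<le> cc l t * q"
  using goodD(1,7)[of t] tau_le by (auto simp: abs_le_iff)

text \<open>\<open>row_step\<close> with its assumptions verified: the leave-one-out bounds come from
  \<open>fresh_to_bound\<close>, with the earlier good events supplying the weight of the seen entries.\<close>

lemma rows_step:
  assumes G: "\<And>tt. tt \<in> {1..t} \<Longrightarrow> good q g L tau x l tt" and t: "1 \<le> t"
    and H: "opb (Ht (cc l t) l t) h" "h \<le> sg / 400"
    and em: "emax n1 n2 (Xs l (t - 1) - M) \<le> 5 * (kap * sg * b1 * b2)"
    and early: "(real t - 1) * q * real r \<le> 1 / 1000000"
    and rows: "\<And>i. (t = 1 \<and> tau * norm (rw i (Xs l (t - 1) - M)) \<le> sg * b1 / 400) \<or> norm (rw i (Xs l (t - 1) - M)) \<le> sg * b1 / 4"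
    and cols: "\<And>j. (t = 1 \<and> tau * norm (rw j (tp (Xs l (t - 1) - M))) \<le> sg * b2 / 400) \<or> norm (rw j (tp (Xs l (t - 1) - M))) \<le> sg * b2 / 4"
    and small_err: "norm (Xs l t - M) \<le> sg / 100"
  shows "norm (rw i (Xs l t - M)) \<le> sg * b1 / 4" and "norm (rw j (tp (Xs l t - M))) \<le> sg * b2 / 4"
proof -
  let ?c = "cc l t" and ?H = "Ht (cc l t) l t" and ?E = "Xs l (t - 1) - M"
  let ?qt = "q / (1 - (real t - 1) * q)" and ?phi = "20 * sqrt (real r) * (kap * sg * b1 * b2) * (x / q)"
  have Gt: "good q g L tau x l t" using G t by simp
  note gt = goodD[OF Gt]
  have tau1: "tau \<le> 1 / 1000" using tau_le gt(7) by simp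
  have tS: "Suc (t - 1) = t" using t by simp
  have h0: "0 \<le> h" using H(1) by (rule opb_nonneg)
  have bH: "blk n1 n2 ?H" by (rule blk_Ht)
  have bE: "blk n1 n2 ?E" by (intro blk_diff blk_Xs blk_M)
  note d = fsvdD[OF svd]
  have W: "spl (M + ?H) (Pf (M + ?H)) (Qf (M + ?H)) (Xs l t) (sg - h) h"
    using step_split[of l "t - 1" h] H sg(1) unfolding tS by (simp add: field_simps)
  have hs: "h < sg" "19 / 20 * sg \<le> sg - h" "h \<le> sg / 100" "sg / 2 \<le> sg - h" using H(2) sg(1) by argo+
  have st: "(real t - 1) * q \<le> 1 / 1000000"
  proof -
    have "(real t - 1) * q * 1 \<le> (real t - 1) * q * real r" using r1 t q by (intro mult_left_mono) auto
    then show ?thesis using early by simp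
  qed
  have r0: "0 \<le> ?phi" using kap sg(1) b x q by simp
  let ?y = "sqrt (x / q)"
  have y2: "?y\<^sup>2 = x / q" using x q by simp
  have y0: "0 \<le> ?y" using x q by simp
  have phib: "?phi * b \<le> 1 / 100 * sg * b'" if "b * b' = b1 * b2" "sqrt (real r) * kap * b * ?y \<le> 1 / 6000" "0 < b" "0 < b'" for b b'
  proof -
    have kb: "b * ?y \<le> 1 / 6000"
    proof -
      have "1 * 1 \<le> sqrt (real r) * kap" using r1 kap by (intro mult_mono) auto
      then have "1 * (b * ?y) \<le> (sqrt (real r) * kap) * (b * ?y)" using that y0 by (intro mult_right_mono) auto
      then show ?thesis using that(2) by (simp add: mult.assoc)
    qed
    have "?phi * b = 20 * (sqrt (real r) * kap * b * ?y) * (b * ?y) * sg * b'"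
    proof -
      have "20 * sr * (kap * sg * b1 * b2) * (Y * Y) * b = 20 * (sr * kap * b * Y) * (b * Y) * sg * b'" for sr Y
      proof -
        have "20 * sr * (kap * sg * b1 * b2) * (Y * Y) * b = 20 * sr * (kap * sg) * (Y * Y) * b * (b1 * b2)" by simp
        also have "\<dots> = 20 * sr * (kap * sg) * (Y * Y) * b * (b * b')" by (simp only: that(1))
        finally show ?thesis by simp
      qed
      moreover have "x / q = ?y * ?y" using x q by simp
      ultimately show ?thesis by metis
    qed
    also have "\<dots> \<le> 20 * (1 / 6000) * (1 / 6000) * sg * b'"
    proof -
      have "(sqrt (real r) * kap * b * ?y) * (b * ?y) \<le> (1 / 6000) * (1 / 6000)"
        using that(3) y0 by (intro mult_mono that(2) kb) simp_all
      then have "20 * ((sqrt (real r) * kap * b * ?y) * (b * ?y)) * (sg * b') \<le> 20 * ((1 / 6000) * (1 / 6000)) * (sg * b')"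
        using sg(1) that(4) by (intro mult_right_mono mult_left_mono) simp_all
      then show ?thesis by (simp only: mult.assoc)
    qed
    also have "\<dots> \<le> 1 / 100 * sg * b'" using sg(1) that by (intro mult_right_mono) auto
    finally show ?thesis .
  qed
  have phi1: "?phi * b2 \<le> 1 / 100 * sg * b1" by (rule phib) (use small b in \<open>auto simp: mult.commute\<close>)
  have phi2: "?phi * b1 \<le> 1 / 100 * sg * b2" by (rule phib) (use small b in auto)
  have em0: "0 \<le> emax n1 n2 ?E" by (rule emax_nonneg)
  have gi: "norm (rw i ?H * Qf (M + (?H - rw i ?H))) \<le> 1 / 100 * sg * b1 + ?phi * vm"
    if i: "i < n1" and vm: "\<And>j. norm (rw j (Qf (M + (?H - rw i ?H)))) \<le> vm" for i vm
  proof -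
    let ?H' = "?H - rw i ?H"
    have bH': "blk n1 n2 ?H'" by (intro blk_diff bH blk_rw)
    note f = fn'[OF bH']
    have W': "spl (M + ?H') (Pf (M + ?H')) (Qf (M + ?H')) (fm (P (mt n1 n2 (M + ?H')))) (sg - h) h"
      by (rule trunc'[OF bH' opb_diff_rw[OF H(1)] hs(1)])
    have "norm (rw i (had (Dt ?c l t) ?E) * Qf (M + ?H')) \<le> 1 / 100 * sg * b1 + (20 * sqrt (real r) * (kap * sg * b1 * b2) * (x / q)) * vm"
    proof (rule fresh_to_bound[where lab = "\<lambda>j. l (i, j)" and n = n2 and m = n1 and em = "emax n1 n2 ?E" and qt = ?qt and tau = tau and v' = v and g = g, OF Mspl W' opb_diff_rw[OF H(1)] hs(4) H(2)])
      show "ent (Dt ?c l t) i j = 1 - ?c * of_bool (l (i, j) = t)" if "j < n2" for j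
        using that i by (simp add: Dt_def ent_Dm parts_def)
      show "\<bar>\<Sum>j<n2. of_bool (l (i, j) \<notin> {1..<t}) * (of_bool (l (i, j) = t) - ?qt) * (ent ?E i j * ent (Vf (M + ?H')) j k)\<bar>
        \<le> 2 * sqrt (?qt * (emax n1 n2 ?E)\<^sup>2 * x) + 2 * (emax n1 n2 ?E * rmax n2 (Qf (M + ?H'))) * x" if "k < r" for k
        using gt(5)[OF early i] that unfolding fresh_row_def by blast
      show "\<exists>c D. (\<forall>j<n2. ent D i j = 1 - c * of_bool (l (i, j) = tt)) \<and> gram_le n2 r D v g \<and> 1 / 2 \<le> c * q" if "tt \<in> {1..<t}" for tt
      proof (intro exI conjI allI impI)
        have Gtt: "good q g L tau x l tt" using G that by simp
        show "ent (Dt (cc l tt) l tt) i j = 1 - cc l tt * of_bool (l (i, j) = tt)" if "j < n2" for j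
          using that i by (simp add: Dt_def ent_Dm parts_def)
        show "gram_le n2 r (Dt (cc l tt) l tt) v g" using goodD[OF Gtt] by blast
        show "1 / 2 \<le> cc l tt * q" using cc_half[OF Gtt] .
      qed
      show "Q0 = v * tp v" by (rule Q0_def)
      show "g \<le> 1" using g_le by simp
      show "blk n1 n2 ?E" by (rule bE)
      show "blk n2 r (Vf (M + ?H'))" "oproj (Qf (M + ?H'))" "Qf (M + ?H') * Vf (M + ?H') = Vf (M + ?H')" by (rule f)+
      show "0 < q" "q \<le> 1" by (rule q)+
      show "(real t - 1) * q \<le> 1 / 1000000" by (rule st)
      show "(real t - 1) * q * real r \<le> 1 / 1000000" by (rule early)
      show "1 \<le> t" by (rule t)
      show "?qt = ?qt" ..
      show "\<bar>?c * q - 1\<bar> \<le> tau" by (rule gt(1))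
      show "tau \<le> 1 / 1000" by (rule tau1)
      show "0 \<le> emax n1 n2 ?E" by (rule em0)
      show "emax n1 n2 ?E \<le> 5 * (kap * sg * b1 * b2)" by (rule em)
      show "0 \<le> x" by (rule x)
      show "0 < b1" by (rule b(1))
      show "sqrt (real r) * kap * b2 * sqrt (x / q) \<le> 1 / 6000" by (rule small(2))
      show "opb v 1" "blk n2 r v" by (rule d)+
      show "(t = 1 \<and> tau * norm (rw i ?E) \<le> sg * b1 / 400) \<or> norm (rw i ?E) \<le> sg * b1 / 4" by (rule rows)
    qed (rule vm)
    then show ?thesis by (simp add: Ht_def)
  qed
  have gj: "norm (rw j (tp ?H) * Pf (M + (?H - cw j ?H))) \<le> 1 / 100 * sg * b2 + ?phi * vm"
    if j: "j < n2" and vm: "\<And>i. norm (rw i (Pf (M + (?H - cw j ?H)))) \<le> vm" for j vm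
  proof -
    let ?H' = "?H - cw j ?H"
    have bH': "blk n1 n2 ?H'" by (intro blk_diff bH blk_cw)
    note f = fn'[OF bH']
    have oH': "opb (tp ?H') h" using opb_diff_rw[OF opb_tp[OF H(1)], of j] by (simp add: tp_cw)
    then have oH: "opb ?H' h" by (simp only: opb_tp_iff)
    have W': "spl (tp M + tp ?H') (Qf (M + ?H')) (Pf (M + ?H')) (tp (fm (P (mt n1 n2 (M + ?H'))))) (sg - h) h"
      using spl_tp[OF trunc'[OF bH' oH hs(1)]] by simp
    have "norm (rw j (had (tp (Dt ?c l t)) (tp ?E)) * Pf (M + ?H')) \<le> 1 / 100 * sg * b2 + (20 * sqrt (real r) * (kap * sg * b2 * b1) * (x / q)) * vm"
    proof (rule fresh_to_bound[where lab = "\<lambda>i. l (i, j)" and n = n1 and m = n2 and em = "emax n1 n2 ?E" and qt = ?qt and tau = tau and v' = u and g = g, OF spl_tp[OF Mspl] W' oH' hs(4) H(2)])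
      show "ent (tp (Dt ?c l t)) j i = 1 - ?c * of_bool (l (i, j) = t)" if "i < n1" for i
        using that j by (simp add: Dt_def ent_Dm parts_def)
      show "\<bar>\<Sum>i<n1. of_bool (l (i, j) \<notin> {1..<t}) * (of_bool (l (i, j) = t) - ?qt) * (ent (tp ?E) j i * ent (Uf (M + ?H')) i k)\<bar>
        \<le> 2 * sqrt (?qt * (emax n1 n2 ?E)\<^sup>2 * x) + 2 * (emax n1 n2 ?E * rmax n1 (Pf (M + ?H'))) * x" if "k < r" for k
        using gt(6)[OF early j] that unfolding fresh_col_def ent_tp by blast
      show "\<exists>c D. (\<forall>i<n1. ent D j i = 1 - c * of_bool (l (i, j) = tt)) \<and> gram_le n1 r D u g \<and> 1 / 2 \<le> c * q" if "tt \<in> {1..<t}" for tt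
      proof (intro exI conjI allI impI)
        have Gtt: "good q g L tau x l tt" using G that by simp
        show "ent (tp (Dt (cc l tt) l tt)) j i = 1 - cc l tt * of_bool (l (i, j) = tt)" if "i < n1" for i
          using that j by (simp add: Dt_def ent_Dm parts_def)
        show "gram_le n1 r (tp (Dt (cc l tt) l tt)) u g" using goodD[OF Gtt] by blast
        show "1 / 2 \<le> cc l tt * q" using cc_half[OF Gtt] .
      qed
      show "P0 = u * tp u" by (rule P0_def)
      show "g \<le> 1" using g_le by simp
      show "emax n1 n2 ?E \<le> 5 * (kap * sg * b2 * b1)" using em by (simp add: mult_ac)
      show "blk n2 n1 (tp ?E)" using bE by (simp only: blk_tp)
      show "blk n1 r (Uf (M + ?H'))" "oproj (Pf (M + ?H'))" "Pf (M + ?H') * Uf (M + ?H') = Uf (M + ?H')" by (rule f)+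
      show "0 < q" "q \<le> 1" by (rule q)+
      show "(real t - 1) * q \<le> 1 / 1000000" by (rule st)
      show "(real t - 1) * q * real r \<le> 1 / 1000000" by (rule early)
      show "1 \<le> t" by (rule t)
      show "?qt = ?qt" ..
      show "\<bar>?c * q - 1\<bar> \<le> tau" by (rule gt(1))
      show "tau \<le> 1 / 1000" by (rule tau1)
      show "0 \<le> emax n1 n2 ?E" by (rule em0)
      show "0 \<le> x" by (rule x)
      show "0 < b2" by (rule b(2))
      show "sqrt (real r) * kap * b1 * sqrt (x / q) \<le> 1 / 6000" by (rule small(1))
      show "opb u 1" "blk n1 r u" by (rule d)+
      show "(t = 1 \<and> tau * norm (rw j (tp ?E)) \<le> sg * b2 / 400) \<or> norm (rw j (tp ?E)) \<le> sg * b2 / 4" by (rule cols)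
    qed (rule vm)
    then show ?thesis by (simp add: Ht_def mult_ac)
  qed
  have Wi: "\<exists>P' X'. spl (M + (?H - rw i ?H)) P' (Qf (M + (?H - rw i ?H))) X' (sg - h) h" for i
    using trunc'[OF blk_diff[OF bH blk_rw[OF bH]] opb_diff_rw[OF H(1)] hs(1)] by blast
  have Wj: "\<exists>Q' X'. spl (M + (?H - cw j ?H)) (Pf (M + (?H - cw j ?H))) Q' X' (sg - h) h" for j
  proof -
    have "opb (tp (?H - cw j ?H)) h" using opb_diff_rw[OF opb_tp[OF H(1)], of j] by (simp add: tp_cw)
    then have "opb (?H - cw j ?H) h" by (simp only: opb_tp_iff)
    then show ?thesis using trunc'[OF blk_diff[OF bH blk_cw[OF bH]] _ hs(1)] by blast
  qed
  note rs = row_step[OF Mspl W H(1) bH Wi Wj hs(2) sg(1) hs(3) rows0 b(1,2) r0 phi1 phi2 _ _ gi gj]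
  have fac: "15 * (1 / 100) + 2 * h / sg \<le> 16 / 100" using H(2) sg(1) by (simp add: field_simps)
  have xi: "norm (rw i ?H * Qf (M + ?H)) \<le> 16 / 100 * sg * b1" for i
  proof -
    have "norm (rw i ?H * Qf (M + ?H)) \<le> (15 * (1 / 100) + 2 * h / sg) * sg * b1" by (rule rs(1)) simp_all
    also have "\<dots> \<le> 16 / 100 * sg * b1" using sg(1) b(1,2) by (intro mult_right_mono fac) simp_all
    finally show ?thesis .
  qed
  have yj: "norm (rw j (tp ?H) * Pf (M + ?H)) \<le> 16 / 100 * sg * b2" for j
  proof -
    have "norm (rw j (tp ?H) * Pf (M + ?H)) \<le> (15 * (1 / 100) + 2 * h / sg) * sg * b2" by (rule rs(2)) simp_all
    also have "\<dots> \<le> 16 / 100 * sg * b2" using sg(1) b(1,2) by (intro mult_right_mono fac) simp_all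
    finally show ?thesis .
  qed
  have "norm (rw i (Xs l t - M)) \<le> norm (rw i P0) * norm (Xs l t - M) + norm (rw i ?H * Qf (M + ?H))"
    by (rule truncation_error_row[OF Mspl W])
  also have "\<dots> \<le> b1 * (sg / 100) + 16 / 100 * sg * b1"
    using rows0 small_err xi b by (intro add_mono mult_mono) auto
  also have "\<dots> \<le> sg * b1 / 4"
  proof -
    have "0 \<le> sg * b1" using sg(1) b by simp
    then show ?thesis by (simp add: mult.commute[of b1])
  qed
  finally show "norm (rw i (Xs l t - M)) \<le> sg * b1 / 4" .
  have W2: "spl (tp M + tp ?H) (Qf (M + ?H)) (Pf (M + ?H)) (tp (Xs l t)) (sg - h) h" using spl_tp[OF W] by simp
  have "norm (rw j (tp (Xs l t) - tp M)) \<le> norm (rw j Q0) * norm (tp (Xs l t) - tp M) + norm (rw j (tp ?H) * Pf (M + ?H))"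
    by (rule truncation_error_row[OF spl_tp[OF Mspl] W2])
  also have "norm (tp (Xs l t) - tp M) = norm (Xs l t - M)" by (metis norm_tp tp_diff)
  also have "norm (rw j Q0) * norm (Xs l t - M) + norm (rw j (tp ?H) * Pf (M + ?H)) \<le> b2 * (sg / 100) + 16 / 100 * sg * b2"
    using rows0 small_err yj b by (intro add_mono mult_mono) auto
  also have "\<dots> \<le> sg * b2 / 4"
  proof -
    have "0 \<le> sg * b2" using sg(1) b by simp
    then show ?thesis by (simp add: mult.commute[of b2])
  qed
  finally show "norm (rw j (tp (Xs l t - M))) \<le> sg * b2 / 4" by simp
qed

text \<open>Since \<open>X\<^sub>0 = 0\<close>, the error is \<open>- M\<close>, to which Schur's bound applies directly. After this
  step the error is already a small multiple of the least singular value.\<close>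

lemma first_step:
  assumes G: "good q g L tau x l 1"
  shows "\<exists>W P Q s' h'. spl W P Q (Xs l 1) s' h' \<and> sg / 2 \<le> s'"
    and "norm (Xs l 1 - M) \<le> 8 * sqrt (real r) * Th * sg"
    and "norm (rw i (Xs l 1 - M)) \<le> sg * b1 / 4" and "norm (rw j (tp (Xs l 1 - M))) \<le> sg * b2 / 4"
proof -
  let ?H = "Ht (cc l 1) l 1"
  note gt = goodD[OF G]
  note m = splD[OF Mspl]
  have E0: "Xs l (1 - 1) - M = - M" by (simp add: Xs_0)
  have rM: "norm (rw i M) \<le> kap * sg * b1" for i by (rule row_M_le[OF Mspl Mopb rows0(1)])
  have rtM: "norm (rw j (tp M)) \<le> kap * sg * b2" for j
    by (rule row_M_le[OF spl_tp[OF Mspl] opb_tp[OF Mopb] rows0(2)])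
  have H: "opb ?H (Th * sg)"
  proof -
    have "opb (had (Dt (cc l 1) l 1) (M * tp Q0)) (L * (kap * sg * b1) * b2)"
      by (rule opb_had[OF gt(2) rM rows0(2)])
    then have "opb (had (Dt (cc l 1) l 1) M) (Th * sg)" by (simp add: oproj_tp m Th mult_ac)
    moreover have "?H = - had (Dt (cc l 1) l 1) M" unfolding Ht_def E0 by (rule fmat_eqI) simp
    ultimately show ?thesis by (simp add: opb_minus)
  qed
  have h: "Th * sg \<le> sg / 400" "Th * sg \<le> sg / 100"
    using mult_right_mono[OF Th_bounds(1)[OF gt(8)], of sg] sg(1) by argo+
  have H': "opb (Ht (cc l (Suc 0)) l (Suc 0)) (Th * sg)" using H by simp
  have W: "spl (M + ?H) (Pf (M + ?H)) (Qf (M + ?H)) (Xs l 1) (sg - Th * sg) (Th * sg)"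
    using step_split[OF H' h(2)] by simp
  have "sg / 2 \<le> sg - Th * sg" using h sg(1) by argo
  then show "\<exists>W P Q s' h'. spl W P Q (Xs l 1) s' h' \<and> sg / 2 \<le> s'" using W by blast
  have "norm (Xs l 1 - M) \<le> 4 * (norm (?H * Q0) + norm (P0 * ?H))" using step_error[OF H' h(2)] by simp
  also have "\<dots> \<le> 4 * (Th * sg * norm Q0 + norm P0 * (Th * sg))"
    by (intro mult_left_mono add_mono opbD opbD2 H) auto
  also have "\<dots> = 8 * sqrt (real r) * Th * sg" by (simp add: norm_P0_Q0)
  finally show err: "norm (Xs l 1 - M) \<le> 8 * sqrt (real r) * Th * sg" .
  also have "\<dots> = 8 * (sqrt (real r) * Th) * sg" by simp
  also have "\<dots> \<le> 8 * (1 / 10000000000) * sg"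
    using sg(1) by (intro mult_right_mono mult_left_mono Th_bounds gt(8)) auto
  also have "\<dots> \<le> sg / 100" using sg(1) by simp
  finally have small_err: "norm (Xs l 1 - M) \<le> sg / 100" .
  have em: "emax n1 n2 (Xs l (1 - 1) - M) \<le> 5 * (kap * sg * b1 * b2)"
  proof (rule emax_le)
    show "0 \<le> 5 * (kap * sg * b1 * b2)" using kap sg(1) b by simp
    fix i j
    have "\<bar>ent (M * Q0) i j\<bar> \<le> norm (rw i M) * norm (rw j Q0)"
    proof -
      have "ent (M * Q0) i j = ent (rw i M * (Q0 * eu j j)) i j"
        by (simp only: rw_mult[symmetric] mult.assoc[symmetric]) (simp add: ent_mult_eu)
      also have "\<bar>\<dots>\<bar> \<le> norm (rw i M * (Q0 * eu j j))" by (rule abs_ent_le)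
      also have "\<dots> \<le> norm (rw i M) * norm (Q0 * eu j j)" by (rule norm_mult_fmat)
      also have "norm (Q0 * eu j j) = norm (rw j Q0)" by (simp add: row_eq_col oproj_tp m)
      finally show ?thesis .
    qed
    also have "\<dots> \<le> kap * sg * b1 * b2" using kap sg(1) b by (intro mult_mono rM rows0) auto
    also have "\<dots> \<le> 5 * (kap * sg * b1 * b2)" using kap sg(1) b by simp
    finally show "\<bar>ent (Xs l (1 - 1) - M) i j\<bar> \<le> 5 * (kap * sg * b1 * b2)" unfolding E0 by (simp add: m)
  qed
  have tb: "tau * y \<le> sg * b' / 400" if "y \<le> kap * sg * b'" "0 < b'" for y b'
  proof -
    have "tau * y \<le> tau * (kap * sg * b')" using that gt(7) by (intro mult_left_mono)
    also have "\<dots> = (tau * kap) * (sg * b')" by simp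
    also have "\<dots> \<le> 1 / 1000 * (sg * b')" using tau sg(1) that by (intro mult_right_mono) auto
    also have "\<dots> \<le> sg * b' / 400" using sg(1) that by simp
    finally show ?thesis .
  qed
  have G': "\<And>tt. tt \<in> {1..1} \<Longrightarrow> good q g L tau x l tt" using G by simp
  have rowsE: "tau * norm (rw i (Xs l (1 - 1) - M)) \<le> sg * b1 / 400" for i
    unfolding E0 rw_minus norm_minus_cancel using b(1) by (rule tb[OF rM])
  have colsE: "tau * norm (rw j (tp (Xs l (1 - 1) - M))) \<le> sg * b2 / 400" for j
    unfolding E0 tp_minus rw_minus norm_minus_cancel using b(2) by (rule tb[OF rtM])
  show "norm (rw i (Xs l 1 - M)) \<le> sg * b1 / 4"
    by (rule rows_step(1)[OF G' _ H h(1) em _ _ _ small_err]) (use rowsE colsE in auto)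
  show "norm (rw j (tp (Xs l 1 - M))) \<le> sg * b2 / 4"
    by (rule rows_step(2)[OF G' _ H h(1) em _ _ _ small_err]) (use rowsE colsE in auto)
qed

lemma incoherent_step:
  assumes G: "\<And>tt. tt \<in> {1..Suc t} \<Longrightarrow> good q g L tau x l tt"
    and W: "spl W PW QW (Xs l t) s' h'" "sg / 2 \<le> s'" and err: "norm (Xs l t - M) \<le> sg / 100"
    and rows: "\<And>i. norm (rw i (Xs l t - M)) \<le> sg * b1 / 4" and cols: "\<And>j. norm (rw j (tp (Xs l t - M))) \<le> sg * b2 / 4"
  shows "\<exists>W P Q s' h'. spl W P Q (Xs l (Suc t)) s' h' \<and> sg / 2 \<le> s'"
    and "norm (Xs l (Suc t) - M) \<le> exp (- 1) * norm (Xs l t - M)"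
    and "(real (Suc t) - 1) * q * real r \<le> 1 / 1000000 \<Longrightarrow> norm (rw i (Xs l (Suc t) - M)) \<le> sg * b1 / 4"
    and "(real (Suc t) - 1) * q * real r \<le> 1 / 1000000 \<Longrightarrow> norm (rw j (tp (Xs l (Suc t) - M))) \<le> sg * b2 / 4"
proof -
  let ?c = "cc l (Suc t)" and ?X = "Xs l t"
  let ?H = "Ht ?c l (Suc t)" and ?D = "Dt ?c l (Suc t)"
  have Gt: "good q g L tau x l (Suc t)" using G by simp
  note gt = goodD[OF Gt]
  note m = splD[OF Mspl] and w = splD[OF W(1)]
  note d = fsvdD[OF svd]
  have Hd: "?H = had ?D (?X - M)" by (simp add: Ht_def)
  have s0: "0 < s'" using W(2) sg(1) by argo
  have rX: "norm (rw i ?X) \<le> 2 * kap * sg * b1" for i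
  proof -
    have "norm (rw i ?X) \<le> norm (rw i M) + norm (rw i (?X - M))"
      using norm_triangle_ineq[of "rw i M" "rw i (?X - M)"] by (simp add: rw_diff)
    also have "\<dots> \<le> kap * sg * b1 + sg * b1 / 4" by (intro add_mono rows row_M_le[OF Mspl Mopb rows0(1)])
    also have "\<dots> \<le> 2 * kap * sg * b1"
    proof -
      have "1 * (sg * b1) \<le> kap * (sg * b1)" using kap sg(1) b by (intro mult_right_mono) auto
      moreover have "0 \<le> sg * b1" using sg(1) b by simp
      ultimately have "kap * (sg * b1) + sg * b1 / 4 \<le> 2 * (kap * (sg * b1))" by argo
      then show ?thesis by (simp only: mult.assoc)
    qed
    finally show ?thesis .
  qed
  have rtX: "norm (rw j (tp ?X)) \<le> 2 * kap * sg * b2" for j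
  proof -
    have "norm (rw j (tp ?X)) \<le> norm (rw j (tp M)) + norm (rw j (tp (?X - M)))"
      using norm_triangle_ineq[of "rw j (tp M)" "rw j (tp (?X - M))"] by (simp add: rw_diff)
    also have "\<dots> \<le> kap * sg * b2 + sg * b2 / 4"
      by (intro add_mono cols row_M_le[OF spl_tp[OF Mspl] opb_tp[OF Mopb] rows0(2)])
    also have "\<dots> \<le> 2 * kap * sg * b2"
    proof -
      have "1 * (sg * b2) \<le> kap * (sg * b2)" using kap sg(1) b by (intro mult_right_mono) auto
      moreover have "0 \<le> sg * b2" using sg(1) b by simp
      ultimately have "kap * (sg * b2) + sg * b2 / 4 \<le> 2 * (kap * (sg * b2))" by argo
      then show ?thesis by (simp only: mult.assoc)
    qed
    finally show ?thesis .
  qed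
  have rQ: "norm (rw j QW) \<le> 2 * b2" for j
  proof (rule proj_rows_of_error[OF spl_tp[OF Mspl] spl_tp[OF W(1)] W(2) sg(1) rows0(2)])
    show "norm (rw j (tp ?X - tp M)) \<le> sg * b2 / 4" using cols[of j] by simp
    have "norm (tp ?X - tp M) = norm (?X - M)" by (metis norm_tp tp_diff)
    then show "norm (tp ?X - tp M) \<le> sg / 4" using err sg(1) by argo
  qed
  have lowQ: "sg / 2 * norm (QW * B) \<le> norm (?X * B)" for B
    using mult_right_mono[OF W(2), of "norm (QW * B)"] w(5)[of B] by simp
  have lowP: "sg / 2 * norm (PW * B) \<le> norm (tp ?X * B)" for B
    using mult_right_mono[OF W(2), of "norm (PW * B)"] w(6)[of B] by simp
  note oi = opb_had_incoherent[OF Mspl Mopb w(2,9) gt(2) rX rQ rows0]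
  have H: "opb ?H (5 * Th * sg)" using oi(1) by (simp add: Hd Th mult_ac)
  have h: "5 * Th * sg \<le> sg / 400" "5 * Th * sg \<le> sg / 100"
    using mult_right_mono[OF Th_bounds(1)[OF gt(8)], of sg] sg(1) by argo+
  have "sg / 2 \<le> sg - 5 * Th * sg" using h sg(1) by argo
  then show "\<exists>W P Q s' h'. spl W P Q (Xs l (Suc t)) s' h' \<and> sg / 2 \<le> s'" using step_split[OF H h(2)] by blast
  have f1: "norm (?H * Q0) \<le> (real r * g + 4 * Th) * norm (?X - M)"
    unfolding Hd Th
    by (rule contraction_incoherent[OF Mspl sg(1) d(2) Q0_def gt(3) g(1) w(2,9) lowQ gt(2) rX rows0(2)])
  have f2: "norm (P0 * ?H) \<le> (real r * g + 4 * Th) * norm (?X - M)"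
  proof -
    have "norm (had (tp ?D) (tp ?X - tp M) * P0) \<le> (real r * g + 4 * (L * kap * b2 * b1)) * norm (tp ?X - tp M)"
      by (rule contraction_incoherent[OF spl_tp[OF Mspl] sg(1) d(1) P0_def gt(4) g(1) w(1) _ lowP _ rtX rows0(1)])
        (use gt(2) arg_cong[OF w(8), of tp] in \<open>auto simp: oproj_tp w(1)\<close>)
    moreover have "norm (had (tp ?D) (tp ?X - tp M) * P0) = norm (P0 * ?H)"
      using norm_tp[of "P0 * ?H"] by (simp add: Hd oproj_tp m)
    moreover have "norm (tp ?X - tp M) = norm (?X - M)" by (metis norm_tp tp_diff)
    ultimately show ?thesis by (simp add: Th mult_ac)
  qed
  have "norm (Xs l (Suc t) - M) \<le> 4 * (norm (?H * Q0) + norm (P0 * ?H))" by (rule step_error[OF H h(2)])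
  also have "\<dots> \<le> 8 * (real r * g + 4 * Th) * norm (?X - M)" by (rule four_sum[OF f1 f2])
  also have "\<dots> \<le> 1 / 3 * norm (?X - M)"
    using g Th_bounds(1)[OF gt(8)] by (intro mult_right_mono) auto
  finally have e3: "norm (Xs l (Suc t) - M) \<le> 1 / 3 * norm (?X - M)" .
  have "1 / 3 \<le> exp (- 1 :: real)" using exp_le by (simp add: exp_minus field_simps)
  then have "1 / 3 * norm (?X - M) \<le> exp (- 1) * norm (?X - M)" by (intro mult_right_mono) auto
  then show "norm (Xs l (Suc t) - M) \<le> exp (- 1) * norm (Xs l t - M)" using e3 by linarith
  have small_err: "norm (Xs l (Suc t) - M) \<le> sg / 100" using e3 err norm_ge_zero[of "?X - M"] by linarith
  have em: "emax n1 n2 (Xs l (Suc t - 1) - M) \<le> 5 * (kap * sg * b1 * b2)"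
    using kap sg(1) b oi(2) by (intro emax_le) (auto simp: mult.assoc)
  assume early: "(real (Suc t) - 1) * q * real r \<le> 1 / 1000000"
  show "norm (rw i (Xs l (Suc t) - M)) \<le> sg * b1 / 4"
    by (rule rows_step(1)[OF G _ H h(1) em early _ _ small_err]) (use rows cols in auto)
  show "norm (rw j (tp (Xs l (Suc t) - M))) \<le> sg * b2 / 4"
    by (rule rows_step(2)[OF G _ H h(1) em early _ _ small_err]) (use rows cols in auto)
qed

text \<open>The entries of \<open>D\<close> are at most \<open>2 / q\<close>, so an error below \<open>q sg / 800\<close> makes the noise small
  in Frobenius norm and the quadratic term of \<open>contraction_close\<close> negligible.\<close>

lemma close_step:
  assumes G: "good q g L tau x l (Suc t)"
    and W: "spl W PW QW (Xs l t) s' h'" "sg / 2 \<le> s'" and err: "norm (Xs l t - M) \<le> q * sg / 800"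
  shows "\<exists>W P Q s' h'. spl W P Q (Xs l (Suc t)) s' h' \<and> sg / 2 \<le> s'"
    and "norm (Xs l (Suc t) - M) \<le> exp (- 1) * norm (Xs l t - M)"
proof -
  let ?c = "cc l (Suc t)" and ?X = "Xs l t"
  let ?H = "Ht ?c l (Suc t)" and ?D = "Dt ?c l (Suc t)"
  note gt = goodD[OF G]
  note m = splD[OF Mspl] and w = splD[OF W(1)]
  note d = fsvdD[OF svd]
  have tau1: "tau \<le> 1" using tau_le[OF gt(7)] by simp
  have Hd: "?H = had ?D (?X - M)" by (simp add: Ht_def)
  have Dle: "\<bar>ent ?D i j\<bar> \<le> 2 / q" for i j by (rule abs_Dt_le(1)[OF q gt(1) tau1])
  have q2: "0 \<le> 2 / q" using q by simp
  have "2 / q * norm (?X - M) \<le> 2 / q * (q * sg / 800)" using err q2 by (rule mult_left_mono)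
  then have e4: "2 / q * norm (?X - M) \<le> sg / 400" using q by simp
  have "norm ?H \<le> 2 / q * norm (?X - M)" unfolding Hd by (rule norm_had_le[OF q2 Dle])
  then have H: "opb ?H (sg / 400)" using e4 opb_mono[OF opb_norm] by (meson order_trans)
  have h: "sg / 400 \<le> sg / 100" "sg / 2 \<le> sg - sg / 400" using sg(1) by argo+
  show "\<exists>W P Q s' h'. spl W P Q (Xs l (Suc t)) s' h' \<and> sg / 2 \<le> s'" using step_split[OF H h(1)] h(2) by blast
  have lowQ: "sg / 2 * norm (QW * B) \<le> norm (?X * B)" for B
    using mult_right_mono[OF W(2), of "norm (QW * B)"] w(5)[of B] by simp
  have lowP: "sg / 2 * norm (PW * B) \<le> norm (tp ?X * B)" for B
    using mult_right_mono[OF W(2), of "norm (PW * B)"] w(6)[of B] by simp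
  have sm: "2 * (2 / q) * norm (?X - M) / sg \<le> 1 / 200"
  proof -
    have "2 * (2 / q * norm (?X - M)) \<le> 1 / 200 * sg" using e4 by argo
    then show ?thesis by (simp only: pos_divide_le_eq[OF sg(1)] mult.assoc)
  qed
  have f1: "norm (?H * Q0) \<le> (real r * g + 2 * Th + 2 * (2 / q) * norm (?X - M) / sg) * norm (?X - M)"
    unfolding Hd Th
    by (rule contraction_close[OF Mspl Mopb sg(1) d(2) Q0_def gt(3) g(1) w(2,9) lowQ gt(2) q2 Dle rows0])
  have f2: "norm (P0 * ?H) \<le> (real r * g + 2 * Th + 2 * (2 / q) * norm (?X - M) / sg) * norm (?X - M)"
  proof -
    have "norm (had (tp ?D) (tp ?X - tp M) * P0) \<le> (real r * g + 2 * (L * kap * b2 * b1) + 2 * (2 / q) * norm (tp ?X - tp M) / sg) * norm (tp ?X - tp M)"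
      by (rule contraction_close[OF spl_tp[OF Mspl] _ sg(1) d(1) P0_def gt(4) g(1) w(1) _ lowP _ q2 _ rows0(2,1)])
        (use Mopb gt(2) Dle arg_cong[OF w(8), of tp] in \<open>auto simp: oproj_tp w(1)\<close>)
    moreover have "norm (had (tp ?D) (tp ?X - tp M) * P0) = norm (P0 * ?H)"
      using norm_tp[of "P0 * ?H"] by (simp add: Hd oproj_tp m)
    moreover have "norm (tp ?X - tp M) = norm (?X - M)" by (metis norm_tp tp_diff)
    ultimately show ?thesis by (simp add: Th mult_ac)
  qed
  have "norm (Xs l (Suc t) - M) \<le> 4 * (norm (?H * Q0) + norm (P0 * ?H))" by (rule step_error[OF H h(1)])
  also have "\<dots> \<le> 8 * (real r * g + 2 * Th + 2 * (2 / q) * norm (?X - M) / sg) * norm (?X - M)"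
    by (rule four_sum[OF f1 f2])
  also have "\<dots> \<le> 1 / 3 * norm (?X - M)"
    using g Th_bounds(1)[OF gt(8)] sm by (intro mult_right_mono) auto
  finally have e3: "norm (Xs l (Suc t) - M) \<le> 1 / 3 * norm (?X - M)" .
  have "1 / 3 \<le> exp (- 1 :: real)" using exp_le by (simp add: exp_minus field_simps)
  then have "1 / 3 * norm (?X - M) \<le> exp (- 1) * norm (?X - M)" by (intro mult_right_mono) auto
  then show "norm (Xs l (Suc t) - M) \<le> exp (- 1) * norm (Xs l t - M)" using e3 by linarith
qed

text \<open>Incoherence is propagated while \<open>t q r \<le> 10\<^sup>-\<^sup>6\<close>. Later \<open>exp (- t) \<le> 1 / t \<le> 10\<^sup>6 q r\<close>, so
  the error is below the threshold of \<open>close_step\<close>.\<close>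

theorem linear_convergence:
  assumes G: "\<And>tt. tt \<in> {1..Suc t} \<Longrightarrow> good q g L tau x l tt"
  shows "norm (Xs l (Suc t) - M) \<le> exp (- real t) * (8 * sqrt (real r) * Th * sg)"
proof -
  let ?b = "8 * sqrt (real r) * Th * sg"
  have Th0: "0 \<le> Th" using goodD(8)[OF G[of 1]] by simp
  have b0: "0 \<le> ?b" using Th0 sg(1) by simp
  have bs: "?b \<le> sg / 100"
  proof -
    have "8 * (sqrt (real r) * Th) * sg \<le> 8 * (1 / 10000000000) * sg"
      using sg(1) by (intro mult_right_mono mult_left_mono Th_bounds Th0) auto
    also have "\<dots> \<le> sg / 100" using sg(1) by simp
    finally show ?thesis by (simp add: mult.assoc)
  qed
  have "(\<exists>W P Q s' h'. spl W P Q (Xs l (Suc t)) s' h' \<and> sg / 2 \<le> s') \<and>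
      norm (Xs l (Suc t) - M) \<le> exp (- real t) * ?b \<and>
      (real t * q * real r \<le> 1 / 1000000 \<longrightarrow>
        (\<forall>i. norm (rw i (Xs l (Suc t) - M)) \<le> sg * b1 / 4) \<and> (\<forall>j. norm (rw j (tp (Xs l (Suc t) - M))) \<le> sg * b2 / 4))"
    using G
  proof (induction t)
    case 0
    then have "good q g L tau x l 1" by simp
    from first_step[OF this] show ?case by simp
  next
    case (Suc t)
    have IH: "\<exists>W P Q s' h'. spl W P Q (Xs l (Suc t)) s' h' \<and> sg / 2 \<le> s'"
      "norm (Xs l (Suc t) - M) \<le> exp (- real t) * ?b"
      "real t * q * real r \<le> 1 / 1000000 \<Longrightarrow>
        (\<forall>i. norm (rw i (Xs l (Suc t) - M)) \<le> sg * b1 / 4) \<and> (\<forall>j. norm (rw j (tp (Xs l (Suc t) - M))) \<le> sg * b2 / 4)"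
      using Suc.IH Suc.prems by auto
    obtain W PW QW s' h' where W: "spl W PW QW (Xs l (Suc t)) s' h'" "sg / 2 \<le> s'" using IH(1) by blast
    have et: "exp (- 1) * (exp (- real t) * ?b) = exp (- real (Suc t)) * ?b"
      by (simp add: exp_add[symmetric] mult.assoc[symmetric] add.commute)
    show ?case
    proof (cases "real t * q * real r \<le> 1 / 1000000")
      case True
      have "exp (- real t) * ?b \<le> 1 * ?b" using b0 by (intro mult_right_mono) auto
      then have err: "norm (Xs l (Suc t) - M) \<le> sg / 100" using IH(2) bs by linarith
      have rc: "\<And>i. norm (rw i (Xs l (Suc t) - M)) \<le> sg * b1 / 4" "\<And>j. norm (rw j (tp (Xs l (Suc t) - M))) \<le> sg * b2 / 4"
        using IH(3)[OF True] by auto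
      note st = incoherent_step[OF Suc.prems W err rc]
      have "norm (Xs l (Suc (Suc t)) - M) \<le> exp (- 1) * (exp (- real t) * ?b)"
        by (rule order_trans[OF st(2)]) (use IH(2) in auto)
      then have "norm (Xs l (Suc (Suc t)) - M) \<le> exp (- real (Suc t)) * ?b" by (simp only: et)
      moreover have "real (Suc (Suc t)) - 1 = real (Suc t)" by simp
      ultimately show ?thesis using st(1) st(3,4) by auto
    next
      case False
      have t0: "0 < real t" using False by (cases t) auto
      have "exp (- real t) \<le> 1 / real t"
      proof -
        have "real t \<le> exp (real t)" using exp_ge_add_one_self[of "real t"] by linarith
        then show ?thesis using t0 by (simp add: exp_minus field_simps)
      qed
      also have "\<dots> \<le> 1000000 * q * real r" using False t0 by (simp add: field_simps)
      finally have "exp (- real t) * ?b \<le> 1000000 * q * real r * ?b" using b0 by (intro mult_right_mono)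
      also have "\<dots> = 8000000 * (sqrt (real r) * real r * Th) * (q * sg)" by simp
      also have "\<dots> \<le> 8000000 * (1 / 10000000000) * (q * sg)"
        using q sg(1) by (intro mult_right_mono mult_left_mono Th(2)) auto
      also have "\<dots> \<le> q * sg / 800" using q sg(1) by simp
      finally have err: "norm (Xs l (Suc t) - M) \<le> q * sg / 800" using IH(2) by linarith
      have Gt: "good q g L tau x l (Suc (Suc t))" using Suc.prems by simp
      note st = close_step[OF Gt W err]
      have "norm (Xs l (Suc (Suc t)) - M) \<le> exp (- 1) * (exp (- real t) * ?b)"
        by (rule order_trans[OF st(2)]) (use IH(2) in auto)
      then have "norm (Xs l (Suc (Suc t)) - M) \<le> exp (- real (Suc t)) * ?b" by (simp only: et)
      moreover have "\<not> real (Suc t) * q * real r \<le> 1 / 1000000"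
      proof -
        have "real t * (q * real r) \<le> real (Suc t) * (q * real r)" using q by (intro mult_right_mono) auto
        then show ?thesis using False by (simp only: mult.assoc)
      qed
      ultimately show ?thesis using st(1) by simp
    qed
  qed
  then show ?thesis by blast
qed

end

end

section \<open>Probability of the good event\<close>

text \<open>The law of the label of one entry: \<open>0\<close> if the entry is not sampled, and otherwise uniform
  among the \<open>N\<close> parts.\<close>

definition lab_pmf :: "real \<Rightarrow> nat \<Rightarrow> nat pmf" where
  "lab_pmf p N = bind_pmf (bernoulli_pmf p) (\<lambda>b. if b then pmf_of_set {1..N} else return_pmf 0)"

lemma finite_lab_pmf: "1 \<le> N \<Longrightarrow> finite (set_pmf (lab_pmf p N))"
  by (auto simp: lab_pmf_def split: if_splits)

lemma pmf_lab_pmf: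
  assumes "0 \<le> p" "p \<le> 1" "t \<in> {1..N}"
  shows "pmf (lab_pmf p N) t = p / real N"
proof -
  have N: "{1..N} \<noteq> {}" using assms by auto
  show ?thesis unfolding lab_pmf_def pmf_bind
    using assms N by (simp add: pmf_of_set indicator_def)
qed

lemma set_lab_pmf: assumes "0 < p" "p \<le> 1" "t \<in> {1..N}" shows "t \<in> set_pmf (lab_pmf p N)"
  using pmf_lab_pmf[of p t N] assms by (auto simp: set_pmf_iff)

lemma prob_lab_unseen:
  assumes p: "0 \<le> p" "p \<le> 1" and t: "t \<in> {1..N}"
  shows "measure_pmf.prob (lab_pmf p N) (- {1..<t}) = 1 - (real t - 1) * (p / real N)"
proof -
  have "measure_pmf.prob (lab_pmf p N) {1..<t} = (\<Sum>c\<in>{1..<t}. pmf (lab_pmf p N) c)"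
    by (rule measure_measure_pmf_finite) simp
  also have "\<dots> = (\<Sum>c\<in>{1..<t}. p / real N)" using t by (intro sum.cong refl pmf_lab_pmf p) auto
  also have "\<dots> = (real t - 1) * (p / real N)" using t by (simp add: of_nat_diff)
  finally have "measure_pmf.prob (lab_pmf p N) {1..<t} = (real t - 1) * (p / real N)" .
  then show ?thesis using measure_pmf.prob_compl[of "{1..<t}" "lab_pmf p N"] by (simp add: Compl_eq_Diff_UNIV)
qed

lemma map_lab_pmf:
  assumes "0 \<le> p" "p \<le> 1" "t \<in> {1..N}"
  shows "map_pmf (\<lambda>c. c = t) (lab_pmf p N) = bernoulli_pmf (p / real N)"
proof -
  have q: "0 \<le> p / real N" "p / real N \<le> 1" using assms by (auto simp: divide_le_eq)
  have T: "pmf (map_pmf (\<lambda>c. c = t) (lab_pmf p N)) True = p / real N"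
  proof -
    have "(\<lambda>c. c = t) -` {True} = {t}" by auto
    then show ?thesis using pmf_lab_pmf[OF assms] by (simp add: pmf_map measure_pmf_single)
  qed
  show ?thesis
  proof (rule pmf_eqI)
    fix v
    show "pmf (map_pmf (\<lambda>c. c = t) (lab_pmf p N)) v = pmf (bernoulli_pmf (p / real N)) v"
    proof (cases v)
      case True then show ?thesis using T q by simp
    next
      case False
      have "pmf (map_pmf (\<lambda>c. c = t) (lab_pmf p N)) False = 1 - pmf (map_pmf (\<lambda>c. c = t) (lab_pmf p N)) True"
        by (simp add: pmf_False_conv_True)
      then show ?thesis using T q False by simp
    qed
  qed
qed

lemma partition_law:
  assumes S: "finite S"
  shows "bind_pmf (random_subset S p) (\<lambda>Om. map_pmf (\<lambda>l. (Om, l)) (Pi_pmf Om 0 (\<lambda>_. pmf_of_set {1..N})))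
    = bind_pmf (Pi_pmf S False (\<lambda>_. bernoulli_pmf p)) (\<lambda>b. map_pmf (\<lambda>l. ({e \<in> S. b e}, l))
        (Pi_pmf S 0 (\<lambda>e. if b e then pmf_of_set {1..N} else return_pmf 0)))"
  unfolding random_subset_def bind_map_pmf by (simp add: Pi_pmf_if_set[OF S])

text \<open>Sampling the set and then partitioning it is the same as labelling the entries
  independently.\<close>

lemma label_law:
  assumes S: "finite S"
  shows "bind_pmf (Pi_pmf S False (\<lambda>_. bernoulli_pmf p)) (\<lambda>b. Pi_pmf S 0 (\<lambda>e. if b e then pmf_of_set {1..N} else return_pmf 0))
    = Pi_pmf S 0 (\<lambda>_. lab_pmf p N)"
  unfolding lab_pmf_def by (subst Pi_pmf_bind[OF S, where d' = False]) simp

lemma svp_iterate_cong: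
  assumes "\<And>t. 1 \<le> t \<Longrightarrow> t \<le> n \<Longrightarrow> Os t = Os' t"
  shows "svp_iterate P Os Y n = svp_iterate P Os' Y n"
  using assms by (induction n) simp_all

lemma svp_output_law:
  assumes M: "M \<in> carrier_mat n1 n2" and P: "\<And>A. A \<in> carrier_mat n1 n2 \<Longrightarrow> P A \<in> carrier_mat n1 n2" and N: "1 \<le> n"
  shows "bind_pmf (random_subset ({..<n1} \<times> {..<n2}) p) (\<lambda>Om. svp_output P n Om (proj_entries Om M)) =
     map_pmf (\<lambda>l. svp_iterate P (\<lambda>t. {e \<in> {..<n1} \<times> {..<n2}. l e = t}) M n) (Pi_pmf ({..<n1} \<times> {..<n2}) 0 (\<lambda>_. lab_pmf p n))"
proof -
  let ?S = "{..<n1} \<times> {..<n2}"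
  let ?F = "\<lambda>(Om, l). svp_iterate P (\<lambda>t. {e \<in> Om. l e = t}) (proj_entries Om M) n"
  have S: "finite ?S" by simp
  have ne: "{1..n} \<noteq> {}" "finite {1..n}" using N by auto
  have "bind_pmf (random_subset ?S p) (\<lambda>Om. svp_output P n Om (proj_entries Om M))
      = map_pmf ?F (bind_pmf (random_subset ?S p) (\<lambda>Om. map_pmf (\<lambda>l. (Om, l)) (Pi_pmf Om 0 (\<lambda>_. pmf_of_set {1..n}))))"
    by (simp add: svp_output_def random_partition_def map_bind_pmf map_pmf_comp o_def)
  also have "\<dots> = bind_pmf (Pi_pmf ?S False (\<lambda>_. bernoulli_pmf p)) (\<lambda>b. map_pmf (\<lambda>l. ?F ({e \<in> ?S. b e}, l))
        (Pi_pmf ?S 0 (\<lambda>e. if b e then pmf_of_set {1..n} else return_pmf 0)))"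
    by (subst partition_law[OF S]) (simp add: map_bind_pmf map_pmf_comp o_def)
  also have "\<dots> = bind_pmf (Pi_pmf ?S False (\<lambda>_. bernoulli_pmf p)) (\<lambda>b. map_pmf (\<lambda>l. svp_iterate P (\<lambda>t. {e \<in> ?S. l e = t}) M n)
        (Pi_pmf ?S 0 (\<lambda>e. if b e then pmf_of_set {1..n} else return_pmf 0)))"
  proof (intro bind_pmf_cong map_pmf_cong refl)
    fix b l assume "l \<in> set_pmf (Pi_pmf ?S 0 (\<lambda>e. if b e then pmf_of_set {1..n} else return_pmf 0))"
    then have "l \<in> PiE_dflt ?S 0 (\<lambda>e. set_pmf (if b e then pmf_of_set {1..n} else return_pmf 0))"
      unfolding set_Pi_pmf[OF S] o_def .
    then have l: "l e \<in> set_pmf (if b e then pmf_of_set {1..n} else return_pmf 0)" if "e \<in> ?S" for e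
      using that unfolding PiE_dflt_def mem_Collect_eq by presburger
    have eq: "{e \<in> {e \<in> ?S. b e}. l e = t} = {e \<in> ?S. l e = t}" if "1 \<le> t" for t
    proof -
      have "b e" if "e \<in> ?S" "l e = t" for e
        using l[OF that(1)] that(2) \<open>1 \<le> t\<close> by (auto split: if_splits)
      then show ?thesis by auto
    qed
    have "?F ({e \<in> ?S. b e}, l) = svp_iterate P (\<lambda>t. {e \<in> {e \<in> ?S. b e}. l e = t}) M n"
      unfolding prod.case by (rule svp_iterate_observed[OF P M]) auto
    also have "\<dots> = svp_iterate P (\<lambda>t. {e \<in> ?S. l e = t}) M n" by (rule svp_iterate_cong) (rule eq)
    finally show "?F ({e \<in> ?S. b e}, l) = svp_iterate P (\<lambda>t. {e \<in> ?S. l e = t}) M n" .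
  qed
  also have "\<dots> = map_pmf (\<lambda>l. svp_iterate P (\<lambda>t. {e \<in> ?S. l e = t}) M n) (Pi_pmf ?S 0 (\<lambda>_. lab_pmf p n))"
    by (simp add: label_law[OF S, symmetric] map_bind_pmf)
  finally show ?thesis .
qed

lemma prob_UN_le:
  assumes "finite I" "\<And>i. i \<in> I \<Longrightarrow> measure_pmf.prob D (A i) \<le> c"
  shows "measure_pmf.prob D (\<Union>i\<in>I. A i) \<le> real (card I) * c"
proof -
  have "measure_pmf.prob D (\<Union>i\<in>I. A i) \<le> (\<Sum>i\<in>I. measure_pmf.prob D (A i))"
    using assms(1) by (intro measure_pmf.finite_measure_subadditive_finite) auto
  also have "\<dots> \<le> (\<Sum>i\<in>I. c)" by (intro sum_mono assms)
  finally show ?thesis by simp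
qed

lemma expectation_card_random_subset:
  assumes S: "finite S" and p: "0 \<le> p" "p \<le> 1"
  shows "measure_pmf.expectation (random_subset S p) (\<lambda>Om. real (card Om)) = p * real (card S)"
proof -
  let ?D = "Pi_pmf S False (\<lambda>_. bernoulli_pmf p)"
  have fin: "finite (set_pmf ?D)" by (intro finite_set_Pi_pmf S) simp
  have "measure_pmf.expectation (random_subset S p) (\<lambda>Om. real (card Om)) = measure_pmf.expectation ?D (\<lambda>b. \<Sum>e\<in>S. of_bool (b e))"
    unfolding random_subset_def integral_map_pmf using S
    by (intro Bochner_Integration.integral_cong refl) (simp add: of_bool_def sum.If_cases Int_def)
  also have "\<dots> = (\<Sum>e\<in>S. measure_pmf.expectation ?D (\<lambda>b. of_bool (b e)))"
    by (rule Bochner_Integration.integral_sum) (rule integrable_measure_pmf_finite[OF fin])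
  also have "\<dots> = (\<Sum>e\<in>S. p)"
  proof (intro sum.cong refl)
    fix e assume e: "e \<in> S"
    have "measure_pmf.expectation ?D (\<lambda>b. of_bool (b e) :: real) = measure_pmf.expectation (map_pmf (\<lambda>b. b e) ?D) (of_bool :: bool \<Rightarrow> real)"
      by simp
    also have "map_pmf (\<lambda>b. b e) ?D = bernoulli_pmf p" using e S by (simp add: Pi_pmf_component)
    also have "measure_pmf.expectation (bernoulli_pmf p) (of_bool :: bool \<Rightarrow> real) = p" using p by simp
    finally show "measure_pmf.expectation ?D (\<lambda>b. of_bool (b e) :: real) = p" .
  qed
  finally show ?thesis by simp
qed

context completion
begin

context
  fixes p q x z :: real and N t :: nat
  assumes p: "0 < p" "p \<le> 1" and t: "t \<in> {1..N}" and q: "q = p / real N" and x: "1 \<le> x"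
begin

abbreviation "Lab \<equiv> Pi_pmf ({..<n1} \<times> {..<n2}) 0 (\<lambda>_. lab_pmf p N)"

lemma q01: "0 < q" "q \<le> 1"
  using p t by (auto simp: q divide_le_eq)

lemma indicator_law: "map_pmf (\<lambda>l e. l e = t) Lab = Pi_pmf ({..<n1} \<times> {..<n2}) False (\<lambda>_. bernoulli_pmf q)"
proof -
  have "Pi_pmf ({..<n1} \<times> {..<n2}) False (\<lambda>_. bernoulli_pmf q) = Pi_pmf ({..<n1} \<times> {..<n2}) False (\<lambda>_. map_pmf (\<lambda>c. c = t) (lab_pmf p N))"
    using map_lab_pmf[of p t N] p t q by simp
  also have "\<dots> = map_pmf (\<lambda>h. (\<lambda>c. c = t) \<circ> h) Lab"
    using t by (intro Pi_pmf_map) auto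
  finally show ?thesis by (simp add: o_def)
qed

lemma indicator_prob:
  "measure_pmf.prob Lab {l. Pr (\<lambda>e. l e = t)} = measure_pmf.prob (Pi_pmf ({..<n1} \<times> {..<n2}) False (\<lambda>_. bernoulli_pmf q)) {f. Pr f}"
  unfolding indicator_law[symmetric] by simp

lemma label_bernstein:
  assumes R: "R \<subseteq> {..<n1} \<times> {..<n2}" and w: "\<And>e. e \<in> R \<Longrightarrow> \<bar>w e\<bar> \<le> b" "(\<Sum>e\<in>R. (w e)\<^sup>2) \<le> S" "0 \<le> b"
  shows "measure_pmf.prob Lab {l. 2 * sqrt (q * S * x) + 2 * b * x < \<bar>\<Sum>e\<in>R. (of_bool (l e = t) - q) * w e\<bar>} \<le> 2 * exp (- x)"
proof -
  have finR: "finite R" using R finite_subset by blast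
  define B where "B = {f. 2 * sqrt (q * S * x) + 2 * b * x < \<bar>\<Sum>e\<in>R. (of_bool (f e) - q) * w e\<bar>}"
  have "Pi_pmf R False (\<lambda>_. bernoulli_pmf q) = map_pmf (\<lambda>f e. if e \<in> R then f e else False) (Pi_pmf ({..<n1} \<times> {..<n2}) False (\<lambda>_. bernoulli_pmf q))"
    by (rule Pi_pmf_subset) (use R in auto)
  then have eq: "Pi_pmf R False (\<lambda>_. bernoulli_pmf q) = map_pmf (\<lambda>l e. if e \<in> R then l e = t else False) Lab"
    by (simp add: indicator_law[symmetric] map_pmf_comp)
  have sum_eq: "(\<Sum>e\<in>R. (of_bool (l e = t) - q) * w e) = (\<Sum>e\<in>R. (of_bool (if e \<in> R then l e = t else False) - q) * w e)" for l
    by (intro sum.cong refl) auto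
  have "{l. 2 * sqrt (q * S * x) + 2 * b * x < \<bar>\<Sum>e\<in>R. (of_bool (l e = t) - q) * w e\<bar>}
      = (\<lambda>l e. if e \<in> R then l e = t else False) -` B"
    unfolding B_def vimage_def mem_Collect_eq sum_eq ..
  then have "measure_pmf.prob Lab {l. 2 * sqrt (q * S * x) + 2 * b * x < \<bar>\<Sum>e\<in>R. (of_bool (l e = t) - q) * w e\<bar>}
      = measure_pmf.prob Lab ((\<lambda>l e. if e \<in> R then l e = t else False) -` B)" by simp
  also have "\<dots> = measure_pmf.prob (Pi_pmf R False (\<lambda>_. bernoulli_pmf q)) B" unfolding eq by simp
  also have "\<dots> \<le> 2 * exp (- x)" unfolding B_def
    by (rule bernstein[OF finR _ _ w(1,2) _ w(3)]) (use q01 x in auto)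
  finally show ?thesis .
qed

lemma card_parts: "real (card (parts l t)) = (\<Sum>e\<in>{..<n1} \<times> {..<n2}. of_bool (l e = t))"
  unfolding parts_def by (simp add: of_bool_def sum.If_cases Int_def)

text \<open>Bernstein's inequality with weights \<open>1\<close>: the size of the part is close to its mean
  \<open>q n1 n2\<close>, so \<open>cc l t\<close> is close to \<open>1 / q\<close>.\<close>

lemma card_event:
  assumes y: "x / (q * (real n1 * real n2)) \<le> 1 / 10000" and n: "0 < n1" "0 < n2"
  shows "measure_pmf.prob Lab {l. \<not> \<bar>cc l t * q - 1\<bar> \<le> 3 * sqrt (x / (q * (real n1 * real n2)))} \<le> 2 * exp (- x)"
proof -
  let ?m = "q * (real n1 * real n2)" and ?S = "{..<n1} \<times> {..<n2}"
  let ?y = "sqrt (x / ?m)"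
  have m0: "0 < ?m" using q01 n by simp
  have y0: "0 \<le> ?y" "?y \<le> 1 / 100"
  proof -
    have "?y \<le> sqrt ((1 / 100)\<^sup>2)" using y by (intro real_sqrt_le_mono) (simp add: power2_eq_square)
    then show "?y \<le> 1 / 100" by simp
  qed (use m0 x in simp)
  have xm: "x = ?m * (?y * ?y)" using x n q01 by simp
  have "measure_pmf.prob Lab {l. \<not> \<bar>cc l t * q - 1\<bar> \<le> 3 * ?y}
      \<le> measure_pmf.prob Lab {l. 2 * sqrt (q * (real n1 * real n2) * x) + 2 * 1 * x < \<bar>\<Sum>e\<in>?S. (of_bool (l e = t) - q) * 1\<bar>}"
  proof (rule pmf_prob_mono, rule ccontr)
    fix l assume bad: "l \<in> {l. \<not> \<bar>cc l t * q - 1\<bar> \<le> 3 * ?y}"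
    assume "l \<notin> {l. 2 * sqrt (q * (real n1 * real n2) * x) + 2 * 1 * x < \<bar>\<Sum>e\<in>?S. (of_bool (l e = t) - q) * 1\<bar>}"
    moreover have "(\<Sum>e\<in>?S. (of_bool (l e = t) - q) * 1) = real (card (parts l t)) - ?m"
      by (simp add: card_parts sum_subtractf card_cartesian_product)
    ultimately have dev: "\<bar>real (card (parts l t)) - ?m\<bar> \<le> 2 * sqrt (?m * x) + 2 * x" by (simp add: not_less)
    have "sqrt (?m * x) = ?m * ?y"
    proof -
      have "?m * x = (?m * ?y)\<^sup>2" using arg_cong[OF xm, of "\<lambda>a. ?m * a"] by (simp only: power2_eq_square mult_ac)
      then show ?thesis using m0 y0 by simp
    qed
    then have "2 * sqrt (?m * x) + 2 * x = 2 * (?m * ?y) + 2 * (?m * (?y * ?y))" by (simp only: xm[symmetric])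
    also have "\<dots> = ?m * (2 * ?y + 2 * (?y * ?y))" by (simp only: distrib_left mult.left_commute[of 2])
    finally have dev2: "\<bar>real (card (parts l t)) - ?m\<bar> \<le> ?m * (2 * ?y + 2 * (?y * ?y))" using dev by (simp only:)
    have yy: "?y * ?y \<le> 1 / 100 * ?y" using y0 by (intro mult_right_mono) auto
    define C where "C = real (card (parts l t)) / ?m"
    have C: "\<bar>C - 1\<bar> \<le> 202 / 100 * ?y"
    proof -
      have "C - 1 = (real (card (parts l t)) - ?m) / ?m" using n q01 by (simp add: C_def diff_divide_distrib)
      then have "\<bar>C - 1\<bar> = \<bar>real (card (parts l t)) - ?m\<bar> / ?m" using m0 by simp
      also have "\<dots> \<le> 2 * ?y + 2 * (?y * ?y)" using dev2 m0 by (simp add: pos_divide_le_eq mult.commute)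
      also have "\<dots> \<le> 202 / 100 * ?y" using yy by linarith
      finally show ?thesis .
    qed
    have C9: "97 / 100 \<le> C" using C y0 unfolding abs_le_iff by argo
    have "\<bar>cc l t * q - 1\<bar> \<le> 3 * ?y"
    proof -
      have "cc l t * q = 1 / C" using m0 by (simp add: cc_def C_def mult_ac)
      then have "cc l t * q - 1 = (1 - C) / C" using C9 by (simp add: diff_divide_distrib)
      then have "\<bar>cc l t * q - 1\<bar> = \<bar>C - 1\<bar> / C" using C9 by (simp add: abs_divide abs_minus_commute)
      also have "\<dots> \<le> (202 / 100 * ?y) / (97 / 100)" using C C9 y0 by (intro frac_le) auto
      also have "\<dots> \<le> 3 * ?y" using y0 by simp
      finally show ?thesis .
    qed
    then show False using bad by simp
  qed
  also have "\<dots> \<le> 2 * exp (- x)" by (rule label_bernstein) (auto simp: card_cartesian_product)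
  finally show ?thesis .
qed

text \<open>\<open>D = c (q - \<xi>) + (1 - c q) J\<close> with \<open>J\<close> the all-ones matrix. The first term is centred; the
  second is small because \<open>1 - c q\<close> is, and the operator norm of \<open>J\<close> is \<open>sqrt (n1 n2)\<close>.\<close>

lemma opb_event:
  assumes k: "2 * x \<le> 4 * q * real (n1 + n2)" and y: "x / (q * (real n1 * real n2)) \<le> 1 / 10000" and n: "0 < n1" "0 < n2"
  shows "measure_pmf.prob Lab {l. \<bar>cc l t * q - 1\<bar> \<le> 3 * sqrt (x / (q * (real n1 * real n2))) \<and>
      \<not> opb (Dt (cc l t) l t) (31 * sqrt (x * real (n1 + n2) / q))} \<le> (real (n1 + n2))\<^sup>2 * exp (- x)"
proof -
  let ?n = "real (n1 + n2)" and ?y = "sqrt (x / (q * (real n1 * real n2)))"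
  define k where "k = nat \<lceil>x\<rceil>"
  have kx: "x \<le> real k" "real k \<le> 2 * x" using x by (auto simp: k_def) linarith
  have k0: "0 < k" using kx x by (cases k) auto
  have kn: "real k \<le> 4 * q * ?n" using kx assms(1) by linarith
  have n0: "0 < ?n" using n by simp
  have m0: "0 < q * (real n1 * real n2)" using q01 n by simp
  have y1: "3 * ?y \<le> 1"
  proof -
    have "?y \<le> sqrt ((1 / 100)\<^sup>2)" using y by (intro real_sqrt_le_mono) (simp add: power2_eq_square)
    then show ?thesis by simp
  qed
  have "measure_pmf.prob Lab {l. \<bar>cc l t * q - 1\<bar> \<le> 3 * ?y \<and> \<not> opb (Dt (cc l t) l t) (31 * sqrt (x * ?n / q))}
      \<le> measure_pmf.prob Lab {l. sqrt (96 * real k * q * ?n) < opn (wmat n1 n2 (\<lambda>e. q - of_bool (l e = t)))}"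
  proof (rule pmf_prob_mono, rule ccontr)
    fix l assume bad: "l \<in> {l. \<bar>cc l t * q - 1\<bar> \<le> 3 * ?y \<and> \<not> opb (Dt (cc l t) l t) (31 * sqrt (x * ?n / q))}"
    assume "l \<notin> {l. sqrt (96 * real k * q * ?n) < opn (wmat n1 n2 (\<lambda>e. q - of_bool (l e = t)))}"
    then have le: "opn (wmat n1 n2 (\<lambda>e. q - of_bool (l e = t))) \<le> sqrt (96 * real k * q * ?n)" by simp
    let ?c = "cc l t"
    have cq: "\<bar>?c * q - 1\<bar> \<le> 3 * ?y" using bad by simp
    note c = abs_Dt_le(2,3)[OF q01 cq y1]
    have one: "opb (wmat n1 n2 (\<lambda>e. 1)) (sqrt (real n1 * real n2))"
    proof -
      have b: "bnd (n1 + n2) (ent (wmat n1 n2 (\<lambda>e. 1)))" by (rule blk_bnd[OF blk_wmat]) auto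
      have "(norm (wmat n1 n2 (\<lambda>e. 1)))\<^sup>2 = (\<Sum>i<n1 + n2. \<Sum>j<n1 + n2. if i < n1 \<and> j < n2 then 1 else 0)"
        unfolding norm_sq_ent[OF b] by (intro sum.cong refl) (simp add: ent_wmat)
      also have "\<dots> = (\<Sum>i<n1. \<Sum>j<n2. 1)"
      proof -
        have "(\<Sum>j<n1 + n2. if i < n1 \<and> j < n2 then 1 else 0 :: real) = (if i < n1 then real n2 else 0)" for i
        proof -
          have "(\<Sum>j<n1 + n2. if i < n1 \<and> j < n2 then 1 else 0 :: real) = (\<Sum>j<n2. if i < n1 \<and> j < n2 then 1 else 0)"
            by (rule sum_lt_extend[symmetric]) auto
          then show ?thesis by simp
        qed
        moreover have "(\<Sum>i<n1 + n2. if i < n1 then real n2 else 0) = (\<Sum>i<n1. if i < n1 then real n2 else 0)"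
          by (rule sum_lt_extend[symmetric]) auto
        ultimately show ?thesis by simp
      qed
      finally have "norm (wmat n1 n2 (\<lambda>e. 1)) = sqrt (real n1 * real n2)" by (simp add: real_sqrt_unique)
      then show ?thesis using opb_norm by metis
    qed
    have dec: "Dt ?c l t = ?c *\<^sub>R wmat n1 n2 (\<lambda>e. q - of_bool (l e = t)) + (1 - ?c * q) *\<^sub>R wmat n1 n2 (\<lambda>e. 1)"
      by (rule fmat_eqI) (auto simp: Dt_def ent_Dm ent_wmat parts_def algebra_simps)
    have "opb (Dt ?c l t) (\<bar>?c\<bar> * sqrt (96 * real k * q * ?n) + \<bar>1 - ?c * q\<bar> * sqrt (real n1 * real n2))"
      unfolding dec by (intro opb_add opb_scaleR opb_mono[OF opb_opn le] one)
    moreover have "\<bar>?c\<bar> * sqrt (96 * real k * q * ?n) + \<bar>1 - ?c * q\<bar> * sqrt (real n1 * real n2) \<le> 31 * sqrt (x * ?n / q)"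
    proof -
      have "96 * real k * q * ?n \<le> (14 * q)\<^sup>2 * (x * ?n / q)"
      proof -
        have "96 * real k * (q * ?n) \<le> 196 * x * (q * ?n)" using kx q01 n0 by (intro mult_right_mono) auto
        also have "\<dots> = (14 * q)\<^sup>2 * (x * ?n / q)" using q01 by (simp add: power2_eq_square)
        finally show ?thesis by (simp only: mult.assoc)
      qed
      then have "sqrt (96 * real k * q * ?n) \<le> sqrt ((14 * q)\<^sup>2 * (x * ?n / q))" by (rule real_sqrt_le_mono)
      also have "\<dots> = 14 * q * sqrt (x * ?n / q)" unfolding real_sqrt_mult[of "(14 * q)\<^sup>2"] real_sqrt_abs using q01 by linarith
      finally have "\<bar>?c\<bar> * sqrt (96 * real k * q * ?n) \<le> (2 / q) * (14 * q * sqrt (x * ?n / q))"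
        using c q01 by (intro mult_mono) auto
      then have 1: "\<bar>?c\<bar> * sqrt (96 * real k * q * ?n) \<le> 28 * sqrt (x * ?n / q)" using q01 by simp
      have "\<bar>1 - ?c * q\<bar> * sqrt (real n1 * real n2) \<le> 3 * ?y * sqrt (real n1 * real n2)"
        using cq by (intro mult_right_mono) auto
      also have "\<dots> = 3 * sqrt (x / q)"
        using n q01 by (simp add: real_sqrt_mult[symmetric] del: real_sqrt_mult)
      also have "\<dots> \<le> 3 * sqrt (x * ?n / q)"
      proof -
        have "x * 1 \<le> x * ?n" using x n by (intro mult_left_mono) auto
        then show ?thesis using q01 by (simp add: divide_right_mono)
      qed
      finally show ?thesis using 1 by linarith
    qed
    ultimately have "opb (Dt ?c l t) (31 * sqrt (x * ?n / q))" by (rule opb_mono)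
    then show False using bad by simp
  qed
  also have "\<dots> = measure_pmf.prob (Pi_pmf ({..<n1} \<times> {..<n2}) False (\<lambda>_. bernoulli_pmf q)) {f. sqrt (96 * real k * q * ?n) < opn (wmat n1 n2 (\<lambda>e. q - of_bool (f e)))}"
    by (rule indicator_prob)
  also have "\<dots> \<le> ?n\<^sup>2 * exp (- real k)" by (rule centered_opn_tail[OF q01 k0 kn])
  also have "\<dots> \<le> ?n\<^sup>2 * exp (- x)" using kx by (intro mult_left_mono) auto
  finally show ?thesis .
qed

text \<open>One entry of one Gram matrix. The map \<open>h\<close> enumerates a row or a column of the index set, so
  that both cases are covered.\<close>

lemma gram_line:
  fixes h :: "nat \<Rightarrow> nat \<times> nat"
  assumes h: "inj_on h {..<m}" "h ` {..<m} \<subseteq> {..<n1} \<times> {..<n2}" and V: "opb V 1" "\<And>j. norm (rw j V) \<le> b"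
    and z: "b * sqrt (x / q) \<le> z" "z \<le> 1" and tau: "tau \<le> 1"
  shows "measure_pmf.prob Lab {l. \<bar>cc l t * q - 1\<bar> \<le> tau \<and>
     8 * z + tau < \<bar>\<Sum>j<m. (1 - cc l t * of_bool (l (h j) = t)) * (ent V j k * ent V j k')\<bar>} \<le> 2 * exp (- x)"
proof -
  define w where "w j = ent V j k * ent V j k'" for j
  let ?sel = "the_inv_into {..<m} h" and ?R = "h ` {..<m}"
  have sel: "?sel (h j) = j" if "j < m" for j using that h(1) by (simp add: the_inv_into_f_f)
  have b0: "0 \<le> b" using V(2)[of 0] norm_ge_zero order_trans by blast
  have entV: "\<bar>ent V j a\<bar> \<le> b" for j a
  proof -
    have "\<bar>ent (rw j V) j a\<bar> \<le> norm (rw j V)" by (rule abs_ent_le)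
    then show ?thesis using V(2)[of j] by simp
  qed
  have w1: "\<bar>w j\<bar> \<le> b * b" for j unfolding w_def abs_mult by (intro mult_mono entV b0) auto
  have w2: "(\<Sum>j<m. (w j)\<^sup>2) \<le> b\<^sup>2"
  proof -
    have "(\<Sum>j<m. (w j)\<^sup>2) \<le> (\<Sum>j<m. b\<^sup>2 * (ent V j k')\<^sup>2)"
    proof (intro sum_mono)
      fix j
      have "(ent V j k)\<^sup>2 \<le> b\<^sup>2" using entV[of j k] b0 by (simp add: abs_le_square_iff[symmetric])
      then show "(w j)\<^sup>2 \<le> b\<^sup>2 * (ent V j k')\<^sup>2" unfolding w_def power_mult_distrib by (rule mult_right_mono) simp
    qed
    also have "\<dots> \<le> b\<^sup>2 * 1" unfolding sum_distrib_left[symmetric] by (intro mult_left_mono sum_col_sq_le V(1)) simp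
    finally show ?thesis by simp
  qed
  have w3: "\<bar>\<Sum>j<m. w j\<bar> \<le> 1"
  proof -
    have "\<bar>\<Sum>j<m. w j\<bar> \<le> (\<Sum>j<m. \<bar>w j\<bar>)" by (rule sum_abs)
    also have "\<dots> \<le> (\<Sum>j<m. ((ent V j k)\<^sup>2 + (ent V j k')\<^sup>2) / 2)"
    proof (intro sum_mono)
      fix j
      have "0 \<le> (\<bar>ent V j k\<bar> - \<bar>ent V j k'\<bar>)\<^sup>2" by simp
      then show "\<bar>w j\<bar> \<le> ((ent V j k)\<^sup>2 + (ent V j k')\<^sup>2) / 2" by (simp add: w_def abs_mult power2_diff)
    qed
    also have "\<dots> = ((\<Sum>j<m. (ent V j k)\<^sup>2) + (\<Sum>j<m. (ent V j k')\<^sup>2)) / 2"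
      by (simp add: sum_divide_distrib[symmetric] sum.distrib)
    also have "\<dots> \<le> 1" using sum_col_sq_le[OF V(1), of k m] sum_col_sq_le[OF V(1), of k' m] by argo
    finally show ?thesis .
  qed
  let ?y = "b * sqrt (x / q)"
  have y: "0 \<le> ?y" "?y \<le> 1" using b0 x q01 z by auto
  have "measure_pmf.prob Lab {l. \<bar>cc l t * q - 1\<bar> \<le> tau \<and>
     8 * z + tau < \<bar>\<Sum>j<m. (1 - cc l t * of_bool (l (h j) = t)) * (ent V j k * ent V j k')\<bar>}
     \<le> measure_pmf.prob Lab {l. 2 * sqrt (q * b\<^sup>2 * x) + 2 * (b * b) * x < \<bar>\<Sum>e\<in>?R. (of_bool (l e = t) - q) * w (?sel e)\<bar>}"
  proof (rule pmf_prob_mono, rule ccontr)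
    fix l assume bad: "l \<in> {l. \<bar>cc l t * q - 1\<bar> \<le> tau \<and>
     8 * z + tau < \<bar>\<Sum>j<m. (1 - cc l t * of_bool (l (h j) = t)) * (ent V j k * ent V j k')\<bar>}"
    assume "l \<notin> {l. 2 * sqrt (q * b\<^sup>2 * x) + 2 * (b * b) * x < \<bar>\<Sum>e\<in>?R. (of_bool (l e = t) - q) * w (?sel e)\<bar>}"
    moreover have "(\<Sum>e\<in>?R. (of_bool (l e = t) - q) * w (?sel e)) = (\<Sum>j<m. (of_bool (l (h j) = t) - q) * w j)"
      by (subst sum.reindex[OF h(1)]) (simp add: sel)
    ultimately have dev: "\<bar>\<Sum>j<m. (of_bool (l (h j) = t) - q) * w j\<bar> \<le> 2 * sqrt (q * b\<^sup>2 * x) + 2 * (b * b) * x" by simp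
    let ?c = "cc l t"
    have cq: "\<bar>?c * q - 1\<bar> \<le> tau" using bad by simp
    note c = abs_Dt_le(2,3)[OF q01 cq tau]
    have "(\<Sum>j<m. (1 - ?c * of_bool (l (h j) = t)) * w j)
      = (\<Sum>j<m. (1 - ?c * q) * w j - ?c * ((of_bool (l (h j) = t) - q) * w j))"
      by (intro sum.cong refl) (simp add: algebra_simps)
    also have "\<dots> = (1 - ?c * q) * (\<Sum>j<m. w j) - ?c * (\<Sum>j<m. (of_bool (l (h j) = t) - q) * w j)"
      by (simp add: sum_subtractf sum_distrib_left)
    finally have "\<bar>\<Sum>j<m. (1 - ?c * of_bool (l (h j) = t)) * w j\<bar>
      \<le> \<bar>1 - ?c * q\<bar> * \<bar>\<Sum>j<m. w j\<bar> + ?c * \<bar>\<Sum>j<m. (of_bool (l (h j) = t) - q) * w j\<bar>"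
      using c(1) abs_triangle_ineq4[of "(1 - ?c * q) * (\<Sum>j<m. w j)" "?c * (\<Sum>j<m. (of_bool (l (h j) = t) - q) * w j)"]
      by (simp add: abs_mult)
    also have "\<dots> \<le> tau * 1 + (2 / q) * (2 * sqrt (q * b\<^sup>2 * x) + 2 * (b * b) * x)"
      using cq c w3 dev q01 by (intro add_mono mult_mono) auto
    also have "\<dots> = tau + (4 * ?y + 4 * (?y * ?y))"
    proof -
      have "q * b\<^sup>2 * x = (q * ?y)\<^sup>2" using q01 x by (simp add: power_mult_distrib) (simp add: power2_eq_square)
      then have "sqrt (q * b\<^sup>2 * x) = q * ?y" using y q01 by (simp add: real_sqrt_unique)
      moreover have "?y * ?y = b * b * (x / q)"
      proof -
        have "sqrt (x / q) * sqrt (x / q) = x / q" using q01 x by simp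
        then show ?thesis by (metis mult.assoc mult.left_commute)
      qed
      ultimately show ?thesis using q01 by (simp add: distrib_left)
    qed
    also have "\<dots> \<le> 8 * z + tau"
    proof -
      have "?y * ?y \<le> ?y * 1" using y by (intro mult_left_mono)
      then show ?thesis using z by linarith
    qed
    finally show False using bad by (simp add: w_def)
  qed
  also have "\<dots> \<le> 2 * exp (- x)"
  proof (rule label_bernstein[OF h(2)])
    show "(\<Sum>e\<in>?R. (w (?sel e))\<^sup>2) \<le> b\<^sup>2" by (subst sum.reindex[OF h(1)]) (use w2 in \<open>simp add: sel\<close>)
  qed (use w1 b0 in auto)
  finally show ?thesis .
qed

lemma gram_event:
  assumes z: "b1 * sqrt (x / q) \<le> z" "b2 * sqrt (x / q) \<le> z" "0 \<le> z" "z \<le> 1" and tau: "0 \<le> tau" "tau \<le> 1"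
  shows "measure_pmf.prob Lab {l. \<bar>cc l t * q - 1\<bar> \<le> tau \<and> \<not> (gram_le n2 r (Dt (cc l t) l t) v (8 * z + tau)
      \<and> gram_le n1 r (tp (Dt (cc l t) l t)) u (8 * z + tau))} \<le> (real n1 + real n2) * (real r)\<^sup>2 * (2 * exp (- x))"
proof -
  note d = fsvdD[OF svd]
  define A where "A = (\<lambda>(i, k, k'). {l. \<bar>cc l t * q - 1\<bar> \<le> tau \<and>
     8 * z + tau < \<bar>\<Sum>j<n2. (1 - cc l t * of_bool (l (i, j) = t)) * (ent v j k * ent v j k')\<bar>})"
  define B where "B = (\<lambda>(j, k, k'). {l. \<bar>cc l t * q - 1\<bar> \<le> tau \<and>
     8 * z + tau < \<bar>\<Sum>i<n1. (1 - cc l t * of_bool (l (i, j) = t)) * (ent u i k * ent u i k')\<bar>})"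
  let ?I = "{..<n1} \<times> {..<r} \<times> {..<r}" and ?J = "{..<n2} \<times> {..<r} \<times> {..<r}"
  have "measure_pmf.prob Lab (\<Union>y\<in>?I. A y) \<le> real (card ?I) * (2 * exp (- x))"
  proof (rule prob_UN_le)
    fix y assume "y \<in> ?I"
    then obtain i k k' where y: "y = (i, k, k')" "i < n1" by auto
    show "measure_pmf.prob Lab (A y) \<le> 2 * exp (- x)" unfolding y A_def prod.case
      by (rule gram_line[where b = b2]) (use y(2) d b z tau in \<open>auto simp: inj_on_def\<close>)
  qed simp
  moreover have "measure_pmf.prob Lab (\<Union>y\<in>?J. B y) \<le> real (card ?J) * (2 * exp (- x))"
  proof (rule prob_UN_le)
    fix y assume "y \<in> ?J"
    then obtain j k k' where y: "y = (j, k, k')" "j < n2" by auto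
    show "measure_pmf.prob Lab (B y) \<le> 2 * exp (- x)" unfolding y B_def prod.case
      by (rule gram_line[where b = b1]) (use y(2) d b z tau in \<open>auto simp: inj_on_def\<close>)
  qed simp
  moreover have "measure_pmf.prob Lab {l. \<bar>cc l t * q - 1\<bar> \<le> tau \<and> \<not> (gram_le n2 r (Dt (cc l t) l t) v (8 * z + tau)
      \<and> gram_le n1 r (tp (Dt (cc l t) l t)) u (8 * z + tau))} \<le> measure_pmf.prob Lab ((\<Union>y\<in>?I. A y) \<union> (\<Union>y\<in>?J. B y))"
  proof (rule pmf_prob_mono, rule ccontr)
    fix l assume bad: "l \<in> {l. \<bar>cc l t * q - 1\<bar> \<le> tau \<and> \<not> (gram_le n2 r (Dt (cc l t) l t) v (8 * z + tau)
      \<and> gram_le n1 r (tp (Dt (cc l t) l t)) u (8 * z + tau))}"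
    assume no: "l \<notin> (\<Union>y\<in>?I. A y) \<union> (\<Union>y\<in>?J. B y)"
    let ?D = "Dt (cc l t) l t"
    have cq: "\<bar>cc l t * q - 1\<bar> \<le> tau" using bad by simp
    have 1: "\<bar>\<Sum>j<n2. (1 - cc l t * of_bool (l (i, j) = t)) * (ent v j k * ent v j k')\<bar> \<le> 8 * z + tau"
      if "i < n1" "k < r" "k' < r" for i k k'
    proof -
      have "l \<notin> A (i, k, k')" using no that by blast
      then show ?thesis using cq by (simp add: A_def)
    qed
    have 2: "\<bar>\<Sum>i<n1. (1 - cc l t * of_bool (l (i, j) = t)) * (ent u i k * ent u i k')\<bar> \<le> 8 * z + tau"
      if "j < n2" "k < r" "k' < r" for j k k'
    proof -
      have "l \<notin> B (j, k, k')" using no that by blast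
      then show ?thesis using cq by (simp add: B_def)
    qed
    have "gram_le n2 r ?D v (8 * z + tau)" unfolding gram_le_def
    proof (intro allI impI)
      fix i k k' assume k: "k < r" "k' < r"
      show "\<bar>\<Sum>j<n2. ent ?D i j * (ent v j k * ent v j k')\<bar> \<le> 8 * z + tau"
      proof (cases "i < n1")
        case True
        have "(\<Sum>j<n2. ent ?D i j * (ent v j k * ent v j k')) = (\<Sum>j<n2. (1 - cc l t * of_bool (l (i, j) = t)) * (ent v j k * ent v j k'))"
          using True by (intro sum.cong refl) (simp add: Dt_def ent_Dm parts_def)
        then show ?thesis using 1[OF True k] by simp
      next
        case False then show ?thesis using z(3) tau by (simp add: Dt_def ent_Dm)
      qed
    qed
    moreover have "gram_le n1 r (tp ?D) u (8 * z + tau)" unfolding gram_le_def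
    proof (intro allI impI)
      fix j k k' assume k: "k < r" "k' < r"
      show "\<bar>\<Sum>i<n1. ent (tp ?D) j i * (ent u i k * ent u i k')\<bar> \<le> 8 * z + tau"
      proof (cases "j < n2")
        case True
        have "(\<Sum>i<n1. ent (tp ?D) j i * (ent u i k * ent u i k')) = (\<Sum>i<n1. (1 - cc l t * of_bool (l (i, j) = t)) * (ent u i k * ent u i k'))"
          using True by (intro sum.cong refl) (simp add: Dt_def ent_Dm parts_def)
        then show ?thesis using 2[OF True k] by simp
      next
        case False then show ?thesis using z(3) tau by (simp add: Dt_def ent_Dm)
      qed
    qed
    ultimately show False using bad by simp
  qed
  moreover have "measure_pmf.prob Lab ((\<Union>y\<in>?I. A y) \<union> (\<Union>y\<in>?J. B y)) \<le> measure_pmf.prob Lab (\<Union>y\<in>?I. A y) + measure_pmf.prob Lab (\<Union>y\<in>?J. B y)"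
    by (rule measure_Un_le) auto
  ultimately show ?thesis by (simp add: card_cartesian_product power2_eq_square algebra_simps)
qed

end

end

context completion
begin

lemma Xs_cong:
  assumes "\<And>e. l e \<in> {1..<t} \<or> l' e \<in> {1..<t} \<Longrightarrow> l' e = l e"
  shows "Xs l' (t - 1) = Xs l (t - 1)"
proof -
  have "parts l' c = parts l c" if "1 \<le> c" "c \<le> t - 1" for c
  proof -
    have "l' e = c \<longleftrightarrow> l e = c" for e
    proof
      assume "l' e = c" then have "l' e \<in> {1..<t}" using that by auto
      then show "l e = c" using assms[of e] \<open>l' e = c\<close> by simp
    next
      assume "l e = c" then have "l e \<in> {1..<t}" using that by auto
      then show "l' e = c" using assms[of e] \<open>l e = c\<close> by simp
    qed
    then show ?thesis by (simp add: parts_def)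
  qed
  then show ?thesis unfolding Xs_def by (intro arg_cong[where f = fm] svp_iterate_cong)
qed

text \<open>With the factor \<open>c\<close> fixed, the noise without row \<open>i\<close> does not see the labels in row \<open>i\<close>,
  except through the earlier iterates.\<close>

lemma Ht_row_cong:
  assumes "Xs l' (t - 1) = Xs l (t - 1)" "\<And>e. e \<notin> Pair i ` {..<n2} \<Longrightarrow> l' e = l e"
  shows "Ht c l' t - rw i (Ht c l' t) = Ht c l t - rw i (Ht c l t)"
proof (rule fmat_eqI)
  fix a j
  have "l' (a, j) = l (a, j)" if "a \<noteq> i" by (rule assms(2)) (use that in auto)
  then show "ent (Ht c l' t - rw i (Ht c l' t)) a j = ent (Ht c l t - rw i (Ht c l t)) a j"
    by (simp add: Ht_def assms(1)[unfolded One_nat_def] Dt_def ent_Dm parts_def)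
qed

lemma Ht_col_cong:
  assumes "Xs l' (t - 1) = Xs l (t - 1)" "\<And>e. e \<notin> (\<lambda>i. (i, j)) ` {..<n1} \<Longrightarrow> l' e = l e"
  shows "Ht c l' t - cw j (Ht c l' t) = Ht c l t - cw j (Ht c l t)"
proof (rule fmat_eqI)
  fix i a
  have "l' (i, a) = l (i, a)" if "a \<noteq> j" by (rule assms(2)) (use that in auto)
  then show "ent (Ht c l' t - cw j (Ht c l' t)) i a = ent (Ht c l t - cw j (Ht c l t)) i a"
    by (simp add: Ht_def assms(1)[unfolded One_nat_def] Dt_def ent_Dm parts_def cw_def)
qed

lemma ent_factor_le:
  assumes "oproj (V * tp V)" "V * tp V * V = V"
  shows "\<bar>ent V j k\<bar> \<le> norm (rw j (V * tp V))"
proof -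
  have "\<bar>ent (rw j V) j k\<bar> \<le> norm (rw j V)" by (rule abs_ent_le)
  moreover have "rw j V = rw j (V * tp V) * V" by (metis assms(2) rw_mult)
  moreover have "norm (rw j (V * tp V) * V) \<le> norm (rw j (V * tp V)) * 1" by (rule opbD2[OF opb_factor(1)[OF assms(1)]])
  ultimately have "norm (rw j V) \<le> norm (rw j (V * tp V))" by simp
  moreover have "\<bar>ent V j k\<bar> \<le> norm (rw j V)" using \<open>\<bar>ent (rw j V) j k\<bar> \<le> norm (rw j V)\<close> by (simp only: ent_rw if_True refl)
  ultimately show ?thesis by linarith
qed

lemma weighted_sq_sum_le:
  assumes "\<And>j. j < m \<Longrightarrow> \<bar>e j\<bar> \<le> em" "opb V 1"
  shows "(\<Sum>j<m. (e j * ent V j k)\<^sup>2) \<le> em\<^sup>2"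
proof -
  have "(\<Sum>j<m. (e j * ent V j k)\<^sup>2) \<le> (\<Sum>j<m. em\<^sup>2 * (ent V j k)\<^sup>2)"
  proof (intro sum_mono)
    fix j assume "j \<in> {..<m}"
    then have "\<bar>e j\<bar> \<le> em" using assms(1) by simp
    then have "(e j)\<^sup>2 \<le> em\<^sup>2" by (metis abs_ge_zero power2_abs power_mono)
    then show "(e j * ent V j k)\<^sup>2 \<le> em\<^sup>2 * (ent V j k)\<^sup>2" unfolding power_mult_distrib by (rule mult_right_mono) simp
  qed
  also have "\<dots> \<le> em\<^sup>2 * 1" unfolding sum_distrib_left[symmetric] by (intro mult_left_mono sum_col_sq_le assms) simp
  finally show ?thesis by simp
qed

context
  fixes p q x :: real and N t :: nat
  assumes p: "0 < p" "p \<le> 1" and t: "t \<in> {1..N}" and q: "q = p / real N" and x: "1 \<le> x"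
begin

text \<open>\<open>fresh_bernstein\<close> with \<open>A\<close> the labels that are not in \<open>{1..<t}\<close>, along a row or a column.\<close>

lemma fresh_line:
  fixes h :: "nat \<Rightarrow> nat \<times> nat" and w :: "(nat \<times> nat \<Rightarrow> nat) \<Rightarrow> nat \<Rightarrow> real" and b Sq :: "(nat \<times> nat \<Rightarrow> nat) \<Rightarrow> real"
  assumes sel: "\<And>j. j < m \<Longrightarrow> sel (h j) = j" and h: "h ` {..<m} \<subseteq> {..<n1} \<times> {..<n2}" and early: "(real t - 1) * q < 1"
    and inv: "\<And>l l'. (\<And>e. e \<notin> h ` {..<m} \<Longrightarrow> l' e = l e) \<Longrightarrow> (\<And>e. l e \<in> {1..<t} \<or> l' e \<in> {1..<t} \<Longrightarrow> l' e = l e)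
        \<Longrightarrow> w l' = w l \<and> b l' = b l \<and> Sq l' = Sq l"
    and w: "\<And>l j. j < m \<Longrightarrow> \<bar>w l j\<bar> \<le> b l" "\<And>l. (\<Sum>j<m. (w l j)\<^sup>2) \<le> Sq l" "\<And>l. 0 \<le> b l"
  defines "a \<equiv> q / (1 - (real t - 1) * q)"
  shows "measure_pmf.prob (Pi_pmf ({..<n1} \<times> {..<n2}) 0 (\<lambda>_. lab_pmf p N))
     {l. 2 * sqrt (a * Sq l * x) + 2 * b l * x < \<bar>\<Sum>j<m. of_bool (l (h j) \<notin> {1..<t}) * (of_bool (l (h j) = t) - a) * w l j\<bar>} \<le> 2 * exp (- x)"
proof -
  let ?R = "h ` {..<m}" and ?A = "- {1..<t}"
  have inj: "inj_on h {..<m}" using sel by (intro inj_on_inverseI[where g = sel]) auto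
  have finR: "finite ?R" by simp
  have pA: "measure_pmf.prob (lab_pmf p N) ?A = 1 - (real t - 1) * q" unfolding q
    by (rule prob_lab_unseen) (use p t in auto)
  have aeq: "a = pmf (lab_pmf p N) t / measure_pmf.prob (lab_pmf p N) ?A"
    unfolding pA a_def using pmf_lab_pmf[of p t N] p t q by simp
  have eq: "(\<Sum>e\<in>{e \<in> ?R. l e \<in> ?A}. (of_bool (l e = t) - a) * w l (sel e))
     = (\<Sum>j<m. of_bool (l (h j) \<notin> {1..<t}) * (of_bool (l (h j) = t) - a) * w l j)" for l
  proof -
    have "(\<Sum>e\<in>{e \<in> ?R. l e \<in> ?A}. (of_bool (l e = t) - a) * w l (sel e))
      = (\<Sum>e\<in>?R. if l e \<in> ?A then (of_bool (l e = t) - a) * w l (sel e) else 0)"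
      by (rule sum.inter_filter[OF finR])
    also have "\<dots> = (\<Sum>j<m. if l (h j) \<in> ?A then (of_bool (l (h j) = t) - a) * w l (sel (h j)) else 0)"
      by (subst sum.reindex[OF inj]) (simp only: o_def)
    also have "\<dots> = (\<Sum>j<m. of_bool (l (h j) \<notin> {1..<t}) * (of_bool (l (h j) = t) - a) * w l j)"
      by (intro sum.cong refl) (auto simp: sel)
    finally show ?thesis .
  qed
  have "measure_pmf.prob (Pi_pmf ({..<n1} \<times> {..<n2}) 0 (\<lambda>_. lab_pmf p N))
     {l. 2 * sqrt (a * Sq l * x) + 2 * b l * x < \<bar>\<Sum>e\<in>{e \<in> ?R. l e \<in> ?A}. (of_bool (l e = t) - a) * w l (sel e)\<bar>} \<le> 2 * exp (- x)"
  proof (rule fresh_bernstein[where w = "\<lambda>l e. w l (sel e)" and A = ?A])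
    show "?R \<subseteq> {..<n1} \<times> {..<n2}" by (rule h)
    show "finite (set_pmf (lab_pmf p N))" using t by (intro finite_lab_pmf) auto
    show "set_pmf (lab_pmf p N) \<inter> ?A \<noteq> {}" using set_lab_pmf[OF p t] by auto
    show "a = pmf (lab_pmf p N) t / measure_pmf.prob (lab_pmf p N) ?A" by (rule aeq)
    show "(\<lambda>e. w l' (sel e)) = (\<lambda>e. w l (sel e)) \<and> b l' = b l \<and> Sq l' = Sq l"
      if 1: "\<And>e. e \<notin> ?R \<Longrightarrow> l' e = l e" and 2: "\<And>e. e \<in> ?R \<Longrightarrow> l e \<notin> ?A \<Longrightarrow> l' e = l e"
        and 3: "\<And>e. e \<in> ?R \<Longrightarrow> l e \<in> ?A \<Longrightarrow> l' e \<in> ?A" for l l'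
    proof -
      have 4: "l' e = l e" if e: "l e \<in> {1..<t} \<or> l' e \<in> {1..<t}" for e
      proof (cases "e \<in> ?R")
        case True
        show ?thesis
        proof (cases "l e \<in> {1..<t}")
          case True2: True show ?thesis using 2[OF True] True2 by blast
        next
          case False then show ?thesis using 3[OF True] e by blast
        qed
      next
        case False then show ?thesis by (rule 1)
      qed
      show ?thesis using inv[OF 1 4] by simp
    qed
    show "\<bar>w l (sel e)\<bar> \<le> b l" if "e \<in> ?R" for l e using that w(1) sel by auto
    show "(\<Sum>e\<in>?R. (w l (sel e))\<^sup>2) \<le> Sq l" for l
      by (subst sum.reindex[OF inj]) (use w(2)[of l] sel in simp)
  qed (use w x t in auto)
  then show ?thesis unfolding eq .
qed

lemma fresh_row_line:
  assumes i: "i < n1" and early: "(real t - 1) * q < 1"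
  defines "a \<equiv> q / (1 - (real t - 1) * q)"
  shows "measure_pmf.prob (Pi_pmf ({..<n1} \<times> {..<n2}) 0 (\<lambda>_. lab_pmf p N))
     {l. 2 * sqrt (a * (emax n1 n2 (Xs l (t - 1) - M))\<^sup>2 * x)
       + 2 * (emax n1 n2 (Xs l (t - 1) - M) * rmax n2 (Qf (M + (Ht c l t - rw i (Ht c l t))))) * x
      < \<bar>\<Sum>j<n2. of_bool (l (i, j) \<notin> {1..<t}) * (of_bool (l (i, j) = t) - a) *
        (ent (Xs l (t - 1) - M) i j * ent (Vf (M + (Ht c l t - rw i (Ht c l t)))) j k)\<bar>} \<le> 2 * exp (- x)"
  unfolding a_def
proof (rule fresh_line[where sel = snd])
  show "(\<lambda>j. ent (Xs l' (t - 1) - M) i j * ent (Vf (M + (Ht c l' t - rw i (Ht c l' t)))) j k)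
      = (\<lambda>j. ent (Xs l (t - 1) - M) i j * ent (Vf (M + (Ht c l t - rw i (Ht c l t)))) j k) \<and>
      emax n1 n2 (Xs l' (t - 1) - M) * rmax n2 (Qf (M + (Ht c l' t - rw i (Ht c l' t))))
      = emax n1 n2 (Xs l (t - 1) - M) * rmax n2 (Qf (M + (Ht c l t - rw i (Ht c l t)))) \<and>
      (emax n1 n2 (Xs l' (t - 1) - M))\<^sup>2 = (emax n1 n2 (Xs l (t - 1) - M))\<^sup>2"
    if l: "\<And>e. e \<notin> Pair i ` {..<n2} \<Longrightarrow> l' e = l e" "\<And>e. l e \<in> {1..<t} \<or> l' e \<in> {1..<t} \<Longrightarrow> l' e = l e" for l l'
  proof -
    have X: "Xs l' (t - 1) = Xs l (t - 1)" by (rule Xs_cong[OF l(2)])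
    show ?thesis using X Ht_row_cong[OF X l(1), where c = c] by simp
  qed
  fix l
  let ?E = "Xs l (t - 1) - M" and ?F = "Ht c l t - rw i (Ht c l t)"
  have bF: "blk n1 n2 ?F" by (intro blk_diff blk_rw blk_Ht)
  note f = fn'[OF bF]
  show "\<bar>ent ?E i j * ent (Vf (M + ?F)) j k\<bar> \<le> emax n1 n2 ?E * rmax n2 (Qf (M + ?F))" if "j < n2" for j
    unfolding abs_mult using that i order_trans[OF ent_factor_le[OF f(4,6)] rmax_ge[OF that]]
    by (intro mult_mono emax_ge emax_nonneg) auto
  show "(\<Sum>j<n2. (ent ?E i j * ent (Vf (M + ?F)) j k)\<^sup>2) \<le> (emax n1 n2 ?E)\<^sup>2"
    by (rule weighted_sq_sum_le[OF _ opb_factor(1)[OF f(4)]]) (rule emax_ge[OF i])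
  show "0 \<le> emax n1 n2 ?E * rmax n2 (Qf (M + ?F))" by (intro mult_nonneg_nonneg emax_nonneg rmax_nonneg)
qed (use i early in auto)

lemma fresh_col_line:
  assumes j: "j < n2" and early: "(real t - 1) * q < 1"
  defines "a \<equiv> q / (1 - (real t - 1) * q)"
  shows "measure_pmf.prob (Pi_pmf ({..<n1} \<times> {..<n2}) 0 (\<lambda>_. lab_pmf p N))
     {l. 2 * sqrt (a * (emax n1 n2 (Xs l (t - 1) - M))\<^sup>2 * x)
       + 2 * (emax n1 n2 (Xs l (t - 1) - M) * rmax n1 (Pf (M + (Ht c l t - cw j (Ht c l t))))) * x
      < \<bar>\<Sum>i<n1. of_bool (l (i, j) \<notin> {1..<t}) * (of_bool (l (i, j) = t) - a) *
        (ent (Xs l (t - 1) - M) i j * ent (Uf (M + (Ht c l t - cw j (Ht c l t)))) i k)\<bar>} \<le> 2 * exp (- x)"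
  unfolding a_def
proof (rule fresh_line[where sel = fst and h = "\<lambda>i. (i, j)"])
  show "(\<lambda>i. ent (Xs l' (t - 1) - M) i j * ent (Uf (M + (Ht c l' t - cw j (Ht c l' t)))) i k)
      = (\<lambda>i. ent (Xs l (t - 1) - M) i j * ent (Uf (M + (Ht c l t - cw j (Ht c l t)))) i k) \<and>
      emax n1 n2 (Xs l' (t - 1) - M) * rmax n1 (Pf (M + (Ht c l' t - cw j (Ht c l' t))))
      = emax n1 n2 (Xs l (t - 1) - M) * rmax n1 (Pf (M + (Ht c l t - cw j (Ht c l t)))) \<and>
      (emax n1 n2 (Xs l' (t - 1) - M))\<^sup>2 = (emax n1 n2 (Xs l (t - 1) - M))\<^sup>2"
    if l: "\<And>e. e \<notin> (\<lambda>i. (i, j)) ` {..<n1} \<Longrightarrow> l' e = l e" "\<And>e. l e \<in> {1..<t} \<or> l' e \<in> {1..<t} \<Longrightarrow> l' e = l e" for l l'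
  proof -
    have X: "Xs l' (t - 1) = Xs l (t - 1)" by (rule Xs_cong[OF l(2)])
    show ?thesis using X Ht_col_cong[OF X l(1), where c = c] by simp
  qed
  fix l
  let ?E = "Xs l (t - 1) - M" and ?F = "Ht c l t - cw j (Ht c l t)"
  have bF: "blk n1 n2 ?F" by (intro blk_diff blk_cw blk_Ht)
  note f = fn'[OF bF]
  show "\<bar>ent ?E i j * ent (Uf (M + ?F)) i k\<bar> \<le> emax n1 n2 ?E * rmax n1 (Pf (M + ?F))" if "i < n1" for i
    unfolding abs_mult using that j order_trans[OF ent_factor_le[OF f(3,5)] rmax_ge[OF that]]
    by (intro mult_mono emax_ge emax_nonneg) auto
  show "(\<Sum>i<n1. (ent ?E i j * ent (Uf (M + ?F)) i k)\<^sup>2) \<le> (emax n1 n2 ?E)\<^sup>2"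
    by (rule weighted_sq_sum_le[OF _ opb_factor(1)[OF f(3)]]) (rule emax_ge[OF _ j])
  show "0 \<le> emax n1 n2 ?E * rmax n1 (Pf (M + ?F))" by (intro mult_nonneg_nonneg emax_nonneg rmax_nonneg)
qed (use j early in auto)

text \<open>The union runs over the rows, the columns, the \<open>r\<close> components and all possible sizes of the
  part, which fixes \<open>c\<close>.\<close>

lemma fresh_event:
  assumes early: "(real t - 1) * q < 1"
  defines "a \<equiv> q / (1 - (real t - 1) * q)"
  shows "measure_pmf.prob (Pi_pmf ({..<n1} \<times> {..<n2}) 0 (\<lambda>_. lab_pmf p N))
     {l. \<not> ((\<forall>i<n1. fresh_row (cc l t) a x l t i) \<and> (\<forall>j<n2. fresh_col (cc l t) a x l t j))}
     \<le> (real n1 + real n2) * real r * (real n1 * real n2 + 1) * (2 * exp (- x))"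
proof -
  let ?Lab = "Pi_pmf ({..<n1} \<times> {..<n2}) 0 (\<lambda>_. lab_pmf p N)"
  define C where "C m = real n1 * real n2 / real m" for m :: nat
  define A where "A = (\<lambda>(i, k, m). {l. 2 * sqrt (a * (emax n1 n2 (Xs l (t - 1) - M))\<^sup>2 * x)
       + 2 * (emax n1 n2 (Xs l (t - 1) - M) * rmax n2 (Qf (M + (Ht (C m) l t - rw i (Ht (C m) l t))))) * x
      < \<bar>\<Sum>j<n2. of_bool (l (i, j) \<notin> {1..<t}) * (of_bool (l (i, j) = t) - a) *
        (ent (Xs l (t - 1) - M) i j * ent (Vf (M + (Ht (C m) l t - rw i (Ht (C m) l t)))) j k)\<bar>})"
  define B where "B = (\<lambda>(j, k, m). {l. 2 * sqrt (a * (emax n1 n2 (Xs l (t - 1) - M))\<^sup>2 * x)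
       + 2 * (emax n1 n2 (Xs l (t - 1) - M) * rmax n1 (Pf (M + (Ht (C m) l t - cw j (Ht (C m) l t))))) * x
      < \<bar>\<Sum>i<n1. of_bool (l (i, j) \<notin> {1..<t}) * (of_bool (l (i, j) = t) - a) *
        (ent (Xs l (t - 1) - M) i j * ent (Uf (M + (Ht (C m) l t - cw j (Ht (C m) l t)))) i k)\<bar>})"
  let ?I = "{..<n1} \<times> {..<r} \<times> {..n1 * n2}" and ?J = "{..<n2} \<times> {..<r} \<times> {..n1 * n2}"
  have "measure_pmf.prob ?Lab (\<Union>y\<in>?I. A y) \<le> real (card ?I) * (2 * exp (- x))"
  proof (rule prob_UN_le)
    fix y assume "y \<in> ?I"
    then obtain i k m where y: "y = (i, k, m)" "i < n1" by auto
    show "measure_pmf.prob ?Lab (A y) \<le> 2 * exp (- x)" unfolding y A_def prod.case a_def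
      by (rule fresh_row_line[OF y(2) early])
  qed simp
  moreover have "measure_pmf.prob ?Lab (\<Union>y\<in>?J. B y) \<le> real (card ?J) * (2 * exp (- x))"
  proof (rule prob_UN_le)
    fix y assume "y \<in> ?J"
    then obtain j k m where y: "y = (j, k, m)" "j < n2" by auto
    show "measure_pmf.prob ?Lab (B y) \<le> 2 * exp (- x)" unfolding y B_def prod.case a_def
      by (rule fresh_col_line[OF y(2) early])
  qed simp
  moreover have "measure_pmf.prob ?Lab {l. \<not> ((\<forall>i<n1. fresh_row (cc l t) a x l t i) \<and> (\<forall>j<n2. fresh_col (cc l t) a x l t j))}
     \<le> measure_pmf.prob ?Lab ((\<Union>y\<in>?I. A y) \<union> (\<Union>y\<in>?J. B y))"
  proof (rule pmf_prob_mono, rule ccontr)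
    fix l assume bad: "l \<in> {l. \<not> ((\<forall>i<n1. fresh_row (cc l t) a x l t i) \<and> (\<forall>j<n2. fresh_col (cc l t) a x l t j))}"
    assume no: "l \<notin> (\<Union>y\<in>?I. A y) \<union> (\<Union>y\<in>?J. B y)"
    define m where "m = card (parts l t)"
    have m: "m \<le> n1 * n2"
    proof -
      have "card (parts l t) \<le> card ({..<n1} \<times> {..<n2})" by (rule card_mono) (auto simp: parts_def)
      then show ?thesis by (simp add: m_def card_cartesian_product)
    qed
    have cC: "cc l t = C m" by (simp add: cc_def C_def m_def)
    have "fresh_row (cc l t) a x l t i" if i: "i < n1" for i
      unfolding fresh_row_def cC
    proof (intro allI impI)
      fix k assume k: "k < r"
      have "l \<notin> A (i, k, m)" using no i k m by blast
      then show "\<bar>\<Sum>j<n2. of_bool (l (i, j) \<notin> {1..<t}) * (of_bool (l (i, j) = t) - a) *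
        (ent (Xs l (t - 1) - M) i j * ent (Vf (M + (Ht (C m) l t - rw i (Ht (C m) l t)))) j k)\<bar>
     \<le> 2 * sqrt (a * (emax n1 n2 (Xs l (t - 1) - M))\<^sup>2 * x)
       + 2 * (emax n1 n2 (Xs l (t - 1) - M) * rmax n2 (Qf (M + (Ht (C m) l t - rw i (Ht (C m) l t))))) * x"
        unfolding A_def prod.case mem_Collect_eq not_less .
    qed
    moreover have "fresh_col (cc l t) a x l t j" if j: "j < n2" for j
      unfolding fresh_col_def cC
    proof (intro allI impI)
      fix k assume k: "k < r"
      have "l \<notin> B (j, k, m)" using no j k m by blast
      then show "\<bar>\<Sum>i<n1. of_bool (l (i, j) \<notin> {1..<t}) * (of_bool (l (i, j) = t) - a) *
        (ent (Xs l (t - 1) - M) i j * ent (Uf (M + (Ht (C m) l t - cw j (Ht (C m) l t)))) i k)\<bar>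
     \<le> 2 * sqrt (a * (emax n1 n2 (Xs l (t - 1) - M))\<^sup>2 * x)
       + 2 * (emax n1 n2 (Xs l (t - 1) - M) * rmax n1 (Pf (M + (Ht (C m) l t - cw j (Ht (C m) l t))))) * x"
        unfolding B_def prod.case mem_Collect_eq not_less .
    qed
    ultimately show False using bad unfolding mem_Collect_eq by blast
  qed
  moreover have "measure_pmf.prob ?Lab ((\<Union>y\<in>?I. A y) \<union> (\<Union>y\<in>?J. B y)) \<le> measure_pmf.prob ?Lab (\<Union>y\<in>?I. A y) + measure_pmf.prob ?Lab (\<Union>y\<in>?J. B y)"
    by (rule measure_Un_le) auto
  ultimately show ?thesis by (simp add: card_cartesian_product algebra_simps)
qed


lemma bad_event:
  assumes n: "0 < n1" "0 < n2" and rn: "r \<le> n1 + n2"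
    and tau: "tau = 3 * sqrt (x / (q * (real n1 * real n2)))" and y: "x / (q * (real n1 * real n2)) \<le> 1 / 10000"
    and L: "L = 31 * sqrt (x * real (n1 + n2) / q)" "2 * x \<le> 4 * q * real (n1 + n2)"
    and z: "b1 * sqrt (x / q) \<le> z" "b2 * sqrt (x / q) \<le> z" "0 \<le> z" "z \<le> 1"
  shows "measure_pmf.prob (Pi_pmf ({..<n1} \<times> {..<n2}) 0 (\<lambda>_. lab_pmf p N)) {l. \<not> good q (8 * z + tau) L tau x l t}
    \<le> 7 * (real (n1 + n2)) ^ 4 * exp (- x)"
proof -
  let ?P = "measure_pmf.prob (Pi_pmf ({..<n1} \<times> {..<n2}) 0 (\<lambda>_. lab_pmf p N))" and ?n = "real (n1 + n2)" and ?e = "exp (- x)"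
  have q01: "0 < q" "q \<le> 1" using p t by (auto simp: q divide_le_eq)
  have m0: "0 < q * (real n1 * real n2)" using q01 n by simp
  have tau01: "0 \<le> tau" "tau \<le> 1"
  proof -
    have "sqrt (x / (q * (real n1 * real n2))) \<le> sqrt ((1 / 100)\<^sup>2)" using y by (intro real_sqrt_le_mono) (simp add: power2_eq_square)
    then show "tau \<le> 1" unfolding tau by simp
    show "0 \<le> tau" unfolding tau using m0 x by simp
  qed
  define E1 where "E1 = {l. \<not> \<bar>cc l t * q - 1\<bar> \<le> tau}"
  define E2 where "E2 = {l. \<bar>cc l t * q - 1\<bar> \<le> tau \<and> \<not> opb (Dt (cc l t) l t) L}"
  define E3 where "E3 = {l. \<bar>cc l t * q - 1\<bar> \<le> tau \<and> \<not> (gram_le n2 r (Dt (cc l t) l t) v (8 * z + tau)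
      \<and> gram_le n1 r (tp (Dt (cc l t) l t)) u (8 * z + tau))}"
  define E4 where "E4 = {l. (real t - 1) * q * real r \<le> 1 / 1000000 \<and>
     \<not> ((\<forall>i<n1. fresh_row (cc l t) (q / (1 - (real t - 1) * q)) x l t i) \<and> (\<forall>j<n2. fresh_col (cc l t) (q / (1 - (real t - 1) * q)) x l t j))}"
  have n1': "1 \<le> ?n" using n by simp
  have pw: "?n ^ a \<le> ?n ^ 4" if "a \<le> 4" for a using n1' that by (rule power_increasing[rotated])
  have rr: "real r \<le> ?n" using rn by (simp only: of_nat_le_iff)
  have e0: "0 \<le> ?e" by simp
  have 1: "?P E1 \<le> 2 * ?n ^ 4 * ?e"
  proof -
    have "?P E1 \<le> 2 * ?n ^ 0 * ?e" unfolding E1_def tau using card_event[OF p t q x y n] by simp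
    also have "\<dots> \<le> 2 * ?n ^ 4 * ?e" by (intro mult_left_mono mult_right_mono pw) auto
    finally show ?thesis .
  qed
  have 2: "?P E2 \<le> 1 * ?n ^ 4 * ?e"
  proof -
    have "?P E2 \<le> 1 * ?n ^ 2 * ?e" unfolding E2_def tau L(1) using opb_event[OF p t q x L(2) y n] by simp
    also have "\<dots> \<le> 1 * ?n ^ 4 * ?e" by (intro mult_left_mono mult_right_mono pw) auto
    finally show ?thesis .
  qed
  have 3: "?P E3 \<le> 2 * ?n ^ 4 * ?e"
  proof -
    have "?P E3 \<le> (real n1 + real n2) * (real r)\<^sup>2 * (2 * ?e)" unfolding E3_def by (rule gram_event[OF p t q x z tau01])
    also have "\<dots> \<le> ?n * ?n\<^sup>2 * (2 * ?e)" using rr by (intro mult_right_mono mult_mono power_mono) auto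
    also have "\<dots> = 2 * ?n ^ 3 * ?e" by (simp add: power3_eq_cube power2_eq_square)
    also have "\<dots> \<le> 2 * ?n ^ 4 * ?e" by (intro mult_left_mono mult_right_mono pw) auto
    finally show ?thesis .
  qed
  have 4: "?P E4 \<le> 2 * ?n ^ 4 * ?e"
  proof (cases "(real t - 1) * q * real r \<le> 1 / 1000000")
    case True
    have "(real t - 1) * q * 1 \<le> (real t - 1) * q * real r" using t q01 r by (intro mult_left_mono) auto
    then have early: "(real t - 1) * q < 1" using True by linarith
    have "?P E4 \<le> (real n1 + real n2) * real r * (real n1 * real n2 + 1) * (2 * ?e)"
      unfolding E4_def using fresh_event[OF early] True by simp
    also have "\<dots> \<le> ?n * ?n * ?n\<^sup>2 * (2 * ?e)"
    proof (intro mult_right_mono mult_mono)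
      have "1 * 1 \<le> real n1 * real n2" using n by (intro mult_mono) auto
      then have "real n1 * real n2 + 1 \<le> 2 * (real n1 * real n2)" by linarith
      also have "\<dots> \<le> ?n\<^sup>2" by (simp add: power2_sum)
      finally show "real n1 * real n2 + 1 \<le> ?n\<^sup>2" .
    qed (use rr in auto)
    also have "\<dots> = 2 * ?n ^ 4 * ?e" by (simp add: power4_eq_xxxx power2_eq_square)
    finally show ?thesis .
  next
    case False
    then have "E4 = {}" by (auto simp: E4_def)
    then show ?thesis by simp
  qed
  have "{l. \<not> good q (8 * z + tau) L tau x l t} \<subseteq> (E1 \<union> E2) \<union> (E3 \<union> E4)"
    unfolding good_def E1_def E2_def E3_def E4_def by blast
  then have "?P {l. \<not> good q (8 * z + tau) L tau x l t} \<le> ?P ((E1 \<union> E2) \<union> (E3 \<union> E4))"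
    by (rule pmf_prob_mono[OF subsetD])
  also have "\<dots> \<le> ?P (E1 \<union> E2) + ?P (E3 \<union> E4)" by (rule measure_Un_le) auto
  also have "\<dots> \<le> (?P E1 + ?P E2) + (?P E3 + ?P E4)" by (intro add_mono measure_Un_le) auto
  also have "\<dots> \<le> 7 * ?n ^ 4 * ?e" using 1 2 3 4 by linarith
  finally show ?thesis .
qed

end

theorem svp_converges_with_high_probability:
  fixes p q x z tau L :: real and N :: nat
  assumes p: "0 < p" "p \<le> 1" and N: "1 \<le> N" and q: "q = p / real N" and x: "1 \<le> x"
    and n: "0 < n1" "0 < n2" and rn: "r \<le> n1 + n2"
    and tau: "tau = 3 * sqrt (x / (q * (real n1 * real n2)))" and y: "x / (q * (real n1 * real n2)) \<le> 1 / 10000"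
    and L: "L = 31 * sqrt (x * real (n1 + n2) / q)" "2 * x \<le> 4 * q * real (n1 + n2)"
    and z: "b1 * sqrt (x / q) \<le> z" "b2 * sqrt (x / q) \<le> z" "z \<le> 1"
    and g: "real r * (8 * z + tau) \<le> 1 / 1000" and tk: "tau * kap \<le> 1 / 1000"
    and Th: "Th = L * kap * b1 * b2" "sqrt (real r) * real r * Th \<le> 1 / 10000000000"
    and small: "sqrt (real r) * kap * z \<le> 1 / 6000"
  shows "measure_pmf.prob (bind_pmf (random_subset ({..<n1} \<times> {..<n2}) p) (\<lambda>Om. svp_output P N Om (proj_entries Om Mm)))
      {X. frob_norm (X - Mm) \<le> exp (1 - real N) * (8 * sqrt (real r) * Th * sg)}
    \<ge> 1 - real N * (7 * (real (n1 + n2)) ^ 4 * exp (- x))"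
proof -
  let ?Lab = "Pi_pmf ({..<n1} \<times> {..<n2}) 0 (\<lambda>_. lab_pmf p N)"
  let ?B = "\<Union>t\<in>{1..N}. {l. \<not> good q (8 * z + tau) L tau x l t}"
  have q01: "0 < q" "q \<le> 1" using p N by (auto simp: q divide_le_eq)
  have z0: "0 \<le> z"
  proof -
    have "0 \<le> b1 * sqrt (x / q)" using b(1) x q01 by simp
    then show ?thesis using z(1) by linarith
  qed
  have tau0: "0 \<le> tau" unfolding tau using x q01 by simp
  have x0: "0 \<le> x" using x by simp
  have g0: "0 \<le> 8 * z + tau" using z0 tau0 by simp
  have sm: "sqrt (real r) * kap * b1 * sqrt (x / q) \<le> 1 / 6000" "sqrt (real r) * kap * b2 * sqrt (x / q) \<le> 1 / 6000"
  proof -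
    have k0: "0 \<le> sqrt (real r) * kap" using kap by simp
    show "sqrt (real r) * kap * b1 * sqrt (x / q) \<le> 1 / 6000"
      using mult_left_mono[OF z(1) k0] small unfolding mult.assoc by linarith
    show "sqrt (real r) * kap * b2 * sqrt (x / q) \<le> 1 / 6000"
      using mult_left_mono[OF z(2) k0] small unfolding mult.assoc by linarith
  qed
  obtain m where Nm: "N = Suc m" using N by (cases N) auto
  have "measure_pmf.prob ?Lab ?B \<le> real (card {1..N}) * (7 * (real (n1 + n2)) ^ 4 * exp (- x))"
    by (intro prob_UN_le bad_event[OF p _ q x n rn tau y L z(1,2) z0 z(3)]) auto
  then have B: "measure_pmf.prob ?Lab ?B \<le> real N * (7 * (real (n1 + n2)) ^ 4 * exp (- x))" by simp
  have "- ?B \<subseteq> {l. frob_norm (svp_iterate P (\<lambda>t. {e \<in> {..<n1} \<times> {..<n2}. l e = t}) Mm N - Mm) \<le> exp (1 - real N) * (8 * sqrt (real r) * Th * sg)}"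
  proof (rule subsetI, unfold mem_Collect_eq)
    fix l assume "l \<in> - ?B"
    then have G: "good q (8 * z + tau) L tau x l tt" if "tt \<in> {1..Suc m}" for tt using that Nm by blast
    have "norm (Xs l (Suc m) - M) \<le> exp (- real m) * (8 * sqrt (real r) * Th * sg)"
      by (rule linear_convergence[OF q01 g0 g x0 tk Th sm G])
    moreover have "frob_norm (svp_iterate P (\<lambda>t. {e \<in> {..<n1} \<times> {..<n2}. l e = t}) Mm N - Mm) = norm (Xs l (Suc m) - M)"
    proof -
      have par: "parts l = (\<lambda>t. {e \<in> {..<n1} \<times> {..<n2}. l e = t})" by (rule ext) (simp add: parts_def)
      have "svp_iterate P (parts l) Mm N \<in> carrier_mat n1 n2" by (rule svp_iterate_carrier[OF Pc Mm])
      then show ?thesis unfolding par[symmetric] norm_fm[symmetric] using Mm by (simp add: fm_minus Xs_def M_def Nm)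
    qed
    ultimately show "frob_norm (svp_iterate P (\<lambda>t. {e \<in> {..<n1} \<times> {..<n2}. l e = t}) Mm N - Mm) \<le> exp (1 - real N) * (8 * sqrt (real r) * Th * sg)"
      by (simp add: Nm)
  qed
  then have "measure_pmf.prob ?Lab (- ?B) \<le> measure_pmf.prob ?Lab {l. frob_norm (svp_iterate P (\<lambda>t. {e \<in> {..<n1} \<times> {..<n2}. l e = t}) Mm N - Mm) \<le> exp (1 - real N) * (8 * sqrt (real r) * Th * sg)}"
    by (rule pmf_prob_mono[OF subsetD])
  moreover have "measure_pmf.prob ?Lab (- ?B) = 1 - measure_pmf.prob ?Lab ?B"
    using measure_pmf.prob_compl[of ?B ?Lab] by (simp add: Compl_eq_Diff_UNIV)
  moreover have "measure_pmf.prob (bind_pmf (random_subset ({..<n1} \<times> {..<n2}) p) (\<lambda>Om. svp_output P N Om (proj_entries Om Mm)))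
      {X. frob_norm (X - Mm) \<le> exp (1 - real N) * (8 * sqrt (real r) * Th * sg)}
    = measure_pmf.prob ?Lab {l. frob_norm (svp_iterate P (\<lambda>t. {e \<in> {..<n1} \<times> {..<n2}. l e = t}) Mm N - Mm) \<le> exp (1 - real N) * (8 * sqrt (real r) * Th * sg)}"
  proof -
    have "bind_pmf (random_subset ({..<n1} \<times> {..<n2}) p) (\<lambda>Om. svp_output P N Om (proj_entries Om Mm))
      = map_pmf (\<lambda>l. svp_iterate P (\<lambda>t. {e \<in> {..<n1} \<times> {..<n2}. l e = t}) Mm N) ?Lab"
      by (rule svp_output_law) (use Mm Pc N in auto)
    then show ?thesis by (simp only: measure_map_pmf vimage_Collect_eq mem_Collect_eq)
  qed
  ultimately show ?thesis using B by linarith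
qed

end

section \<open>The recovery guarantee\<close>

text \<open>With \<open>om\<^sup>2 = x n / (q n1 n2)\<close>, every quantity that has to be small is a constant times \<open>om\<close>
  times a monomial in \<open>mu\<close>, \<open>kap\<close> and \<open>sqrt r\<close> that divides \<open>mu\<^sup>2 kap r\<^sup>2 sqrt r\<close>. The sampling
  assumption says that \<open>Q = mu\<^sup>2 kap r\<^sup>2 (sqrt r) om\<close> is at most \<open>10\<^sup>-\<^sup>1\<^sup>2\<close>, so it implies all
  conditions at once. The largest monomial comes from the error after the first step, of order
  \<open>(sqrt r) Th\<close>, times the factor \<open>r\<close> lost when incoherence is given up.\<close>

lemma rate_conditions:
  fixes mu kap x q :: real and n1 n2 r :: nat
  assumes mu: "1 \<le> mu" and kap: "1 \<le> kap" and r: "1 \<le> r" and n: "0 < n1" "0 < n2" and q: "0 < q" "q \<le> 1" and x: "1 \<le> x"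
    and big: "10 ^ 24 * (mu ^ 4 * kap\<^sup>2 * real r ^ 5) * (real (n1 + n2) * x) \<le> q * (real n1 * real n2)"
  defines "om \<equiv> sqrt (x * real (n1 + n2) / (q * (real n1 * real n2)))"
    and "b1 \<equiv> mu * sqrt (real r) / sqrt (real n1)" and "b2 \<equiv> mu * sqrt (real r) / sqrt (real n2)"
    and "tau \<equiv> 3 * sqrt (x / (q * (real n1 * real n2)))" and "L \<equiv> 31 * sqrt (x * real (n1 + n2) / q)"
  defines "z \<equiv> mu * sqrt (real r) * om" and "Th \<equiv> L * kap * b1 * b2"
  shows "b1 * sqrt (x / q) \<le> z" "b2 * sqrt (x / q) \<le> z" "z \<le> 1"
    "real r * (8 * z + tau) \<le> 1 / 1000" "tau * kap \<le> 1 / 1000" "sqrt (real r) * real r * Th \<le> 1 / 10000000000"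
    "sqrt (real r) * kap * z \<le> 1 / 6000" "x / (q * (real n1 * real n2)) \<le> 1 / 10000"
    "2 * x \<le> 4 * q * real (n1 + n2)" "r \<le> n1 + n2"
proof -
  let ?G = "q * (real n1 * real n2)" and ?n = "real (n1 + n2)" and ?s = "sqrt (real r)"
  define Q where "Q = mu\<^sup>2 * kap * (real r)\<^sup>2 * ?s * om"
  have G0: "0 < ?G" using q n by simp
  have n0: "1 \<le> ?n" using n by simp
  have r1: "1 \<le> real r" using r by simp
  have s1: "1 \<le> ?s" using r1 by simp
  have om0: "0 \<le> om" using G0 x by (simp add: om_def)
  have om2: "om\<^sup>2 = x * ?n / ?G" using G0 x by (simp add: om_def)
  have Q: "Q \<le> 1 / 10 ^ 12"
  proof -
    have "Q\<^sup>2 = (mu ^ 4 * kap\<^sup>2 * real r ^ 5) * om\<^sup>2"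
    proof -
      have "?s\<^sup>2 = real r" by simp
      then have "Q\<^sup>2 = (mu\<^sup>2)\<^sup>2 * kap\<^sup>2 * ((real r)\<^sup>2)\<^sup>2 * real r * om\<^sup>2" unfolding Q_def power_mult_distrib by simp
      then show ?thesis by (simp add: power_mult[symmetric] eval_nat_numeral mult_ac)
    qed
    also have "\<dots> \<le> (1 / 10 ^ 12)\<^sup>2" using big G0 unfolding om2 by (simp add: field_simps)
    finally show ?thesis by (rule power2_le_imp_le) simp
  qed
  have mu2: "1 \<le> mu\<^sup>2" "mu \<le> mu\<^sup>2" using mu by (auto simp: power2_eq_square intro: mult_ge1_I)
  have r2: "real r \<le> (real r)\<^sup>2" using r1 by (simp add: power2_eq_square)
  have le: "a * om \<le> Q" if "a = a1 * a2 * a3 * a4" "0 \<le> a1" "0 \<le> a2" "0 \<le> a3" "0 \<le> a4" "a1 \<le> mu\<^sup>2" "a2 \<le> kap" "a3 \<le> (real r)\<^sup>2" "a4 \<le> ?s"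
    for a a1 a2 a3 a4
  proof -
    have "a1 * a2 * a3 * a4 \<le> mu\<^sup>2 * kap * (real r)\<^sup>2 * ?s"
      using that mu kap r1 s1 by (intro mult_mono) auto
    then show ?thesis unfolding Q_def that(1) using om0 by (rule mult_right_mono)
  qed
  have r1': "1 \<le> (real r)\<^sup>2" using r1 r2 by linarith
  have omQ: "om \<le> Q" using le[of 1 1 1 1 1] mu2 kap r1' s1 by simp
  have zQ: "z \<le> Q" unfolding z_def using le[of "mu * ?s" mu 1 1 ?s] mu mu2 kap r1' by simp
  have om1: "om \<le> 1 / 10 ^ 12" using omQ Q by simp
  have om21: "om\<^sup>2 \<le> 1 / 10000"
  proof -
    have "om\<^sup>2 \<le> (1 / 10 ^ 12)\<^sup>2" using om1 om0 by (rule power_mono)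
    also have "\<dots> \<le> (1 / 10000 :: real)" by (simp add: power2_eq_square)
    finally show ?thesis .
  qed
  have tau_om: "tau \<le> 3 * om"
  proof -
    have "x * 1 \<le> x * ?n" using x n0 by (intro mult_left_mono) auto
    then have "sqrt (x / ?G) \<le> om" unfolding om_def using G0 by (intro real_sqrt_le_mono divide_right_mono) auto
    then show ?thesis by (simp add: tau_def)
  qed
  have bz: "mu * ?s / sqrt a * sqrt (x / q) \<le> z" if "0 < a" "0 < a'" "a * a' = real n1 * real n2" "a' \<le> ?n" for a a'
  proof -
    have "sqrt (x / q) / sqrt a = sqrt (x * a' / ?G)"
    proof -
      have "x / q / a = x * a' / (q * (a * a'))" using that(1,2) q by simp
      then show ?thesis by (simp only: that(3) real_sqrt_divide[symmetric])
    qed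
    also have "\<dots> \<le> om" unfolding om_def using G0 x that by (intro real_sqrt_le_mono divide_right_mono mult_left_mono) auto
    finally have "(mu * ?s) * (sqrt (x / q) / sqrt a) \<le> (mu * ?s) * om" using mu by (intro mult_left_mono) auto
    then show ?thesis by (simp add: z_def)
  qed
  show "b1 * sqrt (x / q) \<le> z" unfolding b1_def by (rule bz[of _ "real n2"]) (use n in auto)
  show "b2 * sqrt (x / q) \<le> z" unfolding b2_def by (rule bz[of _ "real n1"]) (use n in auto)
  show "z \<le> 1" using zQ Q by simp
  show "real r * (8 * z + tau) \<le> 1 / 1000"
  proof -
    have "real r * z \<le> Q" using le[of "mu * real r * ?s" mu 1 "real r" ?s] mu mu2 kap r2 by (simp add: z_def mult_ac)
    moreover have "real r * om \<le> Q" using le[of "real r" 1 1 "real r" 1] mu2 kap r2 s1 by simp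
    moreover have "real r * tau \<le> real r * (3 * om)" using tau_om by (intro mult_left_mono) auto
    ultimately show ?thesis using Q by (simp add: distrib_left)
  qed
  show "tau * kap \<le> 1 / 1000"
  proof -
    have "kap * om \<le> Q" using le[of kap 1 kap 1 1] mu2 kap r1' s1 by simp
    moreover have "tau * kap \<le> (3 * om) * kap" using tau_om kap by (intro mult_right_mono) auto
    ultimately show ?thesis using Q by (simp add: mult.commute)
  qed
  show "sqrt (real r) * real r * Th \<le> 1 / 10000000000"
  proof -
    have "L * (b1 * b2) = 31 * (mu * mu) * real r * om"
    proof -
      have "sqrt (x * ?n / q) / (sqrt (real n1) * sqrt (real n2)) = om" unfolding om_def
        by (simp only: real_sqrt_mult[symmetric] real_sqrt_divide[symmetric] divide_divide_eq_left)
      moreover have "L * (b1 * b2) = 31 * (mu * mu) * (?s * ?s) * (sqrt (x * ?n / q) / (sqrt (real n1) * sqrt (real n2)))"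
        by (simp add: L_def b1_def b2_def)
      ultimately show ?thesis by simp
    qed
    moreover have "sqrt (real r) * real r * Th = ?s * real r * kap * (L * (b1 * b2))" unfolding Th_def by (simp only: mult_ac)
    ultimately have "sqrt (real r) * real r * Th = ?s * real r * kap * (31 * (mu * mu) * real r * om)" by (simp only:)
    also have "\<dots> = 31 * Q" by (simp only: Q_def power2_eq_square mult_ac)
    finally have "sqrt (real r) * real r * Th = 31 * Q" .
    then show ?thesis using Q by simp
  qed
  show "sqrt (real r) * kap * z \<le> 1 / 6000"
  proof -
    have "?s * kap * z = (mu * kap * real r) * om"
    proof -
      have "?s * kap * z = (mu * kap * (?s * ?s)) * om" unfolding z_def by (simp only: mult_ac)
      then show ?thesis by simp
    qed
    also have "\<dots> \<le> Q" using le[of "mu * kap * real r" mu kap "real r" 1] mu mu2 kap r2 s1 by simp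
    finally show ?thesis using Q by simp
  qed
  show "x / ?G \<le> 1 / 10000"
  proof -
    have "x * 1 \<le> x * ?n" using x n0 by (intro mult_left_mono) auto
    then have "x / ?G \<le> om\<^sup>2" unfolding om2 using G0 by (intro divide_right_mono) auto
    then show ?thesis using om21 by (rule order_trans)
  qed
  have nn: "real n1 * real n2 \<le> ?n * ?n" by (intro mult_mono) auto
  have xG: "x * ?n \<le> ?G" using om21 G0 unfolding om2 by (simp add: divide_le_eq)
  show "2 * x \<le> 4 * q * ?n"
  proof -
    have "x * ?n \<le> q * (?n * ?n)" using xG mult_left_mono[OF nn, of q] q by linarith
    then have "x * ?n \<le> (q * ?n) * ?n" by (simp only: mult.assoc)
    then have "x \<le> q * ?n" by (rule mult_right_le_imp_le) (use n0 in linarith)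
    then show ?thesis using x by linarith
  qed
  show "r \<le> n1 + n2"
  proof -
    have rom: "real r * om\<^sup>2 \<le> 1"
    proof -
      have "real r * om \<le> Q" using le[of "real r" 1 1 "real r" 1] mu2 kap r2 s1 by simp
      then have "real r * om * om \<le> 1 * 1" using Q om1 om0 by (intro mult_mono) auto
      then show ?thesis by (simp add: power2_eq_square)
    qed
    have "real r * (x * ?n) \<le> ?G" using rom G0 unfolding om2 by (simp add: divide_le_eq)
    also have "\<dots> \<le> 1 * (?n * ?n)" using q nn by (intro mult_mono) auto
    finally have "(real r * x) * ?n \<le> ?n * ?n" by (simp only: mult.assoc mult_1)
    then have "real r * x \<le> ?n" by (rule mult_right_le_imp_le) (use n0 in linarith)
    moreover have "real r * 1 \<le> real r * x" using x by (intro mult_left_mono) auto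
    ultimately show ?thesis by linarith
  qed
qed

text \<open>The exponent \<open>20 + a\<close> leaves room for the factor \<open>7 n\<^sup>4\<close> of the union bound.\<close>

lemma failure_rate:
  fixes n :: nat and T a :: real
  assumes n: "2 \<le> n" "0 < m" "m \<le> n" and N: "real N \<le> T" and a: "0 \<le> a"
  shows "real N * (7 * real n ^ 4 * exp (- ((20 + a) * ln (real n)))) \<le> T * real m powr (- 10 - a)"
proof -
  have n0: "0 < real n" "1 \<le> real n" using n by auto
  have "7 * real n ^ 4 * exp (- ((20 + a) * ln (real n))) \<le> real n ^ 7 * exp (- ((20 + a) * ln (real n)))"
  proof (rule mult_right_mono)
    have "(2::real) ^ 3 \<le> real n ^ 3" using n by (intro power_mono) auto
    then have "7 * real n ^ 4 \<le> real n ^ 3 * real n ^ 4" by (intro mult_right_mono) auto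
    then show "7 * real n ^ 4 \<le> real n ^ 7" by (simp add: power_add[symmetric])
  qed simp
  also have "\<dots> = real n powr (7 - (20 + a))"
  proof -
    have "real n ^ 7 = real n powr 7" using n0 by simp
    moreover have "exp (- ((20 + a) * ln (real n))) = real n powr (- (20 + a))" using n0 unfolding powr_def by (simp add: algebra_simps)
    moreover have "real n powr 7 * real n powr (- (20 + a)) = real n powr (7 + - (20 + a))" by (rule powr_add[symmetric])
    ultimately show ?thesis by simp
  qed
  also have "\<dots> \<le> real n powr (- 10 - a)" using n0 by (intro powr_mono) auto
  also have "\<dots> \<le> real m powr (- 10 - a)" using n a by (intro powr_mono2') auto
  finally have "real N * (7 * real n ^ 4 * exp (- ((20 + a) * ln (real n)))) \<le> real N * real m powr (- 10 - a)"
    by (intro mult_left_mono) auto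
  also have "\<dots> \<le> T * real m powr (- 10 - a)" using N by (intro mult_right_mono) auto
  finally show ?thesis .
qed

text \<open>The squared row norms of an isometry with \<open>r\<close> columns add up to \<open>r\<close>, which excludes \<open>mu < 1\<close>
  and empty matrices.\<close>

lemma isometry_rows:
  assumes u: "blk n r u" "tp u * u = idn r" and r: "0 < r" and b: "\<And>i. i < n \<Longrightarrow> norm (rw i u) \<le> mu * sqrt (real r) / sqrt (real n)"
  shows "0 < n" "1 \<le> mu"
proof -
  have nr: "(norm u)\<^sup>2 = real r"
  proof -
    have "norm (u * tp u) = sqrt (real r)" using norm_isometry_proj[OF u(2)] by simp
    moreover have "norm (u * tp u) = norm u"
    proof -
      have "norm (u * tp u) = norm (tp u)" using norm_isometry[OF u(2), of "tp u"] blk_mult_idn[OF u(1)] by (metis tp_idn tp_mult)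
      then show ?thesis by simp
    qed
    ultimately show ?thesis by simp
  qed
  have rows: "(norm u)\<^sup>2 = (\<Sum>i<n. (norm (rw i u))\<^sup>2)"
  proof -
    let ?m = "max n r"
    have "(norm u)\<^sup>2 = (\<Sum>i<?m. (norm (rw i u))\<^sup>2)" by (rule norm_sq_rows[OF blk_bnd[OF u(1)]]) auto
    also have "\<dots> = (\<Sum>i<n. (norm (rw i u))\<^sup>2)" by (rule sum_lt_extend[symmetric]) (auto simp: blk_rw_0[OF u(1)])
    finally show ?thesis .
  qed
  show n0: "0 < n" using nr rows r by (cases n) auto
  then have "0 \<le> mu * sqrt (real r) / sqrt (real n)" using b[of 0] norm_ge_zero order_trans by blast
  then have mu0: "0 \<le> mu" using n0 r by (simp add: zero_le_divide_iff zero_le_mult_iff)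
  have "real r = (\<Sum>i<n. (norm (rw i u))\<^sup>2)" using nr rows by simp
  also have "\<dots> \<le> (\<Sum>i<n. (mu * sqrt (real r) / sqrt (real n))\<^sup>2)"
    by (intro sum_mono power_mono b) auto
  also have "\<dots> = mu\<^sup>2 * real r" using n0 by (simp add: power_divide power_mult_distrib)
  finally have "1\<^sup>2 \<le> mu\<^sup>2" using r by simp
  then show "1 \<le> mu" using mu0 by (rule power2_le_imp_le)
qed

theorem theorem2:
  shows "\<exists>C::real. C > 0 \<and>
    (\<forall>(n1::nat) (n2::nat) (r::nat) (M::real mat) (U::real mat) (\<sigma>::nat \<Rightarrow> real) (V::real mat)
        (\<mu>::real) (\<kappa>::real) (p::real) (\<alpha>::real) (\<epsilon>::real) (T::real) (P::real mat \<Rightarrow> real mat).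
      M \<in> carrier_mat n1 n2 \<and> r \<ge> 1 \<and> vec_space.rank n1 M = r \<and>
      is_svd r M U \<sigma> V \<and> incoherent r \<mu> U V \<and> \<kappa> = \<sigma> 0 / \<sigma> (r - 1) \<and>
      0 \<le> p \<and> p \<le> 1 \<and> \<alpha> > 1 \<and> \<epsilon> > 0 \<and>
      T = ln (100 * \<mu>\<^sup>2 * real r * op_norm M / \<epsilon>) \<and> T \<ge> 0 \<and>
      measure_pmf.expectation (random_subset ({..<n1} \<times> {..<n2}) p) (\<lambda>\<Omega>. real (card \<Omega>))
        \<ge> C * \<alpha> * \<mu> ^ 4 * \<kappa>\<^sup>2 * real r ^ 5 * real (n1 + n2) * (ln (real (n1 + n2)))\<^sup>2 * T \<and>
      svd_truncation r P
      \<longrightarrow>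
      measure_pmf.prob
        (bind_pmf (random_subset ({..<n1} \<times> {..<n2}) p)
          (\<lambda>\<Omega>. svp_output P (nat \<lfloor>T\<rfloor>) \<Omega> (proj_entries \<Omega> M)))
        {X. frob_norm (X - M) \<le> \<epsilon>}
        \<ge> 1 - T * real (min n1 n2) powr (- 10 - ln \<alpha>))"
proof (intro exI[of _ "20 * 10 ^ 24"] conjI allI impI)
  fix n1 n2 r :: nat and Mm U V :: "real mat" and s :: "nat \<Rightarrow> real" and mu kap p al ep T :: real and P
  assume asm: "Mm \<in> carrier_mat n1 n2 \<and> r \<ge> 1 \<and> vec_space.rank n1 Mm = r \<and>
      is_svd r Mm U s V \<and> incoherent r mu U V \<and> kap = s 0 / s (r - 1) \<and>
      0 \<le> p \<and> p \<le> 1 \<and> al > 1 \<and> ep > 0 \<and>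
      T = ln (100 * mu\<^sup>2 * real r * op_norm Mm / ep) \<and> T \<ge> 0 \<and>
      measure_pmf.expectation (random_subset ({..<n1} \<times> {..<n2}) p) (\<lambda>\<Omega>. real (card \<Omega>))
        \<ge> 20 * 10 ^ 24 * al * mu ^ 4 * kap\<^sup>2 * real r ^ 5 * real (n1 + n2) * (ln (real (n1 + n2)))\<^sup>2 * T \<and>
      svd_truncation r P"
  then have Mm: "Mm \<in> carrier_mat n1 n2" and r: "1 \<le> r" and rk: "vec_space.rank n1 Mm = r" and S: "is_svd r Mm U s V"
    and inc: "incoherent r mu U V" and kap: "kap = s 0 / s (r - 1)" and p: "0 \<le> p" "p \<le> 1" and al: "1 < al" and ep: "0 < ep"
    and T: "T = ln (100 * mu\<^sup>2 * real r * op_norm Mm / ep)" "0 \<le> T"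
    and E: "20 * 10 ^ 24 * al * mu ^ 4 * kap\<^sup>2 * real r ^ 5 * real (n1 + n2) * (ln (real (n1 + n2)))\<^sup>2 * T
       \<le> measure_pmf.expectation (random_subset ({..<n1} \<times> {..<n2}) p) (\<lambda>\<Omega>. real (card \<Omega>))"
    and Ptr: "svd_truncation r P"
    by blast+
  have dims: "dim_row Mm = n1" "dim_col Mm = n2" using Mm by auto
  have F: "fsvd n1 n2 r (fm Mm) (fm U) s (fm V)" using is_svd_fsvd[OF S] unfolding dims .
  note d = fsvdD[OF F]
  have r0: "0 < r" "r - 1 < r" using r by auto
  define sg where "sg = s (r - 1)"
  have sg0: "0 < sg" using d(5)[OF r0(2)] rank_less[OF Mm F r0(1)] rk unfolding sg_def by force
  have sgs: "sg \<le> s i" "s i \<le> s 0" if "i < r" for i using that d(6) r0 unfolding sg_def by auto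
  have s0: "s 0 = kap * sg" using sg0 unfolding kap sg_def by simp
  have kap1: "1 \<le> kap" using sgs(1)[OF r0(1)] sg0 unfolding s0 by simp
  have dU: "dim_row U = n1" "dim_row V = n2" using S dims by (auto simp: is_svd_def)
  let ?b1 = "mu * sqrt (real r) / sqrt (real n1)" and ?b2 = "mu * sqrt (real r) / sqrt (real n2)"
  have rowU: "norm (rw i (fm U)) \<le> ?b1" if "i < n1" for i
  proof -
    have "vec_l2_norm (Matrix.row U i) \<le> ?b1" using inc that dU unfolding incoherent_def by blast
    then show ?thesis using that dU vec_l2_norm_row[of i U] by simp
  qed
  have rowV: "norm (rw j (fm V)) \<le> ?b2" if "j < n2" for j
  proof -
    have "vec_l2_norm (Matrix.row V j) \<le> ?b2" using inc that dU unfolding incoherent_def by blast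
    then show ?thesis using that dU vec_l2_norm_row[of j V] by simp
  qed
  note iU = isometry_rows[OF d(1,3) r0(1) rowU] and iV = isometry_rows[OF d(2,4) r0(1) rowV]
  have n: "0 < n1" "0 < n2" and mu: "1 \<le> mu" using iU iV by auto
  have b0: "0 < ?b1" "0 < ?b2" using mu n r0 by auto
  have rowU': "norm (rw i (fm U)) \<le> ?b1" for i
    using rowU[of i] blk_rw_0[OF d(1), of i] b0(1) by (cases "i < n1") auto
  have rowV': "norm (rw j (fm V)) \<le> ?b2" for j
    using rowV[of j] blk_rw_0[OF d(2), of j] b0(2) by (cases "j < n2") auto
  obtain Uf Vf where UV: "\<And>F. blk n1 n2 F \<Longrightarrow> blk n1 r (Uf F) \<and> blk n2 r (Vf F) \<and>
    oproj (Uf F * tp (Uf F)) \<and> oproj (Vf F * tp (Vf F)) \<and>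
    Uf F * tp (Uf F) * Uf F = Uf F \<and> Vf F * tp (Vf F) * Vf F = Vf F \<and>
    P (mt n1 n2 F) \<in> carrier_mat n1 n2 \<and>
    (\<forall>H h. F = fm Mm + H \<longrightarrow> opb H h \<longrightarrow> h < sg \<longrightarrow>
       spl F (Uf F * tp (Uf F)) (Vf F * tp (Vf F)) (fm (P (mt n1 n2 F))) (sg - h) h)"
    using exists_truncation_functions[OF Ptr F sgs(1)] by blast
  have Pc: "P A \<in> carrier_mat n1 n2" if A: "A \<in> carrier_mat n1 n2" for A
  proof -
    obtain k U' s' V' where "is_svd k A U' s' V'" and PA: "P A = U' * mat_diag k (\<lambda>i. if i < r then s' i else 0) * transpose_mat V'"
      using Ptr unfolding svd_truncation_def is_truncated_svd_def by blast
    then have "U' \<in> carrier_mat n1 k" "V' \<in> carrier_mat n2 k" using A unfolding is_svd_def by auto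
    then show ?thesis unfolding PA by (intro carrier_matI) auto
  qed
  interpret completion n1 n2 r Mm "fm U" "fm V" s sg kap ?b1 ?b2 P Uf Vf
  proof
    show "s i \<le> kap * sg" if "i < r" for i using sgs(2)[OF that] s0 by simp
    show "spl (fm Mm + H) (Uf (fm Mm + H) * tp (Uf (fm Mm + H))) (Vf (fm Mm + H) * tp (Vf (fm Mm + H)))
         (fm (P (mt n1 n2 (fm Mm + H)))) (sg - h) h" if "blk n1 n2 H" "opb H h" "h < sg" for H h
      using UV[OF blk_add[OF blk_fm'[OF Mm] that(1)]] that by blast
  qed (use Mm F r0 sg0 sgs kap1 b0 rowU' rowV' Pc UV in auto)
  have op: "sg \<le> op_norm Mm" "kap * sg \<le> op_norm Mm"
    using op_norm_ge_sigma[OF S r0(1)] sgs(1)[OF r0(1)] s0 by auto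
  have mu2: "1 \<le> mu\<^sup>2" using mu by simp
  have r1: "1 \<le> real r" using r by simp
  have mr: "1 * 1 \<le> mu\<^sup>2 * real r" using mu2 r1 by (intro mult_mono) auto
  have epT: "ep = 100 * (mu\<^sup>2 * real r) * op_norm Mm * exp (- T)"
  proof -
    have o0: "0 < op_norm Mm" using op(1) sg0 by linarith
    have "0 < 100 * mu\<^sup>2 * real r * op_norm Mm / ep" using o0 ep r mu by (intro divide_pos_pos mult_pos_pos) auto
    then have "exp T = 100 * mu\<^sup>2 * real r * op_norm Mm / ep" unfolding T(1) by (rule exp_ln)
    then have "ep * exp T = 100 * (mu\<^sup>2 * real r) * op_norm Mm" using ep by simp
    then have "ep * (exp T * exp (- T)) = 100 * (mu\<^sup>2 * real r) * op_norm Mm * exp (- T)" by (simp only: mult.assoc[symmetric])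
    then show ?thesis by (simp add: exp_minus)
  qed
  let ?D = "bind_pmf (random_subset ({..<n1} \<times> {..<n2}) p) (\<lambda>\<Omega>. svp_output P (nat \<lfloor>T\<rfloor>) \<Omega> (proj_entries \<Omega> Mm))"
  show "1 - T * real (min n1 n2) powr (- 10 - ln al) \<le> measure_pmf.prob ?D {X. frob_norm (X - Mm) \<le> ep}"
  proof (cases "T < 1")
    case True
    \<comment> \<open>The output is \<open>0\<close>; the error \<open>\<parallel>M\<parallel>\<close> is at most \<open>ep\<close> because \<open>T < 1\<close> bounds \<open>ep\<close> from below.\<close>
    then have N0: "nat \<lfloor>T\<rfloor> = 0" using T(2) by linarith
    have "norm (fm Mm) \<le> sqrt (real r) * (kap * sg)"
    proof -
      have "norm (P0 * M) \<le> norm P0 * (kap * sg)" by (rule opbD2[OF Mopb])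
      moreover have "P0 * M = M" using splD(3)[OF Mspl] by simp
      ultimately show ?thesis by (simp add: norm_P0_Q0 M_def)
    qed
    also have "\<dots> \<le> (mu\<^sup>2 * real r) * op_norm Mm"
    proof (rule mult_mono[OF _ op(2)])
      have "sqrt (real r) \<le> sqrt ((real r)\<^sup>2)" using r1 by (intro real_sqrt_le_mono) (simp add: power2_eq_square)
      also have "\<dots> \<le> mu\<^sup>2 * real r" using mu2 mult_right_mono[OF mu2, of "real r"] by simp
      finally show "sqrt (real r) \<le> mu\<^sup>2 * real r" .
    qed (use kap1 sg0 mr in auto)
    also have "\<dots> \<le> (mu\<^sup>2 * real r) * op_norm Mm * (100 * exp (- T))"
    proof -
      have "exp T \<le> exp 1" using True by simp
      then have "exp T \<le> 100" using exp_le by linarith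
      then have "1 \<le> 100 * exp (- T)" by (simp add: exp_minus field_simps)
      then show ?thesis using mr op sg0 mult_left_mono[of 1 "100 * exp (- T)" "(mu\<^sup>2 * real r) * op_norm Mm"] by simp
    qed
    finally have small: "norm (fm Mm) \<le> ep" unfolding epT by (simp add: mult_ac)
    have "X \<in> {X. frob_norm (X - Mm) \<le> ep}" if "X \<in> set_pmf ?D" for X
    proof -
      have "X = 0\<^sub>m n1 n2" using that dims by (auto simp: N0 svp_output_def proj_entries_def)
      then have "frob_norm (X - Mm) = norm (fm Mm)" unfolding norm_fm[symmetric] by (simp add: fm_minus[OF zero_carrier_mat Mm] fm_zero)
      then show ?thesis using small by simp
    qed
    then have "measure_pmf.prob ?D {X. frob_norm (X - Mm) \<le> ep} = 1" by (intro measure_pmf.prob_eq_1[THEN iffD2]) (auto simp: AE_measure_pmf_iff)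
    then show ?thesis using T(2) by simp
  next
    case False
    \<comment> \<open>From here on there is at least one step, and \<open>N > T - 1\<close> loses only a constant in \<open>exp (- N)\<close>.\<close>
    define N where "N = nat \<lfloor>T\<rfloor>"
    have N: "1 \<le> N" "real N \<le> T" "T < real N + 1" using False unfolding N_def by linarith+
    let ?n = "real (n1 + n2)" and ?Lg = "ln (real (n1 + n2))" and ?K = "mu ^ 4 * kap\<^sup>2 * real r ^ 5"
    have K1: "1 \<le> ?K"
    proof -
      have "1 * 1 * 1 \<le> ?K" using mu kap1 r1 by (intro mult_mono) auto
      then show ?thesis by simp
    qed
    have n2': "2 \<le> n1 + n2" using n by simp
    have Lg0: "2 / 3 \<le> ?Lg"
    proof -
      have "ln 2 \<le> ?Lg" using n2' by simp
      then show ?thesis using ln2_ge_two_thirds by linarith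
    qed
    have E': "20 * 10 ^ 24 * al * ?K * ?n * ?Lg\<^sup>2 * T \<le> p * (real n1 * real n2)"
      using E p by (simp add: expectation_card_random_subset card_cartesian_product mult.assoc)
    define q where "q = p / real N"
    have big: "20 * 10 ^ 24 * al * ?K * ?n * ?Lg\<^sup>2 \<le> q * (real n1 * real n2)"
    proof -
      have "20 * 10 ^ 24 * al * ?K * ?n * ?Lg\<^sup>2 * real N \<le> 20 * 10 ^ 24 * al * ?K * ?n * ?Lg\<^sup>2 * T"
        using N al K1 by (intro mult_left_mono) auto
      then have "20 * 10 ^ 24 * al * ?K * ?n * ?Lg\<^sup>2 * real N \<le> p * (real n1 * real n2)" using E' by linarith
      then have "20 * 10 ^ 24 * al * ?K * ?n * ?Lg\<^sup>2 \<le> p * (real n1 * real n2) / real N" using N(1) by (simp only: pos_le_divide_eq of_nat_0_less_iff)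
      then show ?thesis by (simp add: q_def)
    qed
    have lhs0: "0 < 20 * 10 ^ 24 * al * ?K * ?n * ?Lg\<^sup>2" using al K1 n2' Lg0 r mu kap1 by (intro mult_pos_pos) auto
    have nn0: "0 < real n1 * real n2" using n by simp
    have q0: "0 < q" by (rule zero_less_mult_pos2[OF less_le_trans[OF lhs0 big] nn0])
    have p0: "0 < p" using q0 N by (simp add: q_def zero_less_divide_iff)
    have q1: "q \<le> 1" using p N by (auto simp: q_def divide_le_eq)
    \<comment> \<open>An expected sample size of at most \<open>n1 n2\<close> forces \<open>n\<close> to be large.\<close>
    have Lg1: "1 \<le> ?Lg"
    proof -
      have "(2 / 3)\<^sup>2 \<le> ?Lg\<^sup>2" using Lg0 by (intro power_mono) auto
      moreover have "20 * 10 ^ 24 * 1 * 1 * ?n * (2 / 3)\<^sup>2 \<le> 20 * 10 ^ 24 * al * ?K * ?n * ?Lg\<^sup>2"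
        using al K1 Lg0 by (intro mult_mono power_mono) auto
      moreover have "q * (real n1 * real n2) \<le> 1 * (?n * ?n)" using q1 by (intro mult_mono) auto
      ultimately have "3 * ?n \<le> ?n * ?n" using big by (simp add: power2_eq_square)
      then have "3 \<le> ?n" by (rule mult_right_le_imp_le) (use n2' in linarith)
      then have "exp 1 \<le> ?n" using exp_le by linarith
      then show ?thesis using n2' by (subst ln_ge_iff) auto
    qed
    \<comment> \<open>The deviation parameter: \<open>exp (- x)\<close> is the power \<open>n powr - (20 + ln al)\<close>.\<close>
    define x where "x = (20 + ln al) * ?Lg"
    have la: "0 \<le> ln al" "ln al \<le> al - 1" using al by (auto intro: ln_le_minus_one)
    have x1: "1 \<le> x"
    proof -
      have "1 * 1 \<le> (20 + ln al) * ?Lg" using la Lg1 by (intro mult_mono) auto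
      then show ?thesis by (simp add: x_def)
    qed
    have xle: "x \<le> 20 * al * ?Lg\<^sup>2"
    proof -
      have "x \<le> (20 * al) * ?Lg" unfolding x_def using la al Lg1 by (intro mult_right_mono) auto
      also have "\<dots> \<le> (20 * al) * ?Lg\<^sup>2" using al Lg1 by (intro mult_left_mono) (auto simp: power2_eq_square)
      finally show ?thesis .
    qed
    have big': "10 ^ 24 * ?K * (?n * x) \<le> q * (real n1 * real n2)"
    proof -
      have "10 ^ 24 * ?K * (?n * x) \<le> 10 ^ 24 * ?K * (?n * (20 * al * ?Lg\<^sup>2))"
        using K1 xle by (intro mult_left_mono) auto
      also have "\<dots> = 20 * 10 ^ 24 * al * ?K * ?n * ?Lg\<^sup>2" by (simp only: mult_ac)
      finally show ?thesis using big by linarith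
    qed
    have r1': "1 \<le> r" using r by simp
    note rc = rate_conditions[OF mu kap1 r1' n q0 q1 x1 big']
    let ?L = "31 * sqrt (x * ?n / q)"
    let ?Th = "?L * kap * ?b1 * ?b2"
    have Th0: "0 \<le> ?Th" using kap1 mu x1 q0 by (intro mult_nonneg_nonneg divide_nonneg_nonneg) auto
    have conv: "1 - real N * (7 * ?n ^ 4 * exp (- x)) \<le> measure_pmf.prob ?D
        {X. frob_norm (X - Mm) \<le> exp (1 - real N) * (8 * sqrt (real r) * ?Th * sg)}"
      unfolding N_def[symmetric]
      by (rule svp_converges_with_high_probability[OF p0 p(2) N(1) q_def x1 n rc(10) refl rc(8) refl rc(9) rc(1-5) refl rc(6,7)])
    have err: "exp (1 - real N) * (8 * sqrt (real r) * ?Th * sg) \<le> ep"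
    proof -
      have "sqrt (real r) * 1 * ?Th \<le> sqrt (real r) * real r * ?Th" using r1 Th0 by (intro mult_right_mono mult_left_mono) auto
      then have th: "sqrt (real r) * ?Th \<le> 1 / 100" using rc(6) by linarith
      have "8 * sqrt (real r) * ?Th * sg = 8 * (sqrt (real r) * ?Th) * sg" by simp
      also have "\<dots> \<le> 8 * (1 / 100) * sg" using th sg0 by (intro mult_right_mono mult_left_mono) auto
      finally have 1: "8 * sqrt (real r) * ?Th * sg \<le> 1 / 10 * sg" using sg0 by linarith
      have "exp (1 - real N) \<le> exp (1 + 1 - T)" using N(3) by simp
      also have "\<dots> = exp 1 * exp 1 * exp (- T)" by (simp only: exp_add[symmetric]) simp
      also have "\<dots> \<le> 3 * 3 * exp (- T)" using exp_le by (intro mult_right_mono mult_mono) auto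
      finally have "exp (1 - real N) * (8 * sqrt (real r) * ?Th * sg) \<le> (3 * 3 * exp (- T)) * (1 / 10 * sg)"
      proof (rule mult_mono[OF _ 1])
        have "0 \<le> 8 * sqrt (real r)" by simp
        then show "0 \<le> 8 * sqrt (real r) * ?Th * sg" by (rule mult_nonneg_nonneg[OF mult_nonneg_nonneg[OF _ Th0] less_imp_le[OF sg0]])
      qed simp_all
      also have "\<dots> \<le> exp (- T) * sg" using sg0 by simp
      also have "\<dots> \<le> exp (- T) * (100 * (mu\<^sup>2 * real r) * op_norm Mm)"
      proof (rule mult_left_mono)
        have "1 * op_norm Mm \<le> 100 * (mu\<^sup>2 * real r) * op_norm Mm" using mr op sg0 by (intro mult_right_mono) auto
        then show "sg \<le> 100 * (mu\<^sup>2 * real r) * op_norm Mm" using op(1) by linarith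
      qed simp
      finally show ?thesis unfolding epT by (simp only: mult.commute)
    qed
    have "1 - T * real (min n1 n2) powr (- 10 - ln al) \<le> 1 - real N * (7 * ?n ^ 4 * exp (- x))"
      using failure_rate[OF n2' _ _ N(2) la(1), of "min n1 n2"] n unfolding x_def by simp
    also note conv
    also have "measure_pmf.prob ?D {X. frob_norm (X - Mm) \<le> exp (1 - real N) * (8 * sqrt (real r) * ?Th * sg)}
       \<le> measure_pmf.prob ?D {X. frob_norm (X - Mm) \<le> ep}"
      using err by (intro pmf_prob_mono) auto
    finally show ?thesis .
  qed
qed simp

end
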